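(* Let $(H_{\mathbb R},H_{\mathbb C},F^\bullet,W_\bullet,M,S)$ be a Steenbrink PMHS of weight $m$ with $H_{\mathbb R}\neq\{0\}$, with normalized Seifert form $L^{nor}$ and spectral pairs $\mathrm{Spp}$. For each ordered pair of spectral pair ladders, or single spectral pair ladder, denote its first spectral pair by $(\alpha,m+l)$ and put $\lambda:=e^{-2\pi i\alpha}$; the distance to the partner is $2\alpha+l+1-m$, which is an integer if and only if $\lambda\in\{\pm1\}$. (a) The Seifert form pair $(H_{\mathbb R},L^{nor})$ decomposes as follows (ladders being counted with multiplicity). It contains for each ordered pair of spectral pair ladders with $\lambda\in S^1\setminus\{\pm1\}$ a Seifert form pair of the type $$\mathrm{Seif}\bigl((-1)^{m+1}\lambda,2,l+1,e^{\frac12\pi i(2\alpha+l+1-m)}\bigr).$$ It contains for each pair of spectral pair ladders with odd distance an irreducible Seifert form pair of the type $\mathrm{Seif}((-1)^{m+1}\lambda,2,l+1)$, and then $(-1)^{m+1}\lambda=(-1)^{l+1}$. It contains for each pair of spectral pair ladders with even distance, and for each single spectral pair ladder (then the distance is $0$), two respectively one Seifert form pair(s) of the type $$\mathrm{Seif}\bigl((-1)^{m+1}\lambda,1,l+1,(-1)^{\frac12(2\alpha+l+1-m)}\bigr),$$ and then $(-1)^{m+1}\lambda=(-1)^l$. (b) $\mathrm{Spp}\bmod 2\mathbb{Z}\times\{0\}$ on the one side, and the isomorphism class of $(H_{\mathbb R},L^{nor})$ together with $m$ on the other side, determine one another.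
   Context: Notation: $\theta(1)=1$, $\theta(\lambda)=0$ for $\lambda\in S^1\setminus\{1\}$. For an automorphism $M$ of a finite dimensional real space $H_{\mathbb R}$ with complexification $H_{\mathbb C}$: $M=M_sM_u=M_uM_s$ (semisimple, unipotent), $N=\log M_u$, $H_\lambda=\ker(M_s-\lambda\,\mathrm{id})\subset H_{\mathbb C}$, $H_{\ne1}=\bigoplus_{\lambda\ne1}H_\lambda$. For a nilpotent $N$ and $w\in\mathbb{Z}$, $W^{(N,w)}_\bullet$ is the unique increasing filtration with $N(W_k)\subset W_{k-2}$ and $N^l:\mathrm{Gr}^W_{w+l}\to\mathrm{Gr}^W_{w-l}$ an isomorphism for $l\ge0$; $P_{w+l}=\ker(N^{l+1}:\mathrm{Gr}^W_{w+l}\to\mathrm{Gr}^W_{w-l-2})$ for $l\ge0$. If $N$ is an infinitesimal isometry of a nondegenerate $(-1)^w$-symmetric form $S$, then $S_l(a,b)=S(\tilde a,N^l\tilde b)$ ($\tilde a,\tilde b\in W_{w+l}$ representatives) is well defined on $\mathrm{Gr}^W_{w+l}$. A mixed Hodge structure (MHS) $(H_{\mathbb R},H_{\mathbb C},F^\bullet,W_\bullet)$: decreasing filtration $F^\bullet$ of $H_{\mathbb C}$, increasing filtration $W_\bullet$ of $H_{\mathbb R}$, such that $F^\bullet\mathrm{Gr}^W_k$ is a pure Hodge structure of weight $k$. A polarized MHS (PMHS) of weight $w$ $(H_{\mathbb R},H_{\mathbb C},F^\bullet,W_\bullet,N,S)$: a MHS with $W_\bullet=W_\bullet^{(N,w)}$,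 $S$ nondegenerate $(-1)^w$-symmetric on $H_{\mathbb R}$, $N$ a nilpotent infinitesimal isometry of $S$, $N(F^p)\subset F^{p-1}$, $S(F^p,F^{w+1-p})=0$, and $i^{2p-w-l}S_l(a,\overline a)>0$ for $0\ne a\in F^pP_{w+l}\cap\overline{F^{w+l-p}P_{w+l}}$. A Steenbrink MHS of weight $m$: a MHS with an automorphism $M$ of $(H_{\mathbb R},H_{\mathbb C},W_\bullet)$ such that $M_s(F^p)\subset F^p$, $N(F^p)\subset F^{p-1}$, $W_\bullet=W_\bullet^{(N,m)}$ on $H_{\ne1}$, $W_\bullet=W_\bullet^{(N,m+1)}$ on $H_1$. A Steenbrink PMHS of weight $m$: a Steenbrink MHS with a nondegenerate $M$-invariant bilinear form $S$ on $H_{\mathbb R}$ such that the restriction to $H_{\ne1}$ is a PMHS of weight $m$ and the restriction to $H_1$ is a PMHS of weight $m+1$. All eigenvalues of $M$ are then in $S^1$. Normalized Seifert form: $L^{nor}(a,b)=-S(a,\nu^{-1}b)$ with $\nu=\frac1{M-\mathrm{id}}$ on $H_{\ne1}$ and $\nu=\frac{-N}{M-\mathrm{id}}$ on $H_1$ (i.e. $-\nu^{-1}=\frac{M-\mathrm{id}}N:=\sum_{k\ge1}\frac1{k!}N^{k-1}$ on $H_1$). Its monodromy is $M^{nor}=(-1)^{m+1}M$. Spectral pairs: $\mathrm{Spp}=\sum d(\alpha,k)\cdot(\alpha,k)\in\mathbb{Z}_{\ge0}[\mathbb{R}\times\mathbb{Z}]$ with $d(\alpha,k)=\dim\mathrm{Gr}_F^{\lfloor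 m-\alpha\rfloor}\mathrm{Gr}^W_{k+\theta(\lambda)}H_\lambda$ for $\lambda=e^{-2\pi i\alpha}$. "$\mathrm{Spp}\bmod2\mathbb{Z}\times\{0\}$" means that the first entries are taken modulo $2\mathbb{Z}$ (as a multiset in $(\mathbb{R}/2\mathbb{Z})\times\mathbb{Z}$). Deligne's subspaces: $I^{p,q}=(F^p\cap W_{p+q})\cap\bigl(\overline F^q\cap W_{p+q}+\sum_{j>0}\overline F^{q-j}\cap W_{p+q-j-1}\bigr)$; for $p+q\ge m+\theta(\lambda)$: $(I_0^{p,q})_\lambda=\{a\in I^{p,q}\cap H_\lambda:N^{p+q-m-\theta(\lambda)+1}a=0\}$. Ladders: each $(I_0^{p,q})_\lambda\ne\{0\}$, with $l:=p+q-m-\theta(\lambda)\ge0$ and $\alpha$ determined by $e^{-2\pi i\alpha}=\lambda$, $\lfloor m-\alpha\rfloor=p$, gives (with multiplicity $\dim(I_0^{p,q})_\lambda$) the spectral pair ladder $(\alpha,m+l),(\alpha+1,m+l-2),\dots,(\alpha+l,m-l)$ (coming from the spaces $N^j(I_0^{p,q})_\lambda$, $0\le j\le l$), and the partner ladder $(m-l-1-\alpha,m+l),(m-l-\alpha,m+l-2),\dots,(m-1-\alpha,m-l)$ coming from $N^j(I_0^{q,p})_{\overline\lambda}$. If $(p,\lambda)\ne(q,\overline\lambda)$ they form an ordered pair of spectral pair ladders (one ordering is chosen for each pair); if $(p,\lambda)=(q,\overline\lambda)$ they coincide and one has a single ladder. $\mathrm{Spp}$ is the union of all these pairs of ladders and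 single ladders, and this decomposition is unique up to the ordering of the pairs. The distance of a ladder starting at $(\alpha,m+l)$ to its partner is $2\alpha+l+1-m$. A Seifert form pair is a finite dimensional real vector space with a nondegenerate bilinear form $L$; its monodromy $T$ is defined by $L(Ta,b)=L(b,a)$, with nilpotent part $N=\log T_u$ and generalized eigenspaces $H_\rho^{T}=\ker(T_s-\rho\,\mathrm{id})\subset H_{\mathbb C}$. Decompositions are into $L$-orthogonal summands. Types, each determined up to isomorphism by the listed properties ($n\ge1$, $\varepsilon\in\{\pm1\}$): $\mathrm{Seif}(\rho,1,n,\varepsilon)$, $\rho=(-1)^{n-1}$: $\dim H_{\mathbb R}=n$, $H_{\mathbb C}=H^T_\rho$, one Jordan block, $L(a,N^{n-1}a)\in\varepsilon\mathbb{R}_{>0}$ for $a\in H_{\mathbb R}\setminus\mathrm{Im}\,N$. $\mathrm{Seif}(\rho,2,n)$, $\rho=(-1)^n$: $\dim H_{\mathbb R}=2n$, $H_{\mathbb C}=H^T_\rho$, two Jordan blocks of size $n$. $\mathrm{Seif}(\rho,2,n,\zeta)$, $\rho,\zeta\in S^1\setminus\{\pm1\}$, $\zeta^2=\overline\rho(-1)^{n+1}$: $\dim H_{\mathbb R}=2n$, $H_{\mathbb C}=H^T_\rho\oplus H^T_{\overline\rho}$, two Jordan blocks, $L(a,N^{n-1}\overline a)\in\zeta\mathbb{R}_{>0}$ for $a\in H^T_\rho\setminus\mathrm{Im}\,N$. *)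

theory Defs
  imports
    "HOL-Analysis.Analysis"
    "HOL-Library.Multiset"
    "HOL-Library.Set_Algebras"
    "HOL-Library.Real_Mod"
begin

section \<open>Complexification\<close>

text \<open>
  The complexification of a real vector space \<open>'v\<close> is \<open>'v \<times> 'v\<close>, the pair \<open>(a, b)\<close> standing
  for \<open>a + i b\<close>. Accordingly a real subspace \<open>V\<close> has complexification \<open>V \<times> V\<close>, and a real linear
  map \<open>f\<close> extends to \<open>map_prod f f\<close>.
\<close>

definition scaleCx :: "complex \<Rightarrow> 'v::real_vector \<times> 'v \<Rightarrow> 'v \<times> 'v" where
  "scaleCx z x = (Re z *\<^sub>R fst x - Im z *\<^sub>R snd x, Re z *\<^sub>R snd x + Im z *\<^sub>R fst x)"

global_interpretation cx: vector_space "scaleCx :: complex \<Rightarrow> 'v::real_vector \<times> 'v \<Rightarrow> 'v \<times> 'v"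
  by unfold_locales (auto simp: scaleCx_def algebra_simps prod_eq_iff)

abbreviation cplx :: "'v set \<Rightarrow> ('v \<times> 'v) set" where
  "cplx V \<equiv> V \<times> V"

abbreviation cmap :: "('v \<Rightarrow> 'w) \<Rightarrow> 'v \<times> 'v \<Rightarrow> 'w \<times> 'w" where
  "cmap f \<equiv> map_prod f f"

definition cconj :: "'v::real_vector \<times> 'v \<Rightarrow> 'v \<times> 'v" where
  "cconj x = (fst x, - snd x)"

definition cbil :: "('v \<Rightarrow> 'v \<Rightarrow> real) \<Rightarrow> 'v \<times> 'v \<Rightarrow> 'v \<times> 'v \<Rightarrow> complex" where
  "cbil S x y = Complex (S (fst x) (fst y) - S (snd x) (snd y)) (S (fst x) (snd y) + S (snd x) (fst y))"

definition ray :: "complex \<Rightarrow> complex set" where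
  "ray \<zeta> = {\<zeta> * of_real r | r. r > 0}"


section \<open>Linear algebra on subspaces\<close>

definition fin_dim :: "'v::real_vector set \<Rightarrow> bool" where
  "fin_dim V \<longleftrightarrow> (\<exists>B. finite B \<and> V = span B)"

definition linear_on :: "'v::real_vector set \<Rightarrow> ('v \<Rightarrow> 'w::real_vector) \<Rightarrow> bool" where
  "linear_on V f \<longleftrightarrow> (\<forall>x\<in>V. \<forall>y\<in>V. f (x + y) = f x + f y) \<and> (\<forall>c. \<forall>x\<in>V. f (c *\<^sub>R x) = c *\<^sub>R f x)"

definition bilinear_on :: "'v::real_vector set \<Rightarrow> ('v \<Rightarrow> 'v \<Rightarrow> real) \<Rightarrow> bool" where
  "bilinear_on V L \<longleftrightarrow> (\<forall>a\<in>V. linear_on V (L a)) \<and> (\<forall>b\<in>V. linear_on V (\<lambda>a. L a b))"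

definition nondegenerate_on :: "'v::real_vector set \<Rightarrow> ('v \<Rightarrow> 'v \<Rightarrow> real) \<Rightarrow> bool" where
  "nondegenerate_on V L \<longleftrightarrow>
     (\<forall>a\<in>V. (\<forall>b\<in>V. L a b = 0) \<longrightarrow> a = 0) \<and> (\<forall>b\<in>V. (\<forall>a\<in>V. L a b = 0) \<longrightarrow> b = 0)"

text \<open>
  \<open>T = T\<^sub>s T\<^sub>u = T\<^sub>u T\<^sub>s\<close> on \<open>V\<close> with \<open>T\<^sub>s\<close> semisimple (i.e. diagonalizable on the complexification)
  and \<open>T\<^sub>u\<close> unipotent.
\<close>

definition jordan_decomposition ::
  "'v::real_vector set \<Rightarrow> ('v \<Rightarrow> 'v) \<Rightarrow> ('v \<Rightarrow> 'v) \<Rightarrow> ('v \<Rightarrow> 'v) \<Rightarrow> bool" where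
  "jordan_decomposition V T Ts Tu \<longleftrightarrow>
     linear_on V Ts \<and> Ts ` V \<subseteq> V \<and> linear_on V Tu \<and> Tu ` V \<subseteq> V \<and>
     (\<forall>x\<in>V. T x = Ts (Tu x) \<and> T x = Tu (Ts x)) \<and>
     cx.span {x \<in> cplx V. \<exists>\<mu>. cmap Ts x = scaleCx \<mu> x} = cplx V \<and>
     (\<exists>n. \<forall>x\<in>V. ((\<lambda>y. Tu y - y) ^^ n) x = 0)"

text \<open>Membership in \<open>extensional V\<close> only normalizes the irrelevant values outside \<open>V\<close>.\<close>

definition ss_part :: "'v::real_vector set \<Rightarrow> ('v \<Rightarrow> 'v) \<Rightarrow> 'v \<Rightarrow> 'v" where
  "ss_part V T = (THE Ts. Ts \<in> extensional V \<and> (\<exists>Tu. jordan_decomposition V T Ts Tu))"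

definition uni_part :: "'v::real_vector set \<Rightarrow> ('v \<Rightarrow> 'v) \<Rightarrow> 'v \<Rightarrow> 'v" where
  "uni_part V T = (THE Tu. Tu \<in> extensional V \<and> (\<exists>Ts. jordan_decomposition V T Ts Tu))"

text \<open>\<open>log T\<^sub>u\<close>; the terms of the logarithm series beyond the dimension of \<open>V\<close> vanish.\<close>

definition nilp_part :: "'v::real_vector set \<Rightarrow> ('v \<Rightarrow> 'v) \<Rightarrow> 'v \<Rightarrow> 'v" where
  "nilp_part V T x =
     (\<Sum>k = 1..dim V. ((-1) ^ (k + 1) / real k) *\<^sub>R ((\<lambda>y. uni_part V T y - y) ^^ k) x)"

definition eigsp :: "'v::real_vector set \<Rightarrow> ('v \<Rightarrow> 'v) \<Rightarrow> complex \<Rightarrow> ('v \<times> 'v) set" where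
  "eigsp V T \<mu> = {x \<in> cplx V. cmap (ss_part V T) x = scaleCx \<mu> x}"

text \<open>
  The complexification of \<open>T\<close> on \<open>V\<close> has a Jordan basis \<open>e i j\<close> whose \<open>i\<close>-th chain has the eigenvalue
  and the length given by the \<open>i\<close>-th entry of \<open>bs\<close>.
\<close>

definition jordan_blocks ::
  "'v::real_vector set \<Rightarrow> ('v \<Rightarrow> 'v) \<Rightarrow> (complex \<times> nat) list \<Rightarrow> bool" where
  "jordan_blocks V T bs \<longleftrightarrow>
     (let J = {(i, j). i < length bs \<and> j < snd (bs ! i)} in
      \<exists>e :: nat \<Rightarrow> nat \<Rightarrow> 'v \<times> 'v.
        inj_on (\<lambda>(i, j). e i j) J \<and>
        cx.independent ((\<lambda>(i, j). e i j) ` J) \<and>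
        cx.span ((\<lambda>(i, j). e i j) ` J) = cplx V \<and>
        (\<forall>(i, j) \<in> J. cmap T (e i j) =
           scaleCx (fst (bs ! i)) (e i j) + (if j = 0 then 0 else e i (j - 1))))"


section \<open>Filtrations and mixed Hodge structures\<close>

definition incr_filtration :: "'v::real_vector set \<Rightarrow> (int \<Rightarrow> 'v set) \<Rightarrow> bool" where
  "incr_filtration V W \<longleftrightarrow>
     (\<forall>k. subspace (W k) \<and> W k \<subseteq> V) \<and> mono W \<and> (\<exists>k. W k = {0}) \<and> (\<exists>k. W k = V)"

definition decr_filtration :: "'v::real_vector set \<Rightarrow> (int \<Rightarrow> ('v \<times> 'v) set) \<Rightarrow> bool" where
  "decr_filtration V F \<longleftrightarrow>
     (\<forall>p. cx.subspace (F p) \<and> F p \<subseteq> cplx V) \<and> antimono F \<and> (\<exists>p. F p = {0}) \<and> (\<exists>p. F p = cplx V)"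

text \<open>\<open>f\<close> induces a bijection \<open>A / A' \<rightarrow> B / B'\<close>, where \<open>A' \<subseteq> A\<close> and \<open>B' \<subseteq> B\<close>.\<close>

definition quotient_iso ::
  "('v::real_vector \<Rightarrow> 'v) \<Rightarrow> 'v set \<Rightarrow> 'v set \<Rightarrow> 'v set \<Rightarrow> 'v set \<Rightarrow> bool" where
  "quotient_iso f A A' B B' \<longleftrightarrow>
     f ` A \<subseteq> B \<and> f ` A' \<subseteq> B' \<and> (\<forall>a\<in>A. f a \<in> B' \<longrightarrow> a \<in> A') \<and> B \<subseteq> f ` A + B'"

definition weight_filtration ::
  "'v::real_vector set \<Rightarrow> ('v \<Rightarrow> 'v) \<Rightarrow> int \<Rightarrow> (int \<Rightarrow> 'v set) \<Rightarrow> bool" where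
  "weight_filtration V N w W \<longleftrightarrow>
     incr_filtration V W \<and> (\<forall>k. N ` W k \<subseteq> W (k - 2)) \<and>
     (\<forall>l. quotient_iso (N ^^ l) (W (w + int l)) (W (w + int l - 1)) (W (w - int l)) (W (w - int l - 1)))"

text \<open>
  Subspaces of \<open>Gr\<^sub>k = W\<^sub>k / W\<^sub>k\<^sub>-\<^sub>1\<close> are represented by their preimages in \<open>W\<^sub>k\<close>;
  this is the one of \<open>F\<^sup>p Gr\<^sub>k\<close>.
\<close>

definition grF :: "(int \<Rightarrow> ('v::real_vector \<times> 'v) set) \<Rightarrow> (int \<Rightarrow> 'v set) \<Rightarrow> int \<Rightarrow> int \<Rightarrow> ('v \<times> 'v) set" where
  "grF F W p k = (F p \<inter> cplx (W k)) + cplx (W (k - 1))"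

text \<open>
  The last condition says that \<open>Gr\<^sub>k\<close> is the direct sum of \<open>F\<^sup>p Gr\<^sub>k\<close> and the complex conjugate
  of \<open>F\<^sup>k\<^sup>+\<^sup>1\<^sup>-\<^sup>p Gr\<^sub>k\<close>.
\<close>

definition mhs :: "'v::real_vector set \<Rightarrow> (int \<Rightarrow> ('v \<times> 'v) set) \<Rightarrow> (int \<Rightarrow> 'v set) \<Rightarrow> bool" where
  "mhs V F W \<longleftrightarrow>
     subspace V \<and> fin_dim V \<and> decr_filtration V F \<and> incr_filtration V W \<and>
     (\<forall>k p. grF F W p k + cconj ` grF F W (k + 1 - p) k = cplx (W k) \<and>
            grF F W p k \<inter> cconj ` grF F W (k + 1 - p) k = cplx (W (k - 1)))"

text \<open>
  In the positivity condition, \<open>a\<close> represents a nonzero element of \<open>Gr\<^sub>w\<^sub>+\<^sub>l\<close>; the condition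
  on \<open>N\<^sup>l\<^sup>+\<^sup>1 a\<close> says that its class is primitive.
\<close>

definition pmhs ::
  "'v::real_vector set \<Rightarrow> int \<Rightarrow> (int \<Rightarrow> ('v \<times> 'v) set) \<Rightarrow> (int \<Rightarrow> 'v set) \<Rightarrow> ('v \<Rightarrow> 'v) \<Rightarrow> ('v \<Rightarrow> 'v \<Rightarrow> real) \<Rightarrow> bool"
  where
  "pmhs V w F W N S \<longleftrightarrow>
     mhs V F W \<and> linear_on V N \<and> N ` V \<subseteq> V \<and> (\<exists>n. \<forall>x\<in>V. (N ^^ n) x = 0) \<and>
     weight_filtration V N w W \<and>
     bilinear_on V S \<and> nondegenerate_on V S \<and>
     (\<forall>a\<in>V. \<forall>b\<in>V. S b a = (-1) powi w * S a b) \<and>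
     (\<forall>a\<in>V. \<forall>b\<in>V. S (N a) b + S a (N b) = 0) \<and>
     (\<forall>p. cmap N ` F p \<subseteq> F (p - 1)) \<and>
     (\<forall>p. \<forall>a \<in> F p. \<forall>b \<in> F (w + 1 - p). cbil S a b = 0) \<and>
     (\<forall>(l::nat) p. \<forall>a \<in> grF F W p (w + int l) \<inter> cconj ` grF F W (w + int l - p) (w + int l).
        a \<notin> cplx (W (w + int l - 1)) \<and> (cmap N ^^ (l + 1)) a \<in> cplx (W (w - int l - 3)) \<longrightarrow>
        \<i> powi (2 * p - w - int l) * cbil S a ((cmap N ^^ l) (cconj a)) \<in> ray 1)"


section \<open>Steenbrink mixed Hodge structures\<close>

definition theta :: "complex \<Rightarrow> int" where
  "theta \<mu> = (if \<mu> = 1 then 1 else 0)"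

text \<open>The real vector spaces underlying \<open>H\<^sub>1\<close> and \<open>H\<^bsub>\<noteq>1\<^esub>\<close>.\<close>

definition H1 :: "('v::real_vector \<Rightarrow> 'v) \<Rightarrow> 'v set" where
  "H1 M = {v. (v, 0) \<in> eigsp UNIV M 1}"

definition Hne1 :: "('v::real_vector \<Rightarrow> 'v) \<Rightarrow> 'v set" where
  "Hne1 M = {v. (v, 0) \<in> cx.span (\<Union>\<mu>\<in>-{1}. eigsp UNIV M \<mu>)}"

definition steenbrink_mhs ::
  "int \<Rightarrow> (int \<Rightarrow> ('v::real_vector \<times> 'v) set) \<Rightarrow> (int \<Rightarrow> 'v set) \<Rightarrow> ('v \<Rightarrow> 'v) \<Rightarrow> bool" where
  "steenbrink_mhs m F W M \<longleftrightarrow>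
     mhs UNIV F W \<and> linear M \<and> bij M \<and> (\<forall>k. M ` W k = W k) \<and>
     (\<forall>p. cmap (ss_part UNIV M) ` F p \<subseteq> F p) \<and>
     (\<forall>p. cmap (nilp_part UNIV M) ` F p \<subseteq> F (p - 1)) \<and>
     weight_filtration (Hne1 M) (nilp_part UNIV M) m (\<lambda>k. W k \<inter> Hne1 M) \<and>
     weight_filtration (H1 M) (nilp_part UNIV M) (m + 1) (\<lambda>k. W k \<inter> H1 M)"

definition steenbrink_pmhs ::
  "int \<Rightarrow> (int \<Rightarrow> ('v::real_vector \<times> 'v) set) \<Rightarrow> (int \<Rightarrow> 'v set) \<Rightarrow> ('v \<Rightarrow> 'v) \<Rightarrow> ('v \<Rightarrow> 'v \<Rightarrow> real) \<Rightarrow> bool"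
  where
  "steenbrink_pmhs m F W M S \<longleftrightarrow>
     steenbrink_mhs m F W M \<and>
     bilinear S \<and> nondegenerate_on UNIV S \<and> (\<forall>a b. S (M a) (M b) = S a b) \<and>
     pmhs (Hne1 M) m (\<lambda>p. F p \<inter> cplx (Hne1 M)) (\<lambda>k. W k \<inter> Hne1 M) (nilp_part UNIV M) S \<and>
     pmhs (H1 M) (m + 1) (\<lambda>p. F p \<inter> cplx (H1 M)) (\<lambda>k. W k \<inter> H1 M) (nilp_part UNIV M) S"

text \<open>
  \<open>\<nu>\<^sup>-\<^sup>1\<close> is \<open>M - id\<close> on \<open>H\<^bsub>\<noteq>1\<^esub>\<close> and minus the (finite) sum of the \<open>N\<^sup>k\<^sup>-\<^sup>1 / k!\<close>, \<open>k \<ge> 1\<close>, on \<open>H\<^sub>1\<close>.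
\<close>

definition nu_inv :: "('v::real_vector \<Rightarrow> 'v) \<Rightarrow> 'v \<Rightarrow> 'v" where
  "nu_inv M v = (THE u. \<exists>a\<in>Hne1 M. \<exists>b\<in>H1 M. v = a + b \<and>
     u = (M a - a) - (\<Sum>k = 1..dim (UNIV :: 'v set). (1 / fact k) *\<^sub>R (nilp_part UNIV M ^^ (k - 1)) b))"

definition Lnor :: "('v::real_vector \<Rightarrow> 'v) \<Rightarrow> ('v \<Rightarrow> 'v \<Rightarrow> real) \<Rightarrow> 'v \<Rightarrow> 'v \<Rightarrow> real" where
  "Lnor M S a b = - S a (nu_inv M b)"


section \<open>Spectral pairs and ladders\<close>

definition eig :: "real \<Rightarrow> complex" where
  "eig \<alpha> = exp (- 2 * of_real pi * \<i> * of_real \<alpha>)"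

definition spp_mult ::
  "int \<Rightarrow> (int \<Rightarrow> ('v::real_vector \<times> 'v) set) \<Rightarrow> (int \<Rightarrow> 'v set) \<Rightarrow> ('v \<Rightarrow> 'v) \<Rightarrow> real \<Rightarrow> int \<Rightarrow> nat" where
  "spp_mult m F W M \<alpha> k =
     (let H = eigsp UNIV M (eig \<alpha>);
          p = \<lfloor>of_int m - \<alpha>\<rfloor>;
          k' = k + theta (eig \<alpha>);
          G = (\<lambda>p. (F p \<inter> cplx (W k') \<inter> H) + (cplx (W (k' - 1)) \<inter> H))
      in cx.dim (G p) - cx.dim (G (p + 1)))"

definition spp ::
  "int \<Rightarrow> (int \<Rightarrow> ('v::real_vector \<times> 'v) set) \<Rightarrow> (int \<Rightarrow> 'v set) \<Rightarrow> ('v \<Rightarrow> 'v) \<Rightarrow> (real \<times> int) multiset" where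
  "spp m F W M = Abs_multiset (\<lambda>(\<alpha>, k). spp_mult m F W M \<alpha> k)"

text \<open>Elements of \<open>\<real> / 2\<int>\<close> are represented by real numbers in the interval from 0 (included) to 2.\<close>

definition spp_mod2 ::
  "int \<Rightarrow> (int \<Rightarrow> ('v::real_vector \<times> 'v) set) \<Rightarrow> (int \<Rightarrow> 'v set) \<Rightarrow> ('v \<Rightarrow> 'v) \<Rightarrow> (real \<times> int) multiset" where
  "spp_mod2 m F W M = image_mset (\<lambda>(\<alpha>, k). (\<alpha> rmod 2, k)) (spp m F W M)"

definition deligne ::
  "(int \<Rightarrow> ('v::real_vector \<times> 'v) set) \<Rightarrow> (int \<Rightarrow> 'v set) \<Rightarrow> int \<Rightarrow> int \<Rightarrow> ('v \<times> 'v) set" where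
  "deligne F W p q =
     (F p \<inter> cplx (W (p + q))) \<inter>
     ((cconj ` F q \<inter> cplx (W (p + q))) +
      cx.span (\<Union>j\<in>{1..}. cconj ` F (q - j) \<inter> cplx (W (p + q - j - 1))))"

text \<open>Used only for \<open>p + q \<ge> m + \<theta>(\<mu>)\<close>, where \<open>nat\<close> does not truncate.\<close>

definition deligne0 ::
  "int \<Rightarrow> (int \<Rightarrow> ('v::real_vector \<times> 'v) set) \<Rightarrow> (int \<Rightarrow> 'v set) \<Rightarrow> ('v \<Rightarrow> 'v) \<Rightarrow> int \<Rightarrow> int \<Rightarrow> complex \<Rightarrow> ('v \<times> 'v) set"
  where
  "deligne0 m F W M p q \<mu> =
     {a \<in> deligne F W p q \<inter> eigsp UNIV M \<mu>.
        (cmap (nilp_part UNIV M) ^^ nat (p + q - m - theta \<mu> + 1)) a = 0}"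

text \<open>
  A ladder \<open>(\<alpha>, m + l), (\<alpha> + 1, m + l - 2), \<dots>, (\<alpha> + l, m - l)\<close> is indexed by \<open>\<alpha>\<close> and \<open>l\<close>.
  Since \<open>\<mu> = exp (-2 \<pi> i \<alpha>)\<close>, \<open>p = \<lfloor>m - \<alpha>\<rfloor>\<close> and \<open>q = m + \<theta>(\<mu>) + l - p\<close> correspond bijectively
  to \<open>(\<alpha>, l)\<close> (for \<open>\<mu>\<close> on the unit circle and \<open>p + q \<ge> m + \<theta>(\<mu>)\<close>), its multiplicity as the ladder
  coming from \<open>I\<^sub>0\<close> with indices \<open>p\<close>, \<open>q\<close>, \<open>\<mu>\<close> is a function of \<open>(\<alpha>, l)\<close>.
\<close>

definition ladder_p :: "int \<Rightarrow> real \<Rightarrow> int" where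
  "ladder_p m \<alpha> = \<lfloor>of_int m - \<alpha>\<rfloor>"

definition ladder_q :: "int \<Rightarrow> real \<Rightarrow> nat \<Rightarrow> int" where
  "ladder_q m \<alpha> l = m + theta (eig \<alpha>) + int l - ladder_p m \<alpha>"

definition ladder_mult ::
  "int \<Rightarrow> (int \<Rightarrow> ('v::real_vector \<times> 'v) set) \<Rightarrow> (int \<Rightarrow> 'v set) \<Rightarrow> ('v \<Rightarrow> 'v) \<Rightarrow> real \<Rightarrow> nat \<Rightarrow> nat" where
  "ladder_mult m F W M \<alpha> l = cx.dim (deligne0 m F W M (ladder_p m \<alpha>) (ladder_q m \<alpha> l) (eig \<alpha>))"

definition ladder_partner :: "int \<Rightarrow> real \<Rightarrow> nat \<Rightarrow> real" where
  "ladder_partner m \<alpha> l = of_int m - of_nat l - 1 - \<alpha>"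

definition ladder_distance :: "int \<Rightarrow> real \<Rightarrow> nat \<Rightarrow> real" where
  "ladder_distance m \<alpha> l = 2 * \<alpha> + of_nat l + 1 - of_int m"

definition single_ladder :: "int \<Rightarrow> real \<Rightarrow> nat \<Rightarrow> bool" where
  "single_ladder m \<alpha> l \<longleftrightarrow> ladder_p m \<alpha> = ladder_q m \<alpha> l \<and> eig \<alpha> = cnj (eig \<alpha>)"

text \<open>
  A choice of an ordering for each pair of ladders, pairs being counted with multiplicity:
  \<open>c \<alpha> l\<close> is the number of ordered pairs (respectively single ladders) whose first spectral
  pair is \<open>(\<alpha>, m + l)\<close>.
\<close>

definition ladder_ordering ::
  "int \<Rightarrow> (int \<Rightarrow> ('v::real_vector \<times> 'v) set) \<Rightarrow> (int \<Rightarrow> 'v set) \<Rightarrow> ('v \<Rightarrow> 'v) \<Rightarrow> (real \<Rightarrow> nat \<Rightarrow> nat) \<Rightarrow> bool"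
  where
  "ladder_ordering m F W M c \<longleftrightarrow>
     (\<forall>\<alpha> l. (if single_ladder m \<alpha> l then c \<alpha> l else c \<alpha> l + c (ladder_partner m \<alpha> l) l)
             = ladder_mult m F W M \<alpha> l)"


section \<open>Seifert form pairs\<close>

definition seifert_pair :: "'v::real_vector set \<Rightarrow> ('v \<Rightarrow> 'v \<Rightarrow> real) \<Rightarrow> bool" where
  "seifert_pair V L \<longleftrightarrow> subspace V \<and> fin_dim V \<and> bilinear_on V L \<and> nondegenerate_on V L"

definition seifert_iso ::
  "'v::real_vector set \<Rightarrow> ('v \<Rightarrow> 'v \<Rightarrow> real) \<Rightarrow> 'w::real_vector set \<Rightarrow> ('w \<Rightarrow> 'w \<Rightarrow> real) \<Rightarrow> bool" where
  "seifert_iso V L V' L' \<longleftrightarrow>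
     (\<exists>f. linear_on V f \<and> bij_betw f V V' \<and> (\<forall>a\<in>V. \<forall>b\<in>V. L' (f a) (f b) = L a b))"

definition monodromy :: "'v::real_vector set \<Rightarrow> ('v \<Rightarrow> 'v \<Rightarrow> real) \<Rightarrow> 'v \<Rightarrow> 'v" where
  "monodromy V L = restrict (\<lambda>a. THE c. c \<in> V \<and> (\<forall>b\<in>V. L c b = L b a)) V"

definition orthogonal_decomposition ::
  "'v::real_vector set \<Rightarrow> ('v \<Rightarrow> 'v \<Rightarrow> real) \<Rightarrow> 'i set \<Rightarrow> ('i \<Rightarrow> 'v set) \<Rightarrow> bool" where
  "orthogonal_decomposition V L J U \<longleftrightarrow>
     finite J \<and> (\<forall>j\<in>J. subspace (U j)) \<and>
     span (\<Union>j\<in>J. U j) = V \<and>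
     (\<forall>u. (\<forall>j\<in>J. u j \<in> U j) \<and> (\<Sum>j\<in>J. u j) = 0 \<longrightarrow> (\<forall>j\<in>J. u j = 0)) \<and>
     (\<forall>i\<in>J. \<forall>j\<in>J. i \<noteq> j \<longrightarrow> (\<forall>a\<in>U i. \<forall>b\<in>U j. L a b = 0))"

definition seifert_irreducible :: "'v::real_vector set \<Rightarrow> ('v \<Rightarrow> 'v \<Rightarrow> real) \<Rightarrow> bool" where
  "seifert_irreducible V L \<longleftrightarrow>
     V \<noteq> {0} \<and>
     (\<forall>A B. subspace A \<and> subspace B \<and> A + B = V \<and> A \<inter> B = {0} \<and>
            (\<forall>a\<in>A. \<forall>b\<in>B. L a b = 0 \<and> L b a = 0) \<longrightarrow> A = {0} \<or> B = {0})"

text \<open>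
  The next three predicates say that \<open>(V, L)\<close> is of type \<open>Seif(\<rho>, 1, n, \<epsilon>)\<close>, \<open>Seif(\<rho>, 2, n)\<close> and
  \<open>Seif(\<rho>, 2, n, \<zeta>)\<close>, respectively.
\<close>

definition seif_1 :: "complex \<Rightarrow> nat \<Rightarrow> real \<Rightarrow> 'v::real_vector set \<Rightarrow> ('v \<Rightarrow> 'v \<Rightarrow> real) \<Rightarrow> bool" where
  "seif_1 \<rho> n \<epsilon> V L \<longleftrightarrow>
     seifert_pair V L \<and> n \<ge> 1 \<and> \<epsilon> \<in> {1, -1} \<and> \<rho> = (-1) ^ (n - 1) \<and>
     (let T = monodromy V L; N = nilp_part V T in
      dim V = n \<and> cplx V = eigsp V T \<rho> \<and> jordan_blocks V T [(\<rho>, n)] \<and>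
      (\<forall>a \<in> V - N ` V. \<exists>r>0. L a ((N ^^ (n - 1)) a) = \<epsilon> * r))"

definition seif_2 :: "complex \<Rightarrow> nat \<Rightarrow> 'v::real_vector set \<Rightarrow> ('v \<Rightarrow> 'v \<Rightarrow> real) \<Rightarrow> bool" where
  "seif_2 \<rho> n V L \<longleftrightarrow>
     seifert_pair V L \<and> n \<ge> 1 \<and> \<rho> = (-1) ^ n \<and>
     (let T = monodromy V L in
      dim V = 2 * n \<and> cplx V = eigsp V T \<rho> \<and> jordan_blocks V T [(\<rho>, n), (\<rho>, n)])"

definition seif_2c :: "complex \<Rightarrow> nat \<Rightarrow> complex \<Rightarrow> 'v::real_vector set \<Rightarrow> ('v \<Rightarrow> 'v \<Rightarrow> real) \<Rightarrow> bool" where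
  "seif_2c \<rho> n \<zeta> V L \<longleftrightarrow>
     seifert_pair V L \<and> n \<ge> 1 \<and>
     \<rho> \<in> sphere 0 1 - {1, -1} \<and> \<zeta> \<in> sphere 0 1 - {1, -1} \<and> \<zeta>\<^sup>2 = cnj \<rho> * (-1) ^ (n + 1) \<and>
     (let T = monodromy V L; N = nilp_part V T in
      dim V = 2 * n \<and>
      cplx V = eigsp V T \<rho> + eigsp V T (cnj \<rho>) \<and> eigsp V T \<rho> \<inter> eigsp V T (cnj \<rho>) = {0} \<and>
      jordan_blocks V T [(\<rho>, n), (cnj \<rho>, n)] \<and>
      (\<forall>a \<in> eigsp V T \<rho> - cmap N ` cplx V. cbil L a ((cmap N ^^ (n - 1)) (cconj a)) \<in> ray \<zeta>))"

end

theory Submission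
  imports Defs "HOL-Computational_Algebra.Computational_Algebra" "HOL-Computational_Algebra.Field_as_Ring"
begin

section \<open>Complexified vector spaces\<close>

abbreviation clinear :: "('v::real_vector \<times> 'v => 'w::real_vector \<times> 'w) => bool" where
 "clinear == Vector_Spaces.linear scaleCx scaleCx"

abbreviation sc :: "complex => 'v::real_vector \<times> 'v => 'v \<times> 'v" where "sc == scaleCx"

interpretation cxp: vector_space_pair
 "scaleCx :: complex => 'v::real_vector \<times> 'v => 'v \<times> 'v"
 "scaleCx :: complex => 'w::real_vector \<times> 'w => 'w \<times> 'w"
 by unfold_locales

lemma clinearI:
 assumes "!!x y. f (x + y) = f x + f y" "!!c x. f (sc c x) = sc c (f x)"
 shows "clinear f"
 using assms by unfold_locales auto

lemma scaleCx_of_real [simp]: "sc (of_real r) x = r *\<^sub>R x"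
 by (auto simp: scaleCx_def prod_eq_iff)

lemma scaleCx_fst_snd: "sc z (a, b) = (Re z *\<^sub>R a - Im z *\<^sub>R b, Re z *\<^sub>R b + Im z *\<^sub>R a)"
 by (simp add: scaleCx_def)

lemma scaleCx_scaleR_commute: "sc z (r *\<^sub>R x) = r *\<^sub>R sc z x"
 by (simp add: scaleCx_def prod_eq_iff algebra_simps)

lemma scaleCx_neg_one [simp]: "sc (-1) x = - x"
 by (simp add: scaleCx_def prod_eq_iff)

lemma scaleCx_ii: "sc \<i> (a, b) = (- b, a)"
 by (simp add: scaleCx_def)

lemma pair_eq_real_plus_imag: "(a, b) = (a, 0) + sc \<i> (b, 0)"
 by (simp add: scaleCx_def)

lemma cconj_simps [simp]:
 "cconj (cconj x) = x" "cconj (x + y) = cconj x + cconj y" "cconj (x - y) = cconj x - cconj y"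
 "cconj (- x) = - cconj x" "cconj 0 = 0" "cconj (r *\<^sub>R x) = r *\<^sub>R cconj x"
 "cconj (a, b) = (a, - b)"
 by (auto simp: cconj_def prod_eq_iff)

lemma cconj_scaleCx [simp]: "cconj (sc c x) = sc (cnj c) (cconj x)"
 by (auto simp: cconj_def scaleCx_def prod_eq_iff)

lemma cconj_sum: "cconj (\<Sum>i\<in>A. f i) = (\<Sum>i\<in>A. cconj (f i))"
 by (induction A rule: infinite_finite_induct) auto

lemma cconj_eq_iff [simp]: "cconj x = cconj y \<longleftrightarrow> x = y"
 by (metis cconj_simps(1))

lemma cconj_eq_0_iff [simp]: "cconj x = 0 \<longleftrightarrow> x = 0"
 by (metis cconj_simps(1,5))

lemma cconj_image_iff: "x \<in> cconj ` A \<longleftrightarrow> cconj x \<in> A"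
 by (metis cconj_simps(1) image_iff)

lemma cconj_real_iff: "cconj x = x \<longleftrightarrow> snd x = 0"
proof -
 have "- snd x = snd x \<longleftrightarrow> 2 *\<^sub>R snd x = 0"
  by (metis add_eq_0_iff scaleR_2)
 thus ?thesis by (simp add: cconj_def prod_eq_iff)
qed

lemma cmap_cconj:
 assumes "linear f"
 shows "cmap f (cconj x) = cconj (cmap f x)"
 using assms by (simp add: cconj_def linear_neg map_prod_def case_prod_beta)

lemma clinear_cmap:
 assumes "linear f"
 shows "clinear (cmap f)"
 by (rule clinearI)
  (auto simp: scaleCx_def prod_eq_iff linear_add[OF assms] linear_diff[OF assms] linear_scale[OF assms])

lemma cmap_funpow:
 fixes f :: "'a => 'a"
 shows "(cmap f ^^ n) x = cmap (f ^^ n) x"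
 by (induction n arbitrary: x) (auto simp: prod_eq_iff)

lemma clinear_scaleR:
 assumes "clinear f"
 shows "f (r *\<^sub>R x) = r *\<^sub>R f x"
 using cxp.linear_scale[OF assms, of "of_real r" x] by simp

lemma clinear_imp_linear:
 assumes "clinear f"
 shows "linear f"
 by (rule linearI) (simp_all add: cxp.linear_add[OF assms] clinear_scaleR[OF assms])

lemma clinear_funpow:
 fixes f :: "'v::real_vector \<times> 'v => 'v \<times> 'v"
 assumes "clinear f"
 shows "clinear (f ^^ n)"
proof (induction n)
 case 0
 thus ?case by (auto intro: clinearI)
next
 case (Suc n)
 show ?case
  by (rule clinearI) (simp_all add: cxp.linear_add[OF assms] cxp.linear_scale[OF assms]
    cxp.linear_add[OF Suc] cxp.linear_scale[OF Suc])
qed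

lemma subspace_cplx:
 assumes "subspace V"
 shows "cx.subspace (cplx V)"
 unfolding cx.subspace_def
 by (auto simp: zero_prod_def mem_Times_iff scaleCx_def intro: assms
   real_vector.subspace_0 real_vector.subspace_diff real_vector.subspace_add real_vector.subspace_scale)

lemma cconj_cplx:
 assumes "subspace V"
 shows "cconj x \<in> cplx V \<longleftrightarrow> x \<in> cplx V"
 using real_vector.subspace_neg[OF assms, of "snd x"] real_vector.subspace_neg[OF assms, of "- snd x"]
 by (auto simp: cconj_def mem_Times_iff)

lemma subspace_cconj_image:
 assumes "cx.subspace A"
 shows "cx.subspace (cconj ` A)"
 using assms unfolding cx.subspace_def cconj_image_iff by auto

lemma cx_subspace_scaleR: "cx.subspace A ==> x \<in> A ==> r *\<^sub>R x \<in> A"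
 using cx.subspace_scale[of A x "of_real r"] by simp

lemma cx_subspace_imp_subspace: "cx.subspace A ==> subspace A"
 by (auto simp: subspace_def cx.subspace_0 cx.subspace_add cx_subspace_scaleR)

lemma cx_span_real:
 assumes "x \<in> cx.span A" "!!a. a \<in> A ==> cconj a \<in> cx.span A"
 shows "cconj x \<in> cx.span A"
 using assms(1)
proof (induction rule: cx.span_induct_alt)
 case base
 thus ?case by (simp add: cx.span_zero)
next
 case (step c x y)
 thus ?case
  by (simp add: assms(2) cx.span_add cx.span_scale)
qed

lemma set_plus_subspace:
 assumes "cx.subspace A" "cx.subspace B"
 shows "cx.subspace (A + B)"
proof -
 have "A + B = {x + y |x y. x \<in> A & y \<in> B}"
  unfolding set_plus_def by blast
 thus ?thesis using cx.subspace_sums[OF assms] by simp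
qed

lemma dependent_family:
 fixes u :: "'i => 'v::real_vector \<times> 'v"
 assumes "finite I" "finite B" "u ` I \<subseteq> cx.span B" "card I > card B"
 obtains c where "\<exists>i\<in>I. c i ~= 0" "(\<Sum>i\<in>I. sc (c i) (u i)) = 0"
proof (cases "inj_on u I")
 case True
 have "cx.dependent (u ` I)"
 proof (rule ccontr)
  assume "\<not> cx.dependent (u ` I)"
  hence "card (u ` I) \<le> card B"
   using cx.independent_span_bound[OF assms(2) _ assms(3)] by blast
  thus False using assms(4) card_image[OF True] by simp
 qed
 then obtain r v where r: "v \<in> u ` I" "r v ~= 0" "(\<Sum>x\<in>u ` I. sc (r x) x) = 0"
  using cx.dependent_finite[OF finite_imageI[OF assms(1)], of u] by blast
 thus ?thesis
  using sum.reindex[OF True, of "%x. sc (r x) x"] that[of "%i. r (u i)"] by (auto simp: o_def)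
next
 case False
 then obtain i j where ij: "i \<in> I" "j \<in> I" "i ~= j" "u i = u j"
  by (auto simp: inj_on_def)
 let ?c = "%k. if k = i then 1 else if k = j then -1 else 0 :: complex"
 have "(\<Sum>k\<in>I. sc (?c k) (u k)) = (\<Sum>k\<in>{i,j}. sc (?c k) (u k))"
  by (rule sum.mono_neutral_right) (use assms(1) ij in auto)
 also have "... = 0" using ij by (simp add: prod_eq_iff scaleCx_def)
 finally show ?thesis using that[of ?c] ij(1) by (metis one_neq_zero)
qed

section \<open>Formal power series of nilpotent operators\<close>

definition feval :: "nat => real fps => ('a::real_vector => 'a) => 'a => 'a" where
 "feval n f X x = (\<Sum>k<n. fps_nth f k *\<^sub>R (X ^^ k) x)"

lemma linear_funpow:
 fixes X :: "'a::real_vector => 'a"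
 assumes "linear X"
 shows "linear (X ^^ k)"
proof (induction k)
 case (Suc k)
 show ?case using linear_compose[OF Suc assms] by (simp add: o_def)
qed (simp add: linear_ident)

lemma funpow_nilpotent_mono:
 fixes X :: "'a::real_vector => 'a"
 assumes "linear X" "(X ^^ n) x = 0" "n \<le> k"
 shows "(X ^^ k) x = 0"
proof -
 have "(X ^^ k) x = (X ^^ (k - n)) ((X ^^ n) x)"
  using assms(3) by (metis funpow_add le_add_diff_inverse2 o_apply)
 thus ?thesis using assms linear_0[OF linear_funpow[OF assms(1)]] by simp
qed

lemma linear_feval: "linear X ==> linear (feval n f X)"
 unfolding feval_def by (intro linear_compose_sum ballI linear_compose_scale_right linear_funpow)

lemma feval_1: "n > 0 ==> feval n 1 X x = x"
 unfolding feval_def by (subst sum.remove[of _ 0]) (auto intro: sum.neutral)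

lemma feval_X:
 assumes "linear X" "!!x. (X ^^ n) x = 0"
 shows "feval n fps_X X x = X x"
proof (cases "n \<ge> 2")
 case True
 thus ?thesis
  unfolding feval_def by (subst sum.remove[of _ 1]) (auto intro!: sum.neutral simp: fps_X_def)
next
 case False
 hence "X x = 0" "n = 0 | n = 1"
  using funpow_nilpotent_mono[OF assms, of 1] by auto
 thus ?thesis by (auto simp: feval_def)
qed

lemma feval_add: "feval n (f + g) X x = feval n f X x + feval n g X x"
 by (simp add: feval_def scaleR_add_left sum.distrib)

lemma feval_diff: "feval n (f - g) X x = feval n f X x - feval n g X x"
 by (simp add: feval_def scaleR_diff_left sum_subtractf)

lemma feval_mult:
 assumes "linear X" "!!x. (X ^^ n) x = 0"
 shows "feval n (f * g) X x = feval n f X (feval n g X x)"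
proof -
 let ?h = "%i j. (fps_nth f i * fps_nth g j) *\<^sub>R (X ^^ (i + j)) x"
 have "feval n f X (feval n g X x) = (\<Sum>i<n. \<Sum>j<n. ?h i j)"
  unfolding feval_def
  by (simp add: linear_sum[OF linear_funpow[OF assms(1)]] linear_scale[OF linear_funpow[OF assms(1)]]
    scaleR_sum_right funpow_add)
 also have "... = (\<Sum>(i,j)\<in>{..<n} \<times> {..<n}. ?h i j)"
  by (simp add: sum.cartesian_product)
 also have "... = (\<Sum>(i,j)\<in>{(i,j). i + j < n}. ?h i j)"
  by (rule sum.mono_neutral_right) (auto, metis assms funpow_nilpotent_mono not_less)
 also have "... = (\<Sum>k<n. \<Sum>i\<le>k. ?h i (k - i))"
  by (rule sum.triangle_reindex)
 also have "... = feval n (f * g) X x"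
  unfolding feval_def fps_mult_nth
  by (intro sum.cong) (auto simp: scaleR_sum_left atMost_atLeast0)
 finally show ?thesis ..
qed

lemma feval_power:
 assumes "linear X" "!!x. (X ^^ n) x = 0" "n > 0"
 shows "feval n (f ^ k) X x = ((feval n f X) ^^ k) x"
 by (induction k arbitrary: x) (simp_all add: feval_1 assms feval_mult[OF assms(1,2)])

lemma feval_funpow_eq_0:
 assumes "linear X" "!!x. (X ^^ n) x = 0" "fps_nth f 0 = 0"
 shows "((feval n f X) ^^ n) x = 0"
proof (cases "n = 0")
 case True
 thus ?thesis using assms(2)[of x] by simp
next
 case False
 hence "((feval n f X) ^^ n) x = feval n (f ^ n) X x"
  using feval_power[OF assms(1,2)] by simp
 also have "... = 0" unfolding feval_def
  by (rule sum.neutral) (auto simp: startsby_zero_power_prefix[OF assms(3)])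
 finally show ?thesis .
qed

lemma feval_compose:
 assumes "linear X" "!!x. (X ^^ n) x = 0" "fps_nth g 0 = 0"
 shows "feval n (f oo g) X x = feval n f (feval n g X) x"
proof (cases "n = 0")
 case True
 thus ?thesis by (simp add: feval_def)
next
 case False
 have "feval n f (feval n g X) x = (\<Sum>i<n. fps_nth f i *\<^sub>R feval n (g ^ i) X x)"
  unfolding feval_def[of n f] using feval_power[OF assms(1,2)] False by simp
 also have "... = (\<Sum>i<n. \<Sum>k<n. (fps_nth f i * fps_nth (g ^ i) k) *\<^sub>R (X ^^ k) x)"
  by (simp add: feval_def scaleR_sum_right)
 also have "... = (\<Sum>k<n. \<Sum>i<n. (fps_nth f i * fps_nth (g ^ i) k) *\<^sub>R (X ^^ k) x)"
  by (rule sum.swap)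
 also have "... = (\<Sum>k<n. \<Sum>i\<in>{0..k}. (fps_nth f i * fps_nth (g ^ i) k) *\<^sub>R (X ^^ k) x)"
  by (intro sum.cong refl sum.mono_neutral_right)
   (auto simp: startsby_zero_power_prefix[OF assms(3)])
 also have "... = feval n (f oo g) X x"
  by (simp add: feval_def fps_compose_nth scaleR_sum_left)
 finally show ?thesis ..
qed

lemma feval_in_subspace:
 assumes "subspace Y" "X ` Y \<subseteq> Y" "x \<in> Y"
 shows "feval n f X x \<in> Y"
proof -
 have "(X ^^ k) x \<in> Y" for k
  by (induction k) (use assms in auto)
 thus ?thesis unfolding feval_def
  by (intro subspace_sum assms(1) subspace_scale) auto
qed

lemma feval_commute:
 assumes "linear A" "!!y. A (X y) = X (A y)"
 shows "A (feval n f X x) = feval n f X (A x)"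
proof -
 have "A ((X ^^ k) x) = (X ^^ k) (A x)" for k
  by (induction k) (auto simp: assms(2))
 thus ?thesis unfolding feval_def
  by (simp add: linear_sum[OF assms(1)] linear_scale[OF assms(1)])
qed

lemma exp_log_unipotent:
 assumes "linear X" "!!x. (X ^^ n) x = 0" "n > 0"
 shows "feval n (fps_exp 1) (feval n (fps_ln 1) X) x = x + X x"
proof -
 have "feval n (fps_exp 1 - 1) (feval n (fps_ln 1) X) x = feval n ((fps_exp 1 - 1) oo fps_ln 1) X x"
  using feval_compose[OF assms(1,2), of "fps_ln 1"] by simp
 also have "(fps_exp 1 - 1) oo fps_ln 1 = (fps_X :: real fps)"
  using fps_inv_fps_exp_compose(2)[of "1::real"] fps_ln_fps_exp_inv[of "1::real"] by simp
 finally show ?thesis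
  using feval_X[OF assms(1,2)] feval_1[OF assms(3)] by (simp add: feval_diff algebra_simps)
qed

lemma inverse_sqrt_unipotent:
 assumes "linear X" "!!x. (X ^^ n) x = 0" "n > 0"
 defines "Q == feval n (fps_binomial (-1/2)) X"
 shows "Q (Q (x + X x)) = x"
proof -
 have "fps_binomial (-1/2) * (fps_binomial (-1/2) * (1 + fps_X)) = (1 :: real fps)"
  unfolding fps_binomial_1[symmetric] fps_binomial_add_mult[symmetric] by simp
 hence "feval n (fps_binomial (-1/2) * (fps_binomial (-1/2) * (1 + fps_X))) X x = x"
  using feval_1[OF assms(3)] by simp
 thus ?thesis
  unfolding feval_mult[OF assms(1,2)] feval_add feval_X[OF assms(1,2)] feval_1[OF assms(3)] Q_def .
qed

section \<open>Polynomials of operators and the Jordan decomposition\<close>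

definition peval :: "complex poly => ('v::real_vector \<times> 'v => 'v \<times> 'v) => 'v \<times> 'v => 'v \<times> 'v" where
 "peval p T x = (\<Sum>i\<le>degree p. sc (coeff p i) ((T ^^ i) x))"

lemma peval_bound:
 assumes "degree p \<le> n"
 shows "peval p T x = (\<Sum>i\<le>n. sc (coeff p i) ((T ^^ i) x))"
 unfolding peval_def by (rule sum.mono_neutral_left) (use assms in \<open>auto simp: coeff_eq_0\<close>)

lemma peval_0 [simp]: "peval 0 T x = 0"
 by (simp add: peval_def)

lemma peval_pCons [simp]:
 assumes "clinear T"
 shows "peval (pCons a p) T x = sc a x + T (peval p T x)"
proof -
 have "peval (pCons a p) T x = (\<Sum>i\<le>Suc (degree p). sc (coeff (pCons a p) i) ((T ^^ i) x))"
  by (rule peval_bound) (simp add: degree_pCons_le)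
 also have "... = sc a x + (\<Sum>i\<le>degree p. sc (coeff p i) (T ((T ^^ i) x)))"
  by (simp add: sum.atMost_Suc_shift del: sum.atMost_Suc)
 also have "(\<Sum>i\<le>degree p. sc (coeff p i) (T ((T ^^ i) x))) = T (peval p T x)"
  by (simp add: peval_def cxp.linear_sum[OF assms] cxp.linear_scale[OF assms])
 finally show ?thesis .
qed

lemma peval_add: "peval (p + q) T x = peval p T x + peval q T x"
proof -
 let ?n = "max (degree p) (degree q)"
 show ?thesis
  using peval_bound[of p ?n T x] peval_bound[of q ?n T x] peval_bound[of "p + q" ?n T x]
  by (simp add: degree_add_le cx.scale_left_distrib sum.distrib)
qed

lemma peval_smult: "peval (smult c p) T x = sc c (peval p T x)"
proof -
 have "degree (smult c p) \<le> degree p" by (rule degree_smult_le)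
 from peval_bound[OF this, of T x] show ?thesis
  by (simp add: peval_def[of p] cx.scale_sum_right)
qed

lemma peval_sum: "peval (\<Sum>i\<in>A. p i) T x = (\<Sum>i\<in>A. peval (p i) T x)"
 by (induction A rule: infinite_finite_induct) (auto simp: peval_add)

lemma peval_1 [simp]: "peval 1 T x = x"
 by (simp add: peval_def)

lemma clinear_peval:
 assumes "clinear T"
 shows "clinear (peval p T)"
proof (rule clinearI)
 note l = clinear_funpow[OF assms]
 show "peval p T (x + y) = peval p T x + peval p T y" for x y
  by (simp add: peval_def cxp.linear_add[OF l] cx.scale_right_distrib sum.distrib)
 show "peval p T (sc c x) = sc c (peval p T x)" for c x
  by (simp add: peval_def cxp.linear_scale[OF l] cx.scale_sum_right mult.commute)
qed

lemma peval_mult: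
 assumes "clinear T"
 shows "peval (p * q) T x = peval p T (peval q T x)"
proof (induction p)
 case (pCons a p)
 thus ?case
  by (simp add: assms peval_add peval_smult)
qed simp

lemma peval_linear_factor: "clinear T ==> peval [:-mu, 1:] T x = T x - sc mu x"
 by (simp add: cxp.linear_0)

lemma peval_linear_power:
 assumes "clinear T"
 shows "peval ([:-mu, 1:] ^ n) T x = ((%y. T y - sc mu y) ^^ n) x"
 by (induction n) (simp_all add: peval_mult[OF assms] peval_linear_factor[OF assms] del: peval_pCons mult_pCons_left)

lemma peval_in_subspace:
 assumes "cx.subspace Y" "T ` Y \<subseteq> Y" "x \<in> Y"
 shows "peval p T x \<in> Y"
proof -
 have "(T ^^ i) x \<in> Y" for i by (induction i) (use assms in auto)
 thus ?thesis unfolding peval_def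
  by (intro cx.subspace_sum cx.subspace_scale assms)
qed

lemma peval_commute:
 assumes "clinear A" "!!y. A (T y) = T (A y)"
 shows "A (peval p T x) = peval p T (A x)"
proof -
 have "A ((T ^^ i) x) = (T ^^ i) (A x)" for i by (induction i) (auto simp: assms)
 thus ?thesis
  by (simp add: peval_def cxp.linear_sum[OF assms(1)] cxp.linear_scale[OF assms(1)])
qed

lemma peval_eigenvector:
 assumes "clinear T" "T x = sc mu x"
 shows "peval p T x = sc (poly p mu) x"
proof -
 have *: "T (sc c x) = sc (mu * c) x" for c
  by (simp add: cxp.linear_scale[OF assms(1)] assms(2) mult.commute)
 show ?thesis
  by (induction p) (simp_all add: assms(1) * cx.scale_left_distrib)
qed

lemma peval_eq_0_dvd:
 assumes "clinear T" "p dvd q" "peval p T x = 0"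
 shows "peval q T x = 0"
proof -
 obtain r where "q = p * r" using assms(2) by (rule dvdE)
 hence "q = r * p" by (simp only: mult.commute)
 thus ?thesis
  by (simp add: peval_mult[OF assms(1)] assms(3) cxp.linear_0[OF clinear_peval[OF assms(1)]])
qed

lemma cx_finite_basis:
 assumes "fin_dim (UNIV :: 'v::real_vector set)"
 obtains B :: "('v::real_vector \<times> 'v) set" where "finite B" "cx.independent B" "cx.span B = UNIV"
proof -
 obtain B0 :: "'v set" where B0: "finite B0" "span B0 = UNIV"
  using assms by (auto simp: fin_dim_def)
 let ?B = "(%b. (b, 0)) ` B0"
 have real: "(v, 0) \<in> cx.span ?B" for v
 proof -
  have "v \<in> span B0" using B0 by simp
  thus ?thesis
  proof (induction rule: span_induct_alt)
   case base
   thus ?case using cx.span_zero[of ?B] by (simp add: zero_prod_def)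
  next
   case (step c x y)
   have "sc (of_real c) (x, 0) + (y, 0) \<in> cx.span ?B"
   proof (rule cx.span_add[OF cx.span_scale])
    show "(x, 0) \<in> cx.span ?B" using step by (intro cx.span_base) auto
   qed (use step in auto)
   thus ?case by simp
  qed
 qed
 have "cx.span ?B = UNIV"
 proof -
  have "(a, b) \<in> cx.span ?B" for a b
   unfolding pair_eq_real_plus_imag[of a b] by (intro cx.span_add cx.span_scale real)
  thus ?thesis by auto
 qed
 moreover obtain B where "B \<subseteq> ?B" "cx.independent B" "?B \<subseteq> cx.span B"
  using cx.maximal_independent_subset[of ?B] by auto
 ultimately show ?thesis
  using that[of B] finite_subset[of B ?B] B0(1)
  by (metis cx.span_mono cx.span_span finite_imageI top.extremum_uniqueI)
qed

lemma annihilating_polynomial: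
 fixes T :: "'v::real_vector \<times> 'v => 'v \<times> 'v"
 assumes fd: "fin_dim (UNIV :: 'v set)" and T: "clinear T"
 obtains p where "p ~= 0" "!!x. peval p T x = 0"
proof -
 obtain B :: "('v \<times> 'v) set" where B: "finite B" "cx.span B = UNIV"
  using cx_finite_basis[OF fd] by metis
 have "\<exists>p. p ~= 0 & peval p T b = 0" for b
 proof -
  obtain c where c: "\<exists>i\<in>{..card B}. c i ~= 0" "(\<Sum>i\<in>{..card B}. sc (c i) ((T ^^ i) b)) = 0"
   using dependent_family[of "{..card B}" B "%i. (T ^^ i) b"] B by auto
  define p where "p = (\<Sum>i\<le>card B. monom (c i) i)"
  have co: "coeff p i = (if i \<le> card B then c i else 0)" for i
   by (simp add: p_def coeff_sum)
  have "degree p \<le> card B"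
   by (rule degree_le) (simp add: co)
  from peval_bound[OF this, of T b] have "peval p T b = 0"
   using c(2) by (simp add: co)
  moreover have "p ~= 0"
   using c(1) co by (metis atMost_iff coeff_0)
  ultimately show ?thesis by blast
 qed
 then obtain P where P: "!!b. P b ~= 0" "!!b. peval (P b) T b = 0" by metis
 let ?p = "\<Prod>b\<in>B. P b"
 have "peval ?p T x = 0" for x
 proof -
  have "x \<in> cx.span B" using B by simp
  thus ?thesis
  proof (induction rule: cx.span_induct_alt)
   case base
   thus ?case by (simp add: cxp.linear_0[OF clinear_peval[OF T]])
  next
   case (step c b y)
   have "?p = prod P (B - {b}) * P b"
    using prod.remove[OF B(1) step(1), of P] by (simp add: mult.commute)
   hence "peval ?p T b = 0"
    by (simp add: peval_mult[OF T] P(2) cxp.linear_0[OF clinear_peval[OF T]])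
   thus ?case
    using step by (simp add: cxp.linear_add[OF clinear_peval[OF T]] cxp.linear_scale[OF clinear_peval[OF T]])
  qed
 qed
 moreover have "?p ~= 0" using P(1) B(1) by simp
 ultimately show ?thesis using that by blast
qed

lemma coprime_linear_powers:
 assumes "nu ~= (mu::complex)"
 shows "coprime ([:-nu, 1:] ^ n) ([:-mu, 1:] ^ k)"
proof -
 have "coprime [:-nu, 1:] [:-mu, 1:]"
 proof (rule coprimeI)
  fix c assume c: "c dvd [:-nu, 1:]" "c dvd [:-mu, 1:]"
  hence "c dvd [:-nu, 1:] - [:-mu, 1:]" by (rule dvd_diff)
  hence "c dvd [:mu - nu:]" by simp
  moreover have "[:mu - nu:] dvd 1"
   using assms by (simp add: is_unit_const_poly_iff dvd_field_iff)
  ultimately show "c dvd 1" by (rule dvd_trans)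
 qed
 thus ?thesis by simp
qed

lemma prod_linear_powers_dvd:
 assumes "finite A" "!!mu. mu \<in> A ==> [:-mu, 1::complex:] ^ n dvd q"
 shows "(\<Prod>mu\<in>A. [:-mu, 1:] ^ n) dvd q"
 using assms
proof (induction A)
 case (insert a A)
 have "coprime ([:-a, 1:] ^ n) (\<Prod>mu\<in>A. [:-mu, 1:] ^ n)"
  using insert(2) by (intro prod_coprime_right) (metis coprime_linear_powers)
 thus ?case using insert by (simp add: divides_mult)
qed simp

lemma spectral_projection_polynomials:
 fixes T :: "'v::real_vector \<times> 'v => 'v \<times> 'v"
 assumes fd: "fin_dim (UNIV :: 'v set)" and T: "clinear T"
 obtains A n q where "finite A" "cnj ` A \<subseteq> A" "n > 0"
  "!!x. (\<Sum>nu\<in>A. peval (q nu) T x) = x"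
  "!!nu x. nu \<in> A ==> ((%y. T y - sc nu y) ^^ n) (peval (q nu) T x) = 0"
  "!!nu mu x. nu \<in> A ==> mu \<in> A ==> ((%y. T y - sc mu y) ^^ n) x = 0 ==>
    peval (q nu) T x = (if nu = mu then x else 0)"
proof -
 obtain p where p: "p ~= 0" "!!x. peval p T x = 0"
  using annihilating_polynomial[OF fd T] by metis
 define R where "R = {z. poly p z = 0}"
 have R: "finite R" unfolding R_def using p(1) by (rule poly_roots_finite)
 define A where "A = R \<union> cnj ` R"
 define n where "n = Suc (degree p)"
 have A: "finite A" "cnj ` A \<subseteq> A" using R by (auto simp: A_def)
 let ?l = "%mu. [:-mu, 1:] ^ n :: complex poly"
 have pd: "p dvd (\<Prod>mu\<in>A. ?l mu)"
 proof -
  have "smult (lead_coeff p) (\<Prod>z\<in>R. [:-z, 1:] ^ order z p) dvd (\<Prod>z\<in>R. [:-z, 1:] ^ order z p)"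
   using p(1) by (simp only: smult_dvd_iff) simp
  hence "p dvd (\<Prod>z\<in>R. [:-z, 1:] ^ order z p)"
   unfolding R_def complex_poly_decompose .
  also have "... dvd (\<Prod>mu\<in>R. ?l mu)"
  proof (intro prod_dvd_prod le_imp_power_dvd)
   show "order z p \<le> n" for z using order_degree[OF p(1), of z] by (simp add: n_def)
  qed
  also have "... dvd (\<Prod>mu\<in>A. ?l mu)"
  proof (rule prod_dvd_prod_subset)
   show "finite A" "R \<subseteq> A" using A by (auto simp: A_def)
  qed
  finally show ?thesis .
 qed
 have ann: "peval r T x = 0" if "!!mu. mu \<in> A ==> ?l mu dvd r" for r x
  using peval_eq_0_dvd[OF T dvd_trans[OF pd prod_linear_powers_dvd[OF A(1) that]] p(2)] .
 have "\<exists>b. \<forall>nu\<in>A. ?l nu dvd b nu - 1 & (\<forall>mu\<in>A - {nu}. ?l mu dvd b nu)"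
 proof -
  have "\<exists>b. ?l nu dvd b - 1 & (\<forall>mu\<in>A - {nu}. ?l mu dvd b)" if "nu \<in> A" for nu
  proof -
   define r where "r = (\<Prod>mu\<in>A - {nu}. ?l mu)"
   define u where "u = ?l nu"
   have "coprime u r"
    unfolding u_def r_def
   proof (rule prod_coprime_right)
    fix mu assume "mu \<in> A - {nu}"
    thus "coprime (?l nu) (?l mu)" by (intro coprime_linear_powers) auto
   qed
   hence xy: "fst (bezout_coefficients u r) * u + snd (bezout_coefficients u r) * r = 1"
    using bezout_coefficients_fst_snd[of u r] by (simp only: coprime_imp_gcd_eq_1)
   define b where "b = snd (bezout_coefficients u r) * r"
   have "b - 1 = b - (fst (bezout_coefficients u r) * u + b)"
    using xy by (simp only: b_def)
   hence "b - 1 = - (fst (bezout_coefficients u r) * u)" by simp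
   hence "?l nu dvd b - 1" unfolding u_def by (simp only: dvd_minus_iff dvd_triv_right)
   moreover have "?l mu dvd b" if "mu \<in> A - {nu}" for mu
    unfolding b_def r_def using A(1) that by (intro dvd_mult dvd_prodI) auto
   ultimately show ?thesis by blast
  qed
  thus ?thesis by (intro bchoice) auto
 qed
 then obtain q where q1: "!!nu. nu \<in> A ==> ?l nu dvd q nu - 1"
  and q2: "!!nu mu. nu \<in> A ==> mu \<in> A ==> mu ~= nu ==> ?l mu dvd q nu"
  by auto
 have s: "(\<Sum>nu\<in>A. peval (q nu) T x) = x" for x
 proof -
  have "peval ((\<Sum>nu\<in>A. q nu) - 1) T x = 0"
  proof (rule ann)
   fix mu assume mu: "mu \<in> A"
   have "(\<Sum>nu\<in>A. q nu) - 1 = (q mu - 1) + (\<Sum>nu\<in>A - {mu}. q nu)"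
    using sum.remove[OF A(1) mu, of q] by simp
   moreover have "?l mu dvd (\<Sum>nu\<in>A - {mu}. q nu)"
    using mu by (intro dvd_sum q2) auto
   ultimately show "?l mu dvd (\<Sum>nu\<in>A. q nu) - 1"
    using q1[OF mu] by (simp only: dvd_add)
  qed
  thus ?thesis
   using peval_add[of "(\<Sum>nu\<in>A. q nu) - 1" 1 T x] by (simp add: peval_sum)
 qed
 show ?thesis
 proof (rule that[OF A, of n q])
  show "n > 0" by (simp add: n_def)
  show "(\<Sum>nu\<in>A. peval (q nu) T x) = x" for x by (rule s)
  show "((%y. T y - sc nu y) ^^ n) (peval (q nu) T x) = 0" if "nu \<in> A" for nu x
  proof -
   have "peval (?l nu * q nu) T x = 0"
   proof (rule ann)
    show "?l mu dvd ?l nu * q nu" if "mu \<in> A" for mu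
     using q2[OF \<open>nu \<in> A\<close> that] by (cases "mu = nu") auto
   qed
   thus ?thesis by (simp add: peval_mult[OF T] peval_linear_power[OF T])
  qed
  show "peval (q nu) T x = (if nu = mu then x else 0)"
   if "nu \<in> A" "mu \<in> A" "((%y. T y - sc mu y) ^^ n) x = 0" for nu mu x
  proof -
   have z: "peval (?l mu) T x = 0" using that(3) by (simp add: peval_linear_power[OF T])
   have dz: "peval r T x = 0" if "?l mu dvd r" for r
    by (rule peval_eq_0_dvd[OF T that z])
   show ?thesis
   proof (cases "nu = mu")
    case True
    thus ?thesis using dz[OF q1[OF that(2)]] peval_add[of "q mu - 1" 1 T x] by simp
   next
    case False
    thus ?thesis using dz[OF q2[OF that(1,2)]] by simp
   qed
  qed
 qed
qed

lemma cx_span_of_real: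
 assumes "v \<in> span B"
 shows "(v, 0) \<in> cx.span ((%b. (b, 0)) ` B)"
 using assms
proof (induction rule: span_induct_alt)
 case base
 thus ?case using cx.span_zero by (simp add: zero_prod_def)
next
 case (step c x y)
 have "sc (of_real c) (x, 0) + (y, 0) \<in> cx.span ((%b. (b, 0)) ` B)"
 proof (rule cx.span_add[OF cx.span_scale])
  show "(x, 0) \<in> cx.span ((%b. (b, 0)) ` B)" using step by (intro cx.span_base) auto
 qed (use step in auto)
 thus ?case by simp
qed

lemma real_operator_if_commutes_with_conj:
 assumes f: "clinear f" and c: "!!x. f (cconj x) = cconj (f x)"
 obtains g where "linear g" "f = cmap g"
proof -
 have s: "snd (f (v, 0)) = 0" for v
  using c[of "(v, 0)"] cconj_real_iff[of "f (v, 0)"] by simp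
 define g where "g v = fst (f (v, 0))" for v
 have fg: "f (v, 0) = (g v, 0)" for v
  using s[of v] by (simp add: g_def prod_eq_iff)
 have "f (a, b) = cmap g (a, b)" for a b
 proof -
  have "f (a, b) = f (a, 0) + sc \<i> (f (b, 0))"
   using pair_eq_real_plus_imag[of a b] by (metis cxp.linear_add[OF f] cxp.linear_scale[OF f])
  thus ?thesis by (simp add: fg scaleCx_ii)
 qed
 moreover have "linear g"
 proof (rule linearI)
  show "g (a + b) = g a + g b" for a b
   using cxp.linear_add[OF f, of "(a, 0)" "(b, 0)"] by (simp add: g_def)
  show "g (r *\<^sub>R a) = r *\<^sub>R g a" for r a
   using clinear_scaleR[OF f, of r "(a, 0)"] by (simp add: g_def)
 qed
 ultimately show ?thesis using that[of g] by (simp add: fun_eq_iff)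
qed

lemma clinear_shift: "clinear T ==> clinear (%y. T y - sc mu y)"
 by (rule clinearI)
  (simp_all add: cxp.linear_add cxp.linear_scale cx.scale_right_distrib cx.scale_right_diff_distrib mult.commute)

lemma cmap_minus_id: "cmap (%y. f y - y) = (%y. cmap f y - y)"
 by (auto simp: fun_eq_iff)

lemma jordan_decomposition_exists:
 fixes M :: "'v::real_vector => 'v"
 assumes fd: "fin_dim (UNIV :: 'v set)" and M: "linear M" and inj: "!!x. M x = 0 ==> x = 0"
 obtains Ms Mu where "linear Ms" "linear Mu" "jordan_decomposition UNIV M Ms Mu"
  "!!Y. cx.subspace Y ==> cmap M ` Y \<subseteq> Y ==> cmap Ms ` Y \<subseteq> Y"
proof -
 let ?T = "cmap M"
 have T: "clinear ?T" by (rule clinear_cmap[OF M])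
 obtain A n q where A: "finite A" "cnj ` A \<subseteq> A" "n > 0"
  and sum: "!!x. (\<Sum>nu\<in>A. peval (q nu) ?T x) = x"
  and gen: "!!nu x. nu \<in> A ==> ((%y. ?T y - sc nu y) ^^ n) (peval (q nu) ?T x) = 0"
  and proj: "!!nu mu x. nu \<in> A ==> mu \<in> A ==> ((%y. ?T y - sc mu y) ^^ n) x = 0 ==>
    peval (q nu) ?T x = (if nu = mu then x else 0)"
  by (rule spectral_projection_polynomials[OF fd T], rule that, assumption+)
 define G where "G nu = {x. ((%y. ?T y - sc nu y) ^^ n) x = 0}" for nu
 note lp = clinear_funpow[OF clinear_shift[OF T]]
 have subG: "cx.subspace (G nu)" for nu
  unfolding G_def cx.subspace_def
  by (auto simp: cxp.linear_0[OF lp] cxp.linear_add[OF lp] cxp.linear_scale[OF lp])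
 have T_G: "?T x \<in> G nu" if "x \<in> G nu" for x nu
 proof -
  have comm: "?T (((%y. ?T y - sc nu y) ^^ k) x) = ((%y. ?T y - sc nu y) ^^ k) (?T x)" for k
   by (induction k) (auto simp: cxp.linear_diff[OF T] cxp.linear_scale[OF T])
  show ?thesis using comm[of n, symmetric] that cxp.linear_0[OF T] by (simp add: G_def)
 qed
 have G0: "x = 0" if "x \<in> G 0" for x
 proof -
  have "(?T ^^ k) x = 0 ==> x = 0" for k
   by (induction k) (auto simp: prod_eq_iff dest: inj)
  thus ?thesis using that by (simp add: G_def)
 qed
 have ext: "f = g" if "clinear f" "clinear g" "!!mu x. mu \<in> A ==> x \<in> G mu ==> f x = g x" for f g :: "'v \<times> 'v => 'v \<times> 'v"
 proof
  fix x
  have "f (\<Sum>nu\<in>A. peval (q nu) ?T x) = g (\<Sum>nu\<in>A. peval (q nu) ?T x)"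
   unfolding cxp.linear_sum[OF that(1)] cxp.linear_sum[OF that(2)]
   by (rule sum.cong) (use that(3) gen in \<open>auto simp: G_def\<close>)
  thus "f x = g x" by (simp add: sum)
 qed
 have conjG: "cconj x \<in> G (cnj nu)" if "x \<in> G nu" for x nu
 proof -
  have "((%y. ?T y - sc (cnj nu) y) ^^ k) (cconj x) = cconj (((%y. ?T y - sc nu y) ^^ k) x)" for k
   by (induction k) (auto simp: cmap_cconj[OF M] simp del: cconj_simps(7))
  thus ?thesis using that by (simp add: G_def)
 qed
 define s where "s = (\<Sum>nu\<in>A. smult nu (q nu))"
 define u where "u = (\<Sum>nu\<in>A. smult (1 / nu) ([:0, 1:] * q nu))"
 let ?S = "peval s ?T" and ?U = "peval u ?T"
 have S: "clinear ?S" and U: "clinear ?U" by (rule clinear_peval[OF T])+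
 have pick: "(\<Sum>nu\<in>A. sc (c nu) (f (if nu = mu then x else 0))) = sc (c mu) (f x)"
  if "mu \<in> A" "f 0 = 0" for c mu x and f :: "'v \<times> 'v => 'v \<times> 'v"
  by (subst sum.remove[OF A(1) that(1)]) (auto intro!: sum.neutral simp: that(2))
 have S_G: "?S x = sc mu x" if "mu \<in> A" "x \<in> G mu" for mu x
  using pick[OF that(1), of "%x. x" "%nu. nu" x] proj[OF _ that(1)] that(2)
  by (simp add: s_def peval_sum peval_smult G_def)
 have U_G: "?U x = sc (1 / mu) (?T x)" if "mu \<in> A" "x \<in> G mu" for mu x
  using pick[where f = ?T and c = "%nu. 1 / nu" and x = x, OF that(1) cxp.linear_0[OF T]] proj[OF _ that(1)] that(2)
  by (simp add: u_def peval_sum peval_smult G_def peval_mult[OF T] T cxp.linear_0[OF T] del: mult_pCons_left)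
 have cc: "clinear (%x. cconj (f (cconj x)))" if "clinear f" for f :: "'v \<times> 'v => 'v \<times> 'v"
  by (rule clinearI) (simp_all add: cxp.linear_add[OF that] cxp.linear_scale[OF that])
 have "(%x. cconj (?S (cconj x))) = ?S"
  by (rule ext[OF cc[OF S] S]) (use A(2) S_G conjG in auto)
 hence Sc: "?S (cconj x) = cconj (?S x)" for x by (metis cconj_simps(1))
 have "(%x. cconj (?U (cconj x))) = ?U"
 proof (rule ext[OF cc[OF U] U])
  fix mu x assume *: "mu \<in> A" "x \<in> G mu"
  hence "?U (cconj x) = sc (1 / cnj mu) (?T (cconj x))"
   using A(2) conjG by (intro U_G) auto
  thus "cconj (?U (cconj x)) = ?U x"
   using U_G[OF *] by (simp add: cmap_cconj[OF M])
 qed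
 hence Uc: "?U (cconj x) = cconj (?U x)" for x by (metis cconj_simps(1))
 obtain Ms where Ms: "linear Ms" "?S = cmap Ms"
  using real_operator_if_commutes_with_conj[OF S Sc] .
 obtain Mu where Mu: "linear Mu" "?U = cmap Mu"
  using real_operator_if_commutes_with_conj[OF U Uc] .
 have U_in_G: "?U x \<in> G mu" if "mu \<in> A" "x \<in> G mu" for mu x
  using U_G[OF that] T_G[OF that(2)] subG[of mu] by (simp add: cx.subspace_scale)
 have SU: "(%x. ?S (?U x)) = ?T"
 proof (rule ext[OF _ T])
  show "clinear (%x. ?S (?U x))"
   by (rule clinearI) (simp_all add: cxp.linear_add[OF S] cxp.linear_scale[OF S] cxp.linear_add[OF U] cxp.linear_scale[OF U])
  fix mu x assume *: "mu \<in> A" "x \<in> G mu"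
  show "?S (?U x) = ?T x"
  proof (cases "mu = 0")
   case True
   hence "x = 0" using G0 * by simp
   thus ?thesis by (simp add: cxp.linear_0[OF T] cxp.linear_0[OF S] cxp.linear_0[OF U])
  next
   case False
   thus ?thesis using S_G[OF *(1) U_in_G[OF *]] U_G[OF *] by simp
  qed
 qed
 have US: "(%x. ?U (?S x)) = ?T"
 proof -
  have "?U (?S x) = ?S (?U x)" for x
   by (metis peval_mult[OF T] mult.commute)
  thus ?thesis using SU by simp
 qed
 have real: "M x = Ms (Mu x)" "M x = Mu (Ms x)" for x
  using fun_cong[OF SU, of "(x, 0)"] fun_cong[OF US, of "(x, 0)"] by (simp_all add: Ms(2) Mu(2))
 have "(x::'v \<times> 'v) \<in> cx.span {x. \<exists>mu. cmap Ms x = sc mu x}" for x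
 proof -
  have "(\<Sum>nu\<in>A. peval (q nu) ?T x) \<in> cx.span {x. \<exists>mu. cmap Ms x = sc mu x}"
  proof (intro cx.span_sum cx.span_base)
   fix nu assume "nu \<in> A"
   hence "?S (peval (q nu) ?T x) = sc nu (peval (q nu) ?T x)"
    using gen by (intro S_G) (auto simp: G_def)
   thus "peval (q nu) ?T x \<in> {x. \<exists>mu. cmap Ms x = sc mu x}"
    unfolding Ms(2) by blast
  qed
  thus ?thesis by (simp add: sum)
 qed
 moreover have "((%y. Mu y - y) ^^ n) x = 0" for x
 proof -
  let ?V = "%y. ?U y - y"
  have V: "clinear ?V" using clinear_shift[OF U, of 1] by simp
  have "(?V ^^ n) = (%_. 0)"
  proof (rule ext[OF clinear_funpow[OF V]])
   show "clinear (%x :: 'v \<times> 'v. 0 :: 'v \<times> 'v)" by (rule clinearI) auto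
   fix mu x assume *: "mu \<in> A" "x \<in> G mu"
   show "(?V ^^ n) x = 0"
   proof (cases "mu = 0")
    case True
    hence "x = 0" using G0 * by simp
    thus ?thesis by (simp add: cxp.linear_0[OF clinear_funpow[OF V]])
   next
    case False
    have "(?V ^^ k) x = sc ((1 / mu) ^ k) (((%y. ?T y - sc mu y) ^^ k) x) & (?V ^^ k) x \<in> G mu" for k
    proof (induction k)
     case 0
     thus ?case using * by simp
    next
     case (Suc k)
     let ?y = "(?V ^^ k) x"
     have "?V ?y = sc (1 / mu) (?T ?y - sc mu ?y)"
      using U_G[OF *(1) conjunct2[OF Suc]] False by (simp add: cx.scale_right_diff_distrib)
     also have "?T ?y - sc mu ?y = sc ((1 / mu) ^ k) (((%y. ?T y - sc mu y) ^^ Suc k) x)"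
      using Suc cxp.linear_scale[OF clinear_shift[OF T, of mu]] by simp
     finally show ?case
      using cx.subspace_diff[OF subG U_in_G[OF *(1) conjunct2[OF Suc]] conjunct2[OF Suc]] by simp
    qed
    from this[of n] show ?thesis using * by (simp add: G_def)
   qed
  qed
  hence "cmap ((%y. Mu y - y) ^^ n) (x, 0) = 0"
   unfolding Mu(2) cmap_minus_id[symmetric] cmap_funpow[symmetric] by metis
  thus ?thesis by (simp add: zero_prod_def)
 qed
 ultimately have "jordan_decomposition UNIV M Ms Mu"
  unfolding jordan_decomposition_def
  using Ms(1) Mu(1) real by (auto simp: linear_on_def linear_add linear_scale)
 moreover have "cmap Ms ` Y \<subseteq> Y" if "cx.subspace Y" "cmap M ` Y \<subseteq> Y" for Y
  using peval_in_subspace[OF that, of _ s] Ms(2) by auto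
 ultimately show ?thesis using that Ms(1) Mu(1) by blast
qed

subsection \<open>Uniqueness\<close>

lemma linear_on_extend:
 assumes "subspace V" "linear_on V f"
 obtains g where "linear g" "!!x. x \<in> V ==> g x = f x"
proof -
 obtain B where B: "B \<subseteq> V" "independent B" "V \<subseteq> span B"
  using real_vector.maximal_independent_subset by blast
 obtain g where g: "linear g" "!!b. b \<in> B ==> g b = f b"
  using linear_independent_extend[OF B(2), of f] by blast
 have f0: "f 0 = 0"
  using assms(2) real_vector.subspace_0[OF assms(1)] unfolding linear_on_def by (metis scaleR_zero_left)
 have "x \<in> V & g x = f x" if "x \<in> span B" for x
  using that
 proof (induction rule: span_induct_alt)
  case base
  thus ?case using f0 linear_0[OF g(1)] real_vector.subspace_0[OF assms(1)] by simp
 next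
  case (step c x y)
  thus ?case
   using B(1) g assms(2) real_vector.subspace_add[OF assms(1)] real_vector.subspace_scale[OF assms(1)]
   unfolding linear_on_def by (simp add: linear_add linear_scale subset_iff)
 qed
 thus ?thesis using that[of g] g(1) B(3) by blast
qed

lemma funpow_cong_on:
 assumes "!!x. x \<in> V ==> f x = g x" "!!x. x \<in> V ==> f x \<in> V" "x \<in> V"
 shows "(f ^^ n) x = (g ^^ n) x" "(f ^^ n) x \<in> V"
proof -
 have "(f ^^ n) x = (g ^^ n) x & (f ^^ n) x \<in> V"
  by (induction n) (use assms in auto)
 thus "(f ^^ n) x = (g ^^ n) x" "(f ^^ n) x \<in> V" by auto
qed

lemma jordan_decompositionD:
 assumes "jordan_decomposition V T Ts Tu" "x \<in> V"
 shows "Ts x \<in> V" "Tu x \<in> V" "T x = Ts (Tu x)" "T x = Tu (Ts x)"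
 using assms unfolding jordan_decomposition_def by blast+

lemma jordan_decomposition_cong:
 assumes V: "subspace V" and jd: "jordan_decomposition V T Ts Tu"
  and eq: "!!x. x \<in> V ==> T x = T' x" "!!x. x \<in> V ==> Ts x = Ts' x" "!!x. x \<in> V ==> Tu x = Tu' x"
 shows "jordan_decomposition V T' Ts' Tu'"
proof -
 have st: "Ts x \<in> V" "Tu x \<in> V" if "x \<in> V" for x
  using jd that unfolding jordan_decomposition_def by auto
 obtain n where n: "!!x. x \<in> V ==> ((%y. Tu y - y) ^^ n) x = 0"
  using jd unfolding jordan_decomposition_def by blast
 have "((%y. Tu' y - y) ^^ n) x = 0" if "x \<in> V" for x
  using funpow_cong_on(1)[of V "%y. Tu y - y" "%y. Tu' y - y" x n] that n[OF that] eq(3) st(2)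
   real_vector.subspace_diff[OF V] by simp
 hence u: "\<exists>n. \<forall>x\<in>V. ((%y. Tu' y - y) ^^ n) x = 0" by blast
 have e: "{x \<in> cplx V. \<exists>mu. cmap Ts' x = sc mu x} = {x \<in> cplx V. \<exists>mu. cmap Ts x = sc mu x}"
  using eq(2) by auto
 have "linear_on V Ts" "linear_on V Tu"
  using jd unfolding jordan_decomposition_def by blast+
 hence l: "linear_on V Ts'" "linear_on V Tu'"
  unfolding linear_on_def
  by (simp_all add: eq(2,3)[symmetric] real_vector.subspace_add[OF V] real_vector.subspace_scale[OF V])
 have c: "T' x = Ts' (Tu' x) & T' x = Tu' (Ts' x)" if x: "x \<in> V" for x
 proof -
  have "T x = Ts (Tu x)" "T x = Tu (Ts x)"
   using jd x unfolding jordan_decomposition_def by blast+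
  thus ?thesis using eq(1,2,3)[OF x] eq(2)[OF st(2)[OF x]] eq(3)[OF st(1)[OF x]] by simp
 qed
 have s: "cx.span {x \<in> cplx V. \<exists>mu. cmap Ts x = sc mu x} = cplx V"
  using jd unfolding jordan_decomposition_def by blast
 have i: "Ts' ` V \<subseteq> V" "Tu' ` V \<subseteq> V"
  using st eq by auto
 show ?thesis
  unfolding jordan_decomposition_def e by (intro conjI ballI l i s u) (use c in blast)+
qed

lemma sum_of_eigenvectors:
 fixes f :: "'v::real_vector \<times> 'v => 'v \<times> 'v"
 assumes "clinear f" "cx.subspace Y" "x \<in> cx.span {x \<in> Y. \<exists>mu. f x = sc mu x}"
 obtains A y where "finite A" "!!nu. nu \<in> A ==> y nu \<in> Y & f (y nu) = sc nu (y nu)" "x = (\<Sum>nu\<in>A. y nu)"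
proof -
 from assms(3)[unfolded cx.span_explicit] obtain t r where t: "x = (\<Sum>a\<in>t. sc (r a) a)"
  "finite t" "t \<subseteq> {x \<in> Y. \<exists>mu. f x = sc mu x}"
  by blast
 obtain ev where ev: "!!a. a \<in> t ==> f a = sc (ev a) a"
  using bchoice[of t "%a mu. f a = sc mu a"] t(3) by auto
 let ?y = "%nu. \<Sum>a\<in>{a \<in> t. ev a = nu}. sc (r a) a"
 have "x = (\<Sum>nu\<in>ev ` t. ?y nu)"
  unfolding t(1) by (rule sum.group[symmetric]) (use t(2) in auto)
 moreover have "?y nu \<in> Y" for nu
  by (intro cx.subspace_sum[OF assms(2)] cx.subspace_scale[OF assms(2)]) (use t(3) in auto)
 moreover have "f (?y nu) = sc nu (?y nu)" for nu
  unfolding cxp.linear_sum[OF assms(1)] cx.scale_sum_right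
  by (rule sum.cong) (auto simp: cxp.linear_scale[OF assms(1)] ev mult.commute)
 ultimately show ?thesis using that[of "ev ` t" ?y] t(2) by auto
qed

lemma eigenvectors_independent:
 assumes f: "clinear f" and "finite A" "!!nu. nu \<in> A ==> f (y nu) = sc nu (y nu)" "(\<Sum>nu\<in>A. y nu) = 0" "mu \<in> A"
 shows "y mu = 0"
proof -
 define q where "q = (\<Prod>nu\<in>A - {mu}. [:-nu, 1:])"
 have "0 = peval q f (\<Sum>nu\<in>A. y nu)"
  using assms(4) cxp.linear_0[OF clinear_peval[OF f]] by simp
 also have "... = (\<Sum>nu\<in>A. sc (poly q nu) (y nu))"
  unfolding cxp.linear_sum[OF clinear_peval[OF f]]
  by (rule sum.cong) (auto simp: peval_eigenvector[OF f assms(3)])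
 also have "... = sc (poly q mu) (y mu)"
 proof (subst sum.remove[OF assms(2,5)], subst sum.neutral)
  show "\<forall>nu\<in>A - {mu}. sc (poly q nu) (y nu) = 0"
  proof
   fix nu assume "nu \<in> A - {mu}"
   hence "poly q nu = 0" using assms(2) by (auto simp: q_def poly_prod)
   thus "sc (poly q nu) (y nu) = 0" by simp
  qed
 qed simp
 finally have "sc (poly q mu) (y mu) = 0" by simp
 moreover have "poly q mu ~= 0"
  using assms(2) by (auto simp: q_def poly_prod)
 ultimately show ?thesis by simp
qed

lemma generalized_eigenspaces_disjoint:
 assumes f: "clinear f" and "((%y. f y - sc mu y) ^^ n) x = 0" "((%y. f y - sc nu y) ^^ k) x = 0" "mu ~= nu"
 shows "x = 0"
 using assms(2,3)
proof (induction n arbitrary: x)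
 case (Suc n)
 let ?g = "%y. f y - sc mu y" and ?h = "%y. f y - sc nu y"
 have comm: "?g ((?h ^^ j) x) = (?h ^^ j) (?g x)" for j
 proof (induction j)
  case (Suc j)
  have "?g (?h z) = ?h (?g z)" for z
   by (simp add: cxp.linear_diff[OF f] cxp.linear_scale[OF f] cx.scale_right_diff_distrib mult.commute)
  thus ?case using Suc by simp
 qed simp
 have "(?h ^^ k) (?g x) = 0"
  using comm[of k] Suc.prems(2) cxp.linear_0[OF f] by simp
 hence "?g x = 0"
  using Suc.IH[of "?g x"] Suc.prems(1) unfolding funpow_Suc_right o_apply by blast
 hence fx: "f x = sc mu x" by simp
 have "(?h ^^ j) x = sc ((mu - nu) ^ j) x" for j
  by (induction j) (simp_all add: cxp.linear_scale[OF f] fx cx.scale_left_diff_distrib algebra_simps)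
 thus ?case using Suc.prems(2) assms(4) by simp
qed simp

lemma jordan_decomposition_generalized_eigenvector:
 assumes jd: "jordan_decomposition V T Ts Tu" and lin: "linear T" "linear Ts" "linear Tu"
  and x: "x \<in> cplx V" "cmap Ts x = sc mu x"
 obtains n where "((%y. cmap T y - sc mu y) ^^ n) x = 0"
proof -
 obtain n where n: "!!x. x \<in> V ==> ((%y. Tu y - y) ^^ n) x = 0"
  using jd unfolding jordan_decomposition_def by blast
 have T: "cmap T y = cmap Ts (cmap Tu y)" "cmap T y = cmap Tu (cmap Ts y)" "cmap Tu y \<in> cplx V"
  if "y \<in> cplx V" for y
  using jordan_decompositionD[OF jd, of "fst y"] jordan_decompositionD[OF jd, of "snd y"] that
  by (auto simp: prod_eq_iff mem_Times_iff)
 note l = clinear_cmap[OF lin(1)] clinear_cmap[OF lin(3)]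
 have V: "((%y. cmap Tu y - y) ^^ k) x = cmap ((%y. Tu y - y) ^^ k) x" for k
  unfolding cmap_minus_id[symmetric] cmap_funpow ..
 have Tu_pow: "(cmap Tu ^^ j) x \<in> cplx V & cmap Ts ((cmap Tu ^^ j) x) = sc mu ((cmap Tu ^^ j) x)" for j
 proof (induction j)
  case (Suc j)
  let ?y = "(cmap Tu ^^ j) x"
  have "cmap Ts (cmap Tu ?y) = sc mu (cmap Tu ?y)"
   using T(1)[of ?y] T(2)[of ?y] Suc cxp.linear_scale[OF l(2)] by metis
  thus ?case using T(3)[of ?y] Suc by simp
 qed (use x in simp)
 define E where "E = cx.span {(cmap Tu ^^ j) x | j. True}"
 have E: "cmap T y = sc mu (cmap Tu y) & cmap Tu y \<in> E" if "y \<in> E" for y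
  using that unfolding E_def
 proof (induction rule: cx.span_induct_alt)
  case base
  thus ?case by (simp add: cxp.linear_0[OF l(1)] cxp.linear_0[OF l(2)] cx.span_zero)
 next
  case (step c z y)
  then obtain j where j: "z = (cmap Tu ^^ j) x" by auto
  have "cmap T z = sc mu (cmap Tu z)"
   using T(2)[of z] Tu_pow[of j] j cxp.linear_scale[OF l(2)] by metis
  moreover have "cmap Tu z \<in> cx.span {(cmap Tu ^^ j) x | j. True}"
   by (rule cx.span_base) (use j in \<open>auto intro!: exI[of _ "Suc j"]\<close>)
  ultimately show ?case
   using step by (simp add: cxp.linear_add[OF l(1)] cxp.linear_add[OF l(2)] cxp.linear_scale[OF l(1)]
     cxp.linear_scale[OF l(2)] cx.scale_right_distrib cx.span_add cx.span_scale mult.commute)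
 qed
 have subE: "cx.subspace E" by (simp add: E_def cx.subspace_span)
 have xE: "x \<in> E" unfolding E_def by (rule cx.span_base) (auto intro: exI[of _ 0])
 have "((%y. cmap T y - sc mu y) ^^ k) x = sc (mu ^ k) (((%y. cmap Tu y - y) ^^ k) x)
   & ((%y. cmap Tu y - y) ^^ k) x \<in> E" for k
 proof (induction k)
  case 0
  thus ?case using xE by simp
 next
  case (Suc k)
  let ?y = "((%y. cmap Tu y - y) ^^ k) x"
  have "((%y. cmap T y - sc mu y) ^^ Suc k) x = sc (mu ^ k) (cmap T ?y - sc mu ?y)"
   using Suc cxp.linear_scale[OF clinear_shift[OF l(1), of mu], of "mu ^ k" ?y] by simp
  also have "... = sc (mu ^ Suc k) (cmap Tu ?y - ?y)"
   using E[of ?y] Suc by (simp add: cx.scale_right_diff_distrib mult.commute)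
  finally show ?case using E[of ?y] Suc subE by (simp add: cx.subspace_diff)
 qed
 from this[of n] have "((%y. cmap T y - sc mu y) ^^ n) x = 0"
  using n x(1) unfolding V by (auto simp: mem_Times_iff map_prod_def case_prod_beta zero_prod_def[symmetric])
 thus ?thesis by (rule that)
qed

lemma jordan_decomposition_unique:
 assumes V: "subspace V" and inj: "!!x. x \<in> V ==> T x = 0 ==> x = 0"
  and jd: "jordan_decomposition V T Ts Tu" "jordan_decomposition V T Ts' Tu'" and x: "x \<in> V"
 shows "Ts x = Ts' x" "Tu x = Tu' x"
proof -
 have lin: "linear_on V Ts" "linear_on V Tu" "linear_on V Ts'" "linear_on V Tu'"
  using jd unfolding jordan_decomposition_def by auto
 have linT: "linear_on V T"
  using jd(1) unfolding jordan_decomposition_def linear_on_def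
  by (smt (verit) V image_subset_iff real_vector.subspace_add real_vector.subspace_scale)
 obtain S1 where S1: "linear S1" "!!x. x \<in> V ==> S1 x = Ts x" using linear_on_extend[OF V lin(1)] by blast
 obtain U1 where U1: "linear U1" "!!x. x \<in> V ==> U1 x = Tu x" using linear_on_extend[OF V lin(2)] by blast
 obtain S2 where S2: "linear S2" "!!x. x \<in> V ==> S2 x = Ts' x" using linear_on_extend[OF V lin(3)] by blast
 obtain U2 where U2: "linear U2" "!!x. x \<in> V ==> U2 x = Tu' x" using linear_on_extend[OF V lin(4)] by blast
 obtain D where D: "linear D" "!!x. x \<in> V ==> D x = T x" using linear_on_extend[OF V linT] by blast
 have j1: "jordan_decomposition V D S1 U1" and j2: "jordan_decomposition V D S2 U2"
  by (rule jordan_decomposition_cong[OF V jd(1)], auto simp: S1 U1 D)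
   (rule jordan_decomposition_cong[OF V jd(2)], auto simp: S2 U2 D)
 note c = clinear_cmap[OF D(1)] clinear_cmap[OF S1(1)] clinear_cmap[OF S2(1)]
 have sV: "cx.subspace (cplx V)" by (rule subspace_cplx[OF V])
 have D_st: "D y \<in> V" if "y \<in> V" for y
  using j1 that unfolding jordan_decomposition_def by auto
 have D_S2: "cmap D (cmap S2 y) = cmap S2 (cmap D y)" "cmap S2 y \<in> cplx V" if "y \<in> cplx V" for y
  using jordan_decompositionD[OF j2, of "fst y"] jordan_decompositionD[OF j2, of "snd y"] that
   jordan_decompositionD[OF j2, of "S2 (fst y)"] jordan_decompositionD[OF j2, of "S2 (snd y)"]
  by (auto simp: prod_eq_iff mem_Times_iff)
 have eq: "cmap S1 y = cmap S2 y" if y: "y \<in> cplx V" "cmap S1 y = sc mu y" for y mu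
 proof -
  let ?P = "%y. cmap D y - sc mu y"
  obtain n where n: "(?P ^^ n) y = 0"
   using jordan_decomposition_generalized_eigenvector[OF j1 D(1) S1(1) U1(1) y] .
  have yS: "y \<in> cx.span {x \<in> cplx V. \<exists>mu. cmap S2 x = sc mu x}"
   using j2 y(1) unfolding jordan_decomposition_def by simp
  obtain A z where A: "finite A" "!!nu. nu \<in> A ==> z nu \<in> cplx V & cmap S2 (z nu) = sc nu (z nu)"
   "y = (\<Sum>nu\<in>A. z nu)"
   by (rule sum_of_eigenvectors[OF c(3) sV yS], rule that, assumption+)
  have P: "(?P ^^ k) w \<in> cplx V & cmap S2 ((?P ^^ k) w) = sc nu ((?P ^^ k) w)"
   if "w \<in> cplx V" "cmap S2 w = sc nu w" for w nu k
  proof (induction k)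
   case (Suc k)
   let ?w = "(?P ^^ k) w"
   have "cmap S2 (cmap D ?w) = cmap D (sc nu ?w)" using D_S2(1)[of ?w] Suc by metis
   moreover have "cmap D ?w \<in> cplx V"
    using Suc D_st by (auto simp: mem_Times_iff map_prod_def case_prod_beta)
   ultimately show ?case
    using Suc sV by (simp add: cxp.linear_diff[OF c(3)] cxp.linear_scale[OF c(3)] cxp.linear_scale[OF c(1)]
      cx.scale_right_diff_distrib cx.subspace_diff cx.subspace_scale mult.commute)
  qed (use that in simp)
  have zero: "z nu = 0" if nu: "nu \<in> A" "nu ~= mu" for nu
  proof -
   have "(\<Sum>nu\<in>A. (?P ^^ n) (z nu)) = 0"
    using n A(3) cxp.linear_sum[OF clinear_funpow[OF clinear_shift[OF c(1)]], of n mu z A] by simp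
   hence "(?P ^^ n) (z nu) = 0"
    using eigenvectors_independent[OF c(3) A(1) _ _ nu(1), of "%nu. (?P ^^ n) (z nu)"] P A(2) by blast
   moreover obtain k where k: "((%y. cmap D y - sc nu y) ^^ k) (z nu) = 0"
    using jordan_decomposition_generalized_eigenvector[OF j2 D(1) S2(1) U2(1)
      conjunct1[OF A(2)[OF nu(1)]] conjunct2[OF A(2)[OF nu(1)]]] .
   ultimately show ?thesis
    using generalized_eigenspaces_disjoint[OF c(1) _ k, of n mu] nu(2) by simp
  qed
  have "cmap S2 y = (\<Sum>nu\<in>A. sc mu (z nu))"
   unfolding A(3) cxp.linear_sum[OF c(3)]
  proof (rule sum.cong)
   fix nu assume "nu \<in> A"
   thus "cmap S2 (z nu) = sc mu (z nu)"
    using zero[of nu] A(2)[of nu] by (cases "nu = mu") (auto simp: cxp.linear_0[OF c(3)])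
  qed simp
  thus ?thesis using y(2) A(3) by (simp add: cx.scale_sum_right)
 qed
 have SS: "cmap S1 y = cmap S2 y" if "y \<in> cplx V" for y
 proof -
  have "y \<in> cx.span {x \<in> cplx V. \<exists>mu. cmap S1 x = sc mu x}"
   using j1 that unfolding jordan_decomposition_def by simp
  thus ?thesis
   by (induction rule: cx.span_induct_alt)
    (auto simp: cxp.linear_0[OF c(2)] cxp.linear_0[OF c(3)] cxp.linear_add[OF c(2)] cxp.linear_add[OF c(3)]
     cxp.linear_scale[OF c(2)] cxp.linear_scale[OF c(3)] simp del: map_prod_simp intro: eq)
 qed
 hence S: "Ts y = Ts' y" if "y \<in> V" for y
  using SS[of "(y, 0)"] that S1(2) S2(2) real_vector.subspace_0[OF V] by simp
 show "Ts x = Ts' x" by (rule S[OF x])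
 have st: "Tu x \<in> V" "Tu' x \<in> V" using jd x unfolding jordan_decomposition_def by auto
 have "T y = Tu (Ts y)" if "y \<in> V" for y using jd(1) that unfolding jordan_decomposition_def by auto
 moreover have "Ts (Tu x - Tu' x) = 0"
 proof -
  have "Ts (Tu x - Tu' x) = S1 (Tu x - Tu' x)" using S1(2) st real_vector.subspace_diff[OF V] by metis
  also have "... = Ts (Tu x) - Ts' (Tu' x)" using S1 S st by (simp add: linear_diff)
  also have "... = 0" using jd x unfolding jordan_decomposition_def by (metis diff_self)
  finally show ?thesis .
 qed
 moreover have "Tu 0 = 0"
  using U1 linear_0[OF U1(1)] real_vector.subspace_0[OF V] by metis
 ultimately have "T (Tu x - Tu' x) = 0" using st real_vector.subspace_diff[OF V] by metis
 thus "Tu x = Tu' x" using inj[of "Tu x - Tu' x"] st real_vector.subspace_diff[OF V] by auto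
qed

lemma ss_uni_part_eq:
 assumes V: "subspace V" and inj: "!!x. x \<in> V ==> T x = 0 ==> x = 0"
  and jd: "jordan_decomposition V T Ts Tu"
 shows "ss_part V T = restrict Ts V" "uni_part V T = restrict Tu V"
proof -
 have jr: "jordan_decomposition V T (restrict Ts V) (restrict Tu V)"
  by (rule jordan_decomposition_cong[OF V jd]) auto
 show "ss_part V T = restrict Ts V"
  unfolding ss_part_def
 proof (rule the_equality)
  fix Ts' assume "Ts' \<in> extensional V & (\<exists>Tu. jordan_decomposition V T Ts' Tu)"
  thus "Ts' = restrict Ts V"
   using jordan_decomposition_unique(1)[OF V inj jd] by (auto intro!: extensionalityI[of _ V])
 qed (use jr in auto)
 show "uni_part V T = restrict Tu V"
  unfolding uni_part_def
 proof (rule the_equality)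
  fix Tu' assume "Tu' \<in> extensional V & (\<exists>Ts. jordan_decomposition V T Ts Tu')"
  thus "Tu' = restrict Tu V"
   using jordan_decomposition_unique(2)[OF V inj jd] by (auto intro!: extensionalityI[of _ V])
 qed (use jr in auto)
qed

lemma nilpotent_chain_independent:
 fixes X :: "'v::real_vector \<times> 'v => 'v \<times> 'v"
 assumes X: "clinear X" and x: "(X ^^ n) x = 0" "(X ^^ (n - 1)) x ~= 0"
  and sum: "(\<Sum>i<n. sc (c i) ((X ^^ i) x)) = 0" and j: "j < n"
 shows "c j = 0"
 using j
proof (induction j rule: less_induct)
 case (less j)
 have "0 = (X ^^ (n - 1 - j)) (\<Sum>i<n. sc (c i) ((X ^^ i) x))"
  using sum cxp.linear_0[OF clinear_funpow[OF X]] by simp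
 also have "... = (\<Sum>i<n. sc (c i) ((X ^^ (n - 1 - j + i)) x))"
  by (simp add: cxp.linear_sum[OF clinear_funpow[OF X]] cxp.linear_scale[OF clinear_funpow[OF X]] funpow_add)
 also have "... = sc (c j) ((X ^^ (n - 1 - j + j)) x)"
 proof (subst sum.remove[of _ j], simp, simp add: less.prems, subst sum.neutral)
  show "\<forall>i\<in>{..<n} - {j}. sc (c i) ((X ^^ (n - 1 - j + i)) x) = 0"
  proof
   fix i assume i: "i \<in> {..<n} - {j}"
   show "sc (c i) ((X ^^ (n - 1 - j + i)) x) = 0"
   proof (cases "i < j")
    case True
    thus ?thesis using less.IH[of i] i by simp
   next
    case False
    hence "n \<le> n - 1 - j + i" using i less.prems by auto
    thus ?thesis using funpow_nilpotent_mono[OF clinear_imp_linear[OF X] x(1)] by simp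
   qed
  qed
 qed simp
 finally show ?case using x(2) less.prems by auto
qed

lemma nilpotent_funpow_dim:
 fixes X :: "'v::real_vector => 'v"
 assumes V: "subspace V" "fin_dim V" and X: "linear X" "!!x. x \<in> V ==> X x \<in> V"
  and x: "x \<in> V" "(X ^^ n) x = 0"
 shows "(X ^^ dim V) x = 0"
proof (rule ccontr)
 assume ne: "(X ^^ dim V) x ~= 0"
 define k where "k = (LEAST k. (X ^^ k) x = 0)"
 have k: "(X ^^ k) x = 0" unfolding k_def using x(2) by (rule LeastI)
 have kd: "dim V < k"
  using ne funpow_nilpotent_mono[OF X(1) k] by (meson not_less)
 have k1: "(X ^^ (k - 1)) x ~= 0"
  using not_less_Least[of "k - 1" "%k. (X ^^ k) x = 0"] kd unfolding k_def[symmetric] by simp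
 obtain B0 where B0: "finite B0" "V = span B0" using V(2) unfolding fin_dim_def by auto
 obtain B where B: "B \<subseteq> V" "independent B" "V \<subseteq> span B" "card B = dim V"
  using real_vector.basis_exists by blast
 have fB: "finite B"
  using real_vector.independent_span_bound[OF B0(1) B(2)] B(1) B0(2) by simp
 let ?u = "%i. ((X ^^ i) x, 0) :: 'v \<times> 'v"
 have "(X ^^ i) x \<in> V" for i by (induction i) (use X(2) x(1) in auto)
 hence "?u ` {..<k} \<subseteq> cx.span ((%b. (b, 0)) ` B)"
  using B(3) cx_span_of_real by blast
 moreover have "card {..<k} > card ((%b. (b, 0) :: 'v \<times> 'v) ` B)"
  using kd B(4) by (simp add: card_image inj_on_def)
 ultimately obtain c where c: "\<exists>i\<in>{..<k}. c i ~= 0" "(\<Sum>i\<in>{..<k}. sc (c i) (?u i)) = 0"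
  using dependent_family[of "{..<k}" "(%b. (b, 0)) ` B" ?u] fB by auto
 have u: "(cmap X ^^ i) (x, 0) = ?u i" for i
  by (simp add: cmap_funpow linear_0[OF linear_funpow[OF X(1)]])
 have "c j = 0" if "j < k" for j
  by (rule nilpotent_chain_independent[OF clinear_cmap[OF X(1)], of k "(x, 0)" c])
   (use k k1 c(2) that in \<open>auto simp: u zero_prod_def\<close>)
 thus False using c(1) by auto
qed

section \<open>Complexified bilinear forms\<close>

lemma bilinear_simps:
 assumes "bilinear S"
 shows "S (a + b) c = S a c + S b c" "S a (b + c) = S a b + S a c"
  "S (r *\<^sub>R a) b = r * S a b" "S a (r *\<^sub>R b) = r * S a b"
  "S 0 b = 0" "S a 0 = 0" "S (- a) b = - S a b" "S a (- b) = - S a b"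
  "S (a - b) c = S a c - S b c" "S a (b - c) = S a b - S a c"
 using assms by (simp_all add: bilinear_ladd bilinear_radd bilinear_lmul bilinear_rmul bilinear_lzero
   bilinear_rzero bilinear_lneg bilinear_rneg bilinear_lsub bilinear_rsub)

context
 fixes S :: "'v::real_vector => 'v => real"
 assumes S: "bilinear S"
begin

lemma cbil_add_left: "cbil S (x + y) z = cbil S x z + cbil S y z"
 and cbil_add_right: "cbil S z (x + y) = cbil S z x + cbil S z y"
 and cbil_diff_left: "cbil S (x - y) z = cbil S x z - cbil S y z"
 and cbil_diff_right: "cbil S z (x - y) = cbil S z x - cbil S z y"
 and cbil_minus_left: "cbil S (- x) z = - cbil S x z"
 and cbil_minus_right: "cbil S z (- x) = - cbil S z x"
 and cbil_scale_left: "cbil S (sc c x) z = c * cbil S x z"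
 and cbil_scale_right: "cbil S z (sc c x) = c * cbil S z x"
 and cbil_0_left: "cbil S 0 z = 0"
 and cbil_0_right: "cbil S z 0 = 0"
 by (simp_all add: cbil_def complex_eq_iff bilinear_simps[OF S] scaleCx_def algebra_simps)

lemma cbil_sum_left: "cbil S (\<Sum>i\<in>A. f i) z = (\<Sum>i\<in>A. cbil S (f i) z)"
 by (induction A rule: infinite_finite_induct) (auto simp: cbil_0_left cbil_add_left)

lemma cbil_sum_right: "cbil S z (\<Sum>i\<in>A. f i) = (\<Sum>i\<in>A. cbil S z (f i))"
 by (induction A rule: infinite_finite_induct) (auto simp: cbil_0_right cbil_add_right)

lemma cbil_cconj: "cbil S (cconj x) (cconj y) = cnj (cbil S x y)"
 by (simp add: cbil_def complex_eq_iff bilinear_simps[OF S] cconj_def)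

end

lemma cbil_swap:
 assumes "!!a b. a \<in> V ==> b \<in> V ==> S b a = c * S a b" "x \<in> cplx V" "y \<in> cplx V"
 shows "cbil S y x = of_real c * cbil S x y"
proof -
 have V: "fst x \<in> V" "snd x \<in> V" "fst y \<in> V" "snd y \<in> V"
  using assms(2,3) by (auto simp: mem_Times_iff)
 show ?thesis
  unfolding cbil_def assms(1)[OF V(1,3)] assms(1)[OF V(1,4)] assms(1)[OF V(2,3)] assms(1)[OF V(2,4)]
  by (simp add: complex_eq_iff algebra_simps)
qed

lemma cbil_adjoint:
 assumes "!!a b. a \<in> V ==> b \<in> V ==> S (f a) b = c * S a (g b)" "x \<in> cplx V" "y \<in> cplx V"
 shows "cbil S (cmap f x) y = of_real c * cbil S x (cmap g y)"
proof -
 have V: "fst x \<in> V" "snd x \<in> V" "fst y \<in> V" "snd y \<in> V"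
  using assms(2,3) by (auto simp: mem_Times_iff)
 show ?thesis
  unfolding cbil_def fst_map_prod snd_map_prod assms(1)[OF V(1,3)] assms(1)[OF V(1,4)] assms(1)[OF V(2,3)] assms(1)[OF V(2,4)]
  by (simp add: complex_eq_iff algebra_simps)
qed

lemma cbil_real:
 assumes "bilinear S"
 shows "cbil S (a, 0) (b, 0) = of_real (S a b)"
 using bilinear_rzero[OF assms] bilinear_lzero[OF assms] by (simp add: cbil_def complex_eq_iff)

section \<open>Steenbrink polarized mixed Hodge structures\<close>

lemma pmhsD:
 assumes "pmhs V w F W N S"
 shows "weight_filtration V N w W"
  and "\<forall>a\<in>V. \<forall>b\<in>V. S b a = (-1) powi w * S a b"
  and "\<forall>a\<in>V. \<forall>b\<in>V. S (N a) b + S a (N b) = 0"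
  and "\<forall>p. \<forall>a \<in> F p. \<forall>b \<in> F (w + 1 - p). cbil S a b = 0"
  and "\<forall>(l::nat) p. \<forall>a \<in> grF F W p (w + int l) \<inter> cconj ` grF F W (w + int l - p) (w + int l).
    a \<notin> cplx (W (w + int l - 1)) & (cmap N ^^ (l + 1)) a \<in> cplx (W (w - int l - 3)) -->
    \<i> powi (2 * p - w - int l) * cbil S a ((cmap N ^^ l) (cconj a)) \<in> ray 1"
 using assms unfolding pmhs_def by - (elim conjE, assumption)+

lemma weight_filtrationD:
 assumes "weight_filtration V N w W"
 shows "\<forall>k. N ` W k \<subseteq> W (k - 2)"
  and "\<forall>l. quotient_iso (N ^^ l) (W (w + int l)) (W (w + int l - 1)) (W (w - int l)) (W (w - int l - 1))"
 using assms unfolding weight_filtration_def by - (elim conjE, assumption)+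

locale steenbrink =
 fixes m :: int
  and F :: "int => ('v::real_vector \<times> 'v) set"
  and W :: "int => 'v set"
  and M :: "'v => 'v"
  and S :: "'v => 'v => real"
 assumes spmhs: "steenbrink_pmhs m F W M S"
begin

definition cW :: "int => ('v \<times> 'v) set" where "cW k = cplx (W k)"

lemma in_cW: "x \<in> cW k \<longleftrightarrow> fst x \<in> W k & snd x \<in> W k"
 by (simp add: cW_def mem_Times_iff)

abbreviation sppm where "sppm == spp_mult m F W M"
abbreviation lmult where "lmult == ladder_mult m F W M"
abbreviation Ms where "Ms == ss_part UNIV M"
abbreviation Mu where "Mu == uni_part UNIV M"
abbreviation N where "N == nilp_part UNIV M"
abbreviation H where "H mu == eigsp UNIV M mu"

lemma smhs: "steenbrink_mhs m F W M"
 and bilinear_S: "bilinear S"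
 and nondegenerate_S: "nondegenerate_on UNIV S"
 and S_M_invariant: "S (M a) (M b) = S a b"
 and pmhs_ne1: "pmhs (Hne1 M) m (%p. F p \<inter> cplx (Hne1 M)) (%k. W k \<inter> Hne1 M) N S"
 and pmhs_1: "pmhs (H1 M) (m + 1) (%p. F p \<inter> cplx (H1 M)) (%k. W k \<inter> H1 M) N S"
 using spmhs unfolding steenbrink_pmhs_def by - (elim conjE allE, assumption)+

lemma mhs: "mhs UNIV F W"
 and linear_M: "linear M"
 and bij_M: "bij M"
 and M_W: "M ` W k = W k"
 and Ms_F: "cmap Ms ` F p \<subseteq> F p"
 and N_F: "cmap N ` F p \<subseteq> F (p - 1)"
 using smhs unfolding steenbrink_mhs_def by - (elim conjE allE, assumption)+

lemma fin_dim: "fin_dim (UNIV :: 'v set)"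
 and decr_F: "decr_filtration UNIV F"
 and incr_W: "incr_filtration UNIV W"
 and grF_splitting: "\<forall>k p. grF F W p k + cconj ` grF F W (k + 1 - p) k = cW k &
      grF F W p k \<inter> cconj ` grF F W (k + 1 - p) k = cW (k - 1)"
 using mhs unfolding mhs_def cW_def by - (elim conjE, assumption)+

lemma subspace_F: "cx.subspace (F p)"
 and antimono_F: "antimono F"
 using decr_F unfolding decr_filtration_def by simp_all

lemma subspace_W: "subspace (W k)"
 and mono_W: "mono W"
 using incr_W unfolding incr_filtration_def by simp_all

lemma M_eq_0: "M x = 0 ==> x = 0"
 using bij_M linear_0[OF linear_M] by (metis bij_pointE)

lemma jordan: "jordan_decomposition UNIV M Ms Mu" "linear Ms" "linear Mu"
 and Ms_stable: "!!Y. cx.subspace Y ==> cmap M ` Y \<subseteq> Y ==> cmap Ms ` Y \<subseteq> Y"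
proof -
 obtain A B where AB: "linear A" "linear B" "jordan_decomposition UNIV M A B"
  "!!Y. cx.subspace Y ==> cmap M ` Y \<subseteq> Y ==> cmap A ` Y \<subseteq> Y"
  by (rule jordan_decomposition_exists[OF fin_dim linear_M M_eq_0], assumption, rule that, assumption+)
 have "Ms = A" "Mu = B"
  using ss_uni_part_eq[OF subspace_UNIV M_eq_0 AB(3)] by (simp_all add: restrict_UNIV)
 thus "jordan_decomposition UNIV M Ms Mu" "linear Ms" "linear Mu"
  "!!Y. cx.subspace Y ==> cmap M ` Y \<subseteq> Y ==> cmap Ms ` Y \<subseteq> Y"
  using AB by auto
qed

lemma M_decomposition: "M x = Ms (Mu x)" "M x = Mu (Ms x)"
 using jordan_decompositionD[OF jordan(1)] by auto

lemma linear_Mu_minus_id: "linear (%y. Mu y - y)"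
 by (intro linear_compose_sub jordan linear_ident)

lemma Mu_unipotent: "((%y. Mu y - y) ^^ dim (UNIV :: 'v set)) x = 0"
proof -
 obtain n where "((%y. Mu y - y) ^^ n) x = 0"
  using jordan(1) unfolding jordan_decomposition_def by blast
 thus ?thesis
  using nilpotent_funpow_dim[OF subspace_UNIV fin_dim linear_Mu_minus_id] by simp
qed

lemma Mu_unipotent': "((%y. Mu y - y) ^^ (Suc (dim (UNIV :: 'v set)))) x = 0"
 by (rule funpow_nilpotent_mono[OF linear_Mu_minus_id Mu_unipotent]) simp

lemma N_eq_log: "N = feval (Suc (dim (UNIV :: 'v set))) (fps_ln 1) (%y. Mu y - y)"
proof
 fix x
 have "feval (Suc (dim (UNIV :: 'v set))) (fps_ln 1) (%y. Mu y - y) x = (\<Sum>k\<in>{1..dim (UNIV :: 'v set)}. fps_nth (fps_ln 1) k *\<^sub>R ((%y. Mu y - y) ^^ k) x)"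
  unfolding feval_def by (rule sum.mono_neutral_right) (auto simp: not_le)
 also have "... = N x"
  unfolding nilp_part_def by (rule sum.cong) (auto simp: fps_ln_nth power_eq_if)
 finally show "N x = feval (Suc (dim (UNIV :: 'v set))) (fps_ln 1) (%y. Mu y - y) x" ..
qed

lemma linear_N: "linear N"
 unfolding N_eq_log by (rule linear_feval[OF linear_Mu_minus_id])

lemma N_nilpotent: "(N ^^ (Suc (dim (UNIV :: 'v set)))) x = 0"
 unfolding N_eq_log by (rule feval_funpow_eq_0[OF linear_Mu_minus_id Mu_unipotent']) simp

lemma Mu_eq_exp: "Mu x = (\<Sum>k<(Suc (dim (UNIV :: 'v set))). (1 / fact k) *\<^sub>R (N ^^ k) x)"
proof -
 have "Mu x = feval (Suc (dim (UNIV :: 'v set))) (fps_exp 1) N x"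
  unfolding N_eq_log using exp_log_unipotent[OF linear_Mu_minus_id Mu_unipotent'] by simp
 thus ?thesis by (simp add: feval_def)
qed

lemma Ms_Mu: "Ms (Mu x) = Mu (Ms x)"
 using M_decomposition by metis

lemma Ms_N: "Ms (N x) = N (Ms x)"
 unfolding N_eq_log by (rule feval_commute[OF jordan(2)]) (simp add: Ms_Mu linear_diff[OF jordan(2)])

lemma Mu_N: "Mu (N x) = N (Mu x)"
 unfolding N_eq_log by (rule feval_commute[OF jordan(3)]) (simp add: linear_diff[OF jordan(3)])

lemmas clinear_Ms = clinear_cmap[OF jordan(2)]
lemmas clinear_Mu = clinear_cmap[OF jordan(3)]
lemmas clinear_N = clinear_cmap[OF linear_N]
lemmas clinear_Npow = clinear_funpow[OF clinear_N]

abbreviation NN where "NN k == cmap N ^^ k"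
lemmas addNN = cxp.linear_add[OF clinear_Npow] and scaleNN = cxp.linear_scale[OF clinear_Npow] and zeroNN = cxp.linear_0[OF clinear_Npow] and diffNN = cxp.linear_diff[OF clinear_Npow] and sumNN = cxp.linear_sum[OF clinear_Npow]
lemmas addN = cxp.linear_add[OF clinear_N] and scaleN = cxp.linear_scale[OF clinear_N] and zeroN = cxp.linear_0[OF clinear_N] and diffN = cxp.linear_diff[OF clinear_N] and sumN = cxp.linear_sum[OF clinear_N]

lemma cN_nilpotent: "NN k x = 0" if "k \<ge> (Suc (dim (UNIV :: 'v set)))"
 using funpow_nilpotent_mono[OF linear_N N_nilpotent that] by (cases x) (simp add: cmap_funpow zero_prod_def)

lemma cMs_N: "cmap Ms (cmap N x) = cmap N (cmap Ms x)"
 by (cases x) (simp add: Ms_N)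

lemma cM: "cmap M x = cmap Ms (cmap Mu x)"
 by (cases x) (simp add: M_decomposition(1))

subsection \<open>Eigenspaces of the semisimple part\<close>

lemma in_H: "x \<in> H mu \<longleftrightarrow> cmap Ms x = sc mu x"
 by (simp add: eigsp_def)

lemma subspace_H: "cx.subspace (H mu)"
 unfolding cx.subspace_def
 by (auto simp: in_H cxp.linear_0[OF clinear_Ms] cxp.linear_add[OF clinear_Ms] cxp.linear_scale[OF clinear_Ms]
   cx.scale_right_distrib mult.commute)

lemmas addH = cx.subspace_add[OF subspace_H] and scaleH = cx.subspace_scale[OF subspace_H] and zeroH = cx.subspace_0[OF subspace_H] and diffH = cx.subspace_diff[OF subspace_H] and negH = cx.subspace_neg[OF subspace_H] and sumH = cx.subspace_sum[OF subspace_H]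

lemma N_H: "x \<in> H mu ==> cmap N x \<in> H mu"
 by (simp add: in_H cMs_N scaleN)

lemma Npow_H: "x \<in> H mu ==> (NN k) x \<in> H mu"
 by (induction k) (auto intro: N_H)

lemma cconj_H: "cconj x \<in> H mu \<longleftrightarrow> x \<in> H (cnj mu)"
 by (metis in_H cmap_cconj[OF jordan(2)] cconj_scaleCx cconj_simps(1) complex_cnj_cnj)

lemma cMs_Mu: "cmap Ms (cmap Mu x) = cmap Mu (cmap Ms x)"
 by (cases x) (simp add: Ms_Mu)

lemma Mu_H: "x \<in> H mu ==> cmap Mu x \<in> H mu"
 by (simp add: in_H cMs_Mu cxp.linear_scale[OF clinear_Mu])

lemma M_on_H:
 assumes "x \<in> H mu"
 shows "cmap M x = sc mu (cmap Mu x)"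
proof -
 have "cmap Ms (cmap Mu x) = sc mu (cmap Mu x)"
  using Mu_H[OF assms] in_H by blast
 thus ?thesis by (simp only: cM)
qed

definition eigenvalues :: "complex set" where "eigenvalues = {mu. \<exists>x\<in>H mu. x ~= 0}"

lemma finite_eigenvalues: "finite eigenvalues"
proof (rule ccontr)
 assume inf: "infinite eigenvalues"
 obtain B :: "('v \<times> 'v) set" where B: "finite B" "cx.span B = UNIV"
  using cx_finite_basis[OF fin_dim] by metis
 obtain I where I: "finite I" "card I = Suc (card B)" "I \<subseteq> eigenvalues"
  using infinite_arbitrarily_large[OF inf] by metis
 have "\<forall>mu\<in>I. \<exists>x. x \<in> H mu & x ~= 0" using I(3) unfolding eigenvalues_def by blast
 then obtain u where u: "\<forall>mu\<in>I. u mu \<in> H mu & u mu ~= 0" by (metis bchoice)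
 obtain c where c: "\<exists>mu\<in>I. c mu ~= 0" "(\<Sum>mu\<in>I. sc (c mu) (u mu)) = 0"
  using dependent_family[of I B u] I B by auto
 have "sc (c mu) (u mu) = 0" if "mu \<in> I" for mu
  by (rule eigenvectors_independent[OF clinear_Ms I(1) _ c(2) that])
   (use u in_H scaleH in blast)
 thus False using c(1) u by auto
qed

definition pr :: "complex => 'v \<times> 'v => 'v \<times> 'v" where
 "pr mu = peval (\<Prod>nu\<in>eigenvalues - {mu}. smult (1 / (mu - nu)) [:-nu, 1:]) (cmap Ms)"

lemma clinear_pr: "clinear (pr mu)"
 unfolding pr_def by (rule clinear_peval[OF clinear_Ms])

lemmas addpr = cxp.linear_add[OF clinear_pr] and scalepr = cxp.linear_scale[OF clinear_pr] and zeropr = cxp.linear_0[OF clinear_pr] and diffpr = cxp.linear_diff[OF clinear_pr] and sumpr = cxp.linear_sum[OF clinear_pr]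

lemma pr_H: "x \<in> H nu ==> pr mu x = (if nu = mu then x else 0)"
proof (cases "x = 0")
 case True
 thus ?thesis by (simp add: zeropr)
next
 case False
 assume x: "x \<in> H nu"
 hence "nu \<in> eigenvalues" using False by (auto simp: eigenvalues_def)
 have "poly (\<Prod>nu\<in>eigenvalues - {mu}. smult (1 / (mu - nu)) [:-nu, 1:]) nu = (if nu = mu then 1 else 0)"
 proof (cases "nu = mu")
  case True
  have "(\<Prod>nu\<in>eigenvalues - {mu}. poly (smult (1 / (mu - nu)) [:-nu, 1:]) mu) = 1"
  proof (rule prod.neutral, rule ballI)
   fix \<kappa> assume "\<kappa> \<in> eigenvalues - {mu}"
   hence "mu - \<kappa> ~= 0" by auto
   thus "poly (smult (1 / (mu - \<kappa>)) [:-\<kappa>, 1:]) mu = 1"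
    by (simp add: divide_simps)
  qed
  thus ?thesis using True by (simp add: poly_prod)
 next
  case False
  thus ?thesis
   using \<open>nu \<in> eigenvalues\<close> finite_eigenvalues by (auto simp: poly_prod)
 qed
 thus ?thesis
  unfolding pr_def using peval_eigenvector[OF clinear_Ms, of x nu] x by (simp add: in_H)
qed

lemma span_H: "x \<in> cx.span (\<Union>mu\<in>eigenvalues. H mu)"
proof -
 have "x \<in> cx.span {x. \<exists>mu. cmap Ms x = sc mu x}"
  using jordan(1) unfolding jordan_decomposition_def by simp
 also have "{x. \<exists>mu. cmap Ms x = sc mu x} \<subseteq> insert 0 (\<Union>mu\<in>eigenvalues. H mu)"
  using in_H unfolding eigenvalues_def by blast
 hence "cx.span {x. \<exists>mu. cmap Ms x = sc mu x} \<subseteq> cx.span (insert 0 (\<Union>mu\<in>eigenvalues. H mu))"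
  by (rule cx.span_mono)
 finally show ?thesis by simp
qed

lemma clinear_eqI_H:
 assumes "clinear f" "clinear g" "!!mu x. mu \<in> eigenvalues ==> x \<in> H mu ==> f x = g x"
 shows "f x = g x"
 using span_H[of x]
 by (induction rule: cx.span_induct_alt)
  (auto simp: cxp.linear_0[OF assms(1)] cxp.linear_0[OF assms(2)] cxp.linear_add[OF assms(1)]
   cxp.linear_add[OF assms(2)] cxp.linear_scale[OF assms(1)] cxp.linear_scale[OF assms(2)] assms(3)
   simp del: scaleCx_of_real)

lemma pr_in_H: "pr mu x \<in> H mu"
 using span_H[of x]
proof (induction rule: cx.span_induct_alt)
 case base
 thus ?case by (simp add: zeropr zeroH)
next
 case (step c x y)
 then obtain nu where "x \<in> H nu" by auto
 hence "pr mu x \<in> H mu" by (auto simp: pr_H zeroH)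
 thus ?case using step(2)
  by (simp add: addpr scalepr
    addH scaleH)
qed

lemma pr_idem [simp]: "x \<in> H mu ==> pr mu x = x"
 by (simp add: pr_H)

lemma sum_pr: "(\<Sum>mu\<in>eigenvalues. pr mu x) = x"
proof -
 have "clinear (%x. \<Sum>mu\<in>eigenvalues. pr mu x)"
  by (rule clinearI) (simp_all add: addpr scalepr
    sum.distrib cx.scale_sum_right)
 moreover have "clinear (%x :: 'v \<times> 'v. x)" by (rule clinearI) auto
 moreover have "(\<Sum>mu\<in>eigenvalues. pr mu x) = x" if "nu \<in> eigenvalues" "x \<in> H nu" for nu x
  using that by (simp add: pr_H finite_eigenvalues)
 ultimately show ?thesis by (rule clinear_eqI_H)
qed

lemma pr_in_subspace: "cx.subspace Y ==> cmap Ms ` Y \<subseteq> Y ==> x \<in> Y ==> pr mu x \<in> Y"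
 unfolding pr_def by (rule peval_in_subspace)

lemma H_cases:
 assumes "cx.subspace Y" "cmap Ms ` Y \<subseteq> Y" "x \<in> Y" "!!mu z. z \<in> Y ==> z \<in> H mu ==> z \<in> Z" "cx.subspace Z"
 shows "x \<in> Z"
proof -
 have "(\<Sum>mu\<in>eigenvalues. pr mu x) \<in> Z"
  by (intro cx.subspace_sum[OF assms(5)] assms(4)[OF pr_in_subspace[OF assms(1-3)] pr_in_H])
 thus ?thesis by (simp add: sum_pr)
qed

lemma pr_N: "pr mu (cmap N x) = cmap N (pr mu x)"
 unfolding pr_def by (rule peval_commute[symmetric, OF clinear_N]) (simp add: cMs_N)

lemma pr_Npow: "pr mu (NN k x) = NN k (pr mu x)"
 by (induction k) (auto simp: pr_N)

lemma pr_cconj: "pr mu (cconj x) = cconj (pr (cnj mu) x)"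
proof -
 have "cconj (pr mu (cconj x)) = pr (cnj mu) x"
 proof (rule clinear_eqI_H[OF _ clinear_pr])
  show "clinear (%x. cconj (pr mu (cconj x)))"
   by (rule clinearI) (simp_all add: addpr scalepr)
  show "cconj (pr mu (cconj x)) = pr (cnj mu) x" if "x \<in> H nu" for nu x
   using pr_H[of "cconj x" "cnj nu"] pr_H[OF that] cconj_H[of x "cnj nu"] that by auto
 qed
 thus ?thesis by (metis cconj_simps(1))
qed

subsection \<open>The two real summands\<close>

definition V :: "complex => 'v set" where "V mu = (if mu = 1 then H1 M else Hne1 M)"
definition w :: "complex => int" where "w mu = m + theta mu"

lemma V_cnj [simp]: "V (cnj mu) = V mu"
 and w_cnj [simp]: "w (cnj mu) = w mu"
 by (auto simp: V_def w_def theta_def complex_eq_iff)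

lemma H1_iff: "x \<in> cplx (H1 M) \<longleftrightarrow> x \<in> H 1"
 by (cases x) (auto simp: H1_def in_H linear_0[OF jordan(2)])

lemma span_Hne1: "x \<in> cx.span (\<Union>mu\<in>-{1}. H mu) \<longleftrightarrow> pr 1 x = 0"
proof
 assume "x \<in> cx.span (\<Union>mu\<in>-{1}. H mu)"
 thus "pr 1 x = 0"
  by (induction rule: cx.span_induct_alt)
   (auto simp: zeropr addpr scalepr pr_H)
next
 assume *: "pr 1 x = 0"
 have "(\<Sum>mu\<in>eigenvalues. pr mu x) \<in> cx.span (\<Union>mu\<in>-{1}. H mu)"
 proof (rule cx.span_sum)
  fix mu
  show "pr mu x \<in> cx.span (\<Union>mu\<in>-{1}. H mu)"
   using * pr_in_H[of mu x] by (cases "mu = 1") (auto intro: cx.span_base cx.span_zero)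
 qed
 thus "x \<in> cx.span (\<Union>mu\<in>-{1}. H mu)" by (simp add: sum_pr)
qed

lemma pr_1_real: "pr 1 (a, b) = 0 \<longleftrightarrow> pr 1 (a, 0) = 0 & pr 1 (b, 0) = 0"
proof
 assume *: "pr 1 (a, b) = 0"
 have "pr 1 (cconj (a, b)) = 0"
  using pr_cconj[of 1 "(a, b)"] * by (simp del: cconj_simps(7))
 hence "pr 1 (a, - b) = 0" by simp
 hence "pr 1 ((a, b) + (a, - b)) = 0" "pr 1 ((a, b) - (a, - b)) = 0"
  using * by (simp_all only: addpr diffpr) auto
 moreover have "(a, b) + (a, - b) = 2 *\<^sub>R (a, 0)" "(a, b) - (a, - b) = sc (2 * \<i>) (b, 0)"
  by (simp_all add: scaleR_2 scaleCx_def)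
 ultimately show "pr 1 (a, 0) = 0 & pr 1 (b, 0) = 0"
  by (simp add: clinear_scaleR[OF clinear_pr] scalepr del: scaleR_Pair)
next
 assume "pr 1 (a, 0) = 0 & pr 1 (b, 0) = 0"
 thus "pr 1 (a, b) = 0"
  unfolding pair_eq_real_plus_imag[of a b] by (simp only: addpr scalepr) simp
qed

lemma Hne1_iff: "x \<in> cplx (Hne1 M) \<longleftrightarrow> pr 1 x = 0"
 by (cases x) (simp add: Hne1_def span_Hne1 pr_1_real[symmetric] flip: pr_1_real)

lemma H_V: "x \<in> H mu ==> x \<in> cplx (V mu)"
 by (auto simp only: V_def H1_iff Hne1_iff pr_H split: if_splits)

lemma pmhs_V: "pmhs (V mu) (w mu) (%p. F p \<inter> cplx (V mu)) (%k. W k \<inter> V mu) N S"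
 using pmhs_1 pmhs_ne1 by (simp add: V_def w_def theta_def)

lemma weight_V: "weight_filtration (V mu) N (w mu) (%k. W k \<inter> V mu)"
 by (rule pmhsD(1)[OF pmhs_V])

subsection \<open>The weight filtration on eigenspaces\<close>

lemma subspace_cW: "cx.subspace (cW k)"
 unfolding cW_def by (rule subspace_cplx[OF subspace_W])

lemmas addcW = cx.subspace_add[OF subspace_cW] and scalecW = cx.subspace_scale[OF subspace_cW] and zerocW = cx.subspace_0[OF subspace_cW] and diffcW = cx.subspace_diff[OF subspace_cW] and negcW = cx.subspace_neg[OF subspace_cW] and sumcW = cx.subspace_sum[OF subspace_cW]

lemma W_mono: "j \<le> k ==> x \<in> cW j ==> x \<in> cW k"
 using monoD[OF mono_W, of j k] by (auto simp: mem_Times_iff in_cW)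

lemma F_antimono: "j \<le> k ==> x \<in> F k ==> x \<in> F j"
 using antimonoD[OF antimono_F, of j k] by auto

lemma W_bounds:
 obtains k0 k1 where "!!k x. k \<le> k0 ==> x \<in> cW k ==> x = 0" "!!k x. k1 \<le> k ==> x \<in> cW k"
proof -
 have "\<exists>k. W k = {0}" "\<exists>k. W k = UNIV"
  using incr_W unfolding incr_filtration_def by - (elim conjE, assumption)+
 then obtain k0 k1 where k: "W k0 = {0}" "W k1 = UNIV" by auto
 have "x = 0" if "k \<le> k0" "x \<in> cW k" for k x
  using W_mono[OF that] k(1) by (simp add: mem_Times_iff in_cW prod_eq_iff)
 moreover have "x \<in> cW k" if "k1 \<le> k" for k x
  by (rule W_mono[OF that]) (simp add: k(2) in_cW)
 ultimately show ?thesis using that by blast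
qed

lemma F_bounds:
 obtains p0 p1 where "!!p x. p \<le> p0 ==> x \<in> F p" "!!p x. p1 \<le> p ==> x \<in> F p ==> x = 0"
proof -
 have "\<exists>p. F p = {0}" "\<exists>p. F p = UNIV"
  using decr_F unfolding decr_filtration_def by simp_all
 then obtain p1 p0 where p: "F p1 = {0}" "F p0 = UNIV" by auto
 have "x \<in> F q" if "q \<le> p0" for q x
  by (rule F_antimono[OF that]) (simp add: p(2))
 moreover have "x = 0" if "p1 \<le> q" "x \<in> F q" for q x
  using F_antimono[OF that] p(1) by simp
 ultimately show ?thesis using that by blast
qed

lemma Ms_W: "cmap Ms ` cW k \<subseteq> cW k"
 by (rule Ms_stable[OF subspace_cW]) (use imageI[of _ "W k" M] M_W[of k] in \<open>auto simp: in_cW\<close>)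

lemma pr_W: "x \<in> cW k ==> pr mu x \<in> cW k"
 by (rule pr_in_subspace[OF subspace_cW Ms_W])

lemma pr_F: "x \<in> F p ==> pr mu x \<in> F p"
 by (rule pr_in_subspace[OF subspace_F Ms_F])

lemma cconj_W: "cconj x \<in> cW k \<longleftrightarrow> x \<in> cW k"
 unfolding cW_def by (rule cconj_cplx[OF subspace_W])

lemma N_W:
 assumes "x \<in> cW k"
 shows "cmap N x \<in> cW (k - 2)"
proof -
 have "x \<in> {z. cmap N z \<in> cW (k - 2)}"
 proof (rule H_cases[OF subspace_cW Ms_W assms])
 fix mu z assume z: "z \<in> cW k" "z \<in> H mu"
 hence "z \<in> cplx (W k \<inter> V mu)" using H_V[OF z(2)] by (auto simp: mem_Times_iff in_cW)
 moreover have "N ` (W k \<inter> V mu) \<subseteq> W (k - 2) \<inter> V mu"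
  by (rule weight_filtrationD(1)[OF weight_V, rule_format])
 ultimately show "z \<in> {z. cmap N z \<in> cW (k - 2)}" by (auto simp: mem_Times_iff in_cW)
next
 show "cx.subspace {z. cmap N z \<in> cW (k - 2)}"
  using cxp.linear_subspace_vimage[OF clinear_N subspace_cW[of "k - 2"]] by (simp only: vimage_def)
 qed
 thus ?thesis by simp
qed

lemma Npow_W: "x \<in> cW k ==> (NN j) x \<in> cW (k - 2 * int j)"
proof (induction j)
 case (Suc j)
 thus ?case using N_W[of "NN j x" "k - 2 * int j"] by (simp add: algebra_simps)
qed simp

lemma Npow_F: "x \<in> F p ==> (NN j) x \<in> F (p - int j)"
proof (induction j)
 case (Suc j)
 hence "cmap N (NN j x) \<in> F (p - int j - 1)" using N_F by blast
 thus ?case by (simp add: algebra_simps)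
qed simp

lemma Npow_cconj: "NN j (cconj x) = cconj (NN j x)"
 unfolding cmap_funpow by (rule cmap_cconj[OF linear_funpow[OF linear_N]])

lemma N_inj_gr:
 assumes "x \<in> H mu" "x \<in> cW (w mu + int l)" "NN l x \<in> cW (w mu - int l - 1)"
 shows "x \<in> cW (w mu + int l - 1)"
proof -
 have q: "quotient_iso (N ^^ l) (W (w mu + int l) \<inter> V mu) (W (w mu + int l - 1) \<inter> V mu)
   (W (w mu - int l) \<inter> V mu) (W (w mu - int l - 1) \<inter> V mu)"
  by (rule weight_filtrationD(2)[OF weight_V, rule_format])
 have V: "x \<in> cplx (V mu)" "NN l x \<in> cplx (V mu)" using H_V assms(1) Npow_H by blast+
 thus ?thesis
  using q assms unfolding quotient_iso_def cmap_funpow by (auto simp: mem_Times_iff in_cW)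
qed

lemma N_surj_gr:
 assumes "y \<in> H mu" "y \<in> cW (w mu - int l)"
 obtains x where "x \<in> H mu" "x \<in> cW (w mu + int l)" "y - NN l x \<in> cW (w mu - int l - 1)"
proof -
 have q: "quotient_iso (N ^^ l) (W (w mu + int l) \<inter> V mu) (W (w mu + int l - 1) \<inter> V mu)
   (W (w mu - int l) \<inter> V mu) (W (w mu - int l - 1) \<inter> V mu)"
  by (rule weight_filtrationD(2)[OF weight_V, rule_format])
 have q: "\<exists>a \<in> W (w mu + int l). b - (N ^^ l) a \<in> W (w mu - int l - 1)" if b: "b \<in> W (w mu - int l) \<inter> V mu" for b
 proof -
  have "W (w mu - int l) \<inter> V mu \<subseteq> (N ^^ l) ` (W (w mu + int l) \<inter> V mu) + (W (w mu - int l - 1) \<inter> V mu)"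
   using q unfolding quotient_iso_def by blast
  from subsetD[OF this b] obtain a c where "a \<in> W (w mu + int l)" "c \<in> W (w mu - int l - 1)" "b = (N ^^ l) a + c"
   by (auto elim!: set_plus_elim)
  thus ?thesis by (intro bexI[of _ a]) auto
 qed
 obtain a1 a2 where a: "a1 \<in> W (w mu + int l)" "fst y - (N ^^ l) a1 \<in> W (w mu - int l - 1)"
  "a2 \<in> W (w mu + int l)" "snd y - (N ^^ l) a2 \<in> W (w mu - int l - 1)"
  using q[of "fst y"] q[of "snd y"] assms H_V[OF assms(1)] by (auto simp: mem_Times_iff in_cW)
 hence x: "(a1, a2) \<in> cW (w mu + int l)" "y - NN l (a1, a2) \<in> cW (w mu - int l - 1)"
  unfolding cmap_funpow by (auto simp: mem_Times_iff in_cW)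
 have "pr mu (y - NN l (a1, a2)) = y - NN l (pr mu (a1, a2))"
  using assms(1) by (simp add: diffpr pr_Npow)
 thus ?thesis using that[OF pr_in_H pr_W[OF x(1)]] pr_W[OF x(2), of mu] by simp
qed

lemma W_neg_eq_image:
 assumes "y \<in> H mu" "y \<in> cW (w mu - int j)"
 obtains x where "x \<in> H mu" "x \<in> cW (w mu + int j)" "y = NN j x"
proof -
 obtain k0 where k0: "!!k x. k \<le> k0 ==> x \<in> cW k ==> x = 0"
  using W_bounds by metis
 have "\<exists>x\<in>H mu. x \<in> cW (w mu + int j) & y = NN j x"
  using assms
 proof (induction "nat (w mu - int j - k0)" arbitrary: j y rule: less_induct)
  case less
  show ?case
  proof (cases "w mu - int j \<le> k0")
   case True
   hence "y = 0" using k0 less.prems by blast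
   thus ?thesis
    by (intro bexI[of _ 0]) (auto simp: zeroNN zerocW zeroH)
  next
   case False
   obtain x where x: "x \<in> H mu" "x \<in> cW (w mu + int j)" "y - NN j x \<in> cW (w mu - int j - 1)"
    using N_surj_gr[OF less.prems] .
   have yx: "y - NN j x \<in> H mu"
    using less.prems x(1) by (intro diffH Npow_H)
   have "w mu - int (Suc j) = w mu - int j - 1" by simp
   then obtain z where z: "z \<in> H mu" "z \<in> cW (w mu + int (Suc j))" "y - NN j x = (cmap N ^^ Suc j) z"
   proof -
    have "nat (w mu - int (Suc j) - k0) < nat (w mu - int j - k0)" using False by simp
    from less.hyps[OF this yx] x(3) \<open>w mu - int (Suc j) = w mu - int j - 1\<close>
    show ?thesis using that by metis
   qed
   have "cmap N z \<in> cW (w mu + int j)"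
    using N_W[OF z(2)] by (rule W_mono[rotated]) simp
   moreover have "y = NN j (x + cmap N z)"
    using z(3) by (simp add: addNN funpow_swap1 algebra_simps)
   ultimately show ?thesis
    using x z by (intro bexI[of _ "x + cmap N z"]) (auto intro: addcW addH N_H )
  qed
 qed
 thus ?thesis using that by blast
qed

subsection \<open>The polarization on eigenspaces\<close>

lemmas cS_simps = cbil_add_left[OF bilinear_S] cbil_add_right[OF bilinear_S] cbil_diff_left[OF bilinear_S]
 cbil_diff_right[OF bilinear_S] cbil_minus_left[OF bilinear_S] cbil_minus_right[OF bilinear_S]
 cbil_scale_left[OF bilinear_S] cbil_scale_right[OF bilinear_S] cbil_0_left[OF bilinear_S]
 cbil_0_right[OF bilinear_S] cbil_sum_left[OF bilinear_S] cbil_sum_right[OF bilinear_S]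

lemma cS_M: "cbil S (cmap M x) (cmap M y) = cbil S x y"
 by (simp add: cbil_def S_M_invariant)

lemma cS_orthogonal:
 assumes "x \<in> H mu" "y \<in> H nu" "mu * nu ~= 1"
 shows "cbil S x y = 0"
proof -
 let ?g = "%mu y. cmap M y - sc mu y"
 have "cbil S x y = 0" if "(?g mu ^^ i) x = 0" "(?g nu ^^ j) y = 0" "i + j = n" for i j n x y
  using that
 proof (induction n arbitrary: i j x y rule: less_induct)
  case (less n)
  show ?case
  proof (cases "i = 0 | j = 0")
   case True
   thus ?thesis using less.prems by (auto simp: cS_simps)
  next
   case False
   then obtain i' j' where ij: "i = Suc i'" "j = Suc j'" by (metis not0_implies_Suc)
   have gx: "(?g mu ^^ i') (?g mu x) = 0" and gy: "(?g nu ^^ j') (?g nu y) = 0"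
    using less.prems(1,2) unfolding ij funpow_Suc_right o_apply by blast+
   have 1: "cbil S (?g mu x) y = 0" using less.IH[of "i' + j" i' "?g mu x" j y] gx less.prems ij by auto
   have 2: "cbil S (?g mu x) (?g nu y) = 0" using less.IH[of "i' + j'" i' "?g mu x" j' "?g nu y"] gx gy less.prems ij by auto
   have 3: "cbil S x (?g nu y) = 0" using less.IH[of "i + j'" i x j' "?g nu y"] gy less.prems ij by auto
   have "cbil S x y = cbil S (sc mu x + ?g mu x) (sc nu y + ?g nu y)"
    using cS_M[of x y] by simp
   also have "... = mu * nu * cbil S x y"
    unfolding cbil_add_left[OF bilinear_S] cbil_add_right[OF bilinear_S] cbil_scale_left[OF bilinear_S] cbil_scale_right[OF bilinear_S] 1 2 3 by simp
   finally have "(1 - mu * nu) * cbil S x y = 0" by (simp add: algebra_simps)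
   thus ?thesis using assms(3) by auto
  qed
 qed
 moreover obtain i where "(?g mu ^^ i) x = 0"
  using jordan_decomposition_generalized_eigenvector[OF jordan(1) linear_M jordan(2,3), of x mu] assms(1) in_H by auto
 moreover obtain j where "(?g nu ^^ j) y = 0"
  using jordan_decomposition_generalized_eigenvector[OF jordan(1) linear_M jordan(2,3), of y nu] assms(2) in_H by auto
 ultimately show ?thesis by blast
qed

lemma cS_swap_V: "x \<in> cplx (V mu) ==> y \<in> cplx (V mu) ==> cbil S y x = (-1) powi (w mu) * cbil S x y"
 using cbil_swap[of "V mu" S "(-1) powi (w mu)" x y, OF pmhsD(2)[OF pmhs_V[of mu], rule_format]] by simp

lemma V_eq_if_inverse: "mu * nu = 1 ==> V nu = V mu"
 and w_eq_if_inverse: "mu * nu = 1 ==> w nu = w mu"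
 by (auto simp: V_def w_def theta_def)

lemma cS_swap:
 assumes "x \<in> H mu" "y \<in> H nu"
 shows "cbil S y x = (-1) powi (w mu) * cbil S x y"
proof (cases "mu * nu = 1")
 case True
 thus ?thesis using cS_swap_V H_V[OF assms(1)] H_V[OF assms(2)] V_eq_if_inverse[OF True] by metis
next
 case False
 thus ?thesis using cS_orthogonal[OF assms] cS_orthogonal[OF assms(2,1)] by (simp add: mult.commute)
qed

lemma cS_N: "cbil S (cmap N x) y = - cbil S x (cmap N y)"
proof -
 have H: "cbil S (cmap N x) y = - cbil S x (cmap N y)" if xy: "x \<in> H mu" "y \<in> H nu" for x y mu nu
 proof (cases "mu * nu = 1")
  case True
  have "S (N a) b = (-1) * S a (N b)" if "a \<in> V mu" "b \<in> V mu" for a b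
   using pmhsD(3)[OF pmhs_V[of mu], rule_format, OF that] by simp
  from cbil_adjoint[of "V mu" S N "-1" N x y, OF this] show ?thesis
   using H_V[OF xy(1)] H_V[OF xy(2)] V_eq_if_inverse[OF True] by simp
 next
  case False
  thus ?thesis using cS_orthogonal[OF N_H[OF xy(1)] xy(2)] cS_orthogonal[OF xy(1) N_H[OF xy(2)]] by simp
 qed
 have "cbil S (cmap N (\<Sum>mu\<in>eigenvalues. pr mu x)) (\<Sum>nu\<in>eigenvalues. pr nu y) =
   - cbil S (\<Sum>mu\<in>eigenvalues. pr mu x) (cmap N (\<Sum>nu\<in>eigenvalues. pr nu y))"
  by (simp add: sumN cS_simps H[OF pr_in_H pr_in_H] flip: sum_negf)
 thus ?thesis by (simp add: sum_pr)
qed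

lemma cS_Npow: "cbil S (NN k x) y = (-1) ^ k * cbil S x (NN k y)"
proof (induction k arbitrary: y)
 case (Suc k)
 show ?case using Suc[of "cmap N y"] by (simp add: cS_N funpow_swap1[of "cmap N" k y])
qed simp

lemma cS_W:
 assumes "x \<in> H mu" "y \<in> H nu" "x \<in> cW i" "y \<in> cW j" "i + j < 2 * w mu"
 shows "cbil S x y = 0"
proof (cases "mu * nu = 1")
 case False
 thus ?thesis by (rule cS_orthogonal[OF assms(1,2)])
next
 case True
 obtain k0 where k0: "!!k x. k \<le> k0 ==> x \<in> cW k ==> x = 0"
  using W_bounds by metis
 have key: "cbil S x y = 0"
  if "x \<in> H mu" "y \<in> H nu" "mu * nu = 1" "x \<in> cW (w mu + int l)" "y \<in> cW (w mu - int l - 1)" for x y mu nu l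
  using that
 proof (induction "nat (w mu - int l - k0)" arbitrary: l x y mu nu rule: less_induct)
  case less
  show ?case
  proof (cases "w mu - int l \<le> k0")
   case True
   hence "y = 0" using k0[of "w mu - int l - 1" y] less.prems(5) by linarith
   thus ?thesis by (simp add: cS_simps)
  next
   case False
   have w: "w nu = w mu" by (rule w_eq_if_inverse[OF less.prems(3)])
   obtain z where z: "z \<in> H nu" "z \<in> cW (w nu + int (Suc l))" "y = (cmap N ^^ Suc l) z"
    using W_neg_eq_image[of y nu "Suc l"] less.prems(2,5) w by (auto simp: algebra_simps)
   have "(cmap N ^^ Suc l) x \<in> cW (w nu - int (Suc l) - 1)"
    using Npow_W[OF less.prems(4), of "Suc l"] w by (simp add: algebra_simps)
   hence "cbil S z ((cmap N ^^ Suc l) x) = 0"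
    using less.hyps[of nu "Suc l" z "(cmap N ^^ Suc l) x" mu] False w z less.prems(3) Npow_H[OF less.prems(1), of "Suc l"]
    by (auto simp: mult.commute)
   hence "cbil S ((cmap N ^^ Suc l) x) z = 0"
    using cS_swap[OF z(1) Npow_H[OF less.prems(1)], of "Suc l"] by simp
   thus ?thesis using cS_Npow[of "Suc l" x z] z(3) by simp
  qed
 qed
 have w: "w nu = w mu" by (rule w_eq_if_inverse[OF True])
 show ?thesis
 proof (cases "i \<ge> w mu")
  case True
  hence "w mu + int (nat (i - w mu)) = i" by simp
  moreover have "y \<in> cW (w mu - int (nat (i - w mu)) - 1)"
   using assms(4) by (rule W_mono[rotated]) (use True assms(5) in simp)
  ultimately show ?thesis using key[OF assms(1,2) \<open>mu * nu = 1\<close>, of "nat (i - w mu)"] assms(3) by simp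
 next
  case False
  let ?l = "nat (w mu - i - 1)"
  have "y \<in> cW (w nu + int ?l)"
   using assms(4) by (rule W_mono[rotated]) (use False assms(5) w in simp)
  moreover have "x \<in> cW (w nu - int ?l - 1)"
   using assms(3) by (rule W_mono[rotated]) (use False w in simp)
  moreover have "nu * mu = 1" using True by (simp add: mult.commute)
  ultimately have "cbil S y x = 0" using key[OF assms(2,1), of ?l] by blast
  thus ?thesis using cS_swap[OF assms(2,1)] by simp
 qed
qed

lemma in_grF: "x \<in> grF F W p k \<longleftrightarrow> (\<exists>a b. x = a + b & a \<in> F p & a \<in> cW k & b \<in> cW (k - 1))"
 unfolding grF_def set_plus_def cW_def[symmetric] by blast

lemma grF_H:
 assumes "x \<in> grF F W p k" "x \<in> H mu"
 obtains a b where "x = a + b" "a \<in> F p" "a \<in> cW k" "b \<in> cW (k - 1)" "a \<in> H mu" "b \<in> H mu"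
proof -
 obtain a b where ab: "x = a + b" "a \<in> F p" "a \<in> cW k" "b \<in> cW (k - 1)"
  using assms(1) unfolding in_grF by blast
 have "x = pr mu a + pr mu b"
  using pr_idem[OF assms(2)] ab(1) addpr by metis
 thus ?thesis using that pr_F[OF ab(2)] pr_W[OF ab(3)] pr_W[OF ab(4)] pr_in_H by blast
qed

lemma h_orthogonal:
 assumes "a \<in> H mu" "b \<in> H mu" "a \<in> grF F W p (w mu + int l)" "cconj b \<in> grF F W s (w mu + int l)"
  "p + s > w mu + int l"
 shows "cbil S a (NN l (cconj b)) = 0"
proof -
 obtain a1 a2 where a: "a = a1 + a2" "a1 \<in> F p" "a1 \<in> cW (w mu + int l)" "a2 \<in> cW (w mu + int l - 1)" "a1 \<in> H mu" "a2 \<in> H mu"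
  using grF_H[OF assms(3,1)] .
 have "cconj b \<in> H (cnj mu)" using assms(2) cconj_H[of b "cnj mu"] by simp
 then obtain b1 b2 where b: "cconj b = b1 + b2" "b1 \<in> F s" "b1 \<in> cW (w mu + int l)" "b2 \<in> cW (w mu + int l - 1)" "b1 \<in> H (cnj mu)" "b2 \<in> H (cnj mu)"
  using grF_H[OF assms(4)] by blast
 have "cbil S a1 (NN l b1) = 0"
 proof -
  have "NN l b1 \<in> F (w mu + 1 - p)"
   using Npow_F[OF b(2)] by (rule F_antimono[rotated]) (use assms(5) in simp)
  moreover have "NN l b1 \<in> cplx (V mu)" using H_V[OF Npow_H[OF b(5)]] by simp
  moreover have "a1 \<in> cplx (V mu)" using H_V[OF a(5)] .
  ultimately have i: "a1 \<in> F p \<inter> cplx (V mu)" "NN l b1 \<in> F (w mu + 1 - p) \<inter> cplx (V mu)"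
   using a(2) by (simp_all only: Int_iff)
  show ?thesis by (rule pmhsD(4)[OF pmhs_V[of mu], rule_format, OF i])
 qed
 moreover have "cbil S a1 (NN l b2) = 0"
  by (rule cS_W[OF a(5) Npow_H[OF b(6)] a(3) Npow_W[OF b(4)]]) simp
 moreover have "cbil S a2 (NN l (b1 + b2)) = 0"
 proof -
  have "b1 + b2 \<in> cW (w mu + int l)" "b1 + b2 \<in> H (cnj mu)"
   using b W_mono[of "w mu + int l - 1" "w mu + int l" b2]
   by (auto intro!: addcW addH )
  show ?thesis
   by (rule cS_W[OF a(6) Npow_H[OF \<open>b1 + b2 \<in> H (cnj mu)\<close>] a(4) Npow_W[OF \<open>b1 + b2 \<in> cW (w mu + int l)\<close>]]) simp
 qed
 ultimately show ?thesis unfolding a(1) b(1) by (simp add: cS_simps addNN)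
qed

lemma h_positive:
 assumes "a \<in> H mu" "a \<in> grF F W p (w mu + int l)" "cconj a \<in> grF F W (w mu + int l - p) (w mu + int l)"
  "a \<notin> cW (w mu + int l - 1)" "NN (l + 1) a \<in> cW (w mu - int l - 3)"
 shows "\<i> powi (2 * p - w mu - int l) * cbil S a (NN l (cconj a)) \<in> ray 1"
proof -
 let ?F = "%p. F p \<inter> cplx (V mu)" and ?W = "%k. W k \<inter> V mu"
 have gr: "x \<in> grF ?F ?W p k" if x: "x \<in> grF F W p k" "x \<in> H nu" "V nu = V mu" for x p k nu
 proof -
  obtain a1 a2 where a: "x = a1 + a2" "a1 \<in> F p" "a1 \<in> cW k" "a2 \<in> cW (k - 1)" "a1 \<in> H nu" "a2 \<in> H nu"
   using grF_H[OF x(1,2)] .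
  have "a1 \<in> cplx (V mu)" "a2 \<in> cplx (V mu)" using H_V[OF a(5)] H_V[OF a(6)] x(3) by auto
  thus ?thesis unfolding grF_def a(1) using a(2-4) by (intro set_plus_intro) (auto simp: mem_Times_iff in_cW)
 qed
 have V: "a \<in> cplx (V mu)" "NN (l + 1) a \<in> cplx (V mu)" using H_V assms(1) Npow_H by blast+
 have c: "cconj a \<in> H (cnj mu)" using assms(1) cconj_H[of a "cnj mu"] by simp
 have pos: "\<forall>(l::nat) p. \<forall>a \<in> grF ?F ?W p (w mu + int l) \<inter> cconj ` grF ?F ?W (w mu + int l - p) (w mu + int l).
    a \<notin> cplx (?W (w mu + int l - 1)) & (NN (l + 1)) a \<in> cplx (?W (w mu - int l - 3)) -->
    \<i> powi (2 * p - w mu - int l) * cbil S a (NN l (cconj a)) \<in> ray 1"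
  by (rule pmhsD(5)[OF pmhs_V])
 have g: "a \<in> grF ?F ?W p (w mu + int l) \<inter> cconj ` grF ?F ?W (w mu + int l - p) (w mu + int l)"
  using gr[OF assms(2,1)] gr[OF assms(3) c] by (simp add: cconj_image_iff)
 have i: "a \<notin> cplx (?W (w mu + int l - 1))" "NN (l + 1) a \<in> cplx (?W (w mu - int l - 3))"
  using assms(4,5) V by (auto simp: mem_Times_iff in_cW)
 show ?thesis by (rule pos[rule_format, OF g conjI[OF i]])
qed

end

section \<open>The Deligne splitting\<close>

lemma finite_dimensional_cx:
 assumes "fin_dim (UNIV :: 'v::real_vector set)"
 obtains B :: "('v::real_vector \<times> 'v) set" where "finite_dimensional_vector_space scaleCx B"
proof -
 obtain B :: "('v \<times> 'v) set" where B: "finite B" "cx.independent B" "cx.span B = UNIV"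
  using cx_finite_basis[OF assms] by metis
 have "finite_dimensional_vector_space scaleCx B"
  by unfold_locales (use B in auto)
 thus ?thesis by (rule that)
qed

lemma dim_direct_sum:
 fixes A B :: "('v::real_vector \<times> 'v) set"
 assumes fd: "fin_dim (UNIV :: 'v set)" and A: "cx.subspace A" and B: "cx.subspace B"
  and AB: "!!x. x \<in> A ==> x \<in> B ==> x = 0"
  and C: "A \<subseteq> C" "B \<subseteq> C" "!!x. x \<in> C ==> \<exists>a\<in>A. \<exists>b\<in>B. x = a + b" "cx.subspace C"
 shows "cx.dim C = cx.dim A + cx.dim B"
proof -
 obtain B0 :: "('v \<times> 'v) set" where "finite_dimensional_vector_space scaleCx B0"
  using finite_dimensional_cx[OF fd] .
 then interpret fd: finite_dimensional_vector_space scaleCx B0 .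
 obtain a where a: "a \<subseteq> A" "cx.independent a" "A \<subseteq> cx.span a" "card a = cx.dim A"
  using cx.basis_exists by blast
 obtain b where b: "b \<subseteq> B" "cx.independent b" "B \<subseteq> cx.span b" "card b = cx.dim B"
  using cx.basis_exists by blast
 have fin: "finite a" "finite b" using a(2) b(2) fd.finiteI_independent by auto
 have sa: "cx.span a = A" and sb: "cx.span b = B"
  using a b A B by (simp_all add: cx.span_minimal subset_antisym)
 have disj: "a \<inter> b = {}"
 proof -
  have "x = 0" if "x \<in> a \<inter> b" for x using AB[of x] a(1) b(1) that by blast
  thus ?thesis using a(2) cx.dependent_zero by blast
 qed
 have "cx.independent (a \<union> b)"
 proof (rule ccontr)
  assume "\<not> cx.independent (a \<union> b)"
  then obtain u where u: "\<exists>v\<in>a \<union> b. u v ~= 0" "(\<Sum>v\<in>a \<union> b. sc (u v) v) = 0"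
   using cx.dependent_finite[of "a \<union> b"] fin by blast
  let ?x = "\<Sum>v\<in>a. sc (u v) v" and ?y = "\<Sum>v\<in>b. sc (u v) v"
  have xy: "?x + ?y = 0" using u(2) sum.union_disjoint[OF fin disj, of "%v. sc (u v) v"] by simp
  have x: "?x \<in> A" by (intro cx.subspace_sum[OF A] cx.subspace_scale[OF A]) (use a(1) in blast)
  have y: "?y \<in> B" by (intro cx.subspace_sum[OF B] cx.subspace_scale[OF B]) (use b(1) in blast)
  have "?x = - ?y" using xy by (simp add: eq_neg_iff_add_eq_0)
  hence "?x \<in> B" using cx.subspace_neg[OF B y] by simp
  hence "?x = 0" using AB x by blast
  hence "?y = 0" using xy by simp
  have "u v = 0" if "v \<in> a" for v
   using a(2) \<open>?x = 0\<close> that cx.dependent_finite[OF fin(1)] by blast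
  moreover have "u v = 0" if "v \<in> b" for v
   using b(2) \<open>?y = 0\<close> that cx.dependent_finite[OF fin(2)] by blast
  ultimately show False using u(1) by blast
 qed
 moreover have "a \<union> b \<subseteq> C" using a b C by blast
 moreover have "C \<subseteq> cx.span (a \<union> b)"
 proof
  fix x assume "x \<in> C"
  then obtain y z where "y \<in> A" "z \<in> B" "x = y + z" using C(3) by blast
  thus "x \<in> cx.span (a \<union> b)"
   using a(3) b(3) cx.span_mono[of a "a \<union> b"] cx.span_mono[of b "a \<union> b"] by (blast intro: cx.span_add)
 qed
 ultimately have "card (a \<union> b) = cx.dim C" by (intro cx.basis_card_eq_dim)
 thus ?thesis using card_Un_disjoint[OF fin disj] a(4) b(4) by simp
qed

lemma dim_inj_image:
 fixes A :: "('v::real_vector \<times> 'v) set" and f :: "'v \<times> 'v => 'v \<times> 'v"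
 assumes fd: "fin_dim (UNIV :: 'v set)" and A: "cx.subspace A" and f: "clinear f"
  and inj: "!!x. x \<in> A ==> f x = 0 ==> x = 0"
 shows "cx.dim (f ` A) = cx.dim A"
proof -
 obtain B0 :: "('v \<times> 'v) set" where "finite_dimensional_vector_space scaleCx B0"
  using finite_dimensional_cx[OF fd] .
 then interpret fd: finite_dimensional_vector_space scaleCx B0 .
 interpret fp: finite_dimensional_vector_space_pair sc B0 sc B0 by unfold_locales
 have "inj_on f A"
 proof (rule inj_onI)
  fix x y assume xy: "x \<in> A" "y \<in> A" "f x = f y"
  hence "x - y = 0"
   using inj[of "x - y"] cx.subspace_diff[OF A xy(1,2)] cxp.linear_diff[OF f, of x y] by simp
  thus "x = y" by simp
 qed
 hence "inj_on f (cx.span A)" by (simp only: cx.span_eq_iff[THEN iffD2, OF A])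
 thus ?thesis by (rule fp.dim_image_eq[OF f])
qed

lemma dim_zero_iff:
 fixes A :: "('v::real_vector \<times> 'v) set"
 assumes fd: "fin_dim (UNIV :: 'v set)" and A: "cx.subspace A"
 shows "cx.dim A = 0 \<longleftrightarrow> A = {0}"
proof -
 obtain B0 :: "('v \<times> 'v) set" where "finite_dimensional_vector_space scaleCx B0"
  using finite_dimensional_cx[OF fd] .
 then interpret fd: finite_dimensional_vector_space scaleCx B0 .
 show ?thesis using fd.dim_eq_0[of A] cx.subspace_0[OF A] by auto
qed

lemma in_plus_cconj: "x \<in> A + cconj ` B \<longleftrightarrow> (\<exists>y z. x = y + z & y \<in> A & cconj z \<in> B)"
proof
 assume "x \<in> A + cconj ` B"
 then obtain y u where "x = y + u" "y \<in> A" "u \<in> cconj ` B" by (rule set_plus_elim)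
 thus "\<exists>y z. x = y + z & y \<in> A & cconj z \<in> B"
  using cconj_image_iff[of u B] by (intro exI[of _ y] exI[of _ u]) simp
next
 assume "\<exists>y z. x = y + z & y \<in> A & cconj z \<in> B"
 then obtain y z where yz: "x = y + z" "y \<in> A" "cconj z \<in> B" by (elim exE conjE)
 show "x \<in> A + cconj ` B"
  unfolding yz(1) using yz(2,3) cconj_image_iff[of z B] by (intro set_plus_intro) simp_all
qed

context steenbrink
begin

lemma mhs_split:
 assumes "x \<in> cW k" "x \<in> H mu"
 obtains y z where "x = y + z" "y \<in> grF F W p k" "cconj z \<in> grF F W (k + 1 - p) k" "y \<in> H mu" "z \<in> H mu"
proof -
 have pr_grF: "pr nu x \<in> grF F W p k" if "x \<in> grF F W p k" for nu x p
  using that unfolding in_grF by (metis addpr pr_F pr_W)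
 have "x \<in> grF F W p k + cconj ` grF F W (k + 1 - p) k"
  using grF_splitting assms(1) by simp
 then obtain y z where yz: "x = y + z" "y \<in> grF F W p k" "cconj z \<in> grF F W (k + 1 - p) k"
  unfolding in_plus_cconj by blast
 have "x = pr mu y + pr mu z"
  using pr_idem[OF assms(2)] cxp.linear_add[OF clinear_pr, of mu y z] yz(1) by simp
 moreover have "cconj (pr mu z) \<in> grF F W (k + 1 - p) k"
  using pr_grF[OF yz(3), of "cnj mu"] pr_cconj[of "cnj mu" z] by simp
 ultimately show ?thesis using that pr_grF[OF yz(2)] pr_in_H by blast
qed

lemma mhs_int:
 assumes "x \<in> grF F W p k" "cconj x \<in> grF F W q k" "p + q = k + 1"
 shows "x \<in> cW (k - 1)"
proof -
 have "q = k + 1 - p" using assms(3) by simp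
 hence "x \<in> grF F W p k \<inter> cconj ` grF F W (k + 1 - p) k"
  unfolding Int_iff cconj_image_iff using assms(1,2) by simp
 thus ?thesis using grF_splitting by blast
qed

lemma subspace_grF: "cx.subspace (grF F W p k)"
 unfolding grF_def cW_def[symmetric] by (intro set_plus_subspace cx.subspace_inter subspace_F subspace_cW)

lemma grF_W: "x \<in> grF F W p k ==> x \<in> cW k"
 unfolding in_grF using addcW W_mono[of "k - 1" k] by force

lemma W_grF: "x \<in> cW (k - 1) ==> x \<in> grF F W p k"
 unfolding in_grF using cx.subspace_0[OF subspace_F] zerocW by (metis add_0)

lemma F_grF: "x \<in> F p ==> x \<in> cW k ==> x \<in> grF F W p k"
 unfolding in_grF using zerocW by (metis add_0_right)

lemma grF_antimono: "p \<le> q ==> x \<in> grF F W q k ==> x \<in> grF F W p k"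
 unfolding in_grF using F_antimono by blast

lemma Npow_grF: "x \<in> grF F W p k ==> (NN l) x \<in> grF F W (p - int l) (k - 2 * int l)"
proof -
 assume "x \<in> grF F W p k"
 then obtain a b where ab: "x = a + b" "a \<in> F p" "a \<in> cW k" "b \<in> cW (k - 1)"
  unfolding in_grF by blast
 have "k - 1 - 2 * int l = k - 2 * int l - 1" by simp
 hence "NN l b \<in> cW (k - 2 * int l - 1)" using Npow_W[OF ab(4), of l] by metis
 thus ?thesis
  unfolding in_grF ab(1) using Npow_F[OF ab(2)] Npow_W[OF ab(3)] addNN by blast
qed

definition DI :: "complex => int => int => ('v \<times> 'v) set" where
 "DI mu p q = deligne F W p q \<inter> H mu"

abbreviation lower :: "int => int => ('v \<times> 'v) set" where
 "lower p q == cx.span (\<Union>j\<in>{1..}. cconj ` F (q - j) \<inter> cW (p + q - j - 1))"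

lemma in_deligne: "x \<in> deligne F W p q \<longleftrightarrow> x \<in> F p & x \<in> cW (p + q) &
  (\<exists>b c. x = b + c & cconj b \<in> F q & b \<in> cW (p + q) & c \<in> lower p q)"
 unfolding deligne_def cW_def[symmetric] set_plus_def Bex_def Int_iff cconj_image_iff mem_Collect_eq by blast

lemma lower_subset:
 assumes "c \<in> lower p q" "r \<ge> 1"
 obtains c1 c2 where "c = c1 + c2" "cconj c1 \<in> F (q - r + 1)" "c2 \<in> cW (p + q - r - 1)"
proof -
 have "lower p q \<subseteq> cconj ` F (q - r + 1) + cW (p + q - r - 1)"
 proof (rule cx.span_minimal)
  show "cx.subspace (cconj ` F (q - r + 1) + cW (p + q - r - 1))"
   by (intro set_plus_subspace subspace_cconj_image subspace_F subspace_cW)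
  show "(\<Union>j\<in>{1..}. cconj ` F (q - j) \<inter> cW (p + q - j - 1)) \<subseteq> cconj ` F (q - r + 1) + cW (p + q - r - 1)"
  proof
   fix x assume "x \<in> (\<Union>j\<in>{1..}. cconj ` F (q - j) \<inter> cW (p + q - j - 1))"
   then obtain j where j: "j \<ge> 1" "cconj x \<in> F (q - j)" "x \<in> cW (p + q - j - 1)"
    unfolding UN_iff Int_iff cconj_image_iff by force
   show "x \<in> cconj ` F (q - r + 1) + cW (p + q - r - 1)"
   proof (cases "j \<ge> r")
    case True
    hence "x \<in> cW (p + q - r - 1)" by (intro W_mono[OF _ j(3)]) simp
    moreover have "0 \<in> cconj ` F (q - r + 1)"
     using cx.subspace_0[OF subspace_F] by (simp add: cconj_image_iff)
    ultimately have "0 + x \<in> cconj ` F (q - r + 1) + cW (p + q - r - 1)" by (rule set_plus_intro[rotated])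
    thus ?thesis by simp
   next
    case False
    hence "cconj x \<in> F (q - r + 1)" by (intro F_antimono[OF _ j(2)]) simp
    hence "x + 0 \<in> cconj ` F (q - r + 1) + cW (p + q - r - 1)"
     using zerocW by (intro set_plus_intro) (simp_all only: cconj_image_iff)
    thus ?thesis by simp
   qed
  qed
 qed
 hence "c \<in> cconj ` F (q - r + 1) + cW (p + q - r - 1)" using assms(1) by blast
 then obtain c1 c2 where "c = c1 + c2" "c1 \<in> cconj ` F (q - r + 1)" "c2 \<in> cW (p + q - r - 1)"
  by (rule set_plus_elim)
 thus ?thesis using that cconj_image_iff by blast
qed

lemma deligne_grF:
 assumes "x \<in> deligne F W p q"
 shows "x \<in> grF F W p (p + q)" "cconj x \<in> grF F W q (p + q)"
proof -
 show "x \<in> grF F W p (p + q)" using assms unfolding in_deligne by (blast intro: F_grF)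
 obtain b c where bc: "x = b + c" "cconj b \<in> F q" "b \<in> cW (p + q)" "c \<in> lower p q"
  using assms unfolding in_deligne by blast
 have "lower p q \<subseteq> cW (p + q - 1)"
 proof (rule cx.span_minimal[OF _ subspace_cW])
  show "(\<Union>j\<in>{1..}. cconj ` F (q - j) \<inter> cW (p + q - j - 1)) \<subseteq> cW (p + q - 1)"
  proof
   fix x assume "x \<in> (\<Union>j\<in>{1..}. cconj ` F (q - j) \<inter> cW (p + q - j - 1))"
   then obtain j where "j \<ge> 1" "x \<in> cW (p + q - j - 1)" unfolding UN_iff Int_iff by force
   thus "x \<in> cW (p + q - 1)" by (elim W_mono[rotated]) simp
  qed
 qed
 hence "cconj c \<in> cW (p + q - 1)" using bc(4) cconj_W by blast
 thus "cconj x \<in> grF F W q (p + q)"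
  unfolding in_grF using bc cconj_W[of b] by (metis cconj_simps(2))
qed

lemma deligne_inj:
 assumes x: "x \<in> deligne F W p q" "x \<in> cW (p + q - 1)"
 shows "x = 0"
proof -
 obtain b c where bc: "x = b + c" "cconj b \<in> F q" "b \<in> cW (p + q)" "c \<in> lower p q" and xF: "x \<in> F p"
  using x(1) unfolding in_deligne by blast
 have step: "x \<in> cW (p + q - int r)" if "r \<ge> 1" for r :: nat
  using that
 proof (induction r rule: dec_induct)
  case base
  thus ?case using x(2) by simp
 next
  case (step r)
  obtain c1 c2 where c: "c = c1 + c2" "cconj c1 \<in> F (q - int r + 1)" "c2 \<in> cW (p + q - int r - 1)"
   using lower_subset[OF bc(4), of "int r"] step.hyps by (metis of_nat_1 of_nat_mono One_nat_def)
  have "cconj b \<in> F (q - int r + 1)" using bc(2) by (rule F_antimono[rotated]) (use step.hyps in simp)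
  hence bF: "cconj (b + c1) \<in> F (q - int r + 1)" using c(2) cx.subspace_add[OF subspace_F] by simp
  have "b + c1 = x - c2" using bc(1) c(1) by simp
  moreover have "c2 \<in> cW (p + q - int r)" using c(3) by (rule W_mono[rotated]) simp
  ultimately have "b + c1 \<in> cW (p + q - int r)" using step.IH diffcW by metis
  hence bW: "cconj (b + c1) \<in> cW (p + q - int r)" using cconj_W by blast
  have "cconj x = cconj (b + c1) + cconj c2" using bc(1) c(1) by simp
  moreover have "cconj c2 \<in> cW (p + q - int r - 1)" using c(3) cconj_W by blast
  ultimately have "cconj x \<in> grF F W (q - int r + 1) (p + q - int r)"
   unfolding in_grF using bF bW by blast
  moreover have "x \<in> grF F W p (p + q - int r)" using xF step.IH by (rule F_grF)
  ultimately have "x \<in> cW (p + q - int r - 1)" by (intro mhs_int[of x p _ "q - int r + 1"]) simp_all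
  thus ?case by (simp add: algebra_simps)
 qed
 obtain k0 where k0: "!!k x. k \<le> k0 ==> x \<in> cW k ==> x = 0"
  using W_bounds by metis
 show ?thesis
  by (rule k0[of "p + q - int (Suc (nat (p + q - k0)))"]) (use step[of "Suc (nat (p + q - k0))"] in auto)
qed

lemma pr_deligne:
 assumes "x \<in> deligne F W p q"
 shows "pr mu x \<in> DI mu p q"
proof -
 obtain b c where bc: "x = b + c" "cconj b \<in> F q" "b \<in> cW (p + q)" "c \<in> lower p q"
  and x: "x \<in> F p" "x \<in> cW (p + q)"
  using assms unfolding in_deligne by blast
 have "pr mu c \<in> lower p q"
  using bc(4)
 proof (induction rule: cx.span_induct_alt)
  case base
  thus ?case by (simp add: zeropr cx.span_zero)
 next
  case (step a x y)
  then obtain j where j: "j \<ge> 1" "cconj x \<in> F (q - j)" "x \<in> cW (p + q - j - 1)"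
   unfolding UN_iff Int_iff cconj_image_iff by force
  have "cconj (pr mu x) \<in> F (q - j)" using pr_F[OF j(2), of "cnj mu"] pr_cconj[of "cnj mu" x] by simp
  hence "pr mu x \<in> (\<Union>j\<in>{1..}. cconj ` F (q - j) \<inter> cW (p + q - j - 1))"
   unfolding UN_iff Int_iff cconj_image_iff using j(1) pr_W[OF j(3), of mu] by (metis atLeast_iff)
  thus ?case
   using step by (simp add: addpr scalepr cx.span_add cx.span_scale cx.span_base)
 qed
 moreover have "cconj (pr mu b) \<in> F q" using pr_F[OF bc(2), of "cnj mu"] pr_cconj[of "cnj mu" b] by simp
 moreover have "pr mu x = pr mu b + pr mu c" using bc(1) addpr by blast
 ultimately show ?thesis
  unfolding DI_def Int_iff in_deligne using pr_in_H pr_F[OF x(1)] pr_W[OF x(2)] pr_W[OF bc(3)] by blast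
qed

lemma deligne_surj:
 assumes "x \<in> grF F W p (p + q)" "cconj x \<in> grF F W q (p + q)" "x \<in> H mu"
 obtains a where "a \<in> DI mu p q" "x - a \<in> cW (p + q - 1)"
proof -
 have step: "\<exists>a b c. a \<in> F p & a \<in> cW (p + q) & cconj b \<in> F q & b \<in> cW (p + q) & c \<in> lower p q &
   a - (b + c) \<in> cW (p + q - int r) & x - a \<in> cW (p + q - 1)" if "r \<ge> 1" for r :: nat
  using that
 proof (induction r rule: dec_induct)
  case base
  obtain a u where a: "x = a + u" "a \<in> F p" "a \<in> cW (p + q)" "u \<in> cW (p + q - 1)"
   using assms(1) unfolding in_grF by blast
  obtain b v where b: "cconj x = b + v" "b \<in> F q" "b \<in> cW (p + q)" "v \<in> cW (p + q - 1)"
   using assms(2) unfolding in_grF by blast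
  have "x = cconj b + cconj v" using b(1) by (metis cconj_simps(1,2))
  hence "a - (cconj b + 0) = cconj v - u" using a(1) by (simp add: algebra_simps)
  hence "a - (cconj b + 0) \<in> cW (p + q - int 1)"
   using a(4) b(4) cconj_W diffcW by simp
  moreover have "x - a \<in> cW (p + q - 1)" using a by simp
  moreover have "cconj (cconj b) \<in> F q" "cconj b \<in> cW (p + q)" using b cconj_W by simp_all
  ultimately show ?case using a cx.span_zero by blast
 next
  case (step r)
  obtain a b c where abc: "a \<in> F p" "a \<in> cW (p + q)" "cconj b \<in> F q" "b \<in> cW (p + q)" "c \<in> lower p q"
   "a - (b + c) \<in> cW (p + q - int r)" "x - a \<in> cW (p + q - 1)"
   using step.IH by blast
  have "a - (b + c) \<in> grF F W p (p + q - int r) + cconj ` grF F W (p + q - int r + 1 - p) (p + q - int r)"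
   using grF_splitting abc(6) by blast
  moreover have "p + q - int r + 1 - p = q - int r + 1" by simp
  ultimately obtain y z where yz: "a - (b + c) = y + z" "y \<in> grF F W p (p + q - int r)" "cconj z \<in> grF F W (q - int r + 1) (p + q - int r)"
   unfolding in_plus_cconj by metis
  obtain f u where f: "y = f + u" "f \<in> F p" "f \<in> cW (p + q - int r)" "u \<in> cW (p + q - int r - 1)"
   using yz(2) unfolding in_grF by blast
  obtain g v where g: "cconj z = g + v" "g \<in> F (q - int r + 1)" "g \<in> cW (p + q - int r)" "v \<in> cW (p + q - int r - 1)"
   using yz(3) unfolding in_grF by blast
  have z: "z = cconj g + cconj v" using g(1) by (metis cconj_simps(1,2))
  have 1: "a - f \<in> F p" "a - f \<in> cW (p + q)"
   using abc(1,2) f(2) W_mono[OF _ f(3), of "p + q"] cx.subspace_diff[OF subspace_F] diffcW by auto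
  have "f \<in> cW (p + q - 1)" using f(3) by (rule W_mono[rotated]) (use step.hyps in simp)
  hence "(x - a) + f \<in> cW (p + q - 1)" using abc(7) addcW by blast
  hence 2: "x - (a - f) \<in> cW (p + q - 1)" by (simp add: algebra_simps)
  have 3: "u + cconj v \<in> cW (p + q - int (Suc r))"
  proof -
   have "u + cconj v \<in> cW (p + q - int r - 1)"
    using f(4) g(4) cconj_W addcW by blast
   thus ?thesis by (simp add: algebra_simps)
  qed
  have eq: "(a - f) - (b + c + cconj g) = u + cconj v"
   using yz(1) f(1) z by (simp add: algebra_simps)
  show ?case
  proof (cases "r = 1")
   case True
   have "cconj (b + cconj g) \<in> F q" "b + cconj g \<in> cW (p + q)"
    using abc(3,4) g(2,3) True cx.subspace_add[OF subspace_F] addcW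
     W_mono[of "p + q - 1" "p + q" "cconj g"] cconj_W[of g] by auto
   moreover have "(a - f) - ((b + cconj g) + c) \<in> cW (p + q - int (Suc r))"
    using eq 3 by (simp add: algebra_simps)
   ultimately show ?thesis using 1 2 abc(5) by blast
  next
   case False
   let ?j = "int r - 1"
   have "cconj g \<in> cconj ` F (q - ?j) \<inter> cW (p + q - ?j - 1)"
    using g(2,3) cconj_W[of g] by (auto simp: cconj_image_iff algebra_simps)
   moreover have "?j \<in> {1..}" using False step.hyps by auto
   ultimately have "cconj g \<in> lower p q" by (intro cx.span_base) blast
   hence "c + cconj g \<in> lower p q" using abc(5) by (rule cx.span_add[rotated])
   moreover have "(a - f) - (b + (c + cconj g)) \<in> cW (p + q - int (Suc r))"
    using eq 3 by (simp add: algebra_simps)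
   ultimately show ?thesis using 1 2 abc(3,4) by blast
  qed
 qed
 obtain k0 where k0: "!!k x. k \<le> k0 ==> x \<in> cW k ==> x = 0"
  using W_bounds by metis
 let ?r = "Suc (nat (p + q - k0))"
 obtain a b c where abc: "a \<in> F p" "a \<in> cW (p + q)" "cconj b \<in> F q" "b \<in> cW (p + q)" "c \<in> lower p q"
   "a - (b + c) \<in> cW (p + q - int ?r)" "x - a \<in> cW (p + q - 1)"
  using step[of ?r] by auto
 have "a - (b + c) = 0" by (rule k0[OF _ abc(6)]) simp
 hence "a = b + c" by simp
 hence "a \<in> deligne F W p q" unfolding in_deligne using abc(1-5) by blast
 hence "pr mu a \<in> DI mu p q" by (rule pr_deligne)
 moreover have "pr mu (x - a) = x - pr mu a" using assms(3) by (simp add: diffpr)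
 hence "x - pr mu a \<in> cW (p + q - 1)" using pr_W[OF abc(7), of mu] by simp
 ultimately show ?thesis by (rule that)
qed

lemma DI_D:
 assumes "x \<in> DI mu p q"
 shows "x \<in> H mu" "x \<in> cW (p + q)" "x \<in> F p" "x \<in> grF F W p (p + q)" "cconj x \<in> grF F W q (p + q)"
  "x \<in> deligne F W p q"
 using assms deligne_grF[of x p q] unfolding DI_def Int_iff in_deligne by blast+

lemma DI_inj: "x \<in> DI mu p q ==> x \<in> cW (p + q - 1) ==> x = 0"
 unfolding DI_def using deligne_inj by blast

lemma subspace_DI: "cx.subspace (DI mu p q)"
 unfolding DI_def deligne_def cW_def[symmetric]
 by (intro cx.subspace_inter set_plus_subspace subspace_cconj_image subspace_F subspace_cW subspace_H cx.subspace_span)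

lemma N_DI:
 assumes "x \<in> DI mu p q"
 shows "cmap N x \<in> DI mu (p - 1) (q - 1)"
proof -
 obtain b c where bc: "x = b + c" "cconj b \<in> F q" "b \<in> cW (p + q)" "c \<in> lower p q"
  and x: "x \<in> F p" "x \<in> cW (p + q)" "x \<in> H mu"
  using assms unfolding DI_def Int_iff in_deligne by blast
 have pq: "p - 1 + (q - 1) = p + q - 2" by simp
 have NF: "cmap N y \<in> F (r - 1)" if "y \<in> F r" for y r using N_F that by blast
 have Nc: "cmap N (cconj y) = cconj (cmap N y)" for y by (rule cmap_cconj[OF linear_N])
 have "cmap N c \<in> lower (p - 1) (q - 1)"
  using bc(4)
 proof (induction rule: cx.span_induct_alt)
  case base
  thus ?case by (simp add: zeroN cx.span_zero)
 next
  case (step a x y)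
  then obtain j where j: "j \<ge> 1" "cconj x \<in> F (q - j)" "x \<in> cW (p + q - j - 1)"
   unfolding UN_iff Int_iff cconj_image_iff by force
  have "cconj (cmap N x) \<in> F (q - 1 - j)" using NF[OF j(2)] Nc[of x] by (simp add: algebra_simps)
  moreover have "cmap N x \<in> cW (p - 1 + (q - 1) - j - 1)" using N_W[OF j(3)] by (simp add: algebra_simps)
  ultimately have "cmap N x \<in> (\<Union>j\<in>{1..}. cconj ` F (q - 1 - j) \<inter> cW (p - 1 + (q - 1) - j - 1))"
   unfolding UN_iff Int_iff cconj_image_iff using j(1) by (metis atLeast_iff)
  thus ?case
   using step by (simp add: addN scaleN cx.span_add cx.span_scale cx.span_base)
 qed
 moreover have "cconj (cmap N b) \<in> F (q - 1)" using NF[OF bc(2)] Nc[of b] by simp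
 moreover have "cmap N x = cmap N b + cmap N c" using bc(1) addN by blast
 moreover have "cmap N b \<in> cW (p - 1 + (q - 1))" "cmap N x \<in> cW (p - 1 + (q - 1))"
  using N_W[OF bc(3)] N_W[OF x(2)] unfolding pq by blast+
 ultimately show ?thesis
  unfolding DI_def Int_iff in_deligne using NF[OF x(1)] N_H[OF x(3)] by blast
qed

lemma Npow_DI: "x \<in> DI mu p q ==> (NN l) x \<in> DI mu (p - int l) (q - int l)"
proof (induction l)
 case (Suc l)
 thus ?case using N_DI[of "NN l x" mu "p - int l" "q - int l"] by (simp add: algebra_simps)
qed simp

lemma N_inj_DI:
 assumes "x \<in> DI mu p q" "p + q = w mu + int l" "NN l x = 0"
 shows "x = 0"
proof -
 have "x \<in> cW (w mu + int l - 1)"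
  using DI_D(1,2)[OF assms(1)] assms(2,3) zerocW
  by (intro N_inj_gr) simp_all
 thus ?thesis using DI_inj[OF assms(1)] assms(2) by simp
qed

lemma N_surj_DI:
 assumes y: "y \<in> DI mu (p - int l) (q - int l)" and pq: "p + q = w mu + int l"
 obtains x where "x \<in> DI mu p q" "y = NN l x"
proof -
 have k: "p - int l + (q - int l) = w mu - int l" using pq by simp
 note yD = DI_D[OF y, unfolded k]
 obtain x where x: "x \<in> H mu" "x \<in> cW (w mu + int l)" "y - NN l x \<in> cW (w mu - int l - 1)"
  using N_surj_gr[OF yD(1,2)] .
 have wl: "w mu + int l - 2 * int l = w mu - int l" by simp
 have split: "x \<in> Z" if g: "x = f + g" "f \<in> Z" "g \<in> H mu" "g \<in> cW (w mu + int l)" "cx.subspace Z"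
   "NN l g \<in> cW (w mu - int l - 1)" "!!u. u \<in> cW (w mu + int l - 1) ==> u \<in> Z" for f g Z
  unfolding g(1) by (rule cx.subspace_add[OF g(5) g(2) g(7)[OF N_inj_gr[OF g(3,4,6)]]])
 have x1: "x \<in> grF F W p (w mu + int l)"
 proof -
  obtain f g where fg: "x = f + g" "f \<in> grF F W p (w mu + int l)" "cconj g \<in> grF F W (w mu + int l + 1 - p) (w mu + int l)" "f \<in> H mu" "g \<in> H mu"
   using mhs_split[OF x(2,1), of p] by blast
  have gW: "g \<in> cW (w mu + int l)" using grF_W[OF fg(3)] cconj_W by blast
  have "cconj (NN l g) \<in> grF F W (w mu + 1 - p) (w mu - int l)"
   using Npow_grF[OF fg(3), of l] Npow_cconj[of l g] wl by (simp add: algebra_simps)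
  moreover have "NN l g \<in> grF F W (p - int l) (w mu - int l)"
  proof -
   have "NN l g = y - NN l f - (y - NN l x)"
    using fg(1) by (simp add: addNN)
   thus ?thesis
    using cx.subspace_diff[OF subspace_grF cx.subspace_diff[OF subspace_grF yD(4) Npow_grF[OF fg(2), of l, unfolded wl]] W_grF[OF x(3)]]
    by metis
  qed
  ultimately have "NN l g \<in> cW (w mu - int l - 1)"
   by (intro mhs_int[of _ "p - int l" _ "w mu + 1 - p"]) simp_all
  thus ?thesis using split[OF fg(1,2,5) gW subspace_grF] W_grF by blast
 qed
 have x2: "cconj x \<in> grF F W q (w mu + int l)"
 proof -
  have "cconj x \<in> cW (w mu + int l)" "cconj x \<in> H (cnj mu)"
   using x(1,2) cconj_W cconj_H[of x "cnj mu"] by simp_all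
  then obtain f g where fg: "cconj x = f + g" "f \<in> grF F W q (w mu + int l)" "cconj g \<in> grF F W (w mu + int l + 1 - q) (w mu + int l)" "f \<in> H (cnj mu)" "g \<in> H (cnj mu)"
   using mhs_split[of "cconj x" _ _ q] by blast
  have gW: "g \<in> cW (w mu + int l)" using grF_W[OF fg(3)] cconj_W by blast
  have "cconj (NN l g) \<in> grF F W (w mu + 1 - q) (w mu - int l)"
   using Npow_grF[OF fg(3), of l] Npow_cconj[of l g] wl by (simp add: algebra_simps)
  moreover have "NN l g \<in> grF F W (q - int l) (w mu - int l)"
  proof -
   have "NN l g = cconj y - NN l f - cconj (y - NN l x)"
   proof -
    have "NN l (f + g) = cconj (NN l x)" using fg(1) Npow_cconj[of l x] by simp
    thus ?thesis by (simp add: addNN algebra_simps)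
   qed
   moreover have "cconj (y - NN l x) \<in> grF F W (q - int l) (w mu - int l)"
    using x(3) cconj_W W_grF by blast
   ultimately show ?thesis
    using cx.subspace_diff[OF subspace_grF cx.subspace_diff[OF subspace_grF yD(5) Npow_grF[OF fg(2), of l, unfolded wl]]]
    by metis
  qed
  ultimately have "NN l g \<in> cW (w mu - int l - 1)"
   by (intro mhs_int[of _ "q - int l" _ "w mu + 1 - q"]) simp_all
  hence "g \<in> cW (w mu + int l - 1)"
   using N_inj_gr[of g "cnj mu" l] fg(5) gW by simp
  thus ?thesis unfolding fg(1) using cx.subspace_add[OF subspace_grF fg(2)] W_grF by blast
 qed
 obtain a where a: "a \<in> DI mu p q" "x - a \<in> cW (p + q - 1)"
  using deligne_surj[of x p q mu] x1 x2 x(1) pq by metis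
 have "y - NN l a = (y - NN l x) + NN l (x - a)"
  by (simp add: diffNN)
 moreover have "NN l (x - a) \<in> cW (w mu - int l - 1)"
  using Npow_W[OF a(2), of l] pq by (simp add: algebra_simps)
 ultimately have "y - NN l a \<in> cW (w mu - int l - 1)"
  using x(3) addcW by metis
 moreover have "y - NN l a \<in> DI mu (p - int l) (q - int l)"
  using cx.subspace_diff[OF subspace_DI y Npow_DI[OF a(1)]] .
 ultimately have "y - NN l a = 0" using DI_inj k by metis
 thus ?thesis using that[OF a(1)] by simp
qed

lemma W_generated_by_DI:
 assumes "x \<in> cW k" "x \<in> H mu" "cx.subspace Z"
  "!!p y. y \<in> DI mu p (k - p) ==> y \<in> Z" "!!y. y \<in> cW (k - 1) ==> y \<in> H mu ==> y \<in> Z"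
 shows "x \<in> Z"
proof -
 obtain p0 p1 where p01: "!!p x. p \<le> p0 ==> x \<in> F p" "!!p x. p1 \<le> p ==> x \<in> F p ==> x = 0"
  using F_bounds by metis
 have "x \<in> Z" if "x \<in> grF F W p k" "x \<in> H mu" for x p
  using that
 proof (induction "nat (p1 - p)" arbitrary: p x rule: less_induct)
  case less
  show ?case
  proof (cases "p1 \<le> p")
   case True
   hence "x \<in> cW (k - 1)" using less.prems(1) p01(2) unfolding in_grF by (metis add_0)
   thus ?thesis using less.prems(2) assms(5) by blast
  next
   case False
   obtain y z where yz: "x = y + z" "y \<in> grF F W (p + 1) k" "cconj z \<in> grF F W (k + 1 - (p + 1)) k" "y \<in> H mu" "z \<in> H mu"
    using mhs_split[OF grF_W[OF less.prems(1)] less.prems(2), of "p + 1"] by blast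
   have y: "y \<in> Z" using less.hyps[of "p + 1" y] False yz by auto
   have "z = x - y" using yz(1) by simp
   hence "z \<in> grF F W p k"
    using cx.subspace_diff[OF subspace_grF less.prems(1) grF_antimono[of p "p + 1", OF _ yz(2)]] by simp
   then obtain a where a: "a \<in> DI mu p (k - p)" "z - a \<in> cW (k - 1)"
    using deligne_surj[of z p "k - p" mu] yz(3,5) by auto
   have "z - a \<in> Z" using assms(5)[OF a(2)] diffH[OF yz(5) DI_D(1)[OF a(1)]] by blast
   hence "(z - a) + a \<in> Z" using assms(3) assms(4)[OF a(1)] by (simp only: cx.subspace_add)
   thus ?thesis using y yz(1) assms(3) by (simp add: cx.subspace_add)
  qed
 qed
 moreover have "x \<in> grF F W p0 k" using F_grF p01(1) assms(1) by blast
 ultimately show ?thesis using assms(2) by blast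
qed

definition DI0 :: "complex => int => int => nat => ('v \<times> 'v) set" where
 "DI0 mu p q l = {a \<in> DI mu p q. (NN (l + 1)) a = 0}"

lemma subspace_DI0: "cx.subspace (DI0 mu p q l)"
proof -
 have "DI0 mu p q l = DI mu p q \<inter> ((NN (l + 1)) -` {0})"
  unfolding DI0_def by (simp only: vimage_def) auto
 thus ?thesis
  using cx.subspace_inter[OF subspace_DI cxp.linear_subspace_vimage[OF clinear_Npow[of "l + 1"] cx.subspace_single_0]] by metis
qed

lemma DI_primitive:
 assumes x: "x \<in> DI mu p q" and pq: "p + q = w mu + int l"
 obtains y where "y \<in> DI mu (p + 1) (q + 1)" "x - cmap N y \<in> DI0 mu p q l"
proof -
 have "NN (l + 1) x \<in> DI mu (p - int (l + 1)) (q - int (l + 1))" by (rule Npow_DI[OF x])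
 hence "NN (l + 1) x \<in> DI mu ((p + 1) - int (l + 2)) ((q + 1) - int (l + 2))"
  by (simp add: algebra_simps)
 then obtain y where y: "y \<in> DI mu (p + 1) (q + 1)" "NN (l + 1) x = NN (l + 2) y"
  by (rule N_surj_DI) (use pq in simp)
 have "cmap N y \<in> DI mu p q" using N_DI[OF y(1)] by (simp only: add_diff_cancel_right')
 have e: "NN (l + 1) (cmap N y) = NN (l + 2) y" by (simp add: funpow_swap1)
 have "NN (l + 1) (x - cmap N y) = NN (l + 1) x - NN (l + 1) (cmap N y)"
  by (rule diffNN)
 also have "... = 0" unfolding e y(2) by simp
 finally have "x - cmap N y \<in> DI0 mu p q l"
  unfolding DI0_def using cx.subspace_diff[OF subspace_DI x \<open>cmap N y \<in> DI mu p q\<close>] by blast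
 thus ?thesis using that y(1) by blast
qed

lemma dim_DI0:
 assumes pq: "p + q = w mu + int l"
 shows "cx.dim (DI mu p q) = cx.dim (DI0 mu p q l) + cx.dim (DI mu (p + 1) (q + 1))"
proof -
 have inj: "x = 0" if x: "x \<in> DI mu (p + 1) (q + 1)" "NN (l + 2) x = 0" for x
  by (rule N_inj_DI[OF x(1) _ x(2)]) (use pq in simp)
 have "cx.dim (DI mu p q) = cx.dim (DI0 mu p q l) + cx.dim (cmap N ` DI mu (p + 1) (q + 1))"
 proof (rule dim_direct_sum[OF fin_dim subspace_DI0 cxp.linear_subspace_image[OF clinear_N subspace_DI]])
  show "x = 0" if hx: "x \<in> DI0 mu p q l" "x \<in> cmap N ` DI mu (p + 1) (q + 1)" for x
  proof -
   from hx(2) obtain y where y: "x = cmap N y" "y \<in> DI mu (p + 1) (q + 1)" by (rule imageE)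
   hence "NN (l + 2) y = 0" using hx(1) by (simp add: DI0_def funpow_swap1)
   thus ?thesis using inj[OF y(2)] y(1) zeroN by simp
  qed
  show "DI0 mu p q l \<subseteq> DI mu p q" by (auto simp only: DI0_def)
  show "cmap N ` DI mu (p + 1) (q + 1) \<subseteq> DI mu p q" using N_DI[of _ mu "p + 1" "q + 1"] unfolding image_subset_iff add_diff_cancel_right' by blast
  show "\<exists>a\<in>DI0 mu p q l. \<exists>b\<in>cmap N ` DI mu (p + 1) (q + 1). x = a + b" if xDI: "x \<in> DI mu p q" for x
  proof -
   obtain y where y: "y \<in> DI mu (p + 1) (q + 1)" "x - cmap N y \<in> DI0 mu p q l"
    using DI_primitive[OF xDI pq] .
   show ?thesis by (rule bexI[OF _ y(2)], rule bexI[OF _ imageI[OF y(1)]]) simp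
  qed
 qed (rule subspace_DI)
 also have "cx.dim (cmap N ` DI mu (p + 1) (q + 1)) = cx.dim (DI mu (p + 1) (q + 1))"
 proof (rule dim_inj_image[OF fin_dim subspace_DI clinear_N])
  fix x assume x: "x \<in> DI mu (p + 1) (q + 1)" "cmap N x = 0"
  have "NN (l + 2) x = NN (l + 1) (cmap N x)" by (simp add: funpow_swap1)
  hence "NN (l + 2) x = 0" by (simp only: x(2) zeroNN)
  thus "x = 0" by (rule inj[OF x(1)])
 qed
 finally show ?thesis .
qed

lemma dim_DI_symmetric:
 assumes pq: "p + q = w mu + int l"
 shows "cx.dim (DI mu (p - int l) (q - int l)) = cx.dim (DI mu p q)"
proof -
 have "DI mu (p - int l) (q - int l) = (NN l) ` DI mu p q"
  using Npow_DI[of _ mu p q l] N_surj_DI[OF _ pq] by blast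
 thus ?thesis
  using dim_inj_image[OF fin_dim subspace_DI clinear_Npow N_inj_DI[OF _ pq]] by simp
qed

lemma spp_mult_eq:
 assumes p: "p = \<lfloor>of_int m - al\<rfloor>" and k: "p + q = k + theta (eig al)"
 shows "sppm al k = cx.dim (DI (eig al) p q)"
proof -
 let ?mu = "eig al" and ?k = "k + theta (eig al)"
 define G where "G p = (F p \<inter> cW ?k \<inter> H ?mu) + (cW (?k - 1) \<inter> H ?mu)" for p
 have G: "x \<in> G p \<longleftrightarrow> x \<in> grF F W p ?k & x \<in> H ?mu" for x p
 proof
  assume "x \<in> G p"
  thus "x \<in> grF F W p ?k & x \<in> H ?mu"
   unfolding G_def set_plus_def in_grF using addH by blast
 next
  assume "x \<in> grF F W p ?k & x \<in> H ?mu"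
  then obtain a b where "x = a + b" "a \<in> F p" "a \<in> cW ?k" "b \<in> cW (?k - 1)" "a \<in> H ?mu" "b \<in> H ?mu"
   using grF_H by metis
  thus "x \<in> G p" unfolding G_def set_plus_def by blast
 qed
 have sG: "cx.subspace (G p)" for p
  unfolding G_def by (intro set_plus_subspace cx.subspace_inter subspace_F subspace_cW subspace_H)
 have "cx.dim (G p) = cx.dim (DI ?mu p q) + cx.dim (G (p + 1))"
 proof (rule dim_direct_sum[OF fin_dim subspace_DI sG])
  show "x = 0" if "x \<in> DI ?mu p q" "x \<in> G (p + 1)" for x
  proof (rule DI_inj[OF that(1)])
   show "x \<in> cW (p + q - 1)"
    by (rule mhs_int[of x "p + 1" "p + q" q]) (use that G DI_D(5)[OF that(1)] k in auto)
  qed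
  show "DI ?mu p q \<subseteq> G p"
  proof
   fix x assume "x \<in> DI ?mu p q"
   thus "x \<in> G p" using G DI_D(1,4)[of x ?mu p q] k by simp
  qed
  show "G (p + 1) \<subseteq> G p" using G grF_antimono[of p "p + 1"] by auto
  show "\<exists>a\<in>DI ?mu p q. \<exists>b\<in>G (p + 1). x = a + b" if x: "x \<in> G p" for x
  proof -
   have xg: "x \<in> grF F W p ?k" "x \<in> H ?mu" using G x by blast+
   obtain y z where yz: "x = y + z" "y \<in> grF F W (p + 1) ?k" "cconj z \<in> grF F W (?k + 1 - (p + 1)) ?k" "y \<in> H ?mu" "z \<in> H ?mu"
    using mhs_split[OF grF_W[OF xg(1)] xg(2), of "p + 1"] by blast
   have "z = x - y" using yz(1) by simp
   hence "z \<in> grF F W p ?k"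
    using cx.subspace_diff[OF subspace_grF xg(1) grF_antimono[of p "p + 1", OF _ yz(2)]] by simp
   moreover have "?k + 1 - (p + 1) = q" using k by simp
   ultimately obtain a where a: "a \<in> DI ?mu p q" "z - a \<in> cW (?k - 1)"
    using deligne_surj[of z p q ?mu] yz(3,5) k by metis
   have "z - a \<in> G (p + 1)"
    using G W_grF[OF a(2)] diffH[OF yz(5) DI_D(1)[OF a(1)]] by blast
   hence "y + (z - a) \<in> G (p + 1)" using G yz(2,4) cx.subspace_add[OF sG] by blast
   thus ?thesis using a(1) yz(1) by (intro bexI[of _ a] bexI[of _ "y + (z - a)"]) auto
  qed
 qed (rule sG)
 thus ?thesis unfolding spp_mult_def Let_def G_def p cW_def by simp
qed

lemma deligne0_eq:
 assumes "p + q = w mu + int l"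
 shows "deligne0 m F W M p q mu = DI0 mu p q l"
proof -
 have "nat (p + q - m - theta mu + 1) = l + 1" using assms by (simp add: w_def)
 thus ?thesis unfolding deligne0_def DI0_def DI_def by simp
qed

lemma ladder_pq: "ladder_p m al + ladder_q m al l = w (eig al) + int l"
 by (simp add: ladder_q_def w_def)

lemma ladder_mult_eq: "lmult al l = cx.dim (DI0 (eig al) (ladder_p m al) (ladder_q m al l) l)"
 unfolding ladder_mult_def deligne0_eq[OF ladder_pq] ..

lemma norm_eigenvalue:
 assumes "mu \<in> eigenvalues"
 shows "mu * cnj mu = 1"
proof -
 obtain k0 k1 where k01: "!!k x. k \<le> k0 ==> x \<in> cW k ==> x = 0" "!!k x. k1 \<le> k ==> x \<in> cW k"
  using W_bounds by metis
 have ex: "\<exists>p q. DI mu p q ~= {0}"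
 proof (rule ccontr)
  assume "\<nexists>p q. DI mu p q ~= {0}"
  hence D: "DI mu p q = {0}" for p q by blast
  have "x = 0" if "x \<in> cW k" "x \<in> H mu" for x k
   using that
  proof (induction "nat (k - k0)" arbitrary: k x rule: less_induct)
   case less
   show ?case
   proof (cases "k \<le> k0")
    case True
    thus ?thesis using k01(1) less.prems(1) by blast
   next
    case False
    have "x \<in> {0}"
     by (rule W_generated_by_DI[OF less.prems cx.subspace_single_0])
      (use D less.hyps[of "k - 1"] False in auto)
    thus ?thesis by simp
   qed
  qed
  thus False using assms k01(2)[of k1] unfolding eigenvalues_def by blast
 qed
 have bound: "p + q - 1 < k1" if "DI mu p q ~= {0}" for p q
 proof (rule ccontr)
  assume "\<not> p + q - 1 < k1"
  hence "x = 0" if "x \<in> DI mu p q" for x using DI_inj[OF that] k01(2)[of "p + q - 1"] by simp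
  thus False using that cx.subspace_0[OF subspace_DI] by blast
 qed
 define P where "P n \<longleftrightarrow> (\<exists>p q. DI mu p q ~= {0} & n = nat (k1 + 1 - (p + q)))" for n
 obtain n where "P n" using ex unfolding P_def by blast
 define n0 where "n0 = (LEAST n. P n)"
 have "P n0" unfolding n0_def using \<open>P n\<close> by (rule LeastI)
 then obtain p q where pq: "DI mu p q ~= {0}" "n0 = nat (k1 + 1 - (p + q))" unfolding P_def by blast
 have max: "p' + q' \<le> p + q" if "DI mu p' q' ~= {0}" for p' q'
 proof -
  have "P (nat (k1 + 1 - (p' + q')))" unfolding P_def using that by blast
  hence "n0 \<le> nat (k1 + 1 - (p' + q'))" unfolding n0_def by (rule Least_le)
  thus ?thesis using pq(2) bound[OF that] bound[OF pq(1)] by simp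
 qed
 have "p + q \<ge> w mu"
 proof (rule ccontr)
  assume neg: "\<not> p + q \<ge> w mu"
  define l where "l = nat (w mu - (p + q))"
  have l: "int l = w mu - (p + q)" "l > 0" using neg by (auto simp: l_def)
  obtain y where y: "y \<in> DI mu p q" "y ~= 0" using pq(1) cx.subspace_0[OF subspace_DI] by blast
  hence "y \<in> DI mu ((p + int l) - int l) ((q + int l) - int l)" by simp
  moreover have "p + int l + (q + int l) = w mu + int l" using l by simp
  ultimately obtain x where x: "x \<in> DI mu (p + int l) (q + int l)" "y = NN l x"
   using N_surj_DI by metis
  hence "x ~= 0" using y(2) zeroNN by auto
  hence "DI mu (p + int l) (q + int l) ~= {0}" using x(1) by blast
  thus False using max l(2) by fastforce
 qed
 then obtain l where l: "p + q = w mu + int l" by (metis zle_iff_zadd)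
 obtain x where x: "x \<in> DI mu p q" "x ~= 0" using pq(1) cx.subspace_0[OF subspace_DI] by blast
 obtain y where y: "y \<in> DI mu (p + 1) (q + 1)" "x - cmap N y \<in> DI0 mu p q l"
  using DI_primitive[OF x(1) l] .
 have "DI mu (p + 1) (q + 1) = {0}" using max[of "p + 1" "q + 1"] by force
 hence "y = 0" using y(1) by blast
 hence x0: "x \<in> DI0 mu p q l" using y(2) zeroN by simp
 note xD = DI_D[OF x(1), unfolded l]
 have "q = w mu + int l - p" using l by simp
 moreover have "x \<notin> cW (w mu + int l - 1)" using DI_inj[OF x(1)] x(2) l by metis
 moreover have "NN (l + 1) x \<in> cW (w mu - int l - 3)"
  using x0 zerocW by (simp add: DI0_def)
 ultimately have "\<i> powi (2 * p - w mu - int l) * cbil S x (NN l (cconj x)) \<in> ray 1"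
  using h_positive[OF xD(1,4)] xD(5) by blast
 hence "cbil S x (NN l (cconj x)) ~= 0" by (auto simp: ray_def)
 moreover have "NN l (cconj x) \<in> H (cnj mu)" using xD(1) by (intro Npow_H) (simp add: cconj_H)
 ultimately show ?thesis using cS_orthogonal[OF xD(1)] by blast
qed

end

section \<open>Orthogonal Jordan chains\<close>

context steenbrink
begin

lemma cS_swap_H:
 assumes "x \<in> H mu"
 shows "cbil S y x = (-1) powi (w mu) * cbil S x y"
proof -
 have "cbil S (\<Sum>nu\<in>eigenvalues. pr nu y) x = (-1) powi (w mu) * cbil S x (\<Sum>nu\<in>eigenvalues. pr nu y)"
  by (simp add: cS_simps cS_swap[OF assms pr_in_H] sum_distrib_left)
 thus ?thesis by (simp add: sum_pr)
qed

definition chain_family ::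
 "'i set => ('i => complex) => ('i => nat) => ('i => complex) => ('i => 'i) => ('i => 'v \<times> 'v) => bool" where
 "chain_family X lam len eta sig f \<longleftrightarrow>
   finite X &
   (\<forall>x\<in>X. f x \<in> H (lam x) & (NN (len x + 1)) (f x) = 0 & eta x ~= 0 &
    sig x \<in> X & sig (sig x) = x & len (sig x) = len x & lam (sig x) = cnj (lam x) &
    eta (sig x) = cnj (eta x) & cconj (f x) = f (sig x)) &
   cx.span {(NN j) (f x) | x j. x \<in> X} = UNIV"

definition weakly_orthogonal where
 "weakly_orthogonal X len eta f \<longleftrightarrow> (\<forall>x\<in>X. \<forall>y\<in>X. len x = len y -->
   cbil S (f x) ((cmap N ^^ len x) (cconj (f y))) = (if x = y then eta x else 0))"

definition orthogonal_chains where
 "orthogonal_chains X len eta f \<longleftrightarrow> (\<forall>x\<in>X. \<forall>y\<in>X. \<forall>j.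
   cbil S (f x) (NN j (cconj (f y))) = (if x = y & j = len x then eta x else 0))"

theorem orthogonalize_chains:
 assumes cf: "chain_family X lam len eta sig f" and wo: "weakly_orthogonal X len eta f"
 obtains e where "chain_family X lam len eta sig e" "orthogonal_chains X len eta e"
proof -
 have fin: "finite X"
  and span: "cx.span {(NN j) (f x) | x j. x \<in> X} = UNIV"
  using cf unfolding chain_family_def by blast+
 have X: "f x \<in> H (lam x)" "NN (len x + 1) (f x) = 0" "eta x ~= 0"
    "sig x \<in> X" "sig (sig x) = x" "len (sig x) = len x" "lam (sig x) = cnj (lam x)"
    "eta (sig x) = cnj (eta x)" "cconj (f x) = f (sig x)" if "x \<in> X" for x
  using cf that unfolding chain_family_def by blast+
 have kill: "NN j (f x) = 0" if "x \<in> X" "j > len x" for x j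
  using funpow_nilpotent_mono[OF clinear_imp_linear[OF clinear_N] X(2)[OF that(1)]] that(2) by simp
 have kill': "NN j (cconj (f x)) = 0" if "x \<in> X" "j > len x" for x j
  using kill[OF that] Npow_cconj[of j "f x"] by simp
 have pair_top: "cbil S (f x) ((cmap N ^^ len x) (cconj (f x))) = eta x" if "x \<in> X" for x
  using wo that unfolding weakly_orthogonal_def by simp
 have pair_0: "cbil S (f x) (NN j (cconj (f y))) = 0"
  if xy: "x \<in> X" "y \<in> X" "2 * j \<ge> len x + len y" "\<not> (x = y & j = len x)" for x y j
 proof (cases "j > len y | j > len x")
  case True
  thus ?thesis
   using kill[OF xy(1), of j] kill'[OF xy(2), of j] cS_Npow[of j "f x" "cconj (f y)"] by (auto simp: cS_simps)
 next
  case False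
  hence "j = len x" "len x = len y" using xy(3) by auto
  thus ?thesis using wo xy unfolding weakly_orthogonal_def by auto
 qed
 have fnz: "f x ~= 0" if "x \<in> X" for x
  using pair_top[OF that] X(3)[OF that] by (auto simp: cS_simps)
 have norm: "lam x * cnj (lam x) = 1" if "x \<in> X" for x
  using norm_eigenvalue[of "lam x"] X(1)[OF that] fnz[OF that] unfolding eigenvalues_def by blast
 have eta_sym: "cnj (eta x) = (-1) ^ len x * (-1) powi (w (lam x)) * eta x" if "x \<in> X" for x
 proof -
  have "cnj (eta x) = cbil S (cconj (f x)) ((cmap N ^^ len x) (f x))"
   unfolding pair_top[OF that, symmetric] cbil_cconj[OF bilinear_S, symmetric] Npow_cconj by simp
  also have "... = (-1) powi (w (lam x)) * cbil S ((cmap N ^^ len x) (f x)) (cconj (f x))"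
   by (rule cS_swap_H[OF Npow_H[OF X(1)[OF that]]])
  also have "... = (-1) powi (w (lam x)) * ((-1) ^ len x * eta x)"
   unfolding cS_Npow pair_top[OF that] ..
  finally show ?thesis by (simp add: mult_ac)
 qed
 define J where "J = (SIGMA x:X. {..len x})"
 have finJ: "finite J" unfolding J_def using fin by auto
 have J: "x \<in> X" "i \<le> len x" if "(x, i) \<in> J" for x i using that by (auto simp: J_def)
 define b where "b x j = NN j (cconj (f x))" for x j
 define K where "K v = (\<Sum>(x, i)\<in>J. sc (cbil S (f x) (NN i v) / eta x) (b x (len x - i)))" for v
 define D where "D v = K v - v" for v
 have K: "clinear K"
  unfolding K_def
  by (rule clinearI) (simp_all add: case_prod_beta addNN scaleNN
    cS_simps add_divide_distrib cx.scale_left_distrib sum.distrib cx.scale_sum_right)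
 have D: "clinear D"
  unfolding D_def by (rule clinearI) (simp_all add: cxp.linear_add[OF K] cxp.linear_scale[OF K] cx.scale_right_diff_distrib)
 note linD = clinear_imp_linear[OF D]
 have Nb: "cmap N (b x j) = b x (Suc j)" for x j by (simp add: b_def)
 have b0: "b x j = 0" if "x \<in> X" "j > len x" for x j using kill'[OF that] by (simp add: b_def)
 have KN: "K (cmap N v) = cmap N (K v)" for v
 proof -
  have "K (cmap N v) = (\<Sum>x\<in>X. \<Sum>i\<le>len x. sc (cbil S (f x) ((cmap N ^^ Suc i) v) / eta x) (b x (len x - i)))"
   unfolding K_def J_def using fin by (simp add: sum.Sigma funpow_swap1)
  also have "... = (\<Sum>x\<in>X. \<Sum>i\<le>len x. sc (cbil S (f x) (NN i v) / eta x) (b x (Suc (len x - i))))"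
  proof (rule sum.cong[OF refl])
   fix x assume x: "x \<in> X"
   let ?g = "%i. sc (cbil S (f x) (NN i v) / eta x) (b x (Suc (len x) - i))"
   have g0: "?g 0 = 0" using b0[OF x, of "Suc (len x)"] by simp
   have g1: "?g (Suc (len x)) = 0"
    using cS_Npow[of "Suc (len x)" "f x" v] kill[OF x, of "Suc (len x)"] by (simp add: cS_simps)
   have "(\<Sum>i\<le>len x. ?g (Suc i)) = (\<Sum>i\<le>Suc (len x). ?g i)"
    unfolding sum.atMost_Suc_shift using g0 by simp
   also have "... = (\<Sum>i\<le>len x. ?g i)" using g1 by simp
   finally show "(\<Sum>i\<le>len x. sc (cbil S (f x) ((cmap N ^^ Suc i) v) / eta x) (b x (len x - i))) =
     (\<Sum>i\<le>len x. sc (cbil S (f x) (NN i v) / eta x) (b x (Suc (len x - i))))"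
    by (simp add: Suc_diff_le)
  qed
  also have "... = cmap N (K v)"
   unfolding K_def J_def using fin
   by (simp add: sum.Sigma case_prod_beta sumN scaleN Nb)
  finally show ?thesis .
 qed
 have Kc: "K (cconj v) = cconj (K v)" for v
 proof -
  have "cconj (K v) = (\<Sum>(x, i)\<in>J. sc (cbil S (cconj (f x)) (NN i (cconj v)) / cnj (eta x)) (cconj (b x (len x - i))))"
   unfolding K_def cconj_sum by (simp add: case_prod_beta Npow_cconj cbil_cconj[OF bilinear_S])
  also have "... = K (cconj v)"
   unfolding K_def
   by (rule sum.reindex_bij_witness[of _ "%(x, i). (sig x, i)" "%(x, i). (sig x, i)"])
    (auto simp: J_def X b_def Npow_cconj[symmetric])
  finally show ?thesis ..
 qed
 have KH: "K v \<in> H mu" if v: "v \<in> H mu" for v mu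
  unfolding K_def
 proof (rule sumH, clarify)
  fix x i assume xi: "(x, i) \<in> J"
  show "sc (cbil S (f x) (NN i v) / eta x) (b x (len x - i)) \<in> H mu"
  proof (cases "cbil S (f x) (NN i v) = 0")
   case True
   thus ?thesis by (simp add: zeroH)
  next
   case False
   hence "lam x * mu = 1" using cS_orthogonal[OF X(1)[OF J(1)[OF xi]] Npow_H[OF v]] by blast
   hence "mu = cnj (lam x)" using norm[OF J(1)[OF xi]] by (metis mult_cancel_left mult_zero_left zero_neq_one)
   hence "b x (len x - i) \<in> H mu"
    unfolding b_def using X(1)[OF J(1)[OF xi]] cconj_H[of "f x" mu] by (intro Npow_H) simp
   thus ?thesis by (rule scaleH)
  qed
 qed
 have Kadj: "cbil S (K u) v = cbil S u (K v)" for u v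
 proof -
  have "cbil S (K u) v = (\<Sum>(x, i)\<in>J. cbil S (f x) (NN i u) / eta x * cbil S (b x (len x - i)) v)"
   unfolding K_def by (simp add: cS_simps case_prod_beta)
  also have "... = (\<Sum>(x, i)\<in>J. cbil S (f x) (NN i v) / eta x * cbil S u (b x (len x - i)))"
  proof (rule sum.reindex_bij_witness[of _ "%(x, i). (sig x, len x - i)" "%(x, i). (sig x, len x - i)"], goal_cases)
   case (5 a)
   obtain x i where a: "a = (x, i)" by (cases a)
   hence x: "x \<in> X" and i: "i \<le> len x" using 5 J by auto
   let ?z = "NN (len x - i) (f x)"
   have 1: "cbil S (f (sig x)) (NN (len x - i) v) = (-1) ^ (len x - i) * cbil S (b x (len x - i)) v"
    using cS_Npow[of "len x - i" "cconj (f x)" v] X(9)[OF x] unfolding b_def by simp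
   have 2: "cbil S u (b (sig x) i) = (-1) powi (w (lam x)) * ((-1) ^ i * cbil S (f x) (NN i u))"
    unfolding b_def X(9)[OF x, symmetric] cconj_simps(1) cS_swap_H[OF Npow_H[OF X(1)[OF x]]] cS_Npow ..
   have s: "(-1) ^ (len x - i) * (-1) ^ i = (-1 :: complex) ^ len x"
    using i by (simp flip: power_add)
   have "cbil S (f (sig x)) (NN (len x - i) v) / eta (sig x) * cbil S u (b (sig x) i)
     = ((-1) ^ len x * (-1) powi (w (lam x)) / cnj (eta x)) * (cbil S (f x) (NN i u) * cbil S (b x (len x - i)) v)"
    unfolding 1 2 X(8)[OF x] s[symmetric] by simp
   also have "(-1) ^ len x * (-1) powi (w (lam x)) / cnj (eta x) = 1 / eta x"
    unfolding eta_sym[OF x] using X(3)[OF x] by simp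
   finally show ?case
    using i X(6)[OF x] by (simp add: a)
  qed (use X in \<open>auto simp: J_def\<close>)
  also have "... = cbil S u (K v)"
   unfolding K_def by (simp add: cS_simps case_prod_beta)
  finally show ?thesis .
 qed
 define Z where "Z k = cx.span {b x j | x j. x \<in> X & j \<le> len x & int (len x) - 2 * int j \<le> k}" for k
 have Z_mono: "k \<le> k' ==> Z k \<subseteq> Z k'" for k k'
  unfolding Z_def by (rule cx.span_mono) force
 have D_b: "D (b y j) \<in> Z (int (len y) - 2 * int j - 1)" if y: "y \<in> X" "j \<le> len y" for y j
 proof -
  let ?t = "%(x, i). sc (cbil S (f x) (NN i (b y j)) / eta x) (b x (len x - i))"
  have mem: "(y, len y - j) \<in> J" using y by (simp add: J_def)
  have "?t (y, len y - j) = b y j"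
  proof -
   have "NN (len y - j) (b y j) = (cmap N ^^ len y) (cconj (f y))"
    unfolding b_def using y(2) by (metis funpow_add le_add_diff_inverse2 o_apply)
   thus ?thesis using pair_top[OF y(1)] X(3)[OF y(1)] y(2) by simp
  qed
  hence "D (b y j) = (\<Sum>xi\<in>J - {(y, len y - j)}. ?t xi)"
   unfolding D_def K_def sum.remove[OF finJ mem] by simp
  also have "... \<in> Z (int (len y) - 2 * int j - 1)"
   unfolding Z_def
  proof (rule cx.span_sum)
   fix xi assume xi: "xi \<in> J - {(y, len y - j)}"
   obtain x i where xi': "xi = (x, i)" by (cases xi)
   have x: "x \<in> X" "i \<le> len x" using xi J unfolding xi' by auto
   have Nb': "NN i (b y j) = NN (i + j) (cconj (f y))"
    unfolding b_def by (simp add: funpow_add)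
   show "?t xi \<in> cx.span {b x' j' | x' j'. x' \<in> X & j' \<le> len x' & int (len x') - 2 * int j' \<le> int (len y) - 2 * int j - 1}"
   proof (cases "cbil S (f x) (NN (i + j) (cconj (f y))) = 0")
    case True
    thus ?thesis unfolding xi' by (simp add: Nb' cx.span_zero)
   next
    case False
    have "2 * (i + j) < len x + len y"
    proof (rule ccontr)
     assume "\<not> 2 * (i + j) < len x + len y"
     hence "x = y & i + j = len x" using False pair_0[OF x(1) y(1), of "i + j"] by force
     thus False using xi unfolding xi' by auto
    qed
    hence "int (len x) - 2 * int (len x - i) \<le> int (len y) - 2 * int j - 1" using x(2) by arith
    hence "b x (len x - i) \<in> {b x' j' | x' j'. x' \<in> X & j' \<le> len x' & int (len x') - 2 * int j' \<le> int (len y) - 2 * int j - 1}"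
     using x(1) diff_le_self by blast
    thus ?thesis unfolding xi' by (simp add: cx.span_scale cx.span_base)
   qed
  qed
  finally show ?thesis .
 qed
 have D_Z: "D v \<in> Z (k - 1)" if "v \<in> Z k" for v k
  using that unfolding Z_def[of k]
 proof (induction rule: cx.span_induct_alt)
  case base
  thus ?case by (simp add: cxp.linear_0[OF D] Z_def cx.span_zero)
 next
  case (step c v u)
  then obtain y j where y: "v = b y j" "y \<in> X" "j \<le> len y" "int (len y) - 2 * int j \<le> k" by blast
  have "D v \<in> Z (k - 1)"
   using D_b[OF y(2,3)] Z_mono[of "int (len y) - 2 * int j - 1" "k - 1"] y(1,4) by auto
  thus ?case using step(2)
   by (simp add: cxp.linear_add[OF D] cxp.linear_scale[OF D] Z_def cx.span_add cx.span_scale)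
 qed
 define L where "L = (\<Sum>x\<in>X. len x)"
 have L: "len x \<le> L" if "x \<in> X" for x
  unfolding L_def using fin that by (intro member_le_sum) auto
 have Z_top: "Z (int L) = UNIV"
 proof -
  have "{(NN j) (f x) | x j. x \<in> X} \<subseteq> Z (int L)"
  proof
   fix u assume "u \<in> {(NN j) (f x) | x j. x \<in> X}"
   then obtain x j where u: "u = NN j (f x)" and x: "x \<in> X" by blast
   have "NN j (f x) \<in> Z (int L)"
   proof (cases "j > len x")
    case True
    thus ?thesis using kill[OF x] by (simp add: Z_def cx.span_zero)
   next
    case False
    have "NN j (f x) = b (sig x) j" using X(9)[OF X(4)[OF x]] X(5)[OF x] by (simp add: b_def)
    moreover have "b (sig x) j \<in> {b x j | x j. x \<in> X & j \<le> len x & int (len x) - 2 * int j \<le> int L}"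
     using X(4,6)[OF x] False L[OF x] by (intro CollectI exI[of _ "sig x"] exI[of _ j]) auto
    ultimately show ?thesis unfolding Z_def by (simp add: cx.span_base)
   qed
   thus "u \<in> Z (int L)" unfolding u .
  qed
  hence "cx.span {(NN j) (f x) | x j. x \<in> X} \<subseteq> Z (int L)"
   unfolding Z_def by (rule cx.span_minimal[OF _ cx.subspace_span])
  thus ?thesis using span by blast
 qed
 define n where "n = 2 * L + 2"
 have D_nil: "(D ^^ n) v = 0" for v
 proof -
  have "(D ^^ k) v \<in> Z (int L - int k)" for k
  proof (induction k)
   case (Suc k)
   have "D ((D ^^ k) v) \<in> Z (int L - int k - 1)" by (rule D_Z[OF Suc])
   thus ?case by (simp add: algebra_simps)
  qed (simp add: Z_top)
  from this[of n] have "(D ^^ n) v \<in> Z (- int L - 2)" by (simp add: n_def)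
  moreover have "{b x j | x j. x \<in> X & j \<le> len x & int (len x) - 2 * int j \<le> - int L - 2} = {}"
   using L by force
  ultimately show ?thesis unfolding Z_def by simp
 qed
 define Q where "Q = feval n (fps_binomial (-1/2)) D"
 have linQ: "linear Q" unfolding Q_def by (rule linear_feval[OF linD])
 have QQK: "Q (Q (K v)) = v" for v
  using inverse_sqrt_unipotent[OF linD D_nil, of v] unfolding Q_def D_def by (simp add: n_def)
 have comm: "A (Q v) = Q (A v)" if "linear A" "!!v. A (K v) = K (A v)" for A v
  unfolding Q_def by (rule feval_commute[OF that(1)]) (simp add: D_def that(2) linear_diff[OF that(1)])
 have KQQ: "K (Q (Q v)) = v" for v
  using comm[OF clinear_imp_linear[OF K]] QQK by simp
 have QN: "cmap N (Q v) = Q (cmap N v)" for v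
  by (rule comm[OF clinear_imp_linear[OF clinear_N]]) (simp add: KN)
 have QNpow: "NN j (Q v) = Q (NN j v)" for v j
  by (induction j) (simp_all add: QN)
 have Qc: "cconj (Q v) = Q (cconj v)" for v
  by (rule comm) (auto intro: linearI simp: Kc)
 have Qi: "sc c (Q v) = Q (sc c v)" for v c
  by (rule comm[OF linearI]) (simp_all add: cxp.linear_scale[OF K] cx.scale_right_distrib scaleCx_scaleR_commute)
 have Qlin: "clinear Q" by (rule clinearI) (simp_all add: linear_add[OF linQ] Qi)
 have QH: "Q v \<in> H mu" if "v \<in> H mu" for v mu
  unfolding Q_def
 proof (rule feval_in_subspace[OF cx_subspace_imp_subspace[OF subspace_H] _ that])
  show "D ` H mu \<subseteq> H mu"
   unfolding image_subset_iff D_def by (blast intro: KH diffH)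
 qed
 have Qadj: "cbil S (Q u) v = cbil S u (Q v)" for u v
 proof -
  have "cbil S (D u) v = cbil S u (D v)" for u v by (simp add: D_def cS_simps Kadj)
  hence "cbil S ((D ^^ k) u) v = cbil S u ((D ^^ k) v)" for k u v
   by (induction k arbitrary: u v) (simp_all add: funpow_swap1)
  thus ?thesis
   unfolding Q_def feval_def by (simp add: cS_simps scaleCx_of_real[symmetric] del: scaleCx_of_real)
 qed
 have indep: "c (y, j) = 0" if c: "(\<Sum>(y, j)\<in>J. sc (c (y, j)) (b y j)) = 0" and yj: "(y, j) \<in> J" for c y j
 proof (rule ccontr)
  assume nz: "c (y, j) ~= 0"
  let ?wt = "%(y, j). int (len y) - 2 * int j"
  define J1 where "J1 = {z \<in> J. c z ~= 0}"
  have "finite J1" "J1 ~= {}" using finJ yj nz by (auto simp: J1_def)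
  hence "Max (?wt ` J1) \<in> ?wt ` J1" by (intro Max_in) auto
  then obtain z where z1: "Max (?wt ` J1) = ?wt z" "z \<in> J1" by (rule imageE)
  have z: "z \<in> J1" "!!z'. z' \<in> J1 ==> ?wt z' \<le> ?wt z"
   unfolding z1(1)[symmetric] using z1(2) \<open>finite J1\<close> by simp_all
  obtain y0 j0 where z0: "z = (y0, j0)" by (cases z)
  have y0: "y0 \<in> X" "j0 \<le> len y0" "c (y0, j0) ~= 0" using z(1) J unfolding z0 J1_def by auto
  let ?k = "len y0 - j0"
  have Nb': "NN ?k (b y j) = NN (?k + j) (cconj (f y))" for y j
   unfolding b_def by (simp add: funpow_add)
  have "0 = cbil S (f y0) (NN ?k (\<Sum>(y, j)\<in>J. sc (c (y, j)) (b y j)))"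
   unfolding c zeroNN by (simp add: cS_simps)
  also have "... = (\<Sum>(y, j)\<in>J. c (y, j) * cbil S (f y0) (NN (?k + j) (cconj (f y))))"
   by (simp add: sumNN scaleNN cS_simps case_prod_beta Nb')
  also have "... = c (y0, j0) * eta y0"
  proof (subst sum.remove[OF finJ, of "(y0, j0)"])
   show "(y0, j0) \<in> J" using z(1) unfolding z0 J1_def by auto
   have "(\<Sum>(y, j)\<in>J - {(y0, j0)}. c (y, j) * cbil S (f y0) (NN (?k + j) (cconj (f y)))) = 0"
   proof (rule sum.neutral, rule ballI)
    fix z' assume z': "z' \<in> J - {(y0, j0)}"
    obtain y j where yj': "z' = (y, j)" by (cases z')
    have yj: "(y, j) \<in> J" "(y, j) ~= (y0, j0)" using z' unfolding yj' by auto
    have "c (y, j) * cbil S (f y0) (NN (?k + j) (cconj (f y))) = 0"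
    proof (cases "c (y, j) = 0")
     case False
     hence "int (len y) - 2 * int j \<le> int (len y0) - 2 * int j0"
      using z(2)[of "(y, j)"] yj(1) unfolding z0 J1_def by auto
     hence "2 * (?k + j) \<ge> len y0 + len y" using y0(2) by arith
     moreover have "\<not> (y0 = y & ?k + j = len y0)" using yj(2) y0(2) by auto
     ultimately show ?thesis using pair_0[OF y0(1) J(1)[OF yj(1)]] by simp
    qed simp
    thus "(case z' of (y, j) => c (y, j) * cbil S (f y0) (NN (?k + j) (cconj (f y)))) = 0"
     unfolding yj' by simp
   qed
   thus "(case (y0, j0) of (y, j) => c (y, j) * cbil S (f y0) (NN (?k + j) (cconj (f y)))) +
     (\<Sum>(y, j)\<in>J - {(y0, j0)}. c (y, j) * cbil S (f y0) (NN (?k + j) (cconj (f y)))) = c (y0, j0) * eta y0"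
    using pair_top[OF y0(1)] y0(2) by simp
  qed
  finally show False using y0(3) X(3)[OF y0(1)] by simp
 qed
 define e where "e x = Q (f x)" for x
 have orth: "cbil S (e x) (NN j (cconj (e y))) = (if x = y & j = len x then eta x else 0)"
  if xy: "x \<in> X" "y \<in> X" for x y j
 proof -
  let ?v = "Q (Q (b y j))"
  have eq: "cbil S (e x) (NN j (cconj (e y))) = cbil S (f x) ?v"
   unfolding e_def Qc QNpow Qadj b_def ..
  show ?thesis
  proof (cases "j > len y")
   case True
   thus ?thesis unfolding eq b0[OF xy(2) True] linear_0[OF linQ] by (auto simp: cS_simps)
  next
   case False
   define c where "c = (%(x, i). cbil S (f x) (NN (len x - i) ?v) / eta x - (if (x, i) = (y, j) then 1 else 0))"
   have mem: "(y, j) \<in> J" using xy False by (simp add: J_def)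
   have "K ?v = (\<Sum>(x, i)\<in>J. sc (cbil S (f x) (NN (len x - i) ?v) / eta x) (b x i))"
    unfolding K_def
    by (rule sum.reindex_bij_witness[of _ "%(x, i). (x, len x - i)" "%(x, i). (x, len x - i)"]) (auto simp: J_def)
   moreover have "b y j = (\<Sum>(x, i)\<in>J. sc (if (x, i) = (y, j) then 1 else 0) (b x i))"
   proof -
    have "(\<Sum>(x, i)\<in>J. sc (if (x, i) = (y, j) then 1 else 0) (b x i)) = (\<Sum>z\<in>J. if z = (y, j) then b y j else 0)"
     by (rule sum.cong) (auto split: if_splits)
    thus ?thesis using finJ mem by simp
   qed
   ultimately have "(\<Sum>(x, i)\<in>J. sc (c (x, i)) (b x i)) = K ?v - b y j"
    by (simp add: c_def cx.scale_left_diff_distrib sum_subtractf case_prod_beta)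
   also have "... = 0" using KQQ by simp
   finally have "c (x, len x) = 0" using xy(1) by (intro indep) (auto simp: J_def)
   hence "cbil S (f x) ?v = eta x * (if (x, len x) = (y, j) then 1 else 0)"
    using X(3)[OF xy(1)] by (simp add: c_def field_simps)
   thus ?thesis unfolding eq by auto
  qed
 qed
 have "chain_family X lam len eta sig e"
  unfolding chain_family_def
 proof (intro conjI ballI fin)
  fix x assume x: "x \<in> X"
  show "e x \<in> H (lam x)" unfolding e_def by (rule QH[OF X(1)[OF x]])
  show "NN (len x + 1) (e x) = 0" unfolding e_def QNpow X(2)[OF x] by (rule linear_0[OF linQ])
  show "cconj (e x) = e (sig x)" unfolding e_def Qc X(9)[OF x] ..
 next
  have "u \<in> cx.span {(NN j) (e x) | x j. x \<in> X}" for u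
  proof -
   have u: "Q (K (Q u)) = u" using comm[OF clinear_imp_linear[OF K], of "Q u"] KQQ[of u] by simp
   have in_span: "Q v \<in> cx.span {(NN j) (e x) | x j. x \<in> X}" for v
   proof -
    have "v \<in> cx.span {(NN j) (f x) | x j. x \<in> X}" using span by simp
    thus ?thesis
    proof (induction rule: cx.span_induct_alt)
     case base
     thus ?case by (simp add: cxp.linear_0[OF Qlin] cx.span_zero)
    next
     case (step c a v)
     then obtain x j where "a = NN j (f x)" "x \<in> X" by blast
     hence "Q a \<in> {(NN j) (e x) | x j. x \<in> X}"
      using QNpow[of j "f x"] by (intro CollectI exI[of _ x] exI[of _ j]) (simp add: e_def)
     thus ?case
      using step(2) by (simp add: cxp.linear_add[OF Qlin] cxp.linear_scale[OF Qlin] cx.span_add cx.span_scale cx.span_base)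
    qed
   qed
   show ?thesis using in_span[of "K (Q u)"] unfolding u .
  qed
  thus "cx.span {(NN j) (e x) | x j. x \<in> X} = UNIV" by blast
 qed (use X in auto)
 moreover have "orthogonal_chains X len eta e" unfolding orthogonal_chains_def using orth by blast
 ultimately show ?thesis by (rule that)
qed

end

section \<open>Eigenvalues and spectral numbers\<close>

lemma eig_cis: "eig al = cis (- 2 * pi * al)"
 by (simp add: eig_def cis_conv_exp mult_ac)

lemma eig_norm: "eig al * cnj (eig al) = 1"
 by (simp add: eig_cis cis_cnj cis_mult)

lemma eig_add_int [simp]: "eig (al + of_int n) = eig al"
proof -
 have "cis (- 2 * pi * (al + of_int n)) = cis (- 2 * pi * al) * cis (2 * pi * of_int (- n))"
  by (simp add: cis_mult algebra_simps)
 also have "cis (2 * pi * of_int (- n)) = 1" by (rule cis_multiple_2pi) simp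
 finally show ?thesis by (simp add: eig_cis)
qed

lemma eig_eq_iff: "eig al = eig be \<longleftrightarrow> (\<exists>n. al = be + of_int n)"
proof
 assume "eig al = eig be"
 hence "cis (- 2 * pi * al) = cis (- 2 * pi * be)" by (simp add: eig_cis)
 hence "sin (- 2 * pi * al) = sin (- 2 * pi * be) & cos (- 2 * pi * al) = cos (- 2 * pi * be)"
  by (simp add: complex_eq_iff)
 then obtain n :: int where "- 2 * pi * al = - 2 * pi * be + 2 * pi * of_int n"
  using sin_cos_eq_iff by metis
 hence "2 * pi * (be - al) = 2 * pi * of_int n" by (simp add: algebra_simps)
 hence "al = be + of_int (- n)" by simp
 thus "\<exists>n. al = be + of_int n" by blast
next
 assume "\<exists>n. al = be + of_int n"
 then obtain n where "al = be + of_int n" ..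
 thus "eig al = eig be" by simp
qed

lemma eig_cnj: "cnj (eig al) = eig (- al)"
 by (simp add: eig_cis cis_cnj)

lemma eig_0 [simp]: "eig 0 = 1"
 by (simp add: eig_cis)

lemma eig_half: "eig (1 / 2) = -1"
 by (simp add: eig_cis complex_eq_iff)

lemma eig_eq_1: "eig al = 1 \<longleftrightarrow> al \<in> \<int>"
 using eig_eq_iff[of al 0] by (auto elim: Ints_cases)

lemma eig_eq_minus_1: "eig al = -1 \<longleftrightarrow> al - 1 / 2 \<in> \<int>"
 using eig_eq_iff[of al "1/2"] unfolding eig_half by (auto elim!: Ints_cases simp: algebra_simps)

lemma eig_surj:
 assumes "mu * cnj mu = 1"
 obtains al where "eig al = mu"
proof -
 have "norm mu = 1"
 proof -
  have "(norm mu)\<^sup>2 = 1"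
   using assms complex_norm_square[of mu] by (metis of_real_1 of_real_eq_iff)
  thus ?thesis by (simp add: power2_eq_1_iff) (smt (verit) norm_ge_zero)
 qed
 then obtain t where "mu = cis t" by (metis cis_Arg norm_eq_zero sgn_eq zero_neq_one div_by_1 of_real_1)
 hence "eig (- t / (2 * pi)) = mu" by (simp add: eig_cis)
 thus ?thesis by (rule that)
qed

lemma eig_surj_floor:
 assumes "mu * cnj mu = 1"
 obtains al where "eig al = mu" "\<lfloor>of_int m - al\<rfloor> = p"
proof -
 obtain al where a: "eig al = mu" using eig_surj[OF assms] .
 define n where "n = \<lfloor>of_int m - al\<rfloor> - p"
 have "\<lfloor>of_int m - (al + of_int n)\<rfloor> = \<lfloor>of_int m - al\<rfloor> - n"
  by (metis diff_diff_eq floor_diff_of_int)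
 hence "\<lfloor>of_int m - (al + of_int n)\<rfloor> = p" by (simp only: n_def)
 moreover have "eig (al + of_int n) = mu" using a by (simp only: eig_add_int)
 ultimately show ?thesis using that by blast
qed

lemma eig_floor_inj:
 assumes "eig al = eig be" "\<lfloor>of_int m - al\<rfloor> = \<lfloor>of_int m - be\<rfloor>"
 shows "al = be"
proof -
 obtain n where n: "al = be + of_int n" using assms(1) unfolding eig_eq_iff ..
 have "\<lfloor>of_int m - (be + of_int n)\<rfloor> = \<lfloor>of_int m - be\<rfloor> - n"
  by (metis diff_diff_eq floor_diff_of_int)
 thus ?thesis using assms(2) n by simp
qed

lemma rmod2_eq_iff: "al rmod 2 = be rmod 2 \<longleftrightarrow> (\<exists>z::int. al = be + 2 * of_int z)"
proof
 assume "al rmod 2 = be rmod 2"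
 hence "al = be + 2 * of_int (\<lfloor>al / 2\<rfloor> - \<lfloor>be / 2\<rfloor>)" by (simp add: rmod_def algebra_simps)
 thus "\<exists>z::int. al = be + 2 * of_int z" by blast
next
 assume "\<exists>z::int. al = be + 2 * of_int z"
 then obtain z :: int where z: "al = be + 2 * of_int z" ..
 have "al / 2 = be / 2 + of_int z" using z by simp
 hence "\<lfloor>al / 2\<rfloor> = \<lfloor>be / 2\<rfloor> + z" by simp
 thus "al rmod 2 = be rmod 2" using z by (simp add: rmod_def)
qed

lemma eig_cong:
 assumes "al rmod 2 = be rmod 2"
 shows "eig al = eig be"
proof -
 obtain z :: int where "al = be + 2 * of_int z" using assms unfolding rmod2_eq_iff ..
 hence "al = be + of_int (2 * z)" by simp
 thus ?thesis by (simp only: eig_add_int)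
qed

definition etaf :: "int => real => nat => complex" where
 "etaf m al l = \<i> powi (ladder_q m al l - ladder_p m al)"

lemma etaf_nz [simp]: "etaf m al l ~= 0"
 by (simp add: etaf_def)

lemma ladder_p_shift: "ladder_p m (al + of_int n) = ladder_p m al - n"
 unfolding ladder_p_def by (metis diff_diff_eq floor_diff_of_int)

lemma ladder_q_shift: "ladder_q m (al + of_int n) l = ladder_q m al l + n"
 unfolding ladder_q_def ladder_p_shift by simp

lemma i_powi_4: "\<i> powi (4 * z) = 1"
 by (simp add: power_int_mult)

lemma i_powi_add: "\<i> powi (a + b) = \<i> powi a * \<i> powi b"
 by (simp add: power_int_add)

lemma etaf_cong:
 assumes "al rmod 2 = be rmod 2"
 shows "etaf m al l = etaf m be l"
proof -
 obtain z :: int where "al = be + 2 * of_int z" using assms unfolding rmod2_eq_iff ..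
 hence a: "al = be + of_int (2 * z)" by simp
 have "ladder_q m al l - ladder_p m al = (ladder_q m be l - ladder_p m be) + 4 * z"
  unfolding a ladder_p_shift ladder_q_shift by simp
 thus ?thesis by (simp add: etaf_def i_powi_add i_powi_4)
qed

lemma etaf_cnj:
 "cnj (etaf m al l) = (-1) ^ l * (-1) powi (m + theta (eig al)) * etaf m al l"
proof -
 let ?d = "ladder_q m al l - ladder_p m al"
 have d: "?d = (m + theta (eig al)) + int l + 2 * (- ladder_p m al)" by (simp add: ladder_q_def)
 have "cnj (\<i> powi ?d) * \<i> powi ?d = 1"
  by (simp add: complex_cnj_power_int flip: power_int_mult_distrib)
 moreover have "(-1) powi ?d * \<i> powi ?d * \<i> powi ?d = 1"
  by (simp flip: power_int_mult_distrib)
 ultimately have "cnj (\<i> powi ?d) = (-1) powi ?d * \<i> powi ?d"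
  by (metis (no_types, lifting) mult_cancel_right zero_neq_one mult_zero_right)
 also have "(-1 :: complex) powi ?d = (-1) ^ l * (-1) powi (m + theta (eig al))"
 proof -
  have "(-1 :: complex) powi (a + int l + 2 * b) = (-1) ^ l * (-1) powi a" for a b
   by (simp add: power_int_add power_int_mult)
  thus ?thesis unfolding d .
 qed
 finally show ?thesis by (simp add: etaf_def)
qed

lemma partner_pq:
 shows "ladder_p m (ladder_partner m al l) = ladder_q m al l"
  and "ladder_q m (ladder_partner m al l) l = ladder_p m al"
  and "eig (ladder_partner m al l) = cnj (eig al)"
proof -
 have "eig (ladder_partner m al l) = eig (- al + of_int (m - int l - 1))"
  by (simp add: ladder_partner_def algebra_simps)
 thus e: "eig (ladder_partner m al l) = cnj (eig al)" by (simp only: eig_add_int eig_cnj)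
 have p: "ladder_p m (ladder_partner m al l) = int l + 1 + \<lfloor>al\<rfloor>"
 proof -
  have "of_int m - ladder_partner m al l = al + of_int (int l + 1)" by (simp add: ladder_partner_def)
  thus ?thesis unfolding ladder_p_def by (simp only: floor_add_int[symmetric])
 qed
 have mp: "ladder_p m al = m - \<lceil>al\<rceil>"
 proof -
  have "of_int m - al = - al + of_int m" by simp
  thus ?thesis unfolding ladder_p_def by (simp only: floor_add_int[symmetric] ceiling_def)
 qed
 have "theta (eig al) + \<lceil>al\<rceil> = \<lfloor>al\<rfloor> + 1"
 proof (cases "al \<in> \<int>")
  case True
  thus ?thesis by (auto simp: theta_def eig_eq_1 elim!: Ints_cases)
 next
  case False
  hence "\<lceil>al\<rceil> = \<lfloor>al\<rfloor> + 1" by (simp add: ceiling_altdef) (metis Ints_of_int)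
  thus ?thesis using False by (simp add: theta_def eig_eq_1)
 qed
 thus q: "ladder_p m (ladder_partner m al l) = ladder_q m al l"
  unfolding p ladder_q_def mp by simp
 have th: "theta (cnj z) = theta z" for z by (auto simp: theta_def complex_eq_iff)
 show "ladder_q m (ladder_partner m al l) l = ladder_p m al"
  unfolding ladder_q_def[of m "ladder_partner m al l"] q e th by (simp add: ladder_q_def)
qed

lemma partner_partner [simp]: "ladder_partner m (ladder_partner m al l) l = al"
 by (simp add: ladder_partner_def)

definition star :: "int => nat => real => real" where
 "star m l be = ladder_partner m be l rmod 2"

lemma rmod2_range: "0 \<le> al rmod 2" "al rmod 2 < 2"
 using rmod_nonneg[of 2 al] rmod_less[of 2 al] by simp_all

lemma star_cong:
 assumes "al rmod 2 = be rmod 2"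
 shows "star m l al = star m l be"
proof -
 obtain z :: int where z: "al = be + 2 * of_int z" using assms unfolding rmod2_eq_iff ..
 show ?thesis unfolding star_def rmod2_eq_iff
  by (rule exI[of _ "- z"]) (simp add: ladder_partner_def z)
qed

lemma star_star: "star m l (star m l be) = be rmod 2"
proof -
 have "star m l (star m l be) = star m l (ladder_partner m be l)"
  by (rule star_cong) (simp add: star_def)
 thus ?thesis by (simp add: star_def)
qed

lemma star_range: "0 \<le> star m l be" "star m l be < 2" "star m l be rmod 2 = star m l be"
 unfolding star_def using rmod2_range by simp_all

lemma eig_star: "eig (star m l be) = cnj (eig be)"
 unfolding star_def using eig_cong[of "ladder_partner m be l rmod 2" "ladder_partner m be l"] partner_pq(3) by simp

lemma etaf_star: "etaf m (star m l be) l = cnj (etaf m be l)"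
proof -
 have "etaf m (star m l be) l = etaf m (ladder_partner m be l) l"
  unfolding star_def by (rule etaf_cong) simp
 also have "... = cnj (etaf m be l)"
 proof -
  let ?d = "ladder_q m be l - ladder_p m be"
  have "\<i> powi (ladder_p m be - ladder_q m be l) = \<i> powi (- ?d)" by simp
  also have "... = inverse \<i> powi ?d" by (simp only: power_int_minus power_int_inverse)
  also have "... = cnj (\<i> powi ?d)" by (simp add: complex_cnj_power_int)
  finally show ?thesis unfolding etaf_def partner_pq .
 qed
 finally show ?thesis .
qed

section \<open>Gram-Schmidt for semidefinite hermitian forms\<close>

lemma gram_schmidt_semidefinite:
 fixes g :: "'v::real_vector \<times> 'v => 'v \<times> 'v => complex"
 assumes fd: "fin_dim (UNIV :: 'v set)"
  and add: "!!a b c. g (a + b) c = g a c + g b c" "!!a b c. g c (a + b) = g c a + g c b"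
  and scale: "!!k a c. g (sc k a) c = k * g a c" "!!k a c. g c (sc k a) = cnj k * g c a"
  and herm: "!!a b. a \<in> Z ==> b \<in> Z ==> g b a = cnj (g a b)"
  and pos: "!!a. a \<in> Z ==> \<exists>r\<ge>0. g a a = of_real r"
  and Z: "!!a b. a \<in> Z ==> b \<in> Z ==> a + b \<in> Z" "!!k a. k \<in> K ==> a \<in> Z ==> sc k a \<in> Z"
  and K: "!!r. of_real r \<in> K" "!!k. k \<in> K ==> - k \<in> K" "!!a b. a \<in> Z ==> b \<in> Z ==> g a b \<in> K"
 obtains n :: nat and r where "!!i. i < n ==> r i \<in> Z" "!!i j. i < n ==> j < n ==> g (r i) (r j) = (if i = j then 1 else 0)"
  "!!z. z \<in> Z ==> \<exists>c. z - (\<Sum>i<n. sc (c i) (r i)) \<in> Z & g (z - (\<Sum>i<n. sc (c i) (r i))) (z - (\<Sum>i<n. sc (c i) (r i))) = 0"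
proof -
 define P where "P n \<longleftrightarrow> (\<exists>r. (\<forall>i<n. r i \<in> Z) & (\<forall>i<n. \<forall>j<n. g (r i) (r j) = (if i = j then 1 else 0)))" for n :: nat
 have g0: "g 0 c = 0" for c using scale(1)[of 0 0 c] by simp
 have sum: "g (\<Sum>i\<in>A. f i) c = (\<Sum>i\<in>A. g (f i) c)" for f :: "nat => _" and A c
  by (induction A rule: infinite_finite_induct) (auto simp: g0 add)
 obtain B :: "('v \<times> 'v) set" where B: "finite B" "cx.span B = UNIV"
  using cx_finite_basis[OF fd] by metis
 have bound: "n \<le> card B" if "P n" for n
 proof (rule ccontr)
  assume "\<not> n \<le> card B"
  obtain r where r: "!!i j. i < n ==> j < n ==> g (r i) (r j) = (if i = j then 1 else 0)"
   using \<open>P n\<close> unfolding P_def by blast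
  obtain c where c: "\<exists>i\<in>{..<n}. c i ~= 0" "(\<Sum>i\<in>{..<n}. sc (c i) (r i)) = 0"
   using dependent_family[of "{..<n}" B r] B \<open>\<not> n \<le> card B\<close> by auto
  have "c j = 0" if "j < n" for j
  proof -
   have "0 = g (\<Sum>i\<in>{..<n}. sc (c i) (r i)) (r j)" unfolding c(2) g0 ..
   also have "... = (\<Sum>i<n. if i = j then c j else 0)"
    unfolding sum by (rule sum.cong) (use r that in \<open>auto simp: scale\<close>)
   also have "... = c j" using that by simp
   finally show ?thesis by simp
  qed
  thus False using c(1) by auto
 qed
 have "P 0" unfolding P_def by simp
 define n where "n = (GREATEST n. P n)"
 have Pn: "P n" unfolding n_def by (rule GreatestI_nat[where P = P, OF \<open>P 0\<close>]) (use bound in blast)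
 have max: "k \<le> n" if "P k" for k unfolding n_def by (rule Greatest_le_nat[where P = P, OF that]) (use bound in blast)
 obtain r where r: "!!i. i < n ==> r i \<in> Z" "!!i j. i < n ==> j < n ==> g (r i) (r j) = (if i = j then 1 else 0)"
  using Pn unfolding P_def by blast
 have "\<exists>c. z - (\<Sum>i<n. sc (c i) (r i)) \<in> Z & g (z - (\<Sum>i<n. sc (c i) (r i))) (z - (\<Sum>i<n. sc (c i) (r i))) = 0"
  if z: "z \<in> Z" for z
 proof -
  define c where "c i = g z (r i)" for i
  define u where "u = z + (\<Sum>i<n. sc (- c i) (r i))"
  have u_eq: "u = z - (\<Sum>i<n. sc (c i) (r i))" by (simp add: u_def sum_negf)
  have "z + (\<Sum>i<k. sc (- c i) (r i)) \<in> Z" if "k \<le> n" for k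
   using that
  proof (induction k)
   case (Suc k)
   have k: "k < n" using Suc.prems by simp
   have "z + (\<Sum>i<k. sc (- c i) (r i)) \<in> Z" using Suc by (metis Suc_leD)
   moreover have "sc (- c k) (r k) \<in> Z"
    unfolding c_def by (rule Z(2)[OF K(2)[OF K(3)[OF z r(1)[OF k]]] r(1)[OF k]])
   ultimately have "(z + (\<Sum>i<k. sc (- c i) (r i))) + sc (- c k) (r k) \<in> Z" by (rule Z(1))
   thus ?case by (simp only: sum.lessThan_Suc add.assoc)
  qed (simp add: z)
  hence uZ: "u \<in> Z" unfolding u_def by blast
  have orth: "g u (r j) = 0" if "j < n" for j
  proof -
   have "g u (r j) = g z (r j) + (\<Sum>i<n. if i = j then - c j else 0)"
   proof -
    have "(\<Sum>i<n. g (sc (- c i) (r i)) (r j)) = (\<Sum>i<n. if i = j then - c j else 0)"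
     unfolding scale by (rule sum.cong) (use r(2) that in auto)
    thus ?thesis unfolding u_def add sum by simp
   qed
   thus ?thesis using that by (simp add: c_def)
  qed
  have "g u u = 0"
  proof (rule ccontr)
   assume nz: "g u u ~= 0"
   obtain s where s: "s \<ge> 0" "g u u = of_real s" using pos[OF uZ] by blast
   hence s0: "s > 0" using nz by (metis less_eq_real_def of_real_0)
   define v where "v = sc (of_real (1 / sqrt s)) u"
   have vZ: "v \<in> Z" unfolding v_def by (rule Z(2)[OF K(1) uZ])
   have "g v v = of_real ((1 / sqrt s) * (1 / sqrt s) * s)"
    unfolding v_def scale s(2) by (simp only: complex_cnj_complex_of_real of_real_mult) (simp add: mult_ac)
   hence gv: "g v v = 1" using s0 by (simp add: field_simps)
   have gvr: "g v (r j) = 0" "g (r j) v = 0" if "j < n" for j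
    using orth[OF that] herm[OF vZ r(1)[OF that]] unfolding v_def scale by auto
   have "P (Suc n)"
    unfolding P_def
   proof (intro exI[of _ "%i. if i < n then r i else v"] conjI allI impI)
    show "(if i < n then r i else v) \<in> Z" for i using r(1) vZ by simp
    show "g (if i < n then r i else v) (if j < n then r j else v) = (if i = j then 1 else 0)"
     if "i < Suc n" "j < Suc n" for i j
     using that r(2) gv gvr by auto
   qed
   thus False using max by force
  qed
  thus ?thesis using uZ unfolding u_eq by blast
 qed
 note proj = this
 show ?thesis
 proof (rule that[of n r])
  show "r i \<in> Z" if "i < n" for i using that by (rule r(1))
  show "g (r i) (r j) = (if i = j then 1 else 0)" if "i < n" "j < n" for i j using that by (rule r(2))
  show "\<exists>c. z - (\<Sum>i<n. sc (c i) (r i)) \<in> Z & g (z - (\<Sum>i<n. sc (c i) (r i))) (z - (\<Sum>i<n. sc (c i) (r i))) = 0"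
   if "z \<in> Z" for z using that by (rule proj)
 qed
qed

section \<open>Adapted bases of the primitive Deligne spaces\<close>

context steenbrink
begin

definition hf :: "nat => 'v \<times> 'v => 'v \<times> 'v => complex" where
 "hf l a b = cbil S a (NN l (cconj b))"

lemma hf_add: "hf l (a + b) c = hf l a c + hf l b c" "hf l c (a + b) = hf l c a + hf l c b"
 and hf_scale: "hf l (sc k a) c = k * hf l a c" "hf l c (sc k a) = cnj k * hf l c a"
 and hf_0: "hf l 0 c = 0" "hf l c 0 = 0"
 by (simp_all add: hf_def cS_simps addNN diffNN
   scaleNN zeroNN)

lemma hf_sum: "hf l (\<Sum>i\<in>A. f i) c = (\<Sum>i\<in>A. hf l (f i) c)" "hf l c (\<Sum>i\<in>A. f i) = (\<Sum>i\<in>A. hf l c (f i))"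
 by (induction A rule: infinite_finite_induct) (auto simp: hf_0 hf_add)

lemma hf_herm:
 assumes "a \<in> H mu"
 shows "cnj (hf l b a) = (-1) ^ l * (-1) powi (w mu) * hf l a b"
proof -
 have "cnj (hf l b a) = cbil S (cconj b) (NN l a)"
  unfolding hf_def cbil_cconj[OF bilinear_S, symmetric] Npow_cconj by simp
 also have "... = (-1) powi (w mu) * cbil S (NN l a) (cconj b)"
  by (rule cS_swap_H[OF Npow_H[OF assms]])
 finally show ?thesis unfolding cS_Npow hf_def by simp
qed

lemma hf_cconj: "hf l (cconj a) (cconj b) = cnj (hf l a b)"
 unfolding hf_def Npow_cconj cbil_cconj[OF bilinear_S] ..

definition Wl :: "complex => nat => ('v \<times> 'v) set" where
 "Wl mu l = cW (w mu + int l - 1) \<inter> H mu"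

lemma subspace_Wl: "cx.subspace (Wl mu l)"
 unfolding Wl_def by (intro cx.subspace_inter subspace_cW subspace_H)

lemma Wl_top: "u \<in> Wl mu l ==> u \<in> cW (w mu + int l)"
 unfolding Wl_def using W_mono[of "w mu + int l - 1" "w mu + int l" u] by simp

lemma Wl_cconj: "u \<in> Wl mu l ==> cconj u \<in> Wl (cnj mu) l"
 unfolding Wl_def Int_iff cconj_W cconj_H by simp

lemma hf_lower:
 assumes a: "a \<in> H mu" "a \<in> cW (w mu + int l)" and u: "u \<in> Wl mu l"
 shows "hf l a u = 0" "hf l u a = 0"
proof -
 have uD: "u \<in> H mu" "u \<in> cW (w mu + int l - 1)" using u by (simp_all add: Wl_def)
 have c: "cconj u \<in> H (cnj mu)" "cconj u \<in> cW (w mu + int l - 1)" "cconj a \<in> H (cnj mu)" "cconj a \<in> cW (w mu + int l)"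
  using a uD cconj_W by (simp_all add: cconj_H)
 show "hf l a u = 0" unfolding hf_def
  by (rule cS_W[OF a(1) Npow_H[OF c(1)] a(2) Npow_W[OF c(2)]]) simp
 show "hf l u a = 0" unfolding hf_def
  by (rule cS_W[OF uD(1) Npow_H[OF c(3)] uD(2) Npow_W[OF c(4)]]) simp
qed

definition I0 :: "real => nat => ('v \<times> 'v) set" where
 "I0 al l = DI0 (eig al) (ladder_p m al) (ladder_q m al l) l"

lemma subspace_I0: "cx.subspace (I0 al l)"
 unfolding I0_def by (rule subspace_DI0)

lemma I0_D:
 assumes "a \<in> I0 al l"
 shows "a \<in> DI (eig al) (ladder_p m al) (ladder_q m al l)"
  "a \<in> H (eig al)" "a \<in> cW (w (eig al) + int l)" "a \<in> grF F W (ladder_p m al) (w (eig al) + int l)"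
  "cconj a \<in> grF F W (ladder_q m al l) (w (eig al) + int l)" "NN (l + 1) a = 0"
proof -
 have a: "a \<in> DI (eig al) (ladder_p m al) (ladder_q m al l)" "NN (l + 1) a = 0"
  using assms unfolding I0_def DI0_def by blast+
 thus "a \<in> DI (eig al) (ladder_p m al) (ladder_q m al l)" "NN (l + 1) a = 0" by blast+
 show "a \<in> H (eig al)" "a \<in> cW (w (eig al) + int l)" "a \<in> grF F W (ladder_p m al) (w (eig al) + int l)"
  "cconj a \<in> grF F W (ladder_q m al l) (w (eig al) + int l)"
  using DI_D(1,2,4,5)[OF a(1)] unfolding ladder_pq by blast+
qed

lemma I0_orthogonal:
 assumes a: "a \<in> I0 al l" and b: "b \<in> I0 be l" and e: "eig al = eig be" "al ~= be"
 shows "hf l a b = 0"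
proof -
 have key: "hf l a b = 0" if a: "a \<in> I0 al l" and b: "b \<in> I0 be l" and e: "eig al = eig be" "ladder_p m al > ladder_p m be" for a b al be
  unfolding hf_def
 proof (rule h_orthogonal)
  show "a \<in> H (eig al)" "b \<in> H (eig al)" using I0_D(2)[OF a] I0_D(2)[OF b] e by simp_all
  show "a \<in> grF F W (ladder_p m al) (w (eig al) + int l)" using I0_D(4)[OF a] .
  show "cconj b \<in> grF F W (ladder_q m be l) (w (eig al) + int l)" using I0_D(5)[OF b] e by simp
  show "ladder_p m al + ladder_q m be l > w (eig al) + int l"
   using ladder_pq[of be l] e by simp
 qed
 have "ladder_p m al ~= ladder_p m be" using eig_floor_inj[OF e(1)] e(2) unfolding ladder_p_def by blast
 then consider "ladder_p m al > ladder_p m be" | "ladder_p m be > ladder_p m al" by linarith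
 thus ?thesis
 proof cases
  case 1
  thus ?thesis by (rule key[OF a b e(1)])
 next
  case 2
  hence "hf l b a = 0" by (rule key[OF b a e(1)[symmetric]])
  thus ?thesis using hf_herm[OF I0_D(2)[OF a], of l b] by simp
 qed
qed

lemma I0_positive:
 assumes a: "a \<in> I0 al l" "a ~= 0"
 obtains r where "r > 0" "hf l a a = etaf m al l * of_real r"
proof -
 let ?p = "ladder_p m al" and ?q = "ladder_q m al l" and ?w = "w (eig al)"
 have pq: "?p + ?q = ?w + int l" by (rule ladder_pq)
 hence q: "?q = ?w + int l - ?p" by simp
 have "a \<notin> cW (?w + int l - 1)" using DI_inj[OF I0_D(1)[OF a(1)]] a(2) pq by auto
 moreover have "NN (l + 1) a \<in> cW (?w - int l - 3)"
  unfolding I0_D(6)[OF a(1)] by (rule zerocW)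
 ultimately have "\<i> powi (2 * ?p - ?w - int l) * hf l a a \<in> ray 1"
  using h_positive[OF I0_D(2,4)[OF a(1)] I0_D(5)[OF a(1), unfolded q]] unfolding hf_def by blast
 then obtain r where r: "r > 0" "\<i> powi (2 * ?p - ?w - int l) * hf l a a = of_real r"
  by (auto simp: ray_def)
 have "2 * ?p - ?w - int l = - (?q - ?p)" using pq by simp
 hence "etaf m al l * (\<i> powi (2 * ?p - ?w - int l)) = 1"
  unfolding etaf_def by (simp only: i_powi_add[symmetric]) simp
 hence "hf l a a = etaf m al l * of_real r"
  using r(2) by (metis (no_types, lifting) mult.assoc mult.left_neutral)
 thus ?thesis using that r(1) by blast
qed

subsection \<open>Finiteness and recursion for the spectral pairs\<close>

lemma finite_spp: "finite {(al, k). sppm al k ~= 0}"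
proof -
 obtain k0 k1 where k01: "!!k x. k \<le> k0 ==> x \<in> cW k ==> x = 0" "!!k x. k1 \<le> k ==> x \<in> cW k"
  using W_bounds by metis
 obtain p0 p1 where p01: "!!p x. p \<le> p0 ==> x \<in> F p" "!!p x. p1 \<le> p ==> x \<in> F p ==> x = 0"
  using F_bounds by metis
 let ?f = "%(al, k). (eig al, \<lfloor>of_int m - al\<rfloor>, k + theta (eig al) - \<lfloor>of_int m - al\<rfloor>)"
 have "inj_on ?f {(al, k). sppm al k ~= 0}"
  proof (rule inj_onI, clarify)
   fix al k al' k'
   assume e: "eig al = eig al'" and f: "\<lfloor>of_int m - al\<rfloor> = \<lfloor>of_int m - al'\<rfloor>"
    and k: "k + theta (eig al) - \<lfloor>of_int m - al\<rfloor> = k' + theta (eig al') - \<lfloor>of_int m - al'\<rfloor>"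
   show "al = al' & k = k'" using eig_floor_inj[OF e f] k by simp
  qed
 moreover have "?f ` {(al, k). sppm al k ~= 0} \<subseteq> eigenvalues \<times> {k0 - p1..p1} \<times> {k0 - p1..p1}"
 proof (rule image_subsetI)
  fix z assume "z \<in> {(al, k). sppm al k ~= 0}"
  then obtain al k where z: "z = (al, k)" and nz: "sppm al k ~= 0" by blast
  define p where "p = \<lfloor>of_int m - al\<rfloor>"
  define q where "q = k + theta (eig al) - p"
  have "cx.dim (DI (eig al) p q) ~= 0"
   using nz spp_mult_eq[OF p_def, of q k] by (simp add: q_def)
  hence "DI (eig al) p q ~= {0}" unfolding dim_zero_iff[OF fin_dim subspace_DI] .
  then obtain x where x: "x \<in> DI (eig al) p q" "x ~= 0" using cx.subspace_0[OF subspace_DI] by blast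
  have ev: "eig al \<in> eigenvalues" using DI_D(1)[OF x(1)] x(2) unfolding eigenvalues_def by blast
  have p: "p < p1" using p01(2)[OF _ DI_D(3)[OF x(1)]] x(2) by force
  have q: "q < p1"
  proof (rule ccontr)
   assume "\<not> q < p1"
   hence "cconj x \<in> cW (p + q - 1)" using DI_D(5)[OF x(1)] p01(2)[of q] unfolding in_grF by (metis add_0 not_le)
   hence "x \<in> cW (p + q - 1)" using cconj_W by blast
   thus False using DI_inj[OF x(1)] x(2) by blast
  qed
  have "k0 < p + q" using k01(1)[OF _ DI_D(2)[OF x(1)]] x(2) by force
  thus "?f z \<in> eigenvalues \<times> {k0 - p1..p1} \<times> {k0 - p1..p1}"
   using ev p q unfolding z by (simp add: p_def[symmetric] q_def[symmetric])
 qed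
 ultimately show ?thesis
  using finite_eigenvalues by (meson finite_SigmaI finite_atLeastAtMost_int finite_imageD finite_subset)
qed

lemma ladder_recursion:
 "lmult al l + sppm (al - 1) (m + int l + 2) = sppm al (m + int l)"
proof -
 let ?p = "ladder_p m al" and ?q = "ladder_q m al l"
 have e: "eig (al - 1) = eig al" using eig_add_int[of al "-1"] by simp
 have "sppm al (m + int l) = cx.dim (DI (eig al) ?p ?q)"
  by (rule spp_mult_eq) (simp_all add: ladder_p_def[symmetric] ladder_pq w_def)
 moreover have "sppm (al - 1) (m + int l + 2) = cx.dim (DI (eig (al - 1)) (?p + 1) (?q + 1))"
 proof (rule spp_mult_eq)
  show "?p + 1 = \<lfloor>of_int m - (al - 1)\<rfloor>" using ladder_p_shift[of m al "-1"] by (simp add: ladder_p_def)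
  show "?p + 1 + (?q + 1) = m + int l + 2 + theta (eig (al - 1))"
   using ladder_pq[of al l] e by (simp add: w_def)
 qed
 ultimately show ?thesis
  using dim_DI0[OF ladder_pq] unfolding e ladder_mult_eq by simp
qed

lemma spp_symmetric: "sppm (al + of_nat l) (m - int l) = sppm al (m + int l)"
proof -
 let ?p = "ladder_p m al" and ?q = "ladder_q m al l"
 have e: "eig (al + of_nat l) = eig al" using eig_add_int[of al "int l"] by simp
 have "sppm al (m + int l) = cx.dim (DI (eig al) ?p ?q)"
  by (rule spp_mult_eq) (simp_all add: ladder_p_def[symmetric] ladder_pq w_def)
 moreover have "sppm (al + of_nat l) (m - int l) = cx.dim (DI (eig (al + of_nat l)) (?p - int l) (?q - int l))"
 proof (rule spp_mult_eq)
  show "?p - int l = \<lfloor>of_int m - (al + of_nat l)\<rfloor>" using ladder_p_shift[of m al "int l"] by (simp add: ladder_p_def)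
  show "?p - int l + (?q - int l) = m - int l + theta (eig (al + of_nat l))"
   using ladder_pq[of al l] e by (simp add: w_def)
 qed
 ultimately show ?thesis
  using dim_DI_symmetric[OF ladder_pq] unfolding e by simp
qed

definition specs :: "real set" where "specs = {al. \<exists>k. sppm al k ~= 0}"

lemma finite_specs: "finite specs"
proof -
 have "specs = fst ` {(al, k). sppm al k ~= 0}" unfolding specs_def by force
 thus ?thesis using finite_spp by simp
qed

lemma ladder_mult_spp: "lmult al l ~= 0 ==> sppm al (m + int l) ~= 0"
 using ladder_recursion[of al l] by simp

lemma ladder_mult_specs: "lmult al l ~= 0 ==> al \<in> specs"
 unfolding specs_def using ladder_mult_spp by blast

lemma I0_specs: "a \<in> I0 al l ==> a ~= 0 ==> al \<in> specs"
proof (rule ladder_mult_specs)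
 assume "a \<in> I0 al l" "a ~= 0"
 hence "I0 al l ~= {0}" by blast
 thus "lmult al l ~= 0"
  unfolding ladder_mult_eq I0_def[symmetric] using dim_zero_iff[OF fin_dim subspace_I0] by blast
qed

definition cls :: "real => real set" where "cls be = {al \<in> specs. al rmod 2 = be rmod 2}"

lemma finite_cls: "finite (cls be)"
 unfolding cls_def using finite_specs by simp

definition gcount :: "real => nat => nat" where
 "gcount be l = (\<Sum>al\<in>cls be. lmult al l)"

definition E :: "real => nat => ('v \<times> 'v) set" where
 "E be l = cx.span (\<Union>al\<in>cls be. I0 al l)"

lemma cls_cong: "al \<in> cls be ==> eig al = eig be & etaf m al l = etaf m be l"
 unfolding cls_def using eig_cong etaf_cong by blast

lemma span_I0_sum:
 assumes "e \<in> cx.span (\<Union>al\<in>A. I0 al l)" "finite A"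
 obtains y where "!!al. al \<in> A ==> y al \<in> I0 al l" "e = (\<Sum>al\<in>A. y al)"
proof -
 have "\<exists>y. (\<forall>al\<in>A. y al \<in> I0 al l) & e = (\<Sum>al\<in>A. y al)"
  using assms(1)
 proof (induction rule: cx.span_induct_alt)
  case base
  show ?case by (rule exI[of _ "%_. 0"]) (simp add: cx.subspace_0[OF subspace_I0])
 next
  case (step c x e)
  then obtain al0 y where y: "al0 \<in> A" "x \<in> I0 al0 l" "\<forall>al\<in>A. y al \<in> I0 al l" "e = (\<Sum>al\<in>A. y al)" by blast
  show ?case
  proof (intro exI[of _ "%al. (if al = al0 then sc c x else 0) + y al"] conjI ballI)
   show "sc c x + e = (\<Sum>al\<in>A. (if al = al0 then sc c x else 0) + y al)"
    unfolding sum.distrib y(4) using y(1) assms(2) by simp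
   fix al assume al: "al \<in> A"
   have "(if al = al0 then sc c x else 0) \<in> I0 al l"
    using y(2) cx.subspace_scale[OF subspace_I0] cx.subspace_0[OF subspace_I0] by simp
   thus "(if al = al0 then sc c x else 0) + y al \<in> I0 al l"
    using y(3) al cx.subspace_add[OF subspace_I0] by blast
  qed
 qed
 thus ?thesis using that by blast
qed

lemma E_D:
 assumes "e \<in> E be l"
 shows "e \<in> H (eig be)" "e \<in> cW (w (eig be) + int l)" "NN (l + 1) e = 0"
proof -
 let ?Y = "H (eig be) \<inter> cW (w (eig be) + int l) \<inter> ((NN (l + 1)) -` {0})"
 have "E be l \<subseteq> ?Y"
  unfolding E_def
 proof (rule cx.span_minimal)
  show "(\<Union>al\<in>cls be. I0 al l) \<subseteq> ?Y"
  proof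
   fix a assume "a \<in> (\<Union>al\<in>cls be. I0 al l)"
   then obtain al where al: "al \<in> cls be" "a \<in> I0 al l" by blast
   have e: "eig al = eig be" using cls_cong[OF al(1)] by blast
   show "a \<in> ?Y" using I0_D(2,3,6)[OF al(2)] unfolding e by (simp only: Int_iff vimage_eq singleton_iff)
  qed
  show "cx.subspace ?Y"
   by (intro cx.subspace_inter subspace_H subspace_cW cxp.linear_subspace_vimage[OF clinear_Npow cx.subspace_single_0])
 qed
 hence "e \<in> ?Y" using assms by blast
 thus "e \<in> H (eig be)" "e \<in> cW (w (eig be) + int l)" "NN (l + 1) e = 0"
  by (simp_all only: Int_iff vimage_eq singleton_iff)
qed

lemma E_nonneg:
 assumes "e \<in> E be l"
 obtains r where "r \<ge> 0" "hf l e e = etaf m be l * of_real r" "r = 0 ==> e = 0"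
proof -
 obtain y where y: "!!al. al \<in> cls be ==> y al \<in> I0 al l" "e = (\<Sum>al\<in>cls be. y al)"
  using span_I0_sum[OF assms[unfolded E_def] finite_cls] by metis
 have "\<exists>s. \<forall>al\<in>cls be. s al \<ge> 0 & hf l (y al) (y al) = etaf m be l * of_real (s al) & (s al = 0 --> y al = 0)"
 proof (rule bchoice, rule ballI)
  fix al assume al: "al \<in> cls be"
  show "\<exists>s\<ge>0. hf l (y al) (y al) = etaf m be l * of_real s & (s = 0 --> y al = 0)"
  proof (cases "y al = 0")
   case True
   thus ?thesis by (intro exI[of _ 0]) (simp add: hf_0)
  next
   case False
   obtain r where "r > 0" "hf l (y al) (y al) = etaf m al l * of_real r"
    using I0_positive[OF y(1)[OF al] False] .
   thus ?thesis using cls_cong[OF al, of l] by (intro exI[of _ r]) auto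
  qed
 qed
 then obtain s where s: "!!al. al \<in> cls be ==> s al \<ge> 0" "!!al. al \<in> cls be ==> hf l (y al) (y al) = etaf m be l * of_real (s al)"
  "!!al. al \<in> cls be ==> s al = 0 ==> y al = 0" by blast
 have "hf l e e = (\<Sum>al\<in>cls be. \<Sum>al'\<in>cls be. hf l (y al') (y al))"
  unfolding y(2) hf_sum ..
 also have "... = (\<Sum>al\<in>cls be. \<Sum>al'\<in>cls be. if al' = al then etaf m be l * of_real (s al) else 0)"
 proof (intro sum.cong refl)
  fix al al' assume al: "al \<in> cls be" "al' \<in> cls be"
  have "eig al' = eig al" using cls_cong[OF al(1)] cls_cong[OF al(2)] by simp
  thus "hf l (y al') (y al) = (if al' = al then etaf m be l * of_real (s al) else 0)"
   using I0_orthogonal[OF y(1)[OF al(2)] y(1)[OF al(1)]] s(2)[OF al(1)] by auto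
 qed
 also have "... = etaf m be l * of_real (\<Sum>al\<in>cls be. s al)"
  using finite_cls[of be] by (simp add: sum_distrib_left)
 finally have h: "hf l e e = etaf m be l * of_real (\<Sum>al\<in>cls be. s al)" .
 show ?thesis
 proof (rule that[OF _ h])
  show "(\<Sum>al\<in>cls be. s al) \<ge> 0" using s(1) by (rule sum_nonneg)
  show "e = 0" if "(\<Sum>al\<in>cls be. s al) = 0"
  proof -
   have "s al = 0" if "al \<in> cls be" for al
    using \<open>(\<Sum>al\<in>cls be. s al) = 0\<close> s(1) that finite_cls[of be] by (simp add: sum_nonneg_eq_0_iff)
   thus ?thesis unfolding y(2) using s(3) by simp
  qed
 qed
qed

lemma E_orthogonal:
 assumes a: "a \<in> E al l" and b: "b \<in> E be l" and e: "eig al = eig be" "al rmod 2 ~= be rmod 2"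
 shows "hf l a b = 0"
proof -
 obtain y where y: "!!al'. al' \<in> cls al ==> y al' \<in> I0 al' l" "a = (\<Sum>al'\<in>cls al. y al')"
  using span_I0_sum[OF a[unfolded E_def] finite_cls] by metis
 obtain z where z: "!!be'. be' \<in> cls be ==> z be' \<in> I0 be' l" "b = (\<Sum>be'\<in>cls be. z be')"
  using span_I0_sum[OF b[unfolded E_def] finite_cls] by metis
 have "hf l (y al') (z be') = 0" if "al' \<in> cls al" "be' \<in> cls be" for al' be'
 proof (rule I0_orthogonal[OF y(1)[OF that(1)] z(1)[OF that(2)]])
  show "eig al' = eig be'" using cls_cong[OF that(1)] cls_cong[OF that(2)] e(1) by simp
  show "al' ~= be'" using that e(2) unfolding cls_def by auto
 qed
 thus ?thesis unfolding y(2) z(2) hf_sum by (simp add: sum.neutral)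
qed

lemma dim_E: "cx.dim (E be l) = gcount be l"
proof -
 have "cx.dim (cx.span (\<Union>al\<in>A. I0 al l)) = (\<Sum>al\<in>A. lmult al l)" if "finite A" "A \<subseteq> cls be" for A
  using that
 proof (induction A)
  case (insert al A)
  let ?B = "cx.span (\<Union>al\<in>A. I0 al l)" and ?C = "cx.span (\<Union>al\<in>insert al A. I0 al l)"
  have "cx.dim ?C = cx.dim (I0 al l) + cx.dim ?B"
  proof (rule dim_direct_sum[OF fin_dim subspace_I0 cx.subspace_span])
   show "x = 0" if x: "x \<in> I0 al l" "x \<in> ?B" for x
   proof (rule ccontr)
    assume "x ~= 0"
    then obtain r where r: "r > 0" "hf l x x = etaf m al l * of_real r" using I0_positive[OF x(1)] by blast
    obtain y where y: "!!al. al \<in> A ==> y al \<in> I0 al l" "x = (\<Sum>al\<in>A. y al)"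
     using span_I0_sum[OF x(2) insert.hyps(1)] by metis
    have "hf l x (y al') = 0" if al': "al' \<in> A" for al'
    proof (rule I0_orthogonal[OF x(1) y(1)[OF al']])
     show "eig al = eig al'" using insert.prems al' cls_cong[of al be] cls_cong[of al' be] by auto
     show "al ~= al'" using al' insert.hyps(2) by auto
    qed
    hence "hf l x (\<Sum>al\<in>A. y al) = 0" unfolding hf_sum by (simp add: sum.neutral)
    hence "hf l x x = 0" using y(2) by simp
    thus False using r by simp
   qed
   show "I0 al l \<subseteq> ?C" using cx.span_superset[of "\<Union>al\<in>insert al A. I0 al l"] by blast
   show "?B \<subseteq> ?C" by (rule cx.span_mono) blast
   show "\<exists>a\<in>I0 al l. \<exists>b\<in>?B. x = a + b" if x: "x \<in> ?C" for x
   proof -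
    have "finite (insert al A)" using insert.hyps(1) by simp
    then obtain y where y: "!!al'. al' \<in> insert al A ==> y al' \<in> I0 al' l" "x = (\<Sum>al\<in>insert al A. y al)"
     using span_I0_sum[OF x] by metis
    have "(\<Sum>al\<in>A. y al) \<in> ?B"
     by (intro cx.span_sum cx.span_base) (use y(1) in blast)
    thus ?thesis using y insert.hyps by (intro bexI[of _ "y al"] bexI[of _ "\<Sum>al\<in>A. y al"]) auto
   qed
  qed (rule cx.subspace_span)
  moreover have "cx.dim ?B = (\<Sum>al\<in>A. lmult al l)" using insert by simp
  ultimately show ?case using insert.hyps unfolding ladder_mult_eq I0_def by simp
 next
  case empty
  have "cx.dim ({0} :: ('v \<times> 'v) set) = 0"
   using dim_zero_iff[OF fin_dim cx.subspace_single_0] by blast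
  moreover have "cx.dim ({} :: ('v \<times> 'v) set) = 0"
   using cx.dim_eq_card_independent[OF cx.independent_empty] by simp
  ultimately show ?case by simp
 qed
 from this[OF finite_cls subset_refl] show ?thesis unfolding E_def gcount_def .
qed

definition D :: "real => nat => ('v \<times> 'v) set" where
 "D be l = {z. \<exists>e u. z = e + u & e \<in> E be l & u \<in> Wl (eig be) l}"

lemma subspace_E: "cx.subspace (E be l)"
 unfolding E_def by (rule cx.subspace_span)

lemma subspace_D: "cx.subspace (D be l)"
proof -
 have "D be l = {x + y |x y. x \<in> E be l & y \<in> Wl (eig be) l}" unfolding D_def by blast
 thus ?thesis by (simp only: cx.subspace_sums[OF subspace_E subspace_Wl])
qed

lemma E_subset_D: "e \<in> E be l ==> e \<in> D be l"
proof -
 assume "e \<in> E be l"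
 hence "e = e + 0 & e \<in> E be l & 0 \<in> Wl (eig be) l" using cx.subspace_0[OF subspace_Wl] by simp
 thus ?thesis unfolding D_def by (intro CollectI exI)
qed

lemma Wl_subset_D: "u \<in> Wl (eig be) l ==> u \<in> D be l"
proof -
 assume "u \<in> Wl (eig be) l"
 hence "u = 0 + u & 0 \<in> E be l & u \<in> Wl (eig be) l" using cx.subspace_0[OF subspace_E] by simp
 thus ?thesis unfolding D_def by (intro CollectI exI)
qed

lemma D_D: "z \<in> D be l ==> z \<in> H (eig be)" "z \<in> D be l ==> z \<in> cW (w (eig be) + int l)"
proof -
 assume "z \<in> D be l"
 then obtain e u where z: "z = e + u" "e \<in> E be l" "u \<in> Wl (eig be) l" unfolding D_def by blast
 show "z \<in> H (eig be)" using addH[OF E_D(1)[OF z(2)]] z(1,3) unfolding Wl_def by blast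
 show "z \<in> cW (w (eig be) + int l)" using addcW[OF E_D(2)[OF z(2)] Wl_top[OF z(3)]] z(1) by simp
qed

lemma hf_D:
 assumes "eig al = eig be" "e \<in> E al l" "u \<in> Wl (eig al) l" "e' \<in> E be l" "u' \<in> Wl (eig be) l"
 shows "hf l (e + u) (e' + u') = hf l e e'"
proof -
 note e = E_D(1,2)[OF assms(2)] and e' = E_D(1,2)[OF assms(4), folded assms(1)]
 have u: "u \<in> H (eig al)" "u \<in> cW (w (eig al) + int l)" using assms(3) Wl_top unfolding Wl_def by blast+
 have "u' \<in> Wl (eig al) l" using assms by simp
 thus ?thesis
  using hf_lower(1)[OF e, of u'] hf_lower(2)[OF e' assms(3)] hf_lower(1)[OF u, of u'] by (simp add: hf_add)
qed

lemma E_Wl: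
 assumes "x \<in> E be l" "x \<in> Wl (eig be) l"
 shows "x = 0"
proof -
 obtain r where r: "r \<ge> 0" "hf l x x = etaf m be l * of_real r" "r = 0 ==> x = 0"
  using E_nonneg[OF assms(1)] by blast
 have "hf l x x = 0" by (rule hf_lower(1)[OF E_D(1,2)[OF assms(1)] assms(2)])
 thus ?thesis using r by simp
qed

lemma dim_D: "cx.dim (D be l) = gcount be l + cx.dim (Wl (eig be) l)"
proof -
 have "cx.dim (D be l) = cx.dim (E be l) + cx.dim (Wl (eig be) l)"
 proof (rule dim_direct_sum[OF fin_dim subspace_E subspace_Wl])
  show "x = 0" if "x \<in> E be l" "x \<in> Wl (eig be) l" for x using that by (rule E_Wl)
  show "E be l \<subseteq> D be l" "Wl (eig be) l \<subseteq> D be l" using E_subset_D Wl_subset_D by blast+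
  show "\<exists>a\<in>E be l. \<exists>b\<in>Wl (eig be) l. x = a + b" if "x \<in> D be l" for x
   using that unfolding D_def by blast
 qed (rule subspace_D)
 thus ?thesis by (simp add: dim_E)
qed

lemma D_nonneg:
 assumes "z \<in> D be l"
 obtains r where "r \<ge> 0" "hf l z z = etaf m be l * of_real r" "r = 0 ==> z \<in> Wl (eig be) l"
proof -
 obtain e u where z: "z = e + u" "e \<in> E be l" "u \<in> Wl (eig be) l" using assms unfolding D_def by blast
 obtain r where r: "r \<ge> 0" "hf l e e = etaf m be l * of_real r" "r = 0 ==> e = 0"
  using E_nonneg[OF z(2)] by blast
 have "hf l z z = etaf m be l * of_real r" unfolding z(1) hf_D[OF refl z(2,3,2,3)] by (rule r(2))
 thus ?thesis using that r z by auto
qed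

lemma cconj_D:
 assumes "z \<in> D be l"
 shows "cconj z \<in> D (star m l be) l"
proof -
 have eb: "eig (star m l be) = cnj (eig be)" by (rule eig_star)
 have I0: "cconj a \<in> D (star m l be) l" if a: "a \<in> I0 al l" "al \<in> cls be" for a al
 proof -
  let ?p = "ladder_p m al" and ?q = "ladder_q m al l" and ?al = "ladder_partner m al l"
  have e: "eig al = eig be" using cls_cong[OF a(2)] by blast
  have k: "?q + ?p = w (eig be) + int l" using ladder_pq[of al l] e by simp
  note aD = I0_D[OF a(1), unfolded e]
  have "cconj a \<in> H (cnj (eig be))" using aD(2) by (simp add: cconj_H)
  then obtain a' where a': "a' \<in> DI (cnj (eig be)) ?q ?p" "cconj a - a' \<in> cW (?q + ?p - 1)"
   using deligne_surj[of "cconj a" ?q ?p] aD(4,5) k by (metis cconj_simps(1))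
  have N: "NN (l + 1) a' = 0"
  proof -
   have "NN (l + 1) (cconj a - a') = NN (l + 1) (cconj a) - NN (l + 1) a'"
    by (rule diffNN)
   also have "NN (l + 1) (cconj a) = 0" unfolding Npow_cconj aD(6) by simp
   finally have "NN (l + 1) a' = - NN (l + 1) (cconj a - a')" by simp
   hence "NN (l + 1) a' \<in> cW (?q + ?p - 1 - 2 * int (l + 1))"
    using Npow_W[OF a'(2), of "l + 1"] negcW by metis
   moreover have "?q + ?p - 1 - 2 * int (l + 1) = ?q - int (l + 1) + (?p - int (l + 1)) - 1" by simp
   ultimately show ?thesis using DI_inj[OF Npow_DI[OF a'(1), of "l + 1"]] by metis
  qed
  have a'I: "a' \<in> I0 ?al l"
   unfolding I0_def partner_pq DI0_def e using a'(1) N by blast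
  have aE: "a' \<in> E (star m l be) l"
  proof (cases "a' = 0")
   case True
   thus ?thesis by (simp add: cx.subspace_0[OF subspace_E])
  next
   case False
   have "star m l al = star m l be" using a(2) unfolding cls_def by (intro star_cong) simp
   hence "?al rmod 2 = star m l be rmod 2" using star_range(3)[of m l be] by (simp add: star_def)
   hence "?al \<in> cls (star m l be)" unfolding cls_def using I0_specs[OF a'I False] by simp
   thus ?thesis unfolding E_def using a'I by (intro cx.span_base) blast
  qed
  have "cconj a - a' \<in> H (cnj (eig be))"
   using \<open>cconj a \<in> H (cnj (eig be))\<close> DI_D(1)[OF a'(1)] by (rule diffH)
  hence "cconj a - a' \<in> Wl (eig (star m l be)) l"
   using a'(2) k unfolding Wl_def eb by simp
  hence "a' + (cconj a - a') \<in> D (star m l be) l" unfolding D_def using aE by blast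
  thus ?thesis by simp
 qed
 obtain e u where z: "z = e + u" "e \<in> E be l" "u \<in> Wl (eig be) l" using assms unfolding D_def by blast
 have "cconj e \<in> D (star m l be) l"
  using z(2) unfolding E_def
 proof (induction rule: cx.span_induct_alt)
  case base
  thus ?case by (simp add: cx.subspace_0[OF subspace_D])
 next
  case (step c x y)
  hence "cconj x \<in> D (star m l be) l" using I0 by blast
  thus ?case using step(2) by (simp add: cx.subspace_add[OF subspace_D] cx.subspace_scale[OF subspace_D])
 qed
 moreover have "cconj u \<in> D (star m l be) l"
  by (rule Wl_subset_D) (use Wl_cconj[OF z(3)] eb in simp)
 ultimately show ?thesis unfolding z(1) by (simp add: cx.subspace_add[OF subspace_D])
qed

subsection \<open>Orthonormal lifts\<close>

definition good :: "real => nat => nat => (nat => 'v \<times> 'v) => bool" where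
 "good be l n r \<longleftrightarrow> (\<forall>i<n. r i \<in> D be l & (NN (l + 1)) (r i) = 0) &
   (\<forall>i<n. \<forall>j<n. hf l (r i) (r j) = (if i = j then etaf m be l else 0)) &
   (\<forall>z\<in>D be l. \<exists>c. z - (\<Sum>i<n. sc (c i) (r i)) \<in> Wl (eig be) l)"

lemma good_count:
 assumes "good be l n r"
 shows "n = gcount be l"
proof -
 have r: "!!i. i < n ==> r i \<in> D be l" "!!i j. i < n ==> j < n ==> hf l (r i) (r j) = (if i = j then etaf m be l else 0)"
  "!!z. z \<in> D be l ==> \<exists>c. z - (\<Sum>i<n. sc (c i) (r i)) \<in> Wl (eig be) l"
  using assms unfolding good_def by blast+
 let ?R = "r ` {..<n}"
 have coef: "c j = 0" if c: "(\<Sum>i<n. sc (c i) (r i)) \<in> Wl (eig be) l" and j: "j < n" for c j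
 proof -
  have "0 = hf l (\<Sum>i<n. sc (c i) (r i)) (r j)"
   using hf_lower(2)[OF D_D(1,2)[OF r(1)[OF j]] c] by simp
  also have "... = (\<Sum>i<n. if i = j then c j * etaf m be l else 0)"
   unfolding hf_sum hf_scale by (rule sum.cong) (use r(2) j in auto)
  also have "... = c j * etaf m be l" using j by simp
  finally show ?thesis by simp
 qed
 have inj: "inj_on r {..<n}"
 proof (rule inj_onI)
  fix i j assume ij: "i \<in> {..<n}" "j \<in> {..<n}" "r i = r j"
  hence "hf l (r i) (r j) = etaf m be l" using r(2)[of j j] by simp
  thus "i = j" using r(2)[of i j] ij by (auto split: if_splits)
 qed
 have ind: "cx.independent ?R"
 proof (rule ccontr)
  assume "\<not> cx.independent ?R"
  then obtain c v where c: "v \<in> ?R" "c v ~= 0" "(\<Sum>v\<in>?R. sc (c v) v) = 0"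
   using cx.dependent_finite[of ?R] by blast
  obtain j where j: "j < n" "v = r j" using c(1) by blast
  have "(\<Sum>i<n. sc (c (r i)) (r i)) = 0" using c(3) sum.reindex[OF inj, of "%v. sc (c v) v"] by (simp add: o_def)
  hence "(\<Sum>i<n. sc (c (r i)) (r i)) \<in> Wl (eig be) l" using cx.subspace_0[OF subspace_Wl] by simp
  from coef[OF this j(1)] show False using c(2) j(2) by simp
 qed
 have dimR: "cx.dim (cx.span ?R) = n"
  using cx.dim_span_eq_card_independent[OF ind] card_image[OF inj] by simp
 have span_form: "\<exists>c. x = (\<Sum>i<n. sc (c i) (r i))" if "x \<in> cx.span ?R" for x
 proof -
  obtain u where "x = (\<Sum>v\<in>?R. sc (u v) v)" using \<open>x \<in> cx.span ?R\<close> cx.span_finite[of ?R] by auto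
  thus ?thesis using sum.reindex[OF inj, of "%v. sc (u v) v"] by (intro exI[of _ "%i. u (r i)"]) (simp add: o_def)
 qed
 have "cx.dim (D be l) = cx.dim (cx.span ?R) + cx.dim (Wl (eig be) l)"
 proof (rule dim_direct_sum[OF fin_dim cx.subspace_span subspace_Wl])
  show "x = 0" if x: "x \<in> cx.span ?R" "x \<in> Wl (eig be) l" for x
  proof -
   obtain c where c: "x = (\<Sum>i<n. sc (c i) (r i))" using span_form[OF x(1)] ..
   have "c j = 0" if "j < n" for j using coef[OF _ that] x(2) unfolding c by blast
   thus ?thesis unfolding c by simp
  qed
  show "cx.span ?R \<subseteq> D be l" by (rule cx.span_minimal[OF _ subspace_D]) (use r(1) in blast)
  show "Wl (eig be) l \<subseteq> D be l" using Wl_subset_D by blast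
  show "\<exists>a\<in>cx.span ?R. \<exists>b\<in>Wl (eig be) l. x = a + b" if x: "x \<in> D be l" for x
  proof -
   obtain c where c: "x - (\<Sum>i<n. sc (c i) (r i)) \<in> Wl (eig be) l" using r(3)[OF x] ..
   have "(\<Sum>i<n. sc (c i) (r i)) \<in> cx.span ?R"
    by (intro cx.span_sum cx.span_scale cx.span_base) blast
   thus ?thesis using c by (intro bexI[of _ "\<Sum>i<n. sc (c i) (r i)"] bexI[OF _ c]) auto
  qed
 qed (rule subspace_D)
 thus ?thesis using dim_D[of be l] dimR by simp
qed

lemma good_cconj:
 assumes g: "good be l n r" and b: "be rmod 2 = be"
 shows "good (star m l be) l n (%i. cconj (r i))"
 unfolding good_def
proof (intro conjI allI impI ballI)
 fix i assume i: "i < n"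
 show "cconj (r i) \<in> D (star m l be) l" using g i cconj_D unfolding good_def by blast
 have "NN (l + 1) (r i) = 0" using g i unfolding good_def by blast
 thus "NN (l + 1) (cconj (r i)) = 0" unfolding Npow_cconj by simp
next
 fix i j assume "i < n" "j < n"
 thus "hf l (cconj (r i)) (cconj (r j)) = (if i = j then etaf m (star m l be) l else 0)"
  using g unfolding good_def hf_cconj etaf_star by simp
next
 fix z assume "z \<in> D (star m l be) l"
 hence "cconj z \<in> D (star m l (star m l be)) l" by (rule cconj_D)
 hence "cconj z \<in> D be l" unfolding star_star b .
 then obtain c where c: "cconj z - (\<Sum>i<n. sc (c i) (r i)) \<in> Wl (eig be) l"
  using g unfolding good_def by blast
 have "cconj (cconj z - (\<Sum>i<n. sc (c i) (r i))) = z - (\<Sum>i<n. sc (cnj (c i)) (cconj (r i)))"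
  by (simp add: cconj_sum)
 thus "\<exists>c. z - (\<Sum>i<n. sc (c i) (cconj (r i))) \<in> Wl (eig (star m l be)) l"
  using Wl_cconj[OF c] unfolding eig_star by (intro exI[of _ "%i. cnj (c i)"]) simp
qed

lemma good_exists:
 assumes b: "be rmod 2 = be"
 obtains n r where "good be l n r" "star m l be = be ==> \<forall>i<n. cconj (r i) = r i"
proof -
 let ?eta = "etaf m be l"
 define g where "g a b = hf l a b / ?eta" for a b
 have g_simps: "g (a + b) c = g a c + g b c" "g c (a + b) = g c a + g c b"
   "g (sc k a) c = k * g a c" "g c (sc k a) = cnj k * g c a" for a b c k
  by (simp_all add: g_def hf_add hf_scale add_divide_distrib)
 have wt: "w (eig be) = m + theta (eig be)" by (simp add: w_def)
 have herm: "g b a = cnj (g a b)" if "b \<in> D be l" for a b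
 proof -
  let ?c = "(-1) ^ l * (-1) powi (w (eig be)) :: complex"
  have cc: "?c * ?c = 1"
  proof -
   have "(-1) ^ l * (-1) ^ l = (1::complex)" "(-1) powi (w (eig be)) * (-1) powi (w (eig be)) = (1::complex)"
    by (simp_all flip: power_mult_distrib power_int_mult_distrib)
   thus ?thesis by (metis mult.assoc mult.commute mult.left_neutral)
  qed
  have "cnj (g a b) = (?c * hf l b a) / (?c * ?eta)"
   unfolding g_def using hf_herm[OF D_D(1)[OF that], of l a] etaf_cnj[of m be l] by (simp add: wt)
  also have "... = g b a" unfolding g_def using cc by (metis mult_divide_mult_cancel_left mult_zero_left zero_neq_one)
  finally show ?thesis ..
 qed
 have pos: "\<exists>r\<ge>0. g a a = of_real r" if a: "a \<in> D be l" for a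
 proof -
  obtain r where "r \<ge> 0" "hf l a a = ?eta * of_real r" using D_nonneg[OF a] by blast
  thus ?thesis by (intro exI[of _ r]) (simp add: g_def)
 qed
 have zero: "a \<in> Wl (eig be) l" if a: "a \<in> D be l" "g a a = 0" for a
 proof -
  obtain r where "r \<ge> 0" "hf l a a = ?eta * of_real r" "r = 0 ==> a \<in> Wl (eig be) l"
   using D_nonneg[OF a(1)] by blast
  thus ?thesis using a(2) by (simp add: g_def)
 qed
 have orth: "hf l a b = (if P then ?eta else 0)" if "g a b = (if P then 1 else 0)" for a b P
  using that by (auto simp: g_def split: if_splits)
 show ?thesis
 proof (cases "star m l be = be")
  case False
  have KK: "!!r. of_real r \<in> (UNIV :: complex set)" "!!k::complex. k \<in> UNIV ==> - k \<in> UNIV"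
   "!!a b. a \<in> E be l ==> b \<in> E be l ==> g a b \<in> UNIV" by auto
  obtain n :: nat and r where r: "!!i. i < n ==> r i \<in> E be l"
   "!!i j. i < n ==> j < n ==> g (r i) (r j) = (if i = j then 1 else 0)"
   "!!z. z \<in> E be l ==> \<exists>c. z - (\<Sum>i<n. sc (c i) (r i)) \<in> E be l & g (z - (\<Sum>i<n. sc (c i) (r i))) (z - (\<Sum>i<n. sc (c i) (r i))) = 0"
  proof (rule gram_schmidt_semidefinite[where g = g and Z = "E be l" and K = UNIV, OF fin_dim g_simps _ _ _ _ KK])
   show "g b a = cnj (g a b)" if "a \<in> E be l" "b \<in> E be l" for a b using herm[OF E_subset_D[OF that(2)]] .
   show "\<exists>r\<ge>0. g a a = of_real r" if "a \<in> E be l" for a using pos[OF E_subset_D[OF that]] .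
  qed (assumption | rule cx.subspace_add[OF subspace_E] cx.subspace_scale[OF subspace_E] that)+
  have "good be l n r"
   unfolding good_def
  proof (intro conjI allI impI ballI)
   show "r i \<in> D be l" "NN (l + 1) (r i) = 0" if "i < n" for i
    using E_subset_D[OF r(1)[OF that]] E_D(3)[OF r(1)[OF that]] .
   show "hf l (r i) (r j) = (if i = j then ?eta else 0)" if "i < n" "j < n" for i j
    by (rule orth[OF r(2)[OF that]])
   fix z assume "z \<in> D be l"
   then obtain e u where z: "z = e + u" "e \<in> E be l" "u \<in> Wl (eig be) l" unfolding D_def by blast
   obtain c where c: "e - (\<Sum>i<n. sc (c i) (r i)) \<in> E be l"
    "g (e - (\<Sum>i<n. sc (c i) (r i))) (e - (\<Sum>i<n. sc (c i) (r i))) = 0" using r(3)[OF z(2)] by blast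
   have "(e - (\<Sum>i<n. sc (c i) (r i))) + u \<in> Wl (eig be) l"
    by (rule cx.subspace_add[OF subspace_Wl zero[OF E_subset_D[OF c(1)] c(2)] z(3)])
   thus "\<exists>c. z - (\<Sum>i<n. sc (c i) (r i)) \<in> Wl (eig be) l"
    unfolding z(1) by (intro exI[of _ c]) (simp add: algebra_simps)
  qed
  thus ?thesis using that False by blast
 next
  case True
  define Z where "Z = {z \<in> D be l. cconj z = z & (NN (l + 1)) z = 0}"
  define K where "K = range (of_real :: real => complex)"
  have eta_real: "cnj ?eta = ?eta" using etaf_star[of m l be] True by simp
  have ZD: "a \<in> D be l" if "a \<in> Z" for a using that by (simp add: Z_def)
  have Zadd: "a + b \<in> Z" if "a \<in> Z" "b \<in> Z" for a b
   using that cxp.linear_add[OF clinear_Npow, of "l + 1" a b] cx.subspace_add[OF subspace_D] unfolding Z_def by auto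
  have Zscale: "sc k a \<in> Z" if k: "k \<in> K" "a \<in> Z" for k a
  proof -
   have "cnj k = k" using k(1) unfolding K_def by auto
   moreover have "NN (l + 1) (sc k a) = sc k (NN (l + 1) a)"
    by (rule scaleNN)
   ultimately show ?thesis using k(2) cx.subspace_scale[OF subspace_D] unfolding Z_def by simp
  qed
  have KK: "!!r. of_real r \<in> K" "!!k. k \<in> K ==> - k \<in> K" "!!a b. a \<in> Z ==> b \<in> Z ==> g a b \<in> K"
  proof -
   show "of_real r \<in> K" for r by (simp add: K_def)
   show "- k \<in> K" if "k \<in> K" for k
   proof -
    obtain s where "k = of_real s" using \<open>k \<in> K\<close> unfolding K_def by (rule rangeE)
    hence "- k = of_real (- s)" by simp
    thus ?thesis unfolding K_def by (rule range_eqI)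
   qed
   show "g a b \<in> K" if "a \<in> Z" "b \<in> Z" for a b
   proof -
    have "cnj (g a b) = g a b"
     using that hf_cconj[of l a b] eta_real by (simp add: g_def Z_def)
    hence "g a b \<in> \<real>" by (simp add: Reals_cnj_iff)
    thus ?thesis unfolding K_def Reals_def by simp
   qed
  qed
  obtain n :: nat and r where r: "!!i. i < n ==> r i \<in> Z"
   "!!i j. i < n ==> j < n ==> g (r i) (r j) = (if i = j then 1 else 0)"
   "!!z. z \<in> Z ==> \<exists>c. z - (\<Sum>i<n. sc (c i) (r i)) \<in> Z & g (z - (\<Sum>i<n. sc (c i) (r i))) (z - (\<Sum>i<n. sc (c i) (r i))) = 0"
  proof (rule gram_schmidt_semidefinite[where g = g and Z = Z and K = K, OF fin_dim g_simps _ _ Zadd Zscale KK])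
   show "g b a = cnj (g a b)" if "a \<in> Z" "b \<in> Z" for a b using herm[OF ZD[OF that(2)]] .
   show "\<exists>r\<ge>0. g a a = of_real r" if "a \<in> Z" for a using pos[OF ZD[OF that]] .
  qed (assumption | rule that)+
  have "good be l n r"
   unfolding good_def
  proof (intro conjI allI impI ballI)
   show "r i \<in> D be l" "NN (l + 1) (r i) = 0" if "i < n" for i
    using r(1)[OF that] unfolding Z_def by blast+
   show "hf l (r i) (r j) = (if i = j then ?eta else 0)" if "i < n" "j < n" for i j
    by (rule orth[OF r(2)[OF that]])
   fix z assume "z \<in> D be l"
   then obtain e u where z: "z = e + u" "e \<in> E be l" "u \<in> Wl (eig be) l" unfolding D_def by blast
   define e1 where "e1 = sc (1 / 2) (e + cconj e)"
   define e2 where "e2 = sc (1 / (2 * \<i>)) (e - cconj e)"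
   have eD: "e \<in> D be l" "cconj e \<in> D be l" using E_subset_D[OF z(2)] cconj_D[OF E_subset_D[OF z(2)]] True by simp_all
   have Ne: "NN (l + 1) e = 0" "NN (l + 1) (cconj e) = 0"
    using E_D(3)[OF z(2)] unfolding Npow_cconj by simp_all
   have e1: "e1 \<in> Z"
   proof -
    have "e1 \<in> D be l" unfolding e1_def by (intro cx.subspace_scale[OF subspace_D] cx.subspace_add[OF subspace_D] eD)
    moreover have "cconj e1 = e1" by (simp add: e1_def add.commute)
    moreover have "NN (l + 1) e1 = 0"
     unfolding e1_def scaleNN addNN Ne by simp
    ultimately show ?thesis by (simp add: Z_def)
   qed
   have e2: "e2 \<in> Z"
   proof -
    have "e2 \<in> D be l" unfolding e2_def by (intro cx.subspace_scale[OF subspace_D] cx.subspace_diff[OF subspace_D] eD)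
    moreover have "cconj e2 = e2"
     unfolding e2_def by (simp add: cx.scale_right_diff_distrib)
    moreover have "NN (l + 1) e2 = 0"
     unfolding e2_def scaleNN diffNN Ne by simp
    ultimately show ?thesis by (simp add: Z_def)
   qed
   have e_eq: "e = e1 + sc \<i> e2"
   proof -
    have "sc \<i> e2 = sc (1 / 2) (e - cconj e)" by (simp add: e2_def)
    hence "e1 + sc \<i> e2 = sc (1 / 2) ((e + cconj e) + (e - cconj e))" by (simp only: e1_def cx.scale_right_distrib)
    also have "... = sc (1 / 2) e + sc (1 / 2) e" by (simp add: cx.scale_right_distrib cx.scale_right_diff_distrib)
    also have "... = e" by (simp flip: cx.scale_left_distrib)
    finally show ?thesis ..
   qed
   obtain c1 where c1: "e1 - (\<Sum>i<n. sc (c1 i) (r i)) \<in> Wl (eig be) l" using r(3)[OF e1] zero ZD by blast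
   obtain c2 where c2: "e2 - (\<Sum>i<n. sc (c2 i) (r i)) \<in> Wl (eig be) l" using r(3)[OF e2] zero ZD by blast
   have "(e1 - (\<Sum>i<n. sc (c1 i) (r i))) + sc \<i> (e2 - (\<Sum>i<n. sc (c2 i) (r i))) + u \<in> Wl (eig be) l"
    by (intro cx.subspace_add[OF subspace_Wl] cx.subspace_scale[OF subspace_Wl] c1 c2 z(3))
   also have "(e1 - (\<Sum>i<n. sc (c1 i) (r i))) + sc \<i> (e2 - (\<Sum>i<n. sc (c2 i) (r i))) + u =
     z - (\<Sum>i<n. sc (c1 i + \<i> * c2 i) (r i))"
    unfolding z(1) by (subst e_eq) (simp add: cx.scale_right_diff_distrib cx.scale_sum_right cx.scale_left_distrib sum.distrib algebra_simps)
   finally show "\<exists>c. z - (\<Sum>i<n. sc (c i) (r i)) \<in> Wl (eig be) l"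
    by (rule exI[of _ "%i. c1 i + \<i> * c2 i"])
  qed
  moreover have "\<forall>i<n. cconj (r i) = r i" using r(1) by (simp add: Z_def)
  ultimately show ?thesis using that by blast
 qed
qed

end

context steenbrink
begin

lemma gcount_cong: "al rmod 2 = be rmod 2 ==> gcount al l = gcount be l"
 unfolding gcount_def cls_def by simp

lemma gcount_star:
 assumes "be rmod 2 = be"
 shows "gcount (star m l be) l = gcount be l"
proof -
 obtain n r where g: "good be l n r" using good_exists[OF assms, of l] by metis
 have "n = gcount (star m l be) l" by (rule good_count[OF good_cconj[OF g assms]])
 thus ?thesis using good_count[OF g] by simp
qed

definition idx :: "(real \<times> nat \<times> nat) set" where
 "idx = {x. fst x rmod 2 = fst x & snd (snd x) < gcount (fst x) (fst (snd x))}"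

definition xlam :: "real \<times> nat \<times> nat => complex" where "xlam x = eig (fst x)"
definition xlen :: "real \<times> nat \<times> nat => nat" where "xlen x = fst (snd x)"
definition xeta :: "real \<times> nat \<times> nat => complex" where "xeta x = etaf m (fst x) (fst (snd x))"
definition xsig :: "real \<times> nat \<times> nat => real \<times> nat \<times> nat" where
 "xsig x = (star m (fst (snd x)) (fst x), snd x)"

lemma finite_idx: "finite idx"
proof -
 let ?A = "(%(al, k). (al rmod 2, nat (k - m))) ` {(al, k). sppm al k ~= 0}"
 have "idx \<subseteq> (\<Union>y\<in>?A. (%i. (fst y, snd y, i)) ` {..<gcount (fst y) (snd y)})"
 proof
  fix x assume x: "x \<in> idx"
  obtain be l i where xe: "x = (be, l, i)" by (rule prod_cases3)
  have b: "be rmod 2 = be" and i: "i < gcount be l" using x unfolding xe idx_def by simp_all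
  have "gcount be l ~= 0" using i by simp
  then obtain al where al: "al \<in> cls be" "lmult al l ~= 0"
   unfolding gcount_def by (rule sum.not_neutral_contains_not_neutral)
  have "(al, m + int l) \<in> {(al, k). sppm al k ~= 0}" using ladder_mult_spp[OF al(2)] by simp
  hence "(%(al, k). (al rmod 2, nat (k - m))) (al, m + int l) \<in> ?A" by (rule imageI)
  moreover have "(%(al, k). (al rmod 2, nat (k - m))) (al, m + int l) = (be, l)"
   using al(1) b unfolding cls_def by simp
  ultimately have "(be, l) \<in> ?A" by (simp only:)
  thus "x \<in> (\<Union>y\<in>?A. (%i. (fst y, snd y, i)) ` {..<gcount (fst y) (snd y)})"
   by (rule UN_I) (use i xe in simp)
 qed
 moreover have "finite (\<Union>y\<in>?A. (%i. (fst y, snd y, i)) ` {..<gcount (fst y) (snd y)})"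
  using finite_spp by (intro finite_UN_I finite_imageI) simp_all
 ultimately show ?thesis by (rule finite_subset)
qed

definition lift :: "real => nat => nat => 'v \<times> 'v" where
 "lift be l = (SOME r. good be l (gcount be l) r & (star m l be = be --> (\<forall>i<gcount be l. cconj (r i) = r i)))"

lemma good_lift:
 assumes "be rmod 2 = be"
 shows "good be l (gcount be l) (lift be l)" "star m l be = be ==> i < gcount be l ==> cconj (lift be l i) = lift be l i"
proof -
 obtain n r where g: "good be l n r" "star m l be = be ==> \<forall>i<n. cconj (r i) = r i"
  using good_exists[OF assms, of l] by metis
 have n: "n = gcount be l" by (rule good_count[OF g(1)])
 have "good be l (gcount be l) r & (star m l be = be --> (\<forall>i<gcount be l. cconj (r i) = r i))"
  using g unfolding n by blast
 from someI[of "%r. good be l (gcount be l) r & (star m l be = be --> (\<forall>i<gcount be l. cconj (r i) = r i))", OF this]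
 have *: "good be l (gcount be l) (lift be l) & (star m l be = be --> (\<forall>i<gcount be l. cconj (lift be l i) = lift be l i))"
  unfolding lift_def .
 thus "good be l (gcount be l) (lift be l)" "star m l be = be ==> i < gcount be l ==> cconj (lift be l i) = lift be l i"
  by blast+
qed

definition fv :: "real => nat => nat => 'v \<times> 'v" where
 "fv be l i = (if be \<le> star m l be then lift be l i else cconj (lift (star m l be) l i))"

lemma good_fv:
 assumes "be rmod 2 = be"
 shows "good be l (gcount be l) (fv be l)"
proof (cases "be \<le> star m l be")
 case True
 hence "fv be l = lift be l" unfolding fv_def by simp
 thus ?thesis using good_lift(1)[OF assms] by simp
next
 case False
 hence "fv be l = (%i. cconj (lift (star m l be) l i))" unfolding fv_def by simp
 moreover have "good (star m l (star m l be)) l (gcount (star m l be) l) (%i. cconj (lift (star m l be) l i))"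
  by (rule good_cconj[OF good_lift(1)[OF star_range(3)] star_range(3)])
 ultimately show ?thesis unfolding star_star assms gcount_star[OF assms] by simp
qed

lemma cconj_fv:
 assumes b: "be rmod 2 = be" and i: "i < gcount be l"
 shows "cconj (fv be l i) = fv (star m l be) l i"
proof -
 have ss: "star m l (star m l be) = be" unfolding star_star b ..
 consider "be = star m l be" | "be < star m l be" | "star m l be < be" by linarith
 thus ?thesis
 proof cases
  case 1
  hence "fv be l i = lift be l i" unfolding fv_def by simp
  thus ?thesis using good_lift(2)[OF b 1[symmetric] i] 1 by simp
 next
  case 2
  thus ?thesis unfolding fv_def ss by simp
 next
  case 3
  thus ?thesis unfolding fv_def ss by simp
 qed
qed

lemma good_parts:
 assumes "good be l n r" "i < n"
 shows "r i \<in> D be l" "r i \<in> H (eig be)" "NN (l + 1) (r i) = 0"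
  "j < n ==> hf l (r i) (r j) = (if i = j then etaf m be l else 0)"
 using assms D_D(1) unfolding good_def by blast+

lemma hf_D_orthogonal:
 assumes "x \<in> D al l" "y \<in> D be l" "eig al = eig be" "al rmod 2 ~= be rmod 2"
 shows "hf l x y = 0"
proof -
 obtain e u where x: "x = e + u" "e \<in> E al l" "u \<in> Wl (eig al) l" using assms(1) unfolding D_def by blast
 obtain e' u' where y: "y = e' + u'" "e' \<in> E be l" "u' \<in> Wl (eig be) l" using assms(2) unfolding D_def by blast
 show ?thesis
  unfolding x(1) y(1) hf_D[OF assms(3) x(2,3) y(2,3)] by (rule E_orthogonal[OF x(2) y(2) assms(3,4)])
qed

definition fx :: "real \<times> nat \<times> nat => 'v \<times> 'v" where "fx x = fv (fst x) (fst (snd x)) (snd (snd x))"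

lemma weakly_orthogonal_fx: "weakly_orthogonal idx xlen xeta fx"
 unfolding weakly_orthogonal_def
proof (intro ballI impI)
 fix x y assume xy: "x \<in> idx" "y \<in> idx" "xlen x = xlen y"
 obtain be l i where x: "x = (be, l, i)" by (rule prod_cases3)
 obtain ga j where y: "y = (ga, l, j)" using xy(3) unfolding x xlen_def by (cases y) auto
 have b: "be rmod 2 = be" "i < gcount be l" and c: "ga rmod 2 = ga" "j < gcount ga l"
  using xy(1,2) unfolding x y idx_def by simp_all
 note gb = good_parts[OF good_fv[OF b(1)] b(2)] and gc = good_parts[OF good_fv[OF c(1)] c(2)]
 have "hf l (fv be l i) (fv ga l j) = (if x = y then etaf m be l else 0)"
 proof (cases "be = ga")
  case True
  thus ?thesis using gb(4)[of j] c(2) unfolding x y by simp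
 next
  case False
  have "hf l (fv be l i) (fv ga l j) = 0"
  proof (cases "eig be = eig ga")
   case True
   show ?thesis by (rule hf_D_orthogonal[OF gb(1) gc(1) True]) (use False b c in simp)
  next
   case ne: False
   have "eig be * cnj (eig ga) ~= 1"
   proof
    assume "eig be * cnj (eig ga) = 1"
    hence "eig be * (cnj (eig ga) * eig ga) = eig ga" by (simp add: mult.assoc[symmetric])
    thus False using ne eig_norm[of ga] by (simp add: mult.commute)
   qed
   thus ?thesis unfolding hf_def
    using cS_orthogonal[OF gb(2) Npow_H, of "cconj (fv ga l j)" "cnj (eig ga)"] gc(2) by (simp add: cconj_H)
  qed
  thus ?thesis using False unfolding x y by simp
 qed
 thus "cbil S (fx x) ((cmap N ^^ xlen x) (cconj (fx y))) = (if x = y then xeta x else 0)"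
  unfolding hf_def fx_def xlen_def xeta_def x y by simp
qed

lemma span_fx:
 defines "Y == %mu. cx.span {(NN j) (fx x) |x j. x \<in> idx & xlam x = mu}"
 assumes "mu \<in> eigenvalues" "x \<in> H mu"
 shows "x \<in> Y mu"
proof -
 have Y_sub: "cx.subspace (Y mu)" unfolding Y_def by (rule cx.subspace_span)
 have N_Y: "NN k y \<in> Y mu" if "y \<in> Y mu" for y k
 proof -
  let ?G = "{(NN j) (fx x) |x j. x \<in> idx & xlam x = mu}"
  have "(NN k) ` ?G \<subseteq> ?G"
  proof (rule image_subsetI)
   fix g assume "g \<in> ?G"
   then obtain x j where g: "g = NN j (fx x)" "x \<in> idx" "xlam x = mu" by blast
   have "NN k g = NN (k + j) (fx x)" unfolding g(1) funpow_add o_apply ..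
   thus "NN k g \<in> ?G" using g by blast
  qed
  hence "cx.span ((NN k) ` ?G) \<subseteq> Y mu" unfolding Y_def by (rule cx.span_mono)
  moreover have "NN k y \<in> (NN k) ` cx.span ?G" using that unfolding Y_def by (rule imageI)
  ultimately show ?thesis unfolding cxp.linear_span_image[OF clinear_Npow, symmetric] by (rule subsetD)
 qed
 have fx_H: "fx x \<in> H (xlam x)" if "x \<in> idx" for x
  using that good_parts(2)[OF good_fv] unfolding fx_def xlam_def idx_def by simp
 have Y_H: "y \<in> H mu" if "y \<in> Y mu" for y
 proof -
  have "Y mu \<subseteq> H mu" unfolding Y_def
  proof (rule cx.span_minimal[OF _ subspace_H], rule subsetI)
   fix g assume "g \<in> {(NN j) (fx x) |x j. x \<in> idx & xlam x = mu}"
   then obtain x j where g: "g = NN j (fx x)" "x \<in> idx" "xlam x = mu" by blast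
   show "g \<in> H mu" unfolding g(1) using Npow_H[OF fx_H[OF g(2)]] g(3) by simp
  qed
  thus ?thesis using that by blast
 qed
 have prim: "\<exists>u\<in>Y mu. a - u \<in> cW (p + q - 1)" if a: "a \<in> DI0 mu p q l" and pq: "p + q = w mu + int l" for a p q l
 proof (cases "a = 0")
  case True
  thus ?thesis using cx.subspace_0[OF Y_sub] zerocW by (intro bexI[of _ 0]) simp_all
 next
  case False
  obtain al where al: "eig al = mu" "\<lfloor>of_int m - al\<rfloor> = p" using eig_surj_floor[OF norm_eigenvalue[OF assms(2)]] .
  have lp: "ladder_p m al = p" using al(2) unfolding ladder_p_def .
  have lq: "ladder_q m al l = q" using ladder_pq[of al l] al(1) lp pq by simp
  have aI: "a \<in> I0 al l" unfolding I0_def lp lq al(1) by (rule a)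
  define be where "be = al rmod 2"
  have b: "be rmod 2 = be" "al rmod 2 = be rmod 2" unfolding be_def by simp_all
  have eb: "eig be = mu" using eig_cong[OF b(2)] al(1) by simp
  have "al \<in> cls be" unfolding cls_def using I0_specs[OF aI False] b(2) by simp
  hence "a \<in> E be l" unfolding E_def using aI by (intro cx.span_base) (rule UN_I)
  hence "a \<in> D be l" by (rule E_subset_D)
  then obtain c where c: "a - (\<Sum>i<gcount be l. sc (c i) (fv be l i)) \<in> Wl (eig be) l"
   using good_fv[OF b(1)] unfolding good_def by blast
  have "(\<Sum>i<gcount be l. sc (c i) (fv be l i)) \<in> Y mu"
   unfolding Y_def
  proof (intro cx.span_sum cx.span_scale cx.span_base)
   fix i assume "i \<in> {..<gcount be l}"
   hence "(be, l, i) \<in> idx" using b(1) unfolding idx_def by simp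
   moreover have "xlam (be, l, i) = mu" using eb unfolding xlam_def by simp
   moreover have "fv be l i = NN 0 (fx (be, l, i))" unfolding fx_def by simp
   ultimately show "fv be l i \<in> {(NN j) (fx x) |x j. x \<in> idx & xlam x = mu}" by blast
  qed
  moreover have "a - (\<Sum>i<gcount be l. sc (c i) (fv be l i)) \<in> cW (p + q - 1)"
   using c unfolding Wl_def eb pq by blast
  ultimately show ?thesis by blast
 qed
 obtain k0 k1 where k01: "!!k x. k \<le> k0 ==> x \<in> cW k ==> x = 0" "!!k x. k1 \<le> k ==> x \<in> cW k"
  using W_bounds by metis
 have upper: "\<exists>u\<in>Y mu. a - u \<in> cW (p + q - 1)"
  if "nat (k1 - (w mu + int l)) \<le> n" and a: "a \<in> DI mu p q" and pq: "p + q = w mu + int l" for a p q l n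
  using that
 proof (induction n arbitrary: a p q l)
  case 0
  have "a \<in> cW (w mu + int l)" using DI_D(2)[OF "0"(2)] "0"(3) by simp
  obtain y where y: "y \<in> DI mu (p + 1) (q + 1)" "a - cmap N y \<in> DI0 mu p q l"
   using DI_primitive[OF "0"(2,3)] .
  have "y \<in> cW (p + 1 + (q + 1) - 1)" using k01(2) "0" by simp
  hence "y = 0" by (rule DI_inj[OF y(1)])
  hence "a \<in> DI0 mu p q l" using y(2) zeroN by simp
  thus ?case by (rule prim[OF _ "0"(3)])
 next
  case (Suc n)
  obtain y where y: "y \<in> DI mu (p + 1) (q + 1)" "a - cmap N y \<in> DI0 mu p q l"
   using DI_primitive[OF Suc.prems(2,3)] .
  have "\<exists>u\<in>Y mu. y - u \<in> cW (p + 1 + (q + 1) - 1)"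
   by (rule Suc.IH[of "l + 2", OF _ y(1)]) (use Suc.prems in simp_all)
  then obtain u where u: "u \<in> Y mu" "y - u \<in> cW (p + 1 + (q + 1) - 1)" by blast
  obtain v where v: "v \<in> Y mu" "a - cmap N y - v \<in> cW (p + q - 1)" using prim[OF y(2) Suc.prems(3)] by blast
  have "cmap N (y - u) \<in> cW (p + q - 1)" using N_W[OF u(2)] by simp
  hence "(a - cmap N y - v) + cmap N (y - u) \<in> cW (p + q - 1)" using v(2) addcW by blast
  moreover have "(a - cmap N y - v) + cmap N (y - u) = a - (v + cmap N u)"
   unfolding diffN by (simp only: algebra_simps)
  moreover have "v + cmap N u \<in> Y mu" using N_Y[OF u(1), of 1] v(1) cx.subspace_add[OF Y_sub] by simp
  ultimately show ?case by (intro bexI[of _ "v + cmap N u"]) simp_all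
 qed
 have all: "\<exists>u\<in>Y mu. a - u \<in> cW (p + q - 1)" if a: "a \<in> DI mu p q" for a p q
 proof (cases "p + q \<ge> w mu")
  case True
  show ?thesis by (rule upper[OF order_refl a, of "nat (p + q - w mu)"]) (use True in simp)
 next
  case False
  define l where "l = nat (w mu - (p + q))"
  have l: "(p + int l) + (q + int l) = w mu + int l" "p + q = w mu - int l" using False unfolding l_def by simp_all
  have "a \<in> DI mu (p + int l - int l) (q + int l - int l)" using a by simp
  then obtain y where y: "y \<in> DI mu (p + int l) (q + int l)" "a = NN l y" using N_surj_DI[OF _ l(1)] by blast
  obtain u where u: "u \<in> Y mu" "y - u \<in> cW (p + int l + (q + int l) - 1)" using upper[OF order_refl y(1) l(1)] by blast
  have "NN l (y - u) \<in> cW (p + int l + (q + int l) - 1 - 2 * int l)" by (rule Npow_W[OF u(2)])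
  hence "a - NN l u \<in> cW (p + q - 1)"
   unfolding diffNN y(2)[symmetric] by (simp add: algebra_simps)
  thus ?thesis using N_Y[OF u(1)] by blast
 qed
 have "z \<in> Y mu" if "z \<in> cW (k0 + int n)" "z \<in> H mu" for z n
  using that
 proof (induction n arbitrary: z)
  case 0
  hence "z = 0" using k01(1)[of k0 z] by simp
  thus ?case using cx.subspace_0[OF Y_sub] by simp
 next
  case (Suc n)
  show ?case
  proof (rule W_generated_by_DI[OF Suc.prems Y_sub])
   show y: "y \<in> Y mu" if "y \<in> cW (k0 + int (Suc n) - 1)" "y \<in> H mu" for y
    by (rule Suc.IH) (use that in simp_all)
   fix p y assume yD: "y \<in> DI mu p (k0 + int (Suc n) - p)"
   obtain u where u: "u \<in> Y mu" "y - u \<in> cW (p + (k0 + int (Suc n) - p) - 1)" using all[OF yD] by blast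
   have "y - u \<in> H mu" using DI_D(1)[OF yD] Y_H[OF u(1)] by (rule diffH)
   hence "y - u \<in> Y mu" using u(2) by (intro Suc.IH) simp_all
   hence "(y - u) + u \<in> Y mu" using u(1) by (rule cx.subspace_add[OF Y_sub])
   thus "y \<in> Y mu" by simp
  qed
 qed
 moreover have "x \<in> cW (k0 + int (nat (k1 - k0)))" by (rule k01(2)) simp
 ultimately show ?thesis using assms(3) by blast
qed

lemma chain_family_fx: "chain_family idx xlam xlen xeta xsig fx"
 unfolding chain_family_def
proof (intro conjI ballI finite_idx)
 fix x assume xi: "x \<in> idx"
 obtain be l i where x: "x = (be, l, i)" by (rule prod_cases3)
 have b: "be rmod 2 = be" "i < gcount be l" using xi unfolding x idx_def by simp_all
 note g = good_parts[OF good_fv[OF b(1)] b(2)]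
 show "fx x \<in> H (xlam x)" "NN (xlen x + 1) (fx x) = 0" using g unfolding x fx_def xlam_def xlen_def by simp_all
 show "xeta x ~= 0" unfolding xeta_def by simp
 show "xsig x \<in> idx" unfolding x xsig_def idx_def using star_range(3) gcount_star[OF b(1)] b(2) by simp
 show "xsig (xsig x) = x" unfolding x xsig_def using star_star[of m l be] b(1) by simp
 show "xlen (xsig x) = xlen x" unfolding x xsig_def xlen_def by simp
 show "xlam (xsig x) = cnj (xlam x)" unfolding x xsig_def xlam_def by (simp add: eig_star)
 show "xeta (xsig x) = cnj (xeta x)" unfolding x xsig_def xeta_def by (simp add: etaf_star)
 show "cconj (fx x) = fx (xsig x)" unfolding x fx_def xsig_def using cconj_fv[OF b] by simp
next
 have "x \<in> cx.span {(NN j) (fx x) |x j. x \<in> idx}" for x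
 proof -
  have "(\<Union>mu\<in>eigenvalues. H mu) \<subseteq> cx.span {(NN j) (fx x) |x j. x \<in> idx}"
  proof
   fix z assume "z \<in> (\<Union>mu\<in>eigenvalues. H mu)"
   then obtain mu where "mu \<in> eigenvalues" "z \<in> H mu" by (rule UN_E)
   hence "z \<in> cx.span {(NN j) (fx x) |x j. x \<in> idx & xlam x = mu}" by (rule span_fx)
   moreover have "{(NN j) (fx x) |x j. x \<in> idx & xlam x = mu} \<subseteq> {(NN j) (fx x) |x j. x \<in> idx}" by blast
   ultimately show "z \<in> cx.span {(NN j) (fx x) |x j. x \<in> idx}" using cx.span_mono by blast
  qed
  hence "cx.span (\<Union>mu\<in>eigenvalues. H mu) \<subseteq> cx.span {(NN j) (fx x) |x j. x \<in> idx}"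
   by (rule cx.span_minimal[OF _ cx.subspace_span])
  thus ?thesis using span_H by (rule subsetD)
 qed
 thus "cx.span {(NN j) (fx x) |x j. x \<in> idx} = UNIV" by (intro UNIV_eq_I[symmetric])
qed

theorem normal_form:
 obtains e where "chain_family idx xlam xlen xeta xsig e" "orthogonal_chains idx xlen xeta e"
 using orthogonalize_chains[OF chain_family_fx weakly_orthogonal_fx] .

end

section \<open>The normalized Seifert form and its monodromy\<close>

definition fneg :: "real fps => real fps" where
 "fneg f = Abs_fps (%k. (-1) ^ k * fps_nth f k)"

definition fps_exp_quot :: "real fps" where
 "fps_exp_quot = Abs_fps (%k. 1 / fact (Suc k))"

lemma fneg_fneg: "fneg (fneg f) = f"
 by (rule fps_ext) (simp add: fneg_def mult.assoc[symmetric] flip: power_mult_distrib)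

lemma fps_exp_quot_reflect: "fneg fps_exp_quot * fps_exp 1 = fps_exp_quot"
proof -
 have g: "fps_X * fps_exp_quot = fps_exp 1 - 1"
 proof (rule fps_ext)
  show "fps_nth (fps_X * fps_exp_quot) n = fps_nth (fps_exp 1 - 1) n" for n
   by (cases n) (simp_all add: fps_exp_quot_def field_simps)
 qed
 have gn: "fps_X * fneg fps_exp_quot = 1 - fps_exp (-1)"
 proof (rule fps_ext)
  show "fps_nth (fps_X * fneg fps_exp_quot) n = fps_nth (1 - fps_exp (-1)) n" for n
   by (cases n) (simp_all add: fps_exp_quot_def fneg_def field_simps)
 qed
 have "fps_X * (fneg fps_exp_quot * fps_exp 1) = (1 - fps_exp (-1)) * fps_exp (1::real)"
  using gn by (simp only: mult.assoc[symmetric])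
 also have "... = fps_exp 1 - 1"
  using fps_exp_add_mult[of "-1" "1::real"] by (simp add: algebra_simps)
 also have "... = fps_X * fps_exp_quot" by (rule g[symmetric])
 finally show ?thesis by simp
qed

context steenbrink
begin

lemma N_pow_dim: "(N ^^ (dim (UNIV :: 'v set))) x = 0"
 by (rule nilpotent_funpow_dim[OF _ fin_dim linear_N _ _ N_nilpotent]) simp_all

definition P1 :: "'v => 'v" where "P1 v = fst (pr 1 (v, 0))"

lemma P1: "linear P1" "pr 1 = cmap P1"
proof -
 have c: "pr 1 (cconj x) = cconj (pr 1 x)" for x using pr_cconj[of 1 x] by simp
 obtain g where g: "linear g" "pr 1 = cmap g" using real_operator_if_commutes_with_conj[OF clinear_pr c] by metis
 have "P1 = g" unfolding P1_def g(2) by (rule ext) simp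
 thus "linear P1" "pr 1 = cmap P1" using g by simp_all
qed

lemma Hne1_P1: "a \<in> Hne1 M \<longleftrightarrow> P1 a = 0"
 using Hne1_iff[of "(a, a)"] unfolding P1(2) by (simp add: prod_eq_iff)

lemma H1_P1: "a \<in> H1 M \<longleftrightarrow> P1 a = a"
proof -
 have "(a, a) \<in> H 1 \<longleftrightarrow> pr 1 (a, a) = (a, a)" using pr_in_H[of 1 "(a, a)"] pr_idem[of "(a, a)" 1] by metis
 thus ?thesis using H1_iff[of "(a, a)"] unfolding P1(2) by simp
qed

lemma P1_P1: "P1 (P1 a) = P1 a"
proof -
 have "pr 1 (pr 1 (a, a)) = pr 1 (a, a)" by (rule pr_idem[OF pr_in_H])
 thus ?thesis unfolding P1(2) by simp
qed

definition nuI :: "'v => 'v" where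
 "nuI v = (M (v - P1 v) - (v - P1 v)) - (\<Sum>k<(dim (UNIV :: 'v set)). (1 / fact (Suc k)) *\<^sub>R (N ^^ k) (P1 v))"

lemma nu_inv_eq: "nu_inv M v = nuI v"
 unfolding nu_inv_def
proof (rule the_equality)
 have reindex: "(\<Sum>k = 1..(dim (UNIV :: 'v set)). (1 / fact k) *\<^sub>R (N ^^ (k - 1)) b) = (\<Sum>k<(dim (UNIV :: 'v set)). (1 / fact (Suc k)) *\<^sub>R (N ^^ k) b)" for b
  by (rule sum.reindex_bij_witness[of _ Suc "%k. k - 1"]) auto
 have d: "P1 (v - P1 v) = 0" using P1_P1 by (simp add: linear_diff[OF P1(1)])
 show "\<exists>a\<in>Hne1 M. \<exists>b\<in>H1 M. v = a + b &
  nuI v = M a - a - (\<Sum>k = 1..(dim (UNIV :: 'v set)). (1 / fact k) *\<^sub>R (N ^^ (k - 1)) b)"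
  unfolding reindex nuI_def
  by (rule bexI[of _ "v - P1 v"], rule bexI[of _ "P1 v"]) (use d P1_P1 in \<open>simp_all add: Hne1_P1 H1_P1\<close>)
 fix u assume "\<exists>a\<in>Hne1 M. \<exists>b\<in>H1 M. v = a + b &
  u = M a - a - (\<Sum>k = 1..(dim (UNIV :: 'v set)). (1 / fact k) *\<^sub>R (N ^^ (k - 1)) b)"
 then obtain a b where "a \<in> Hne1 M" "b \<in> H1 M" and ab': "v = a + b"
  "u = M a - a - (\<Sum>k = 1..(dim (UNIV :: 'v set)). (1 / fact k) *\<^sub>R (N ^^ (k - 1)) b)"
  by blast
 hence ab: "P1 a = 0" "P1 b = b" "v = a + b"
  "u = M a - a - (\<Sum>k<(dim (UNIV :: 'v set)). (1 / fact (Suc k)) *\<^sub>R (N ^^ k) b)"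
  unfolding reindex Hne1_P1 H1_P1 by simp_all
 have "P1 v = b" using ab by (simp add: linear_add[OF P1(1)])
 moreover have "v - P1 v = a" using calculation ab by simp
 ultimately show "u = nuI v" unfolding nuI_def ab(4) by simp
qed

lemma linear_nuI: "linear nuI"
 unfolding nuI_def
 by (intro linear_compose_sub linear_compose_sum ballI linear_compose_scale_right
   linear_compose[OF _ linear_M, unfolded o_def] linear_compose[OF P1(1) linear_funpow[OF linear_N], unfolded o_def]
   linear_ident P1(1))

lemmas clinear_nuI = clinear_cmap[OF linear_nuI]

definition kco :: "complex => nat => complex" where
 "kco mu k = (if mu = 1 then 1 / fact (Suc k) else (if k = 0 then 1 else 0) - mu / fact k)"

lemma kco_0: "kco mu 0 = (if mu = 1 then 1 else 1 - mu)"
 by (simp add: kco_def)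

lemma cmap_sum_N: "cmap (%v. \<Sum>k<n. c k *\<^sub>R (N ^^ k) v) x = (\<Sum>k<n. c k *\<^sub>R (NN k) x)"
 by (cases x) (simp add: cmap_funpow prod_eq_iff fst_sum snd_sum)

lemma cMu_exp: "cmap Mu x = (\<Sum>k<Suc (dim (UNIV :: 'v set)). (1 / fact k) *\<^sub>R (NN k) x)"
proof -
 have "Mu = (%v. \<Sum>k<Suc (dim (UNIV :: 'v set)). (1 / fact k) *\<^sub>R (N ^^ k) v)" by (rule ext) (rule Mu_eq_exp)
 thus ?thesis unfolding cmap_sum_N[symmetric] by (rule arg_cong)
qed

lemma nuI_H_1: "x \<in> H 1 ==> cmap nuI x = - cmap (feval (Suc (dim (UNIV :: 'v set))) fps_exp_quot N) x"
proof -
 assume x: "x \<in> H 1"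
 have "cmap P1 x = x" using pr_idem[OF x] unfolding P1(2) .
 hence p: "P1 (fst x) = fst x" "P1 (snd x) = snd x" by (simp_all add: prod_eq_iff)
 have "nuI v = - feval (Suc (dim (UNIV :: 'v set))) fps_exp_quot N v" if "P1 v = v" for v
  unfolding nuI_def that feval_def by (simp add: linear_0[OF linear_M] N_pow_dim fps_exp_quot_def)
 thus ?thesis using p by (simp add: prod_eq_iff)
qed

lemma nuI_H_ne1: "x \<in> H mu ==> mu ~= 1 ==> cmap nuI x = cmap M x - x"
proof -
 assume x: "x \<in> H mu" "mu ~= 1"
 have "cmap P1 x = 0" using pr_H[OF x(1), of 1] x(2) unfolding P1(2) by simp
 hence p: "P1 (fst x) = 0" "P1 (snd x) = 0" by (simp_all add: prod_eq_iff)
 have "nuI v = M v - v" if "P1 v = 0" for v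
  unfolding nuI_def that by (simp add: linear_0[OF linear_funpow[OF linear_N]])
 thus ?thesis using p by (simp add: prod_eq_iff)
qed

lemma nuI_H:
 assumes "x \<in> H mu"
 shows "cmap nuI x = - (\<Sum>k<Suc (dim (UNIV :: 'v set)). sc (kco mu k) (NN k x))"
proof (cases "mu = 1")
 case True
 have "cmap (feval (Suc (dim (UNIV :: 'v set))) fps_exp_quot N) x = (\<Sum>k<Suc (dim (UNIV :: 'v set)). fps_nth fps_exp_quot k *\<^sub>R (NN k) x)"
  unfolding cmap_sum_N[symmetric] feval_def ..
 also have "... = (\<Sum>k<Suc (dim (UNIV :: 'v set)). sc (kco mu k) (NN k x))"
 proof (rule sum.cong[OF refl])
  fix k
  have "kco mu k = of_real (fps_nth fps_exp_quot k)" unfolding kco_def True fps_exp_quot_def by simp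
  thus "fps_nth fps_exp_quot k *\<^sub>R (NN k) x = sc (kco mu k) (NN k x)"
   by (simp only: scaleCx_of_real)
 qed
 finally show ?thesis using nuI_H_1 assms True by simp
next
 case False
 have "cmap M x = sc mu (\<Sum>k<Suc (dim (UNIV :: 'v set)). (1 / fact k) *\<^sub>R (NN k) x)"
  unfolding M_on_H[OF assms] cMu_exp ..
 also have "... = (\<Sum>k<Suc (dim (UNIV :: 'v set)). sc (mu / fact k) (NN k x))"
  unfolding cx.scale_sum_right
 proof (rule sum.cong[OF refl])
  fix k
  have "sc mu ((1 / fact k) *\<^sub>R (NN k) x) = sc mu (sc (of_real (1 / fact k)) (NN k x))"
   by (simp only: scaleCx_of_real)
  thus "sc mu ((1 / fact k) *\<^sub>R (NN k) x) = sc (mu / fact k) (NN k x)"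
   by simp
 qed
 finally have M: "cmap M x = (\<Sum>k<Suc (dim (UNIV :: 'v set)). sc (mu / fact k) (NN k x))" .
 have x: "x = (\<Sum>k<Suc (dim (UNIV :: 'v set)). sc (if k = 0 then 1 else 0) (NN k x))"
  by (subst sum.remove[of _ 0]) (simp_all add: sum.neutral)
 have "- cmap nuI x = x - cmap M x" using nuI_H_ne1[OF assms False] by simp
 also have "... = (\<Sum>k<Suc (dim (UNIV :: 'v set)). sc (if k = 0 then 1 else 0) (NN k x)) - (\<Sum>k<Suc (dim (UNIV :: 'v set)). sc (mu / fact k) (NN k x))"
  using x M by simp
 also have "... = (\<Sum>k<Suc (dim (UNIV :: 'v set)). sc (kco mu k) (NN k x))"
  unfolding sum_subtractf[symmetric] kco_def if_not_P[OF False] cx.scale_left_diff_distrib ..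
 finally show ?thesis by (metis minus_minus)
qed

lemma nuI_in_H: "x \<in> H mu ==> cmap nuI x \<in> H mu"
 unfolding nuI_H
 by (intro negH sumH scaleH Npow_H)

abbreviation L where "L == Lnor M S"

lemma L_eq: "L a b = - S a (nuI b)"
 unfolding Lnor_def nu_inv_eq ..

lemma bilinear_L: "bilinear L"
 unfolding bilinear_def L_eq
 by (auto intro!: linearI simp: bilinear_simps[OF bilinear_S] linear_add[OF linear_nuI] linear_scale[OF linear_nuI])

lemma cL_eq: "cbil L x y = - cbil S x (cmap nuI y)"
 unfolding cbil_def L_eq by (simp add: complex_eq_iff)

lemmas cL_simps = cbil_add_left[OF bilinear_L] cbil_add_right[OF bilinear_L] cbil_diff_left[OF bilinear_L]
 cbil_diff_right[OF bilinear_L] cbil_minus_left[OF bilinear_L] cbil_minus_right[OF bilinear_L]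
 cbil_scale_left[OF bilinear_L] cbil_scale_right[OF bilinear_L] cbil_0_left[OF bilinear_L]
 cbil_0_right[OF bilinear_L] cbil_sum_left[OF bilinear_L] cbil_sum_right[OF bilinear_L]

lemma cL_H:
 assumes "y \<in> H mu"
 shows "cbil L x y = (\<Sum>k<Suc (dim (UNIV :: 'v set)). kco mu k * cbil S x (NN k y))"
 unfolding cL_eq nuI_H[OF assms] by (simp only: cS_simps minus_minus)

lemma S_N: "S (N a) b = - S a (N b)"
proof -
 have z: "N 0 = 0" by (rule linear_0[OF linear_N])
 have "of_real (S (N a) b) = (of_real (- S a (N b)) :: complex)"
  using cS_N[of "(a, 0)" "(b, 0)"] z by (simp add: cbil_real[OF bilinear_S])
 thus ?thesis by (simp only: of_real_eq_iff)
qed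

lemma S_Npow: "S ((N ^^ k) a) b = (-1) ^ k * S a ((N ^^ k) b)"
 by (induction k arbitrary: b) (simp_all add: S_N funpow_swap1[symmetric])

lemma S_feval: "S (feval n f N a) b = S a (feval n (fneg f) N b)"
proof -
 have sl: "S (\<Sum>k<n. c k *\<^sub>R g k) b = (\<Sum>k<n. c k * S (g k) b)" for c g b
  by (induction n) (simp_all add: bilinear_simps[OF bilinear_S])
 have sr: "S a (\<Sum>k<n. c k *\<^sub>R g k) = (\<Sum>k<n. c k * S a (g k))" for c g
  by (induction n) (simp_all add: bilinear_simps[OF bilinear_S])
 show ?thesis unfolding feval_def sl sr fneg_def S_Npow by (simp add: mult_ac)
qed

lemma S_exp_quot: "S (Mu a) (feval (Suc (dim (UNIV :: 'v set))) fps_exp_quot N b) = S (feval (Suc (dim (UNIV :: 'v set))) fps_exp_quot N a) b"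
proof -
 let ?f = "feval (Suc (dim (UNIV :: 'v set)))"
 have "S (Mu a) (?f fps_exp_quot N b) = S (Mu a) (?f (fneg (fneg fps_exp_quot)) N b)" unfolding fneg_fneg ..
 also have "... = S (?f (fneg fps_exp_quot) N (Mu a)) b" by (rule S_feval[symmetric])
 also have "?f (fneg fps_exp_quot) N (Mu a) = ?f (fneg fps_exp_quot) N (?f (fps_exp 1) N a)"
  unfolding Mu_eq_exp feval_def by simp
 also have "?f (fneg fps_exp_quot) N (?f (fps_exp 1) N a) = ?f (fneg fps_exp_quot * fps_exp 1) N a"
  by (rule feval_mult[OF linear_N N_nilpotent, symmetric])
 finally show ?thesis unfolding fps_exp_quot_reflect .
qed

definition T0 :: "'v => 'v" where "T0 v = ((-1) powi (m + 1)) *\<^sub>R M v"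

lemma linear_T0: "linear T0"
 unfolding T0_def by (intro linear_compose_scale_right linear_M)

lemma cmap_T0: "cmap T0 x = sc ((-1) powi (m + 1)) (cmap M x)"
proof -
 have "((-1) powi (m + 1) :: complex) = of_real ((-1) powi (m + 1))" by simp
 hence "sc ((-1) powi (m + 1)) (cmap M x) = ((-1) powi (m + 1) :: real) *\<^sub>R cmap M x"
  by (simp only: scaleCx_of_real)
 thus ?thesis by (simp add: prod_eq_iff T0_def)
qed

lemma sign_sq: "((-1) powi k :: 'a::field) * (-1) powi k = 1"
 by (simp flip: power_int_mult_distrib)

lemma sign_sq': "(-1) powi k * ((-1) powi k * x) = (x :: 'a::field)"
 by (simp only: mult.assoc[symmetric] sign_sq mult_1_left)

lemma cL_monodromy_H:
 assumes x: "x \<in> H mu" and y: "y \<in> H nu"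
 shows "cbil L (cmap T0 x) y = cbil L y x"
proof (cases "mu * nu = 1")
 case False
 have Mx: "cmap M x \<in> H mu" unfolding M_on_H[OF x] by (intro scaleH Mu_H x)
 have "cbil S (cmap M x) (cmap nuI y) = 0" by (rule cS_orthogonal[OF Mx nuI_in_H[OF y] False])
 moreover have "cbil S y (cmap nuI x) = 0" by (rule cS_orthogonal[OF y nuI_in_H[OF x]]) (use False in \<open>simp add: mult.commute\<close>)
 ultimately show ?thesis unfolding cL_eq cmap_T0 cS_simps by simp
next
 case True
 show ?thesis
 proof (cases "mu = 1")
  case 1: True
  hence nu: "nu = 1" using True by simp
  let ?g = "feval (Suc (dim (UNIV :: 'v set))) fps_exp_quot N"
  have Mx: "cmap M x = cmap Mu x" using M_on_H[OF x] 1 by simp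
  have gx: "cmap ?g x \<in> H 1"
   using negH[OF nuI_in_H[OF x]] nuI_H_1[of x] x 1 by simp
  have "cbil S (cmap Mu x) (cmap ?g y) = cbil S (cmap ?g x) y"
   unfolding cbil_def by (simp add: S_exp_quot)
  also have "... = (-1) powi (m + 1) * cbil S y (cmap ?g x)"
   using cS_swap[of y 1 "cmap ?g x" 1] gx y nu by (simp add: w_def theta_def)
  finally show ?thesis
   unfolding cL_eq cmap_T0 cS_simps Mx
   using nuI_H_1[of x] nuI_H_1[of y] x y 1 nu by (simp add: cS_simps sign_sq')
 next
  case ne: False
  hence nn: "nu ~= 1" using True by auto
  have wm: "w mu = m" "w nu = m" using ne nn by (simp_all add: w_def theta_def)
  have Mx: "cmap M x \<in> H mu" unfolding M_on_H[OF x] by (intro scaleH Mu_H x)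
  have s1: "cbil S (cmap M x) y = (-1) powi m * cbil S y (cmap M x)"
   using cS_swap[OF y Mx] wm by simp
  have s2: "cbil S x y = (-1) powi m * cbil S y x"
   using cS_swap[OF y x] wm by simp
  have p: "(-1) powi (m + 1) = - ((-1) powi m :: complex)" by (simp add: power_int_add)
  show ?thesis
   unfolding cL_eq cmap_T0 nuI_H_ne1[OF x ne] nuI_H_ne1[OF y nn] cS_simps cS_M s1 s2 p
   by (simp add: algebra_simps sign_sq')
 qed
qed

lemma cL_monodromy: "cbil L (cmap T0 x) y = cbil L y x"
proof -
 have x: "x = (\<Sum>mu\<in>eigenvalues. pr mu x)" and y: "y = (\<Sum>mu\<in>eigenvalues. pr mu y)" by (simp_all add: sum_pr)
 have "cbil L (cmap T0 (\<Sum>mu\<in>eigenvalues. pr mu x)) (\<Sum>nu\<in>eigenvalues. pr nu y)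
   = (\<Sum>mu\<in>eigenvalues. \<Sum>nu\<in>eigenvalues. cbil L (cmap T0 (pr mu x)) (pr nu y))"
  unfolding cxp.linear_sum[OF clinear_cmap[OF linear_T0]] cL_simps by (rule sum.swap)
 also have "... = (\<Sum>mu\<in>eigenvalues. \<Sum>nu\<in>eigenvalues. cbil L (pr nu y) (pr mu x))"
  by (intro sum.cong refl cL_monodromy_H[OF pr_in_H pr_in_H])
 also have "... = cbil L (\<Sum>nu\<in>eigenvalues. pr nu y) (\<Sum>mu\<in>eigenvalues. pr mu x)"
  unfolding cL_simps ..
 finally show ?thesis by (simp only: sum_pr)
qed

lemma L_monodromy: "L (T0 a) b = L b a"
proof -
 have "T0 0 = 0" by (rule linear_0[OF linear_T0])
 hence "of_real (L (T0 a) b) = (of_real (L b a) :: complex)"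
  using cL_monodromy[of "(a, 0)" "(b, 0)"] by (simp add: cbil_real[OF bilinear_L])
 thus ?thesis by (simp only: of_real_eq_iff)
qed

lemma nuI_inj:
 assumes "nuI v = 0"
 shows "v = 0"
proof -
 have H0: "x = 0" if x: "x \<in> H mu" "cmap nuI x = 0" for x mu
 proof (rule ccontr)
  assume "x ~= 0"
  define j where "j = (LEAST j. (NN j) x = 0)"
  have j0: "NN j x = 0" unfolding j_def by (rule LeastI[of _ "Suc (dim (UNIV :: 'v set))"]) (rule cN_nilpotent, simp)
  have "j ~= 0" using j0 \<open>x ~= 0\<close> by (cases j) auto
  then obtain i where i: "j = Suc i" by (cases j) auto
  have ni: "NN i x ~= 0" using not_less_Least[of i "%j. (NN j) x = 0"] unfolding j_def[symmetric] i by simp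
  have "0 = NN i (\<Sum>k<Suc (dim (UNIV :: 'v set)). sc (kco mu k) (NN k x))"
   using nuI_H[OF x(1)] x(2) by (simp add: zeroNN del: sum.lessThan_Suc)
  also have "... = (\<Sum>k<Suc (dim (UNIV :: 'v set)). sc (kco mu k) (NN (i + k) x))"
   unfolding sumNN scaleNN funpow_add o_apply ..
  also have "... = (\<Sum>k<Suc (dim (UNIV :: 'v set)). if k = 0 then sc (kco mu 0) (NN i x) else 0)"
  proof (rule sum.cong[OF refl])
   fix k
   have "NN (i + k) x = 0" if "k ~= 0"
    by (rule funpow_nilpotent_mono[OF clinear_imp_linear[OF clinear_N] j0]) (use that i in simp)
   thus "sc (kco mu k) (NN (i + k) x) = (if k = 0 then sc (kco mu 0) (NN i x) else 0)"
    by auto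
  qed
  also have "... = sc (kco mu 0) (NN i x)" by simp
  finally show False using ni by (simp add: kco_0 split: if_splits)
 qed
 have z: "cmap nuI (v, 0) = 0" using assms linear_0[OF linear_nuI] by (simp add: zero_prod_def)
 have "pr mu (v, 0) = 0" for mu
 proof (rule H0[OF pr_in_H])
  have "cmap nuI (\<Sum>nu\<in>eigenvalues. pr nu (v, 0)) = (\<Sum>nu\<in>eigenvalues. cmap nuI (pr nu (v, 0)))"
   by (rule cxp.linear_sum[OF clinear_nuI])
  hence s: "(\<Sum>nu\<in>eigenvalues. cmap nuI (pr nu (v, 0))) = 0" using z by (simp only: sum_pr)
  show "cmap nuI (pr mu (v, 0)) = 0"
  proof (cases "mu \<in> eigenvalues")
   case True
   have "0 = pr mu (\<Sum>nu\<in>eigenvalues. cmap nuI (pr nu (v, 0)))" unfolding s by (simp add: zeropr)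
   also have "... = (\<Sum>nu\<in>eigenvalues. if nu = mu then cmap nuI (pr nu (v, 0)) else 0)"
    unfolding sumpr by (intro sum.cong refl pr_H nuI_in_H pr_in_H)
   also have "... = cmap nuI (pr mu (v, 0))" using True finite_eigenvalues by simp
   finally show ?thesis ..
  next
   case False
   hence "pr mu (v, 0) = 0" using pr_in_H[of mu "(v, 0)"] unfolding eigenvalues_def by blast
   thus ?thesis by (simp add: cxp.linear_0[OF clinear_nuI])
  qed
 qed
 hence "(\<Sum>nu\<in>eigenvalues. pr nu (v, 0)) = 0" by simp
 thus ?thesis unfolding sum_pr by (simp add: zero_prod_def)
qed

lemma nondegenerate_L: "nondegenerate_on UNIV L"
proof -
 have r: "b = 0" if "!!a. L a b = 0" for b
 proof -
  have "S a (nuI b) = 0" for a using that[of a] unfolding L_eq by simp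
  hence "nuI b = 0" using nondegenerate_S unfolding nondegenerate_on_def by simp
  thus ?thesis by (rule nuI_inj)
 qed
 have l: "a = 0" if a: "!!b. L a b = 0" for a
 proof -
  obtain a' where a': "M a' = ((-1) powi (m + 1)) *\<^sub>R a" using bij_M by (metis bij_pointE)
  have T: "T0 a' = a" unfolding T0_def a' by (simp only: scaleR_scaleR sign_sq scaleR_one)
  have "L b a' = 0" for b using L_monodromy[of a' b] a[of b] unfolding T by simp
  hence "a' = 0" by (rule r)
  thus ?thesis using T linear_0[OF linear_T0] by simp
 qed
 show ?thesis unfolding nondegenerate_on_def using l r by blast
qed

lemma bilinear_on_L: "bilinear_on V' L"
 unfolding bilinear_on_def linear_on_def by (simp add: bilinear_simps[OF bilinear_L])

theorem seifert_pair_L: "seifert_pair UNIV L"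
 unfolding seifert_pair_def using subspace_UNIV fin_dim bilinear_on_L nondegenerate_L by blast

end

section \<open>Splitting the Seifert form along the chains\<close>

lemma fin_dim_subspace:
 assumes "fin_dim (UNIV :: 'v::real_vector set)" "subspace (V :: 'v set)"
 obtains B where "finite B" "independent B" "V = span B" "card B = dim V"
proof -
 obtain B0 :: "'v set" where B0: "finite B0" "UNIV = span B0" using assms(1) unfolding fin_dim_def by blast
 obtain B where B: "B \<subseteq> V" "independent B" "V \<subseteq> span B" "card B = dim V"
  using real_vector.basis_exists by blast
 have "finite B" using real_vector.independent_span_bound[OF B0(1) B(2)] B0(2) by simp
 moreover have "V = span B" using B(1,3) real_vector.span_minimal[OF B(1) assms(2)] by blast
 ultimately show ?thesis using that B(2,4) by blast
qed

lemma fin_dim_subspaceI: "fin_dim (UNIV :: 'v::real_vector set) ==> subspace (V :: 'v set) ==> fin_dim V"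
 unfolding fin_dim_def[of V] using fin_dim_subspace by metis

lemma dim_cplx:
 assumes fd: "fin_dim (UNIV :: 'v::real_vector set)" and V: "subspace (V :: 'v set)"
 shows "cx.dim (cplx V) = dim V"
proof -
 obtain B where B: "finite B" "independent B" "V = span B" "card B = dim V"
  using fin_dim_subspace[OF fd V] .
 let ?C = "(%b. (b, 0) :: 'v \<times> 'v) ` B"
 have inj: "inj_on (%b. (b, 0) :: 'v \<times> 'v) B" by (rule inj_onI) simp
 have span: "cx.span ?C = cplx V"
 proof
  show "cx.span ?C \<subseteq> cplx V"
  proof (rule cx.span_minimal[OF _ subspace_cplx[OF V]])
   show "?C \<subseteq> cplx V"
   proof (rule image_subsetI)
    fix b assume "b \<in> B"
    hence "b \<in> V" unfolding B(3) by (rule real_vector.span_base)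
    thus "(b, 0) \<in> cplx V" using real_vector.subspace_0[OF V] by simp
   qed
  qed
  show "cplx V \<subseteq> cx.span ?C"
  proof
   fix x assume "x \<in> cplx V"
   then obtain a b where x: "x = (a, b)" "a \<in> V" "b \<in> V" by (cases x) auto
   have "(a, 0) \<in> cx.span ?C" "(b, 0) \<in> cx.span ?C" using x B(3) cx_span_of_real by blast+
   thus "x \<in> cx.span ?C" unfolding x(1) pair_eq_real_plus_imag[of a b] by (intro cx.span_add cx.span_scale)
  qed
 qed
 have ind: "cx.independent ?C"
 proof (rule ccontr)
  assume "\<not> cx.independent ?C"
  then obtain u v where u: "v \<in> ?C" "u v ~= 0" "(\<Sum>v\<in>?C. sc (u v) v) = 0"
   using cx.dependent_finite[of ?C] B(1) by blast
  have s: "(\<Sum>b\<in>B. sc (u (b, 0)) (b, 0)) = (0 :: 'v \<times> 'v)"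
   using u(3) sum.reindex[OF inj, of "%v. sc (u v) v"] by (simp add: o_def)
  have "fst (\<Sum>b\<in>B. sc (u (b, 0)) (b, 0)) = (\<Sum>b\<in>B. Re (u (b, 0)) *\<^sub>R b)"
   "snd (\<Sum>b\<in>B. sc (u (b, 0)) (b, 0)) = (\<Sum>b\<in>B. Im (u (b, 0)) *\<^sub>R b)"
   by (simp_all add: fst_sum snd_sum scaleCx_fst_snd)
  hence r: "(\<Sum>b\<in>B. Re (u (b, 0)) *\<^sub>R b) = 0" "(\<Sum>b\<in>B. Im (u (b, 0)) *\<^sub>R b) = 0" unfolding s by simp_all
  obtain b where b: "b \<in> B" "v = (b, 0)" using u(1) by (rule imageE)
  have "Re (u (b, 0)) = 0"
   by (rule real_vector.independentD[OF B(2,1) subset_refl, of "%b. Re (u (b, 0))", OF r(1) b(1)])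
  moreover have "Im (u (b, 0)) = 0"
   by (rule real_vector.independentD[OF B(2,1) subset_refl, of "%b. Im (u (b, 0))", OF r(2) b(1)])
  ultimately have "Re (u (b, 0)) = 0" "Im (u (b, 0)) = 0" by blast+
  thus False using u(2) b(2) by (simp add: complex_eq_iff)
 qed
 have "cx.dim (cplx V) = card ?C" by (rule cx.dim_eq_card[OF _ ind]) (simp add: span[symmetric] cx.span_span)
 thus ?thesis using card_image[OF inj] B(4) by simp
qed

lemma spanning_family_basis:
 fixes g :: "'i => 'v::real_vector \<times> 'v"
 assumes fd: "fin_dim (UNIV :: 'v set)" and J: "finite J" and sp: "cx.span (g ` J) = A" and dim: "cx.dim A = card J"
 shows "inj_on g J" "cx.independent (g ` J)"
proof -
 obtain B0 :: "('v \<times> 'v) set" where "finite_dimensional_vector_space scaleCx B0"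
  using finite_dimensional_cx[OF fd] .
 then interpret fd: finite_dimensional_vector_space scaleCx B0 .
 have le: "card (g ` J) \<le> card J" by (rule card_image_le[OF J])
 show ind: "cx.independent (g ` J)"
  by (rule fd.card_le_dim_spanning[of "g ` J" A]) (use sp J dim le cx.span_superset[of "g ` J"] in simp_all)
 have "cx.dim A = card (g ` J)" by (rule cx.dim_eq_card[OF _ ind]) (simp add: sp[symmetric] cx.span_span)
 thus "inj_on g J" using dim J by (simp add: inj_on_iff_eq_card)
qed

context steenbrink
begin

lemma cL_span_zero:
 assumes "!!a b. a \<in> A ==> b \<in> B ==> cbil L a b = 0" "x \<in> cx.span A" "y \<in> cx.span B"
 shows "cbil L x y = 0"
proof -
 have 1: "cbil L a y = 0" if "a \<in> A" for a
  using assms(3) by (induction rule: cx.span_induct_alt) (simp_all add: cL_simps assms(1)[OF that])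
 show ?thesis
  using assms(2) by (induction rule: cx.span_induct_alt) (simp_all add: cL_simps 1)
qed

lemma T0_Mu: "T0 v = Mu (((-1) powi (m + 1)) *\<^sub>R Ms v)" "T0 v = ((-1) powi (m + 1)) *\<^sub>R Ms (Mu v)"
 unfolding T0_def by (simp_all only: linear_scale[OF jordan(3)] M_decomposition(2)[symmetric] M_decomposition(1)[symmetric])

context
 fixes V' :: "'v set"
 assumes V': "subspace V'" and stab: "Ms ` V' \<subseteq> V'" "Mu ` V' \<subseteq> V'" and nd: "nondegenerate_on V' L"
begin

lemma T0_stable: "v \<in> V' ==> T0 v \<in> V'"
 unfolding T0_Mu(2) using stab by (intro real_vector.subspace_scale[OF V']) blast

lemma monodromy_restrict: "monodromy V' L = restrict T0 V'"
 unfolding monodromy_def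
proof (rule restrict_ext)
 fix a assume a: "a \<in> V'"
 show "(THE c. c \<in> V' & (\<forall>b\<in>V'. L c b = L b a)) = T0 a"
 proof (rule the_equality)
  show "T0 a \<in> V' & (\<forall>b\<in>V'. L (T0 a) b = L b a)" using T0_stable[OF a] L_monodromy by blast
  fix c assume c: "c \<in> V' & (\<forall>b\<in>V'. L c b = L b a)"
  have "c - T0 a \<in> V'" using c T0_stable[OF a] by (blast intro: real_vector.subspace_diff[OF V'])
  moreover have "\<forall>b\<in>V'. L (c - T0 a) b = 0" using c L_monodromy by (simp add: bilinear_simps[OF bilinear_L])
  ultimately have "c - T0 a = 0" using nd unfolding nondegenerate_on_def by blast
  thus "c = T0 a" by simp
 qed
qed

lemma T0_inj: "T0 x = 0 ==> x = 0"
 unfolding T0_def using M_eq_0 by simp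

lemma jordan_restrict: "jordan_decomposition V' (restrict T0 V') (%v. ((-1) powi (m + 1)) *\<^sub>R Ms v) Mu"
 unfolding jordan_decomposition_def
proof (intro conjI ballI)
 let ?c = "(-1) powi (m + 1) :: real" and ?cc = "(-1) powi (m + 1) :: complex"
 have lin: "linear (%v. ?c *\<^sub>R Ms v)" by (intro linear_compose_scale_right jordan(2))
 show "linear_on V' (%v. ?c *\<^sub>R Ms v)" unfolding linear_on_def by (simp add: linear_add[OF lin] linear_scale[OF lin])
 show "linear_on V' Mu" unfolding linear_on_def by (simp add: linear_add[OF jordan(3)] linear_scale[OF jordan(3)])
 show "(%v. ?c *\<^sub>R Ms v) ` V' \<subseteq> V'" using stab(1) real_vector.subspace_scale[OF V'] by blast
 show "Mu ` V' \<subseteq> V'" by (rule stab(2))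
 fix x assume x: "x \<in> V'"
 thus "restrict T0 V' x = ?c *\<^sub>R Ms (Mu x)" "restrict T0 V' x = Mu (?c *\<^sub>R Ms x)" using T0_Mu by simp_all
next
 let ?G = "{x \<in> cplx V'. \<exists>mu. cmap (%v. ((-1) powi (m + 1)) *\<^sub>R Ms v) x = sc mu x}"
 have csub: "cx.subspace (cplx V')" by (rule subspace_cplx[OF V'])
 have cst: "cmap Ms ` cplx V' \<subseteq> cplx V'" using stab(1) by auto
 have "x \<in> cx.span ?G" if x: "x \<in> cplx V'" for x
 proof (rule H_cases[OF csub cst x _ cx.subspace_span])
  fix mu z assume z: "z \<in> cplx V'" "z \<in> H mu"
  have "cmap (%v. ((-1) powi (m + 1)) *\<^sub>R Ms v) z = ((-1) powi (m + 1)) *\<^sub>R cmap Ms z" by (cases z) simp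
  also have "... = sc (of_real ((-1) powi (m + 1)) * mu) z"
   using z(2) unfolding in_H by (metis cx.scale_scale scaleCx_of_real)
  finally show "z \<in> cx.span ?G" using z(1) by (intro cx.span_base) blast
 qed
 moreover have "cx.span ?G \<subseteq> cplx V'" by (rule cx.span_minimal[OF _ csub]) blast
 ultimately show "cx.span ?G = cplx V'" by blast
 show "\<exists>n. \<forall>x\<in>V'. ((%y. Mu y - y) ^^ n) x = 0" using Mu_unipotent by blast
qed

lemma T_parts:
 "ss_part V' (restrict T0 V') = restrict (%v. ((-1) powi (m + 1)) *\<^sub>R Ms v) V'"
 "uni_part V' (restrict T0 V') = restrict Mu V'"
 by (rule ss_uni_part_eq[OF V' _ jordan_restrict]; simp add: T0_inj)+

lemma eigsp_restrict:
 "eigsp V' (monodromy V' L) rho = {x \<in> cplx V'. x \<in> H ((-1) powi (m + 1) * rho)}"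
proof -
 let ?c = "(-1) powi (m + 1) :: real" and ?cc = "(-1) powi (m + 1) :: complex"
 have "cmap (ss_part V' (monodromy V' L)) x = sc rho x \<longleftrightarrow> x \<in> H (?cc * rho)" if x: "x \<in> cplx V'" for x
 proof -
  have c: "sc ?cc y = ?c *\<^sub>R y" for y :: "'v \<times> 'v"
   using scaleCx_of_real[of ?c y] by simp
  have "cmap (ss_part V' (monodromy V' L)) x = ?c *\<^sub>R cmap Ms x"
   unfolding monodromy_restrict T_parts using x by (cases x) simp
  also have "... = sc ?cc (cmap Ms x)" unfolding c ..
  finally have 1: "cmap (ss_part V' (monodromy V' L)) x = sc ?cc (cmap Ms x)" .
  show ?thesis unfolding 1 in_H
  proof
   assume "sc ?cc (cmap Ms x) = sc rho x"
   hence "sc ?cc (sc ?cc (cmap Ms x)) = sc ?cc (sc rho x)" by simp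
   thus "cmap Ms x = sc (?cc * rho) x" by (simp add: sign_sq)
  next
   assume "cmap Ms x = sc (?cc * rho) x"
   thus "sc ?cc (cmap Ms x) = sc rho x" by (simp add: sign_sq')
  qed
 qed
 thus ?thesis unfolding eigsp_def[of V'] by blast
qed

lemma nilp_restrict:
 assumes "x \<in> V'"
 shows "nilp_part V' (monodromy V' L) x = N x"
proof -
 let ?A = "%y. Mu y - y" and ?B = "%y. restrict Mu V' y - y"
 have st: "?A y \<in> V'" if "y \<in> V'" for y using that stab(2) real_vector.subspace_diff[OF V'] by blast
 have pow: "(?B ^^ k) x = (?A ^^ k) x" for k
  by (rule funpow_cong_on(1)[of V', symmetric]) (use st assms in auto)
 have z: "(?A ^^ k) x = 0" if "k \<ge> dim V'" for k
 proof (rule funpow_nilpotent_mono[OF linear_Mu_minus_id _ that])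
  show "(?A ^^ dim V') x = 0"
   by (rule nilpotent_funpow_dim[OF V' fin_dim_subspaceI[OF fin_dim V'] linear_Mu_minus_id st assms Mu_unipotent])
 qed
 have le: "dim V' \<le> dim (UNIV :: 'v set)"
 proof -
  obtain B where B: "finite B" "independent B" "V' = span B" "card B = dim V'" using fin_dim_subspace[OF fin_dim V'] .
  obtain C :: "'v set" where C: "finite C" "independent C" "UNIV = span C" "card C = dim (UNIV :: 'v set)"
   using fin_dim_subspace[OF fin_dim subspace_UNIV] .
  show ?thesis using real_vector.independent_span_bound[OF C(1) B(2)] C(3,4) B(4) by simp
 qed
 have "nilp_part V' (monodromy V' L) x = (\<Sum>k = 1..dim V'. ((-1) ^ (k + 1) / real k) *\<^sub>R (?A ^^ k) x)"
  unfolding nilp_part_def monodromy_restrict T_parts pow ..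
 also have "... = (\<Sum>k = 1..dim (UNIV :: 'v set). ((-1) ^ (k + 1) / real k) *\<^sub>R (?A ^^ k) x)"
  by (rule sum.mono_neutral_left) (use le z in auto)
 also have "... = N x" unfolding nilp_part_def ..
 finally show ?thesis .
qed

end

end

locale chains = steenbrink m F W M S
 for m :: int and F :: "int => ('v::real_vector \<times> 'v) set" and W :: "int => 'v set" and M :: "'v => 'v"
  and S :: "'v => 'v => real" +
 fixes Ix :: "'i set" and lam :: "'i => complex" and len :: "'i => nat" and eta :: "'i => complex" and sig :: "'i => 'i"
  and e :: "'i => 'v \<times> 'v"
 assumes cf: "chain_family Ix lam len eta sig e" and oc: "orthogonal_chains Ix len eta e"
begin

lemma fin_Ix: "finite Ix"
 and span_e: "cx.span {(NN j) (e x) | x j. x \<in> Ix} = UNIV"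
 using cf unfolding chain_family_def by blast+

lemma Ix: "x \<in> Ix ==> e x \<in> H (lam x)" "x \<in> Ix ==> (NN (len x + 1)) (e x) = 0" "x \<in> Ix ==> eta x ~= 0"
 "x \<in> Ix ==> sig x \<in> Ix" "x \<in> Ix ==> sig (sig x) = x" "x \<in> Ix ==> len (sig x) = len x"
 "x \<in> Ix ==> lam (sig x) = cnj (lam x)" "x \<in> Ix ==> eta (sig x) = cnj (eta x)" "x \<in> Ix ==> cconj (e x) = e (sig x)"
 using cf unfolding chain_family_def by blast+

lemma pairing:
 assumes "x \<in> Ix" "y \<in> Ix"
 shows "cbil S (NN i (e x)) (NN j (cconj (e y))) = (-1) ^ i * (if x = y & i + j = len x then eta x else 0)"
proof -
 have "cbil S (NN i (e x)) (NN j (cconj (e y))) = (-1) ^ i * cbil S (e x) (NN (i + j) (cconj (e y)))"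
  unfolding cS_Npow funpow_add o_apply ..
 thus ?thesis using oc assms unfolding orthogonal_chains_def by simp
qed

lemma kill: "x \<in> Ix ==> j > len x ==> (NN j) (e x) = 0"
 using funpow_nilpotent_mono[OF clinear_imp_linear[OF clinear_N] Ix(2)] by simp

lemma chain_nz: "x \<in> Ix ==> j \<le> len x ==> (NN j) (e x) ~= 0"
proof
 assume x: "x \<in> Ix" "j \<le> len x" "NN j (e x) = 0"
 have "cbil S (NN j (e x)) (NN (len x - j) (cconj (e x))) = (-1) ^ j * eta x"
  using pairing[OF x(1,1)] x(2) by simp
 thus False unfolding x(3) using Ix(3)[OF x(1)] by (simp add: cS_simps)
qed

lemma len_le: "x \<in> Ix ==> len x < Suc (dim (UNIV :: 'v set))"
proof (rule ccontr)
 assume x: "x \<in> Ix" "\<not> len x < Suc (dim (UNIV :: 'v set))"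
 hence "(cmap N ^^ len x) (e x) = 0" by (intro cN_nilpotent) simp
 thus False using chain_nz[OF x(1) order_refl] by simp
qed

lemma cL_chains:
 assumes x: "x \<in> Ix" and y: "y \<in> Ix"
 shows "cbil L (NN i (e x)) (NN j (cconj (e y))) =
  (-1) ^ i * (if x = y & i + j \<le> len x then kco (cnj (lam x)) (len x - i - j) * eta x else 0)"
proof -
 have "cconj (e y) \<in> H (cnj (lam y))" using Ix(1)[OF y] by (simp add: cconj_H)
 hence yH: "NN j (cconj (e y)) \<in> H (cnj (lam y))" by (rule Npow_H)
 have "cbil L (NN i (e x)) (NN j (cconj (e y))) =
   (\<Sum>k<Suc (dim (UNIV :: 'v set)). kco (cnj (lam y)) k * cbil S (NN i (e x)) (NN (k + j) (cconj (e y))))"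
  unfolding cL_H[OF yH] funpow_add o_apply ..
 also have "... = (\<Sum>k<Suc (dim (UNIV :: 'v set)). if k = len x - i - j then
   (-1) ^ i * (if x = y & i + j \<le> len x then kco (cnj (lam x)) (len x - i - j) * eta x else 0) else 0)"
  by (rule sum.cong[OF refl]) (auto simp: pairing[OF x y])
 also have "... = (-1) ^ i * (if x = y & i + j \<le> len x then kco (cnj (lam x)) (len x - i - j) * eta x else 0)"
  using len_le[OF x] by (simp del: sum.lessThan_Suc)
 finally show ?thesis .
qed

definition coef :: "'i => nat => 'v \<times> 'v => complex" where
 "coef x j v = (-1) ^ j * cbil S v (NN (len x - j) (cconj (e x))) / eta x"

lemma coef_simps: "coef x j (u + v) = coef x j u + coef x j v" "coef x j (sc c v) = c * coef x j v" "coef x j 0 = 0"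
  "coef x j (u - v) = coef x j u - coef x j v"
 by (simp_all add: coef_def cS_simps algebra_simps add_divide_distrib diff_divide_distrib)

lemma coef_sum: "coef x j (\<Sum>i\<in>A. f i) = (\<Sum>i\<in>A. coef x j (f i))"
 by (induction A rule: infinite_finite_induct) (simp_all add: coef_simps)

lemma coef_chain:
 assumes "x \<in> Ix" "y \<in> Ix" "j \<le> len x"
 shows "coef x j (NN i (e y)) = (if x = y & i = j then 1 else 0)"
proof (cases "x = y & i = j")
 case True
 have "(-1) ^ j * ((-1) ^ j * eta x) / eta x = (1 :: complex)"
  unfolding mult.assoc[symmetric] power_mult_distrib[symmetric] using Ix(3)[OF assms(1)] by simp
 thus ?thesis unfolding coef_def pairing[OF assms(2,1)] using True assms(3) by simp
next
 case False
 hence nf: "\<not> (y = x & i + (len x - j) = len y)" using assms(3) by auto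
 show ?thesis unfolding coef_def pairing[OF assms(2,1)] if_not_P[OF nf] if_not_P[OF False] by simp
qed

definition part :: "'i => 'v \<times> 'v => 'v \<times> 'v" where
 "part x v = (\<Sum>j\<le>len x. sc (coef x j v) (NN j (e x)))"

lemma part_simps: "part x (u + v) = part x u + part x v" "part x (sc c v) = sc c (part x v)" "part x 0 = 0"
 by (simp_all add: part_def coef_simps cx.scale_left_distrib sum.distrib cx.scale_sum_right)

lemma part_chain:
 assumes "x \<in> Ix" "y \<in> Ix"
 shows "part x (NN i (e y)) = (if x = y then (NN i) (e y) else 0)"
proof -
 have "part x (NN i (e y)) = (\<Sum>j\<le>len x. if j = i then (if x = y then (NN i) (e y) else 0) else 0)"
  unfolding part_def by (rule sum.cong[OF refl]) (auto simp: coef_chain[OF assms])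
 thus ?thesis using kill[OF assms(1), of i] by (auto simp: not_le)
qed

lemma sum_part: "(\<Sum>x\<in>Ix. part x v) = v"
proof -
 have "v \<in> cx.span {(NN j) (e x) | x j. x \<in> Ix}" unfolding span_e by simp
 thus ?thesis
 proof (induction rule: cx.span_induct_alt)
  case base
  show ?case by (simp add: part_simps)
 next
  case (step c g v)
  then obtain y j where g: "g = NN j (e y)" "y \<in> Ix" by blast
  have "(\<Sum>x\<in>Ix. part x g) = g" unfolding g(1) using part_chain[OF _ g(2)] fin_Ix g(2) by simp
  thus ?case using step(2) by (simp add: part_simps sum.distrib cx.scale_sum_right[symmetric])
 qed
qed

definition Blk :: "'i => ('v \<times> 'v) set" where
 "Blk x = cx.span {(NN j) (e y) | y j. y \<in> {x, sig x}}"

definition Ublk :: "'i => 'v set" where "Ublk x = {v. (v, 0) \<in> Blk x}"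

lemma chain_in_Blk: "y \<in> {x, sig x} ==> (NN j) (e y) \<in> Blk x"
 unfolding Blk_def by (rule cx.span_base) blast

lemma subspace_Blk: "cx.subspace (Blk x)"
 unfolding Blk_def by (rule cx.subspace_span)

lemmas addBlk = cx.subspace_add[OF subspace_Blk] and scaleBlk = cx.subspace_scale[OF subspace_Blk] and zeroBlk = cx.subspace_0[OF subspace_Blk] and diffBlk = cx.subspace_diff[OF subspace_Blk] and sumBlk = cx.subspace_sum[OF subspace_Blk]

lemma Blk_subset: "(!!y j. y \<in> {x, sig x} ==> (NN j) (e y) \<in> Y) ==> cx.subspace Y ==> Blk x \<subseteq> Y"
 unfolding Blk_def by (rule cx.span_minimal) blast+

context
 fixes x assumes x: "x \<in> Ix"
begin

lemma orbit: "y \<in> {x, sig x} ==> y \<in> Ix" "y \<in> {x, sig x} ==> sig y \<in> {x, sig x}" "y \<in> {x, sig x} ==> len y = len x"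
 using Ix(4-6)[OF x] x by auto

lemma Blk_cconj: "v \<in> Blk x ==> cconj v \<in> Blk x"
proof -
 assume "v \<in> Blk x"
 thus ?thesis unfolding Blk_def
 proof (rule cx_span_real)
  fix a assume "a \<in> {(NN j) (e y) | y j. y \<in> {x, sig x}}"
  then obtain y j where a: "a = NN j (e y)" "y \<in> {x, sig x}" by blast
  have "cconj a = NN j (e (sig y))" unfolding a(1) Npow_cconj[symmetric] Ix(9)[OF orbit(1)[OF a(2)]] ..
  thus "cconj a \<in> cx.span {(NN j) (e y) | y j. y \<in> {x, sig x}}"
   using chain_in_Blk[OF orbit(2)[OF a(2)]] unfolding Blk_def by simp
 qed
qed

lemma Blk_real: "(a, b) \<in> Blk x \<longleftrightarrow> (a, 0) \<in> Blk x & (b, 0) \<in> Blk x"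
proof
 assume ab: "(a, b) \<in> Blk x"
 have c: "(a, - b) \<in> Blk x" using Blk_cconj[OF ab] by simp
 have "sc (1 / 2) ((a, b) + (a, - b)) \<in> Blk x"
  by (intro scaleBlk addBlk ab c)
 moreover have "sc (1 / 2) ((a, b) + (a, - b)) = (a, 0)" by (simp add: scaleCx_def flip: scaleR_2)
 moreover have "sc (- \<i> / 2) ((a, b) - (a, - b)) \<in> Blk x"
  by (intro scaleBlk diffBlk ab c)
 moreover have "sc (- \<i> / 2) ((a, b) - (a, - b)) = (b, 0)" by (simp add: scaleCx_def flip: scaleR_2)
 ultimately show "(a, 0) \<in> Blk x & (b, 0) \<in> Blk x" by simp
next
 assume "(a, 0) \<in> Blk x & (b, 0) \<in> Blk x"
 hence "(a, 0) + sc \<i> (b, 0) \<in> Blk x"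
  by (blast intro: addBlk scaleBlk)
 thus "(a, b) \<in> Blk x" by (simp only: pair_eq_real_plus_imag[symmetric])
qed

lemma cplx_Ublk: "cplx (Ublk x) = Blk x"
proof (rule set_eqI)
 fix z
 show "z \<in> cplx (Ublk x) \<longleftrightarrow> z \<in> Blk x"
  using Blk_real[of "fst z" "snd z"] unfolding mem_Times_iff Ublk_def mem_Collect_eq prod.collapse by (rule sym)
qed

lemma subspace_Ublk: "subspace (Ublk x)"
proof (rule real_vector.subspaceI)
 show "0 \<in> Ublk x" unfolding Ublk_def using cx.subspace_0[OF subspace_Blk, of x] by (simp add: zero_prod_def)
 show "u + v \<in> Ublk x" if "u \<in> Ublk x" "v \<in> Ublk x" for u v
  using that cx.subspace_add[OF subspace_Blk, of "(u, 0)" x "(v, 0)"] unfolding Ublk_def by simp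
 show "c *\<^sub>R u \<in> Ublk x" if "u \<in> Ublk x" for c u
  using that cx_subspace_scaleR[OF subspace_Blk, of "(u, 0)" x c] unfolding Ublk_def by simp
qed

lemma Blk_N: "v \<in> Blk x ==> (NN k) v \<in> Blk x"
proof -
 assume "v \<in> Blk x"
 moreover have "Blk x \<subseteq> (NN k) -` Blk x"
 proof (rule Blk_subset)
  show "cx.subspace ((NN k) -` Blk x)" by (rule cxp.linear_subspace_vimage[OF clinear_Npow subspace_Blk])
  fix y j assume y: "y \<in> {x, sig x}"
  have "NN (k + j) (e y) \<in> Blk x" by (rule chain_in_Blk[OF y])
  thus "NN j (e y) \<in> (NN k) -` Blk x" unfolding funpow_add o_apply vimage_eq .
 qed
 ultimately show ?thesis by blast
qed

lemma Blk_Mu: "v \<in> Blk x ==> cmap Mu v \<in> Blk x"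
 unfolding cMu_exp by (intro sumBlk cx_subspace_scaleR[OF subspace_Blk] Blk_N)

lemma Blk_Ms: "v \<in> Blk x ==> cmap Ms v \<in> Blk x"
proof -
 assume "v \<in> Blk x"
 moreover have "Blk x \<subseteq> cmap Ms -` Blk x"
 proof (rule Blk_subset)
  show "cx.subspace (cmap Ms -` Blk x)" by (rule cxp.linear_subspace_vimage[OF clinear_Ms subspace_Blk])
  fix y j assume y: "y \<in> {x, sig x}"
  have "cmap Ms (NN j (e y)) = sc (lam y) (NN j (e y))"
   using Npow_H[OF Ix(1)[OF orbit(1)[OF y]], of j] unfolding in_H .
  thus "NN j (e y) \<in> cmap Ms -` Blk x"
   unfolding vimage_eq using scaleBlk[OF chain_in_Blk[OF y]] by simp
 qed
 ultimately show ?thesis by blast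
qed

lemma real_stable:
 assumes "!!v. v \<in> Blk x ==> cmap f v \<in> Blk x" "f 0 = 0"
 shows "f ` Ublk x \<subseteq> Ublk x"
proof (rule image_subsetI)
 fix v assume "v \<in> Ublk x"
 hence "cmap f (v, 0) \<in> Blk x" unfolding Ublk_def by (intro assms(1)) simp
 thus "f v \<in> Ublk x" unfolding Ublk_def using assms(2) by simp
qed

lemma Ublk_stable: "Ms ` Ublk x \<subseteq> Ublk x" "Mu ` Ublk x \<subseteq> Ublk x" "N ` Ublk x \<subseteq> Ublk x"
 using real_stable[OF Blk_Ms linear_0[OF jordan(2)]] real_stable[OF Blk_Mu linear_0[OF jordan(3)]]
  real_stable[OF Blk_N[of _ 1, simplified] linear_0[OF linear_N]] by blast+

lemma Ublk_orthogonal: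
 assumes y: "y \<in> Ix" "y \<notin> {x, sig x}" and ab: "a \<in> Ublk x" "b \<in> Ublk y"
 shows "L a b = 0"
proof -
 have "cbil L (a, 0) (b, 0) = 0"
 proof (rule cL_span_zero)
  show "(a, 0) \<in> cx.span {(NN j) (e z) | z j. z \<in> {x, sig x}}"
   "(b, 0) \<in> cx.span {(NN j) (e z) | z j. z \<in> {y, sig y}}"
   using ab unfolding Ublk_def Blk_def by simp_all
  fix u v assume "u \<in> {(NN j) (e z) | z j. z \<in> {x, sig x}}" "v \<in> {(NN j) (e z) | z j. z \<in> {y, sig y}}"
  then obtain z i z' j where u: "u = NN i (e z)" "z \<in> {x, sig x}" and v: "v = NN j (e z')" "z' \<in> {y, sig y}"
   by blast
  have z: "z \<in> Ix" by (rule orbit(1)[OF u(2)])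
  have z': "sig z' \<in> Ix" "sig (sig z') = z'" "sig z' \<in> {y, sig y}" using v(2) Ix(4-5)[OF y(1)] y(1) by auto
  have "sig z' ~= z" using z'(3) u(2) y(2) Ix(4-5)[OF x] Ix(4-5)[OF y(1)] by auto
  have "e z' = cconj (e (sig z'))" using Ix(9)[OF z'(1)] z'(2) by simp
  thus "cbil L u v = 0" unfolding u(1) v(1) using cL_chains[OF z z'(1)] \<open>sig z' ~= z\<close> by simp
 qed
 thus ?thesis by (simp add: cbil_real[OF bilinear_L])
qed

end

lemma Blk_part:
 assumes "v \<in> Blk x" "x \<in> Ix" "y \<in> Ix" "y \<notin> {x, sig x}"
 shows "part y v = 0"
proof -
 have "Blk x \<subseteq> {v. part y v = 0}"
 proof (rule Blk_subset)
  show "NN j (e z) \<in> {v. part y v = 0}" if z: "z \<in> {x, sig x}" for z j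
   using part_chain[OF assms(3) orbit(1)[OF assms(2) z]] assms(4) z by auto
  show "cx.subspace {v. part y v = 0}" by (rule cx.subspaceI) (simp_all add: part_simps)
 qed
 thus ?thesis using assms(1) by blast
qed

lemma Blk_expand:
 assumes "v \<in> Blk x" "x \<in> Ix"
 shows "v = (\<Sum>y\<in>{x, sig x}. part y v)"
proof -
 have "(\<Sum>y\<in>Ix. part y v) = (\<Sum>y\<in>{x, sig x}. part y v)"
 proof (rule sum.mono_neutral_right[OF fin_Ix])
  show "{x, sig x} \<subseteq> Ix" using orbit(1)[OF assms(2)] by blast
  show "\<forall>y\<in>Ix - {x, sig x}. part y v = 0" using Blk_part[OF assms] by blast
 qed
 thus ?thesis using sum_part[of v] by simp
qed

subsection \<open>A block decomposition\<close>

context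
 fixes R :: "'j set" and \<phi> :: "'j => 'i"
 assumes R: "finite R" "!!j. j \<in> R ==> \<phi> j \<in> Ix" "!!x. x \<in> Ix ==> \<exists>!j. j \<in> R & (\<phi> j = x | \<phi> j = sig x)"
begin

lemma R_distinct: "i \<in> R ==> j \<in> R ==> i ~= j ==> \<phi> j \<notin> {\<phi> i, sig (\<phi> i)}"
 using R(3)[OF R(2)] by blast

lemma R_orthogonal: "i \<in> R ==> j \<in> R ==> i ~= j ==> a \<in> Ublk (\<phi> i) ==> b \<in> Ublk (\<phi> j) ==> L a b = 0"
 by (rule Ublk_orthogonal[OF R(2) R(2) R_distinct])

lemma R_span: "span (\<Union>j\<in>R. Ublk (\<phi> j)) = UNIV"
proof -
 let ?Y = "span (\<Union>j\<in>R. Ublk (\<phi> j))"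
 have sub: "subspace ?Y" by (rule real_vector.subspace_span)
 have "{(NN j) (e x) | x j. x \<in> Ix} \<subseteq> cplx ?Y"
 proof
  fix g assume "g \<in> {(NN j) (e x) | x j. x \<in> Ix}"
  then obtain x k where g: "g = NN k (e x)" "x \<in> Ix" by blast
  obtain j where j: "j \<in> R" "\<phi> j = x | \<phi> j = sig x" using R(3)[OF g(2)] by blast
  have "x \<in> {\<phi> j, sig (\<phi> j)}" using j(2) Ix(5)[OF g(2)] by auto
  hence "g \<in> Blk (\<phi> j)" unfolding g(1) by (rule chain_in_Blk)
  hence "g \<in> cplx (Ublk (\<phi> j))" unfolding cplx_Ublk[OF R(2)[OF j(1)]] .
  moreover have "Ublk (\<phi> j) \<subseteq> ?Y" using j(1) real_vector.span_superset[of "\<Union>j\<in>R. Ublk (\<phi> j)"] by blast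
  ultimately show "g \<in> cplx ?Y" by (auto simp: mem_Times_iff)
 qed
 hence "cx.span {(NN j) (e x) | x j. x \<in> Ix} \<subseteq> cplx ?Y" by (rule cx.span_minimal[OF _ subspace_cplx[OF sub]])
 hence "UNIV \<subseteq> cplx ?Y" unfolding span_e .
 thus ?thesis by blast
qed

lemma R_nondegenerate:
 assumes i: "i \<in> R"
 shows "nondegenerate_on (Ublk (\<phi> i)) L"
proof -
 have r: "a = 0" if a: "a \<in> Ublk (\<phi> i)" "!!b. b \<in> Ublk (\<phi> i) ==> L a b = 0" for a
 proof -
  have "subspace {b. L a b = 0}" by (rule real_vector.subspaceI) (simp_all add: bilinear_simps[OF bilinear_L])
  moreover have "(\<Union>j\<in>R. Ublk (\<phi> j)) \<subseteq> {b. L a b = 0}"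
  proof
   fix b assume "b \<in> (\<Union>j\<in>R. Ublk (\<phi> j))"
   then obtain j where j: "j \<in> R" "b \<in> Ublk (\<phi> j)" by blast
   show "b \<in> {b. L a b = 0}" using a(2) j R_orthogonal[OF i j(1) _ a(1) j(2)] by (cases "i = j") auto
  qed
  ultimately have "UNIV \<subseteq> {b. L a b = 0}" unfolding R_span[symmetric] by (intro real_vector.span_minimal)
  thus ?thesis using nondegenerate_L unfolding nondegenerate_on_def by blast
 qed
 have l: "b = 0" if b: "b \<in> Ublk (\<phi> i)" "!!a. a \<in> Ublk (\<phi> i) ==> L a b = 0" for b
 proof -
  have "subspace {a. L a b = 0}" by (rule real_vector.subspaceI) (simp_all add: bilinear_simps[OF bilinear_L])
  moreover have "(\<Union>j\<in>R. Ublk (\<phi> j)) \<subseteq> {a. L a b = 0}"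
  proof
   fix a assume "a \<in> (\<Union>j\<in>R. Ublk (\<phi> j))"
   then obtain j where j: "j \<in> R" "a \<in> Ublk (\<phi> j)" by blast
   show "a \<in> {a. L a b = 0}" using b(2) j R_orthogonal[OF j(1) i _ j(2) b(1)] by (cases "i = j") auto
  qed
  ultimately have "UNIV \<subseteq> {a. L a b = 0}" unfolding R_span[symmetric] by (intro real_vector.span_minimal)
  thus ?thesis using nondegenerate_L unfolding nondegenerate_on_def by blast
 qed
 show ?thesis unfolding nondegenerate_on_def using r l by blast
qed

theorem block_decomposition: "orthogonal_decomposition UNIV L R (%j. Ublk (\<phi> j))"
 unfolding orthogonal_decomposition_def
proof (intro conjI ballI allI impI)
 show "finite R" by (rule R(1))
 show "subspace (Ublk (\<phi> j))" if "j \<in> R" for j by (rule subspace_Ublk[OF R(2)[OF that]])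
 show "span (\<Union>j\<in>R. Ublk (\<phi> j)) = UNIV" by (rule R_span)
 show "L a b = 0" if "i \<in> R" "j \<in> R" "i ~= j" "a \<in> Ublk (\<phi> i)" "b \<in> Ublk (\<phi> j)" for i j a b
  by (rule R_orthogonal[OF that])
 fix u i assume u: "(\<forall>j\<in>R. u j \<in> Ublk (\<phi> j)) & (\<Sum>j\<in>R. u j) = 0" and i: "i \<in> R"
 have "L (u i) b = 0" if b: "b \<in> Ublk (\<phi> i)" for b
 proof -
  have "0 = L (\<Sum>j\<in>R. u j) b" using u by (simp add: bilinear_simps[OF bilinear_L])
  also have "... = (\<Sum>j\<in>R. L (u j) b)"
   using linear_sum[of "%a. L a b" u R] bilinear_L unfolding bilinear_def by blast
  also have "... = (\<Sum>j\<in>R. if j = i then L (u i) b else 0)"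
   by (rule sum.cong[OF refl]) (use u R_orthogonal[OF _ i _ _ b] in auto)
  also have "... = L (u i) b" using i R(1) by simp
  finally show ?thesis ..
 qed
 thus "u i = 0" using R_nondegenerate[OF i] u i unfolding nondegenerate_on_def by blast
qed

end

end

section \<open>The types of the blocks\<close>

context steenbrink
begin

abbreviation Mu1 :: "'v \<times> 'v => 'v \<times> 'v" where "Mu1 == %v. cmap Mu v - v"

lemma clinear_Mu1: "clinear Mu1"
 using clinear_cmap[OF linear_Mu_minus_id] unfolding cmap_minus_id .

lemma Mu1_eq: "Mu1 v = (\<Sum>k<dim (UNIV :: 'v set). (1 / fact (Suc k)) *\<^sub>R (cmap N ^^ Suc k) v)"
 unfolding cMu_exp sum.lessThan_Suc_shift by simp

lemma Mu1_kill:
 assumes "(cmap N ^^ Suc k) v = 0"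
 shows "NN k (Mu1 v) = 0"
proof -
 have "NN k ((cmap N ^^ Suc j) v) = 0" for j
 proof -
  have "NN (k + Suc j) v = 0"
   by (rule funpow_nilpotent_mono[OF clinear_imp_linear[OF clinear_N] assms]) simp
  thus ?thesis unfolding funpow_add o_apply .
 qed
 thus ?thesis
  unfolding Mu1_eq sumNN clinear_scaleR[OF clinear_Npow] by simp
qed

lemma Mu1_pow_kill: "NN n v = 0 ==> (Mu1 ^^ n) v = 0"
proof (induction n arbitrary: v)
 case (Suc n)
 have "(Mu1 ^^ Suc n) v = (Mu1 ^^ n) (Mu1 v)" unfolding funpow_Suc_right o_apply ..
 thus ?case using Suc.IH[OF Mu1_kill[OF Suc.prems]] by simp
qed simp

lemma cN_log: "cmap N v = (\<Sum>k = 1..dim (UNIV :: 'v set). ((-1) ^ (k + 1) / real k) *\<^sub>R (Mu1 ^^ k) v)"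
proof -
 define G where "G = (%u. \<Sum>k = 1..dim (UNIV :: 'v set). ((-1) ^ (k + 1) / real k) *\<^sub>R ((%y. Mu y - y) ^^ k) u)"
 have N: "N = G"
  unfolding G_def by (rule ext) (simp only: nilp_part_def)
 have "cmap N v = cmap G v" by (simp only: N)
 also have "... = (\<Sum>k = 1..dim (UNIV :: 'v set). ((-1) ^ (k + 1) / real k) *\<^sub>R (Mu1 ^^ k) v)"
  unfolding G_def cmap_minus_id[symmetric] cmap_funpow by (simp add: prod_eq_iff fst_sum snd_sum)
 finally show ?thesis .
qed

lemma Mu1_H: "v \<in> H mu ==> (Mu1 ^^ k) v \<in> H mu"
 by (induction k) (auto intro: diffH Mu_H)

lemma H_inter: "v \<in> H mu ==> v \<in> H nu ==> mu ~= nu ==> v = 0"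
proof -
 assume v: "v \<in> H mu" "v \<in> H nu" "mu ~= nu"
 have "pr mu v = v" by (rule pr_idem[OF v(1)])
 moreover have "pr mu v = 0" using pr_H[OF v(2), of mu] v(3) by simp
 ultimately show "v = 0" by simp
qed

end

context chains
begin

lemma lam_norm: "x \<in> Ix ==> lam x * cnj (lam x) = 1"
 by (rule norm_eigenvalue) (use Ix(1) chain_nz[of x 0] in \<open>auto simp: eigenvalues_def\<close>)

lemma cL_top:
 assumes y: "y \<in> Ix"
 shows "cbil L a ((cmap N ^^ len y) (cconj (e y))) = coef y 0 a * (kco (cnj (lam y)) 0 * eta y)"
proof -
 have yH: "(cmap N ^^ len y) (cconj (e y)) \<in> H (cnj (lam y))" using Ix(1)[OF y] by (intro Npow_H) (simp add: cconj_H)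
 have z: "NN k ((cmap N ^^ len y) (cconj (e y))) = 0" if "k ~= 0" for k
 proof -
  have "NN k ((cmap N ^^ len y) (cconj (e y))) = NN (k + len y) (cconj (e y))"
   unfolding funpow_add o_apply ..
  also have "... = cconj (NN (k + len y) (e y))" by (rule Npow_cconj)
  also have "NN (k + len y) (e y) = 0" by (rule kill[OF y]) (use that in simp)
  finally show ?thesis by simp
 qed
 have "cbil L a ((cmap N ^^ len y) (cconj (e y))) =
   (\<Sum>k<Suc (dim (UNIV :: 'v set)). if k = 0 then kco (cnj (lam y)) 0 * cbil S a ((cmap N ^^ len y) (cconj (e y))) else 0)"
  unfolding cL_H[OF yH] by (rule sum.cong[OF refl]) (auto simp: z cS_simps)
 also have "... = kco (cnj (lam y)) 0 * cbil S a ((cmap N ^^ len y) (cconj (e y)))" by (simp del: sum.lessThan_Suc)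
 finally show ?thesis unfolding coef_def using Ix(3)[OF y] by simp
qed

lemma coef_cconj:
 assumes "x \<in> Ix"
 shows "coef (sig x) j (cconj v) = cnj (coef x j v)"
proof -
 have "e (sig x) = cconj (e x)" using Ix(9)[OF assms] by simp
 hence "cbil S (cconj v) (NN (len x - j) (cconj (e (sig x)))) = cnj (cbil S v (NN (len x - j) (cconj (e x))))"
  unfolding cbil_cconj[OF bilinear_S, symmetric] by (simp add: Npow_cconj)
 thus ?thesis unfolding coef_def Ix(6)[OF assms] Ix(8)[OF assms] by simp
qed

lemma coef_N:
 assumes "x \<in> Ix" "j < len x"
 shows "coef x (Suc j) (cmap N v) = coef x j v"
proof -
 have "len x - j = Suc (len x - Suc j)" using assms(2) by simp
 hence "NN (len x - j) (cconj (e x)) = cmap N (NN (len x - Suc j) (cconj (e x)))" by simp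
 thus ?thesis unfolding coef_def cS_N by simp
qed

lemma part_H: "x \<in> Ix ==> part x v \<in> H (lam x)"
 unfolding part_def by (intro sumH scaleH Npow_H Ix(1))

lemma part_Blk: "y \<in> {x, sig x} ==> part y v \<in> Blk x"
 unfolding part_def by (intro sumBlk scaleBlk chain_in_Blk)

lemma part_image:
 assumes "coef x 0 v = 0"
 shows "part x v = cmap N (\<Sum>j<len x. sc (coef x (Suc j) v) (NN j (e x)))"
 unfolding part_def lessThan_Suc_atMost[symmetric] sum.lessThan_Suc_shift sumN scaleN
 using assms by simp

lemma Npow_top:
 assumes v: "v \<in> Blk x" and x: "x \<in> Ix"
 shows "(cmap N ^^ len x) v = (\<Sum>y\<in>{x, sig x}. sc (coef y 0 v) ((cmap N ^^ len x) (e y)))"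
proof -
 have "(cmap N ^^ len x) (part y v) = sc (coef y 0 v) ((cmap N ^^ len x) (e y))" if y: "y \<in> {x, sig x}" for y
 proof -
  note yI = orbit(1)[OF x y] and ly = orbit(3)[OF x y]
  have "(cmap N ^^ len x) (NN j (e y)) = (if j = 0 then (cmap N ^^ len x) (e y) else 0)" for j
  proof -
   have "(cmap N ^^ len x) (NN j (e y)) = NN (len x + j) (e y)" unfolding funpow_add o_apply ..
   thus ?thesis using kill[OF yI, of "len x + j"] ly by auto
  qed
  hence "(cmap N ^^ len x) (part y v) = (\<Sum>j\<le>len y. if j = 0 then sc (coef y 0 v) ((cmap N ^^ len x) (e y)) else 0)"
   unfolding part_def sumNN scaleNN by (intro sum.cong refl) auto
  thus ?thesis by simp
 qed
 hence "(\<Sum>y\<in>{x, sig x}. (cmap N ^^ len x) (part y v)) = (\<Sum>y\<in>{x, sig x}. sc (coef y 0 v) ((cmap N ^^ len x) (e y)))"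
  by (intro sum.cong refl)
 moreover have "(cmap N ^^ len x) v = (\<Sum>y\<in>{x, sig x}. (cmap N ^^ len x) (part y v))"
  using arg_cong[OF Blk_expand[OF v x], of "cmap N ^^ len x"] unfolding sumNN .
 ultimately show ?thesis by simp
qed

lemma top_form:
 assumes b: "b \<in> Blk x" and x: "x \<in> Ix"
 shows "cbil L a ((cmap N ^^ len x) (cconj b)) =
  (\<Sum>y\<in>{x, sig x}. coef y 0 a * cnj (coef y 0 b) * (kco (cnj (lam y)) 0 * eta y))"
proof -
 have "(cmap N ^^ len x) (cconj b) = (\<Sum>y\<in>{x, sig x}. sc (cnj (coef y 0 b)) ((cmap N ^^ len x) (cconj (e y))))"
  unfolding Npow_cconj Npow_top[OF b x] cconj_sum cconj_scaleCx ..
 hence "cbil L a ((cmap N ^^ len x) (cconj b)) = (\<Sum>y\<in>{x, sig x}. cnj (coef y 0 b) * cbil L a ((cmap N ^^ len x) (cconj (e y))))"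
  by (simp only: cL_simps)
 also have "... = (\<Sum>y\<in>{x, sig x}. coef y 0 a * cnj (coef y 0 b) * (kco (cnj (lam y)) 0 * eta y))"
 proof (rule sum.cong[OF refl])
  fix y assume y: "y \<in> {x, sig x}"
  show "cnj (coef y 0 b) * cbil L a ((cmap N ^^ len x) (cconj (e y))) = coef y 0 a * cnj (coef y 0 b) * (kco (cnj (lam y)) 0 * eta y)"
   using cL_top[OF orbit(1)[OF x y], of a] orbit(3)[OF x y] by simp
 qed
 finally show ?thesis .
qed

lemma dim_Blk:
 assumes x: "x \<in> Ix"
 shows "cx.dim (Blk x) = card {x, sig x} * (len x + 1)"
proof -
 let ?J = "{x, sig x} \<times> {..len x}" and ?g = "%(y, j). (NN j) (e y)"
 have cg: "coef y j (?g p) = (if p = (y, j) then 1 else 0)" if "(y, j) \<in> ?J" "p \<in> ?J" for y j p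
  using that coef_chain[OF orbit(1)[OF x] orbit(1)[OF x], of y "fst p" j "snd p"] orbit(3)[OF x, of y]
  by (cases p) auto
 have inj: "inj_on ?g ?J"
 proof (rule inj_onI)
  fix p q assume pq: "p \<in> ?J" "q \<in> ?J" "?g p = ?g q"
  have "coef (fst p) (snd p) (?g p) = 1" using cg[of "fst p" "snd p" p] pq(1) by simp
  moreover have "coef (fst p) (snd p) (?g q) = (if q = p then 1 else 0)" using cg[of "fst p" "snd p" q] pq(1,2) by simp
  ultimately have "(if q = p then 1 else 0) = (1 :: complex)" by (simp only: pq(3))
  thus "p = q" by (cases "q = p") simp_all
 qed
 have ind: "cx.independent (?g ` ?J)"
 proof (rule ccontr)
  assume "\<not> cx.independent (?g ` ?J)"
  then obtain u v where u: "v \<in> ?g ` ?J" "u v ~= 0" "(\<Sum>v\<in>?g ` ?J. sc (u v) v) = 0"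
   using cx.dependent_finite[of "?g ` ?J"] by blast
  obtain p where p: "p \<in> ?J" "v = ?g p" using u(1) by (rule imageE)
  have "0 = coef (fst p) (snd p) (\<Sum>q\<in>?J. sc (u (?g q)) (?g q))"
   using u(3) sum.reindex[OF inj, of "%v. sc (u v) v"] by (simp add: o_def coef_simps)
  also have "... = (\<Sum>q\<in>?J. if q = p then u (?g p) else 0)"
   unfolding coef_sum coef_simps
  proof (rule sum.cong[OF refl])
   fix q assume q: "q \<in> ?J"
   show "u (?g q) * coef (fst p) (snd p) (?g q) = (if q = p then u (?g p) else 0)"
    using cg[of "fst p" "snd p" q] p(1) q by simp
  qed
  also have "... = u (?g p)" using p(1) by simp
  finally show False using u(2) p(2) by simp
 qed
 have span: "cx.span (?g ` ?J) = Blk x"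
 proof
  show "cx.span (?g ` ?J) \<subseteq> Blk x"
  proof (rule cx.span_minimal[OF _ subspace_Blk], rule image_subsetI)
   fix p assume "p \<in> ?J"
   thus "?g p \<in> Blk x" using chain_in_Blk[of "fst p" x "snd p"] by (cases p) auto
  qed
  show "Blk x \<subseteq> cx.span (?g ` ?J)"
  proof (rule Blk_subset[OF _ cx.subspace_span])
   fix y j assume y: "y \<in> {x, sig x}"
   show "NN j (e y) \<in> cx.span (?g ` ?J)"
   proof (cases "j \<le> len x")
    case True
    hence "?g (y, j) \<in> ?g ` ?J" using y by (intro imageI) simp
    thus ?thesis by (intro cx.span_base) simp
   next
    case False
    hence "NN j (e y) = 0" using kill[OF orbit(1)[OF x y]] orbit(3)[OF x y] by simp
    thus ?thesis using cx.span_zero by simp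
   qed
  qed
 qed
 have "cx.dim (Blk x) = card (?g ` ?J)" by (rule cx.dim_eq_card[OF _ ind]) (simp add: span[symmetric] cx.span_span)
 also have "... = card ?J" by (rule card_image[OF inj])
 also have "... = card {x, sig x} * (len x + 1)" by (simp add: card_cartesian_product)
 finally show ?thesis .
qed

context
 fixes x assumes x: "x \<in> Ix" and ndx: "nondegenerate_on (Ublk x) L"
begin

lemma dim_Ublk: "dim (Ublk x) = card {x, sig x} * (len x + 1)"
 using dim_cplx[OF fin_dim subspace_Ublk[OF x]] dim_Blk[OF x] unfolding cplx_Ublk[OF x] by simp

lemma seifert_Ublk: "seifert_pair (Ublk x) L"
 unfolding seifert_pair_def
 using subspace_Ublk[OF x] fin_dim_subspaceI[OF fin_dim subspace_Ublk[OF x]] bilinear_on_L ndx by blast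

lemmas Ublk_restrict = monodromy_restrict[OF subspace_Ublk[OF x] Ublk_stable(1,2)[OF x] ndx]
 and Ublk_eigsp = eigsp_restrict[OF subspace_Ublk[OF x] Ublk_stable(1,2)[OF x] ndx, unfolded cplx_Ublk[OF x]]
 and Ublk_nilp = nilp_restrict[OF subspace_Ublk[OF x] Ublk_stable(1,2)[OF x] ndx]

lemma Ublk_nilp_pow: "v \<in> Ublk x ==> (nilp_part (Ublk x) (monodromy (Ublk x) L) ^^ k) v = (N ^^ k) v"
 by (rule funpow_cong_on(1)[of "Ublk x"]) (use Ublk_nilp Ublk_stable(3)[OF x] in auto)

lemma cmap_nilp: "v \<in> Blk x ==> cmap (nilp_part (Ublk x) (monodromy (Ublk x) L)) v = cmap N v"
proof -
 assume "v \<in> Blk x"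
 hence "v \<in> cplx (Ublk x)" unfolding cplx_Ublk[OF x] .
 thus ?thesis using Ublk_nilp by (cases v) simp
qed

lemma cmap_nilp_pow: "v \<in> Blk x ==> (cmap (nilp_part (Ublk x) (monodromy (Ublk x) L)) ^^ k) v = NN k v"
 by (rule funpow_cong_on(1)[of "Blk x"]) (use cmap_nilp Blk_N[OF x, of _ 1] in simp_all)

lemma not_image:
 assumes "v \<in> Blk x" "v \<notin> cmap (nilp_part (Ublk x) (monodromy (Ublk x) L)) ` Blk x"
 shows "\<exists>y\<in>{x, sig x}. coef y 0 v ~= 0"
proof (rule ccontr)
 assume "\<not> ?thesis"
 hence z: "!!y. y \<in> {x, sig x} ==> coef y 0 v = 0" by blast
 let ?u = "\<Sum>y\<in>{x, sig x}. \<Sum>j<len y. sc (coef y (Suc j) v) (NN j (e y))"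
 have "v = (\<Sum>y\<in>{x, sig x}. part y v)" by (rule Blk_expand[OF assms(1) x])
 also have "... = (\<Sum>y\<in>{x, sig x}. cmap N (\<Sum>j<len y. sc (coef y (Suc j) v) (NN j (e y))))"
  by (intro sum.cong refl part_image z)
 also have "... = cmap N ?u" unfolding sumN ..
 finally have v: "v = cmap N ?u" .
 have u: "?u \<in> Blk x"
  by (intro sumBlk scaleBlk chain_in_Blk)
 have "v = cmap (nilp_part (Ublk x) (monodromy (Ublk x) L)) ?u" unfolding cmap_nilp[OF u] by (rule v)
 hence "v \<in> cmap (nilp_part (Ublk x) (monodromy (Ublk x) L)) ` Blk x" using u by (rule image_eqI)
 thus False using assms(2) by blast
qed

lemma Ublk_jordan_blocks:
 assumes ys: "distinct ys" "set ys = {x, sig x}"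
 shows "jordan_blocks (Ublk x) (monodromy (Ublk x) L) (map (%y. ((-1) powi (m + 1) * lam y, len x + 1)) ys)"
proof -
 let ?l = "len x" and ?bs = "map (%y. ((-1) powi (m + 1) * lam y, len x + 1)) ys"
 define rho where "rho i = (-1) powi (m + 1) * lam (ys ! i)" for i
 define u where "u i j = sc (rho i ^ (?l - j)) ((Mu1 ^^ (?l - j)) (e (ys ! i)))" for i j
 define J where "J = {(i, j). i < length ?bs & j < snd (?bs ! i)}"
 have J: "J = {..<length ys} \<times> {..?l}" unfolding J_def by auto
 have ysI: "ys ! i \<in> Ix" "len (ys ! i) = ?l" "ys ! i \<in> {x, sig x}" if "i < length ys" for i
  using orbit(1,3)[OF x, of "ys ! i"] nth_mem[OF that] ys(2) by auto
 have rho0: "rho i ~= 0" if "i < length ys" for i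
  using lam_norm[OF ysI(1)[OF that]] unfolding rho_def by auto
 have Blk_Mu1: "(Mu1 ^^ k) v \<in> Blk x" if "v \<in> Blk x" for k v
 proof (induction k)
  case (Suc k)
  thus ?case unfolding funpow.simps o_apply by (intro diffBlk Blk_Mu[OF x])
 qed (use that in simp)
 have eB: "e (ys ! i) \<in> Blk x" if "i < length ys" for i
  using chain_in_Blk[OF ysI(3)[OF that], of 0] by simp
 have uB: "u i j \<in> Blk x" if "i < length ys" for i j
  unfolding u_def by (intro scaleBlk Blk_Mu1 eB that)
 have kill1: "(Mu1 ^^ k) (e (ys ! i)) = 0" if "i < length ys" "k > ?l" for i k
  by (rule Mu1_pow_kill) (use kill[OF ysI(1)[OF that(1)], of k] ysI(2)[OF that(1)] that(2) in simp)
 have T: "cmap (monodromy (Ublk x) L) (u i j) = sc (rho i) (u i j) + (if j = 0 then 0 else u i (j - 1))"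
  if i: "i < length ys" and j: "j \<le> ?l" for i j
 proof -
  have uH: "u i j \<in> H (lam (ys ! i))"
   unfolding u_def by (intro scaleH Mu1_H Ix(1) ysI(1) i)
  have "u i j \<in> cplx (Ublk x)" using uB[OF i] unfolding cplx_Ublk[OF x] .
  hence "cmap (monodromy (Ublk x) L) (u i j) = cmap T0 (u i j)" unfolding Ublk_restrict by (cases "u i j") simp
  also have "... = sc (rho i) (cmap Mu (u i j))" unfolding cmap_T0 M_on_H[OF uH] rho_def by simp
  also have "... = sc (rho i) (u i j) + sc (rho i) (Mu1 (u i j))" by (simp add: cx.scale_right_diff_distrib)
  also have "sc (rho i) (Mu1 (u i j)) = sc (rho i ^ Suc (?l - j)) ((Mu1 ^^ Suc (?l - j)) (e (ys ! i)))"
   unfolding u_def cxp.linear_scale[OF clinear_Mu1] by simp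
  also have "... = (if j = 0 then 0 else u i (j - 1))"
  proof (cases "j = 0")
   case True
   thus ?thesis using kill1[OF i, of "Suc (?l - j)"] by (simp only: if_P diff_zero lessI cx.scale_zero_right)
  next
   case False
   hence "Suc (?l - j) = ?l - (j - 1)" using j by simp
   thus ?thesis unfolding u_def using False by simp
  qed
  finally show ?thesis .
 qed
 define Y where "Y = cx.span {(Mu1 ^^ k) (e y) | y k. y \<in> {x, sig x}}"
 have Y_sub: "cx.subspace Y" unfolding Y_def by (rule cx.subspace_span)
 have Y_Mu1: "(Mu1 ^^ k) v \<in> Y" if v: "v \<in> Y" for v k
 proof -
  have cl: "clinear (Mu1 ^^ k)" by (rule clinear_funpow[OF clinear_Mu1])
  have "Y \<subseteq> (Mu1 ^^ k) -` Y"
   unfolding Y_def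
  proof (rule cx.span_minimal)
   show "cx.subspace ((Mu1 ^^ k) -` cx.span {(Mu1 ^^ k) (e y) | y k. y \<in> {x, sig x}})"
    by (rule cxp.linear_subspace_vimage[OF cl cx.subspace_span])
   show "{(Mu1 ^^ k) (e y) | y k. y \<in> {x, sig x}} \<subseteq> (Mu1 ^^ k) -` cx.span {(Mu1 ^^ k) (e y) | y k. y \<in> {x, sig x}}"
   proof
    fix g assume "g \<in> {(Mu1 ^^ k) (e y) | y k. y \<in> {x, sig x}}"
    then obtain y i where g: "g = (Mu1 ^^ i) (e y)" "y \<in> {x, sig x}" by blast
    have "(Mu1 ^^ k) g = (Mu1 ^^ (k + i)) (e y)" unfolding g(1) funpow_add o_apply ..
    hence "(Mu1 ^^ k) g \<in> {(Mu1 ^^ k) (e y) | y k. y \<in> {x, sig x}}" using g(2) by blast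
    thus "g \<in> (Mu1 ^^ k) -` cx.span {(Mu1 ^^ k) (e y) | y k. y \<in> {x, sig x}}"
     unfolding vimage_eq by (rule cx.span_base)
   qed
  qed
  thus ?thesis using v by blast
 qed
 have Y_N: "cmap N v \<in> Y" if "v \<in> Y" for v
  unfolding cN_log by (intro cx.subspace_sum[OF Y_sub] cx_subspace_scaleR[OF Y_sub] Y_Mu1 that)
 have Y_Npow: "NN k v \<in> Y" if "v \<in> Y" for v k by (induction k) (use that Y_N in simp_all)
 have "Blk x \<subseteq> Y"
 proof (rule Blk_subset[OF _ Y_sub], rule Y_Npow)
  fix y assume "y \<in> {x, sig x}"
  hence "(Mu1 ^^ 0) (e y) \<in> {(Mu1 ^^ k) (e y) | y k. y \<in> {x, sig x}}" by blast
  thus "e y \<in> Y" unfolding Y_def by (intro cx.span_base) simp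
 qed
 moreover have "Y \<subseteq> cx.span ((%(i, j). u i j) ` J)"
  unfolding Y_def
 proof (rule cx.span_minimal[OF _ cx.subspace_span])
  show "{(Mu1 ^^ k) (e y) | y k. y \<in> {x, sig x}} \<subseteq> cx.span ((%(i, j). u i j) ` J)"
  proof
   fix g assume "g \<in> {(Mu1 ^^ k) (e y) | y k. y \<in> {x, sig x}}"
   then obtain y k where g: "g = (Mu1 ^^ k) (e y)" "y \<in> {x, sig x}" by blast
   obtain i where i: "i < length ys" "y = ys ! i" using g(2) unfolding ys(2)[symmetric] by (metis in_set_conv_nth)
   show "g \<in> cx.span ((%(i, j). u i j) ` J)"
   proof (cases "k \<le> ?l")
    case True
    have "(%(i, j). u i j) (i, ?l - k) \<in> (%(i, j). u i j) ` J" by (rule imageI) (use i J in simp)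
    hence "u i (?l - k) \<in> cx.span ((%(i, j). u i j) ` J)" by (intro cx.span_base) simp
    moreover have "g = sc (1 / rho i ^ k) (u i (?l - k))"
     unfolding g(1) i(2) u_def using True rho0[OF i(1)] by simp
    ultimately show ?thesis using cx.span_scale by simp
   next
    case False
    hence "g = 0" unfolding g(1) i(2) using kill1[OF i(1)] by simp
    thus ?thesis using cx.span_zero by simp
   qed
  qed
 qed
 moreover have "cx.span ((%(i, j). u i j) ` J) \<subseteq> Blk x"
  by (rule cx.span_minimal[OF _ subspace_Blk]) (use uB J in auto)
 ultimately have span: "cx.span ((%(i, j). u i j) ` J) = Blk x" by blast
 have "card J = length ys * (?l + 1)" unfolding J by (simp add: card_cartesian_product)
 also have "length ys = card {x, sig x}" using distinct_card[OF ys(1)] ys(2) by simp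
 finally have "cx.dim (Blk x) = card J" using dim_Blk[OF x] by simp
 note basis = spanning_family_basis[OF fin_dim _ span this]
 have finJ: "finite J" unfolding J by simp
 show ?thesis
  unfolding jordan_blocks_def Let_def J_def[symmetric]
 proof (intro exI[of _ u] conjI)
  show "inj_on (%(i, j). u i j) J" "cx.independent ((%(i, j). u i j) ` J)" by (rule basis[OF finJ])+
  show "cx.span ((%(i, j). u i j) ` J) = cplx (Ublk x)" unfolding cplx_Ublk[OF x] by (rule span)
  show "\<forall>(i, j)\<in>J. cmap (monodromy (Ublk x) L) (u i j) = sc (fst (?bs ! i)) (u i j) + (if j = 0 then 0 else u i (j - 1))"
  proof (rule ballI, clarify)
   fix i j assume "(i, j) \<in> J"
   hence ij: "i < length ys" "j \<le> ?l" unfolding J by simp_all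
   have "fst (?bs ! i) = rho i" using ij(1) unfolding rho_def by simp
   thus "cmap (monodromy (Ublk x) L) (u i j) = sc (fst (?bs ! i)) (u i j) + (if j = 0 then 0 else u i (j - 1))"
    using T[OF ij] by simp
  qed
 qed
qed

end

end

context chains
begin

lemma Im_mult_of_real: "Im (z * of_real r) = Im z * r"
 by simp

lemma ray_mult: "r > 0 ==> z \<in> ray \<zeta> ==> of_real r * z \<in> ray \<zeta>"
proof -
 assume r: "r > 0" "z \<in> ray \<zeta>"
 then obtain s where "s > 0" "z = \<zeta> * of_real s" unfolding ray_def by blast
 hence "r * s > 0" "of_real r * z = \<zeta> * of_real (r * s)" using r(1) by simp_all
 thus ?thesis unfolding ray_def by blast
qed

context
 fixes x assumes x: "x \<in> Ix" and ndx: "nondegenerate_on (Ublk x) L"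
begin

lemma eigsp_eq: "eigsp (Ublk x) (monodromy (Ublk x) L) ((-1) powi (m + 1) * mu) = {v \<in> Blk x. v \<in> H mu}"
 unfolding Ublk_eigsp[OF x ndx] mult.assoc[symmetric] sign_sq mult_1_left ..

theorem seif_2c_Ublk:
 assumes lam: "lam x \<notin> {1, -1}"
  and \<zeta>: "\<zeta> \<in> sphere 0 1 - {1, -1}" "\<zeta>\<^sup>2 = cnj ((-1) powi (m + 1) * lam x) * (-1) ^ (len x + 2)"
  and top: "kco (cnj (lam x)) 0 * eta x \<in> ray \<zeta>"
 shows "seif_2c ((-1) powi (m + 1) * lam x) (len x + 1) \<zeta> (Ublk x) L"
proof -
 let ?c = "(-1) powi (m + 1) :: complex" and ?T = "monodromy (Ublk x) L"
 let ?N = "nilp_part (Ublk x) ?T"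
 have norm: "norm (lam x) = 1"
 proof -
  have "of_real ((norm (lam x))\<^sup>2) = (1 :: complex)" using lam_norm[OF x] unfolding complex_norm_square by simp
  hence "(norm (lam x))\<^sup>2 = 1" by (simp only: of_real_eq_1_iff)
  thus ?thesis by (simp add: power2_eq_1_iff) (smt (verit) norm_ge_zero)
 qed
 have c1: "?c = 1 | ?c = -1" using sign_sq[of "m + 1", where ?'a = complex] square_eq_1_iff[of ?c] by blast
 have ne: "cnj (lam x) ~= lam x"
 proof
  assume "cnj (lam x) = lam x"
  hence "lam x * lam x = 1" using lam_norm[OF x] by simp
  thus False using lam square_eq_1_iff[of "lam x"] by blast
 qed
 have sx: "sig x ~= x" using ne Ix(7)[OF x] by auto
 have cc: "cnj ?c = ?c" using c1 by auto
 have rho: "?c * lam x \<in> sphere 0 1 - {1, -1}"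
 proof -
  have "norm (?c * lam x) = 1" using c1 norm by (auto simp: norm_mult)
  moreover have "?c * lam x ~= 1" "?c * lam x ~= -1" using c1 lam by (auto simp: minus_equation_iff[of "lam x"])
  ultimately show ?thesis by simp
 qed
 have cr: "cnj (?c * lam x) = ?c * cnj (lam x)" using cc by simp
 have E: "eigsp (Ublk x) ?T (?c * lam x) = {v \<in> Blk x. v \<in> H (lam x)}"
  "eigsp (Ublk x) ?T (cnj (?c * lam x)) = {v \<in> Blk x. v \<in> H (cnj (lam x))}"
  unfolding cr by (rule eigsp_eq)+
 have plus: "cplx (Ublk x) = eigsp (Ublk x) ?T (?c * lam x) + eigsp (Ublk x) ?T (cnj (?c * lam x))"
  unfolding E cplx_Ublk[OF x]
 proof
  show "Blk x \<subseteq> {v \<in> Blk x. v \<in> H (lam x)} + {v \<in> Blk x. v \<in> H (cnj (lam x))}"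
  proof
   fix v assume v: "v \<in> Blk x"
   have s: "v = part x v + part (sig x) v" using Blk_expand[OF v x] sx by simp
   have p: "part x v \<in> {v \<in> Blk x. v \<in> H (lam x)}" using part_Blk[of x x v] part_H[OF x] by simp
   have q: "part (sig x) v \<in> {v \<in> Blk x. v \<in> H (cnj (lam x))}"
    using part_Blk[of "sig x" x v] part_H[OF Ix(4)[OF x]] Ix(7)[OF x] by simp
   show "v \<in> {v \<in> Blk x. v \<in> H (lam x)} + {v \<in> Blk x. v \<in> H (cnj (lam x))}"
    by (subst s) (rule set_plus_intro[OF p q])
  qed
  show "{v \<in> Blk x. v \<in> H (lam x)} + {v \<in> Blk x. v \<in> H (cnj (lam x))} \<subseteq> Blk x"
  proof
   fix v assume "v \<in> {v \<in> Blk x. v \<in> H (lam x)} + {v \<in> Blk x. v \<in> H (cnj (lam x))}"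
   then obtain a b where v: "v = a + b" "a \<in> {v \<in> Blk x. v \<in> H (lam x)}" "b \<in> {v \<in> Blk x. v \<in> H (cnj (lam x))}"
    by (rule set_plus_elim)
   show "v \<in> Blk x" unfolding v(1) by (rule addBlk) (use v(2,3) in simp_all)
  qed
 qed
 have inter: "eigsp (Ublk x) ?T (?c * lam x) \<inter> eigsp (Ublk x) ?T (cnj (?c * lam x)) = {0}"
  unfolding E
 proof
  show "{v \<in> Blk x. v \<in> H (lam x)} \<inter> {v \<in> Blk x. v \<in> H (cnj (lam x))} \<subseteq> {0}"
  proof
   fix v assume "v \<in> {v \<in> Blk x. v \<in> H (lam x)} \<inter> {v \<in> Blk x. v \<in> H (cnj (lam x))}"
   hence "v = 0" by (intro H_inter[OF _ _ ne[symmetric]]) simp_all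
   thus "v \<in> {0}" by simp
  qed
  show "{0} \<subseteq> {v \<in> Blk x. v \<in> H (lam x)} \<inter> {v \<in> Blk x. v \<in> H (cnj (lam x))}"
   by (simp add: zeroBlk zeroH)
 qed
 have jb: "jordan_blocks (Ublk x) ?T [(?c * lam x, len x + 1), (cnj (?c * lam x), len x + 1)]"
  using Ublk_jordan_blocks[OF x ndx, of "[x, sig x]"] sx Ix(7)[OF x] unfolding cr by simp
 have pos: "cbil L a ((cmap ?N ^^ (len x + 1 - 1)) (cconj a)) \<in> ray \<zeta>"
  if a: "a \<in> eigsp (Ublk x) ?T (?c * lam x) - cmap ?N ` cplx (Ublk x)" for a
 proof -
  have aB: "a \<in> Blk x" "a \<in> H (lam x)" and ai: "a \<notin> cmap ?N ` Blk x" using a unfolding E cplx_Ublk[OF x] by blast+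
  have "part (sig x) a = 0"
  proof (rule H_inter[OF _ _ ne])
   show "part (sig x) a \<in> H (cnj (lam x))" using part_H[OF Ix(4)[OF x]] Ix(7)[OF x] by simp
   have "part (sig x) a + part x a = a" using Blk_expand[OF aB(1) x, symmetric] sx by (simp add: add.commute)
   hence "part (sig x) a = a - part x a" by (rule add_implies_diff)
   thus "part (sig x) a \<in> H (lam x)" using diffH[OF aB(2) part_H[OF x]] by simp
  qed
  hence "a = part x a" using Blk_expand[OF aB(1) x] sx by simp
  hence s0: "coef (sig x) 0 a = 0"
  proof -
   assume "a = part x a"
   have "coef (sig x) 0 (part x a) = 0"
    unfolding part_def coef_sum coef_simps
    by (rule sum.neutral) (use coef_chain[OF Ix(4)[OF x] x] sx in auto)
   thus ?thesis using \<open>a = part x a\<close> by simp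
  qed
  hence x0: "coef x 0 a ~= 0" using not_image[OF x ndx aB(1) ai] by auto
  have "cbil L a ((cmap ?N ^^ (len x + 1 - 1)) (cconj a)) = cbil L a ((cmap N ^^ len x) (cconj a))"
   using cmap_nilp_pow[OF x ndx Blk_cconj[OF x aB(1)]] by simp
  also have "... = coef x 0 a * cnj (coef x 0 a) * (kco (cnj (lam x)) 0 * eta x)"
   unfolding top_form[OF aB(1) x] using sx s0 by simp
  also have "... = of_real ((norm (coef x 0 a))\<^sup>2) * (kco (cnj (lam x)) 0 * eta x)"
   unfolding complex_norm_square ..
  also have "... \<in> ray \<zeta>" by (rule ray_mult[OF _ top]) (use x0 in simp)
  finally show ?thesis .
 qed
 have d: "dim (Ublk x) = 2 * (len x + 1)" using dim_Ublk[OF x ndx] sx by simp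
 show ?thesis
  unfolding seif_2c_def Let_def
  by (intro conjI ballI seifert_Ublk[OF x ndx] rho \<zeta>(1) d plus inter jb pos) (use \<zeta>(2) in simp_all)
qed

theorem seif_1_Ublk:
 assumes sx: "sig x = x" and rho: "(-1) powi (m + 1) * lam x = (-1) ^ len x" and \<epsilon>: "\<epsilon> \<in> {1, -1}"
  and top: "kco (cnj (lam x)) 0 * eta x \<in> ray (of_real \<epsilon>)"
 shows "seif_1 ((-1) powi (m + 1) * lam x) (len x + 1) \<epsilon> (Ublk x) L"
proof -
 let ?c = "(-1) powi (m + 1) :: complex" and ?T = "monodromy (Ublk x) L"
 let ?N = "nilp_part (Ublk x) ?T"
 have d: "dim (Ublk x) = len x + 1" using dim_Ublk[OF x ndx] sx by simp
 have one: "v = part x v" if "v \<in> Blk x" for v using Blk_expand[OF that x] sx by simp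
 have eig: "cplx (Ublk x) = eigsp (Ublk x) ?T (?c * lam x)"
 proof -
  have "v \<in> H (lam x)" if "v \<in> Blk x" for v by (subst one[OF that]) (rule part_H[OF x])
  thus ?thesis unfolding eigsp_eq cplx_Ublk[OF x] by blast
 qed
 have jb: "jordan_blocks (Ublk x) ?T [(?c * lam x, len x + 1)]"
  using Ublk_jordan_blocks[OF x ndx, of "[x]"] sx by simp
 have pos: "\<exists>r>0. L a ((?N ^^ (len x + 1 - 1)) a) = \<epsilon> * r" if a: "a \<in> Ublk x - ?N ` Ublk x" for a
 proof -
  have aB: "(a, 0) \<in> Blk x" using a unfolding Ublk_def by simp
  have "(a, 0) \<notin> cmap ?N ` Blk x"
  proof
   assume "(a, 0) \<in> cmap ?N ` Blk x"
   then obtain b where b: "(a, 0) = cmap ?N b" "b \<in> Blk x" by (rule imageE)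
   have "fst b \<in> Ublk x" using b(2) unfolding cplx_Ublk[OF x, symmetric] by (simp add: mem_Times_iff)
   moreover have "a = ?N (fst b)" using arg_cong[OF b(1), of fst] by simp
   ultimately show False using a by blast
  qed
  hence x0: "coef x 0 (a, 0) ~= 0" using not_image[OF x ndx aB] sx by auto
  obtain r where r: "r > 0" "kco (cnj (lam x)) 0 * eta x = of_real \<epsilon> * of_real r" using top unfolding ray_def by blast
  have z: "(N ^^ len x) 0 = 0" by (rule linear_0[OF linear_funpow[OF linear_N]])
  have "of_real (L a ((?N ^^ (len x + 1 - 1)) a)) = (of_real (L a ((N ^^ len x) a)) :: complex)"
   using Ublk_nilp_pow[OF x ndx, of a] a by simp
  also have "... = cbil L (a, 0) ((cmap N ^^ len x) (cconj (a, 0)))"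
   unfolding cmap_funpow cconj_simps by (simp add: z cbil_real[OF bilinear_L])
  also have "... = coef x 0 (a, 0) * cnj (coef x 0 (a, 0)) * (kco (cnj (lam x)) 0 * eta x)"
   unfolding top_form[OF aB x] using sx by simp
  also have "... = of_real (\<epsilon> * ((norm (coef x 0 (a, 0)))\<^sup>2 * r))"
   unfolding complex_norm_square[symmetric] r(2) by simp
  finally have "L a ((?N ^^ (len x + 1 - 1)) a) = \<epsilon> * ((norm (coef x 0 (a, 0)))\<^sup>2 * r)" by (simp only: of_real_eq_iff)
  moreover have "(norm (coef x 0 (a, 0)))\<^sup>2 * r > 0" using r(1) x0 by simp
  ultimately show ?thesis by blast
 qed
 have rho': "?c * lam x = (-1) ^ (len x + 1 - 1)" using rho by simp
 show ?thesis
  unfolding seif_1_def Let_def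
  by (intro conjI ballI seifert_Ublk[OF x ndx] \<epsilon> rho' d eig jb pos) simp
qed

theorem seif_2_Ublk:
 assumes sx: "sig x ~= x" and lam: "cnj (lam x) = lam x" and rho: "(-1) powi (m + 1) * lam x = (-1) ^ (len x + 1)"
 shows "seif_2 ((-1) powi (m + 1) * lam x) (len x + 1) (Ublk x) L"
proof -
 let ?c = "(-1) powi (m + 1) :: complex" and ?T = "monodromy (Ublk x) L"
 have d: "dim (Ublk x) = 2 * (len x + 1)" using dim_Ublk[OF x ndx] sx by simp
 have ls: "lam (sig x) = lam x" using Ix(7)[OF x] lam by simp
 have inH: "v \<in> H (lam x)" if v: "v \<in> Blk x" for v
 proof -
  have "v = part x v + part (sig x) v" using Blk_expand[OF v x] sx by simp
  thus ?thesis using addH[OF part_H[OF x, of v] part_H[OF Ix(4)[OF x], of v, unfolded ls]] by simp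
 qed
 have eig: "cplx (Ublk x) = eigsp (Ublk x) ?T (?c * lam x)"
  unfolding eigsp_eq cplx_Ublk[OF x] using inH by blast
 have jb: "jordan_blocks (Ublk x) ?T [(?c * lam x, len x + 1), (?c * lam x, len x + 1)]"
  using Ublk_jordan_blocks[OF x ndx, of "[x, sig x]"] sx[symmetric] ls by simp
 show ?thesis
  unfolding seif_2_def Let_def
  by (intro conjI seifert_Ublk[OF x ndx] rho d eig jb) simp
qed

theorem irreducible_Ublk:
 assumes sx: "sig x ~= x" and lam: "cnj (lam x) = lam x"
  and top: "kco (cnj (lam x)) 0 * eta x = \<i> * of_real s" "s ~= 0"
 shows "seifert_irreducible (Ublk x) L"
proof -
 let ?l = "len x" and ?V = "Ublk x"
 define c where "c v = coef x 0 (v, 0)" for v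
 have sxI: "sig x \<in> Ix" by (rule Ix(4)[OF x])
 have ls: "lam (sig x) = lam x" using Ix(7)[OF x] lam by simp
 have cs: "coef (sig x) 0 (v, 0) = cnj (c v)" for v
  using coef_cconj[OF x, of 0 "(v, 0)"] unfolding c_def by simp
 have c_add: "c (u + v) = c u + c v" for u v
  using coef_simps(1)[of x 0 "(u, 0)" "(v, 0)"] unfolding c_def by simp
 have kcs: "kco (cnj (lam (sig x))) 0 * eta (sig x) = cnj (\<i> * of_real s)"
  unfolding top(1)[symmetric] ls Ix(8)[OF x] complex_cnj_mult using lam by (simp add: kco_0)
 have form: "L u ((N ^^ ?l) v) = - 2 * s * Im (c u * cnj (c v))" if v: "v \<in> ?V" for u v
 proof -
  have vB: "(v, 0) \<in> Blk x" using v unfolding Ublk_def by simp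
  have z: "(N ^^ ?l) 0 = 0" by (rule linear_0[OF linear_funpow[OF linear_N]])
  have "(of_real (L u ((N ^^ ?l) v)) :: complex) = cbil L (u, 0) (NN ?l (cconj (v, 0)))"
   unfolding cmap_funpow cconj_simps by (simp add: z cbil_real[OF bilinear_L])
  also have "... = c u * cnj (c v) * (\<i> * of_real s) + cnj (c u) * c v * cnj (\<i> * of_real s)"
   unfolding top_form[OF vB x] using sx[symmetric] by (simp add: cs c_def[symmetric] kcs top(1) del: complex_cnj_mult)
  also have "... = of_real (- 2 * s * Im (c u * cnj (c v)))"
   by (simp add: complex_eq_iff algebra_simps)
  finally show ?thesis by (simp only: of_real_eq_iff)
 qed
 have surj: "\<exists>v\<in>?V. c v = z" for z
 proof -
  define y where "y = sc z (e x) + sc (cnj z) (e (sig x))"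
  have yB: "y \<in> Blk x" unfolding y_def
   using chain_in_Blk[of x x 0] chain_in_Blk[of "sig x" x 0]
   by (intro addBlk scaleBlk) simp_all
  have "cconj (e (sig x)) = e x" using Ix(9)[OF sxI] Ix(5)[OF x] by simp
  hence "cconj y = y" unfolding y_def using Ix(9)[OF x] by (simp add: add.commute)
  hence "snd y = 0" unfolding cconj_real_iff .
  hence y: "y = (fst y, 0)" by (simp add: prod_eq_iff)
  have "fst y \<in> ?V" unfolding Ublk_def using yB y by simp
  moreover have "c (fst y) = z"
   unfolding c_def y[symmetric] unfolding y_def coef_simps
   using coef_chain[OF x x, of 0 0] coef_chain[OF x sxI, of 0 0] sx[symmetric] by simp
  ultimately show ?thesis by blast
 qed
 have bottom: "L v u = 0" if u: "u \<in> ?V" "N u = 0" and v: "c v = 0" for u v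
 proof -
  have uB: "(u, 0) \<in> Blk x" using u(1) unfolding Ublk_def by simp
  have Nu: "cmap N (u, 0) = 0" using u(2) linear_0[OF linear_N] by (simp add: zero_prod_def)
  have part_u: "part y (u, 0) = sc (coef y ?l (u, 0)) (NN ?l (e y))" if y: "y \<in> {x, sig x}" for y
  proof -
   have ly: "len y = ?l" by (rule orbit(3)[OF x y])
   have "coef y j (u, 0) = 0" if "j < ?l" for j
   proof -
    have "coef y j (u, 0) = coef y (Suc j) (cmap N (u, 0))"
     by (rule coef_N[OF orbit(1)[OF x y], symmetric]) (use that ly in simp)
    thus ?thesis unfolding Nu coef_simps .
   qed
   hence "part y (u, 0) = (\<Sum>j\<le>?l. if j = ?l then sc (coef y ?l (u, 0)) (NN ?l (e y)) else 0)"
    unfolding part_def ly by (intro sum.cong refl) auto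
   thus ?thesis by simp
  qed
  have "cbil L (v, 0) (part y (u, 0)) = 0" if y: "y \<in> {x, sig x}" for y
  proof -
   have yI: "y \<in> Ix" and syI: "sig y \<in> Ix" and sy: "sig y \<in> {x, sig x}" and ssy: "sig (sig y) = y"
    using orbit(1,2)[OF x y] Ix(4,5) by blast+
   have "cconj (e (sig y)) = e y" using Ix(9)[OF syI] ssy by simp
   hence "cbil L (v, 0) (NN ?l (e y)) = coef (sig y) 0 (v, 0) * (kco (cnj (lam (sig y))) 0 * eta (sig y))"
    using cL_top[OF syI, of "(v, 0)"] orbit(3)[OF x sy] by simp
   moreover have "coef (sig y) 0 (v, 0) = 0" using sy cs[of v] v unfolding c_def by auto
   ultimately show ?thesis unfolding part_u[OF y] cL_simps by simp
  qed
  hence "cbil L (v, 0) (u, 0) = 0"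
   by (subst Blk_expand[OF uB x]) (simp only: cL_simps sum.neutral_const cong: sum.cong)
  thus ?thesis by (simp add: cbil_real[OF bilinear_L])
 qed
 have V_H: "(v, 0) \<in> H (lam x)" if v: "v \<in> ?V" for v
 proof -
  have vB: "(v, 0) \<in> Blk x" using v unfolding Ublk_def by simp
  have "(v, 0) = part x (v, 0) + part (sig x) (v, 0)" using Blk_expand[OF vB x] sx by simp
  thus ?thesis using addH[OF part_H[OF x, of "(v, 0)"] part_H[OF sxI, of "(v, 0)", unfolded ls]] by simp
 qed
 obtain rho :: real where rho: "rho ~= 0" "!!v. v \<in> ?V ==> T0 v = rho *\<^sub>R Mu v"
 proof -
  have l: "lam x = of_real (Re (lam x))" using lam by (simp add: complex_eq_iff)
  have nz: "Re (lam x) ~= 0" using lam_norm[OF x] l by (metis mult_zero_left of_real_0 zero_neq_one)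
  have "Ms v = Re (lam x) *\<^sub>R v" if v: "v \<in> ?V" for v
  proof -
   have "cmap Ms (v, 0) = sc (of_real (Re (lam x))) (v, 0)" using V_H[OF v] l unfolding in_H by simp
   thus ?thesis unfolding scaleCx_of_real by simp
  qed
  hence "T0 v = ((-1) powi (m + 1) * Re (lam x)) *\<^sub>R Mu v" if v: "v \<in> ?V" for v
   unfolding T0_Mu(1) using v by (simp add: linear_scale[OF jordan(3)])
  thus ?thesis using that[of "(-1) powi (m + 1) * Re (lam x)"] nz by simp
 qed
 have VT: "T0 v \<in> ?V" if "v \<in> ?V" for v
  by (rule T0_stable[OF subspace_Ublk[OF x] Ublk_stable(1,2)[OF x] ndx that])
 have key: "(\<forall>a\<in>A. N a \<in> A) & (A ~= {0} --> (\<exists>a\<in>A. c a ~= 0))"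
  if AB: "subspace A" "A + B = ?V" "!!a b. a \<in> A ==> b \<in> B ==> L a b = 0 & L b a = 0" "0 \<in> B" for A B
 proof -
  have AV: "a \<in> ?V" if "a \<in> A" for a using set_plus_intro[OF that AB(4)] AB(2) by simp
  have TA: "T0 a \<in> A" if a: "a \<in> A" for a
  proof -
   obtain a' b' where ab: "T0 a = a' + b'" "a' \<in> A" "b' \<in> B"
    using VT[OF AV[OF a]] unfolding AB(2)[symmetric] by (rule set_plus_elim)
   have b'V: "b' \<in> ?V" using set_plus_intro[of 0 A b' B] real_vector.subspace_0[OF AB(1)] ab(3) AB(2) by simp
   have b': "b' = T0 a - a'" using ab(1) by simp
   have "L b' v = 0" if v: "v \<in> ?V" for v
   proof -
    obtain a2 b2 where v: "v = a2 + b2" "a2 \<in> A" "b2 \<in> B"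
     using v unfolding AB(2)[symmetric] by (rule set_plus_elim)
    have "L b' b2 = L (T0 a) b2 - L a' b2" unfolding b' bilinear_simps[OF bilinear_L] ..
    also have "... = 0" unfolding L_monodromy using AB(3)[OF a v(3)] AB(3)[OF ab(2) v(3)] by simp
    finally show ?thesis unfolding v(1) bilinear_simps[OF bilinear_L] using AB(3)[OF v(2) ab(3)] by simp
   qed
   hence "b' = 0" using ndx b'V unfolding nondegenerate_on_def by blast
   thus ?thesis using ab by simp
  qed
  have MuA: "Mu a - a \<in> A" if a: "a \<in> A" for a
  proof -
   have "(1 / rho) *\<^sub>R T0 a = Mu a" using rho(2)[OF AV[OF a]] rho(1) by simp
   hence "Mu a \<in> A" using real_vector.subspace_scale[OF AB(1) TA[OF a], of "1 / rho"] by simp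
   thus ?thesis using a by (rule real_vector.subspace_diff[OF AB(1)])
  qed
  have NA: "N a \<in> A" if a: "a \<in> A" for a
  proof -
   have "feval (Suc (dim (UNIV :: 'v set))) (fps_ln 1) (%y. Mu y - y) a \<in> A"
    by (rule feval_in_subspace[OF AB(1) _ a]) (use MuA in blast)
   thus ?thesis unfolding N_eq_log[symmetric] .
  qed
  have "\<exists>a\<in>A. c a ~= 0" if "A ~= {0}"
  proof (rule ccontr)
   assume "\<not> (\<exists>a\<in>A. c a ~= 0)"
   hence c0: "!!a. a \<in> A ==> c a = 0" by blast
   obtain a where a: "a \<in> A" "a ~= 0" using \<open>A ~= {0}\<close> real_vector.subspace_0[OF AB(1)] by blast
   have NpA: "(N ^^ k) a \<in> A" for k by (induction k) (use a(1) NA in simp_all)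
   define k where "k = (LEAST k. (N ^^ k) a = 0)"
   have k0: "(N ^^ k) a = 0" unfolding k_def by (rule LeastI[where P = "%k. (N ^^ k) a = 0", OF N_nilpotent])
   have "k ~= 0"
   proof
    assume "k = 0"
    thus False using k0 a(2) by simp
   qed
   then obtain i where i: "k = Suc i" by (cases k) auto
   have ni: "(N ^^ i) a ~= 0" using not_less_Least[of i "%k. (N ^^ k) a = 0"] unfolding k_def[symmetric] i by simp
   have Ni: "N ((N ^^ i) a) = 0" using k0 unfolding i by simp
   have "L v ((N ^^ i) a) = 0" if v: "v \<in> ?V" for v
   proof -
    obtain a2 b2 where v: "v = a2 + b2" "a2 \<in> A" "b2 \<in> B"
     using v unfolding AB(2)[symmetric] by (rule set_plus_elim)
    show ?thesis unfolding v(1) bilinear_simps[OF bilinear_L]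
     using bottom[OF AV[OF NpA] Ni c0[OF v(2)]] AB(3)[OF NpA[of i] v(3)] by simp
   qed
   hence "(N ^^ i) a = 0" using ndx AV[OF NpA[of i]] unfolding nondegenerate_on_def by blast
   thus False using ni by blast
  qed
  thus ?thesis using NA by blast
 qed
 show ?thesis
  unfolding seifert_irreducible_def
 proof (intro conjI allI impI)
  have "(e x) \<in> Blk x" using chain_in_Blk[of x x 0] by simp
  hence "e x \<in> cplx ?V" unfolding cplx_Ublk[OF x] .
  moreover have "e x ~= 0" using chain_nz[OF x, of 0] by simp
  ultimately show "?V ~= {0}" by (cases "e x") (auto simp: zero_prod_def)
  fix A B assume "subspace A & subspace B & A + B = ?V & A \<inter> B = {0} & (\<forall>a\<in>A. \<forall>b\<in>B. L a b = 0 & L b a = 0)"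
  hence AB: "subspace A" "subspace B" "A + B = ?V" and AB': "\<forall>a\<in>A. \<forall>b\<in>B. L a b = 0 & L b a = 0"
   by - (elim conjE, assumption)+
  note AB = AB AB'[THEN bspec, THEN bspec]
  have BA: "B + A = ?V" "!!b a. b \<in> B ==> a \<in> A ==> L b a = 0 & L a b = 0"
   using AB(3,4) by (simp_all add: add.commute)
  have O: "0 \<in> A" "0 \<in> B" using AB(1,2) real_vector.subspace_0 by blast+
  note kA = key[OF AB(1,3,4) O(2)] and kB = key[OF AB(2) BA O(1)]
  show "A = {0} | B = {0}"
  proof (rule ccontr)
   assume "\<not> (A = {0} | B = {0})"
   then obtain a b where a: "a \<in> A" "c a ~= 0" and b: "b \<in> B" "c b ~= 0" using kA kB by blast
   have AV: "a \<in> ?V" if "a \<in> A" for a using set_plus_intro[OF that O(2)] AB(3) by simp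
   have BV: "b \<in> ?V" if "b \<in> B" for b using set_plus_intro[OF O(1) that] AB(3) by simp
   have orth: "Im (c a' * cnj (c b')) = 0" if "a' \<in> A" "b' \<in> B" for a' b'
   proof -
    have "(N ^^ k) b' \<in> B" for k by (induction k) (use kB that(2) in simp_all)
    hence "L a' ((N ^^ ?l) b') = 0" using AB(4) that(1) by blast
    thus ?thesis using form[OF BV[OF that(2)], of a'] top(2) by simp
   qed
   obtain v where v: "v \<in> ?V" "c v = \<i> * c a" using surj by blast
   obtain a' b' where ab: "v = a' + b'" "a' \<in> A" "b' \<in> B"
    using v(1) unfolding AB(3)[symmetric] by (rule set_plus_elim)
   have "Im (c a * cnj (c v)) = Im (c a * cnj (c a')) + Im (c a * cnj (c b'))"
    unfolding ab(1) c_add by (simp add: algebra_simps)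
   hence i1: "Im (c a * cnj (c a')) = Im (c a * cnj (\<i> * c a))" unfolding v(2) orth[OF a(1) ab(3)] by simp
   have i2: "Im (c a * cnj (\<i> * c a)) = - (norm (c a))\<^sup>2" by (simp add: cmod_def power2_eq_square)
   have r: "c a * cnj (c b) = of_real (Re (c a * cnj (c b)))" "c a' * cnj (c b) = of_real (Re (c a' * cnj (c b)))"
    using orth[OF a(1) b(1)] orth[OF ab(2) b(1)] by (simp_all add: complex_eq_iff)
   have "c a * cnj (c a') * of_real ((norm (c b))\<^sup>2) = (c a * cnj (c b)) * cnj (c a' * cnj (c b))"
    unfolding complex_norm_square by (simp add: mult_ac)
   also have "... = of_real (Re (c a * cnj (c b)) * Re (c a' * cnj (c b)))"
    by (subst r(1), subst r(2)) simp
   finally have "Im (c a * cnj (c a') * of_real ((norm (c b))\<^sup>2)) = 0" by (simp only: Im_complex_of_real)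
   hence "Im (c a * cnj (c a')) * (norm (c b))\<^sup>2 = 0" by (simp only: Im_mult_of_real)
   thus False using i1 i2 a(2) b(2) by simp
  qed
 qed
qed

end

end

section \<open>Signs and eigenvalues attached to a ladder\<close>

lemma i_powi_cis: "\<i> powi z = cis (pi / 2 * of_int z)"
proof -
 have "cis (pi / 2) powi z = cis (of_int z * (pi / 2))" by (rule cis_power_int)
 thus ?thesis by (simp add: mult.commute)
qed

lemma neg_one_powi_cis: "(-1) powi z = cis (pi * of_int z)"
proof -
 have "cis pi powi z = cis (of_int z * pi)" by (rule cis_power_int)
 thus ?thesis by (simp add: mult.commute)
qed

lemma exp_cis: "exp (of_real pi * \<i> / 2 * of_real d) = cis (pi / 2 * d)"
 unfolding cis_conv_exp by (simp add: mult_ac)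

lemma one_minus_cis: "1 - cis (2 * t) = 2 * of_real (sin t) * cis (t - pi / 2)"
proof -
 have "cos (t - pi / 2) = sin t" "sin (t - pi / 2) = - cos t" by (simp_all add: cos_diff sin_diff)
 thus ?thesis
  by (simp add: complex_eq_iff cos_double_sin sin_double power2_eq_square)
qed

lemma ladder_distance_partner: "ladder_distance m al l = al - ladder_partner m al l"
 by (simp add: ladder_distance_def ladder_partner_def)

lemma distance_integer_iff: "ladder_distance m al l \<in> \<int> \<longleftrightarrow> eig al \<in> {1, -1}"
proof
 assume "ladder_distance m al l \<in> \<int>"
 then obtain z where z: "ladder_distance m al l = of_int z" by (rule Ints_cases)
 define y where "y = z - int l - 1 + m"
 have a: "2 * al = of_int y" using z by (simp add: ladder_distance_def y_def)
 show "eig al \<in> {1, -1}"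
 proof (cases "even y")
  case True
  then obtain k where "y = 2 * k" ..
  hence "al = of_int k" using a by simp
  thus ?thesis using eig_eq_1[of al] by simp
 next
  case False
  then obtain k where "y = 2 * k + 1" by (rule oddE)
  hence "al - 1 / 2 = of_int k" using a by simp
  thus ?thesis using eig_eq_minus_1[of al] by simp
 qed
next
 assume "eig al \<in> {1, -1}"
 hence "al \<in> \<int> | al - 1 / 2 \<in> \<int>" using eig_eq_1 eig_eq_minus_1 by blast
 hence "2 * al \<in> \<int>"
 proof
  assume "al - 1 / 2 \<in> \<int>"
  hence "2 * (al - 1 / 2) + 1 \<in> \<int>" by (intro Ints_add Ints_mult) simp_all
  thus ?thesis by simp
 qed (intro Ints_mult, simp_all)
 hence "2 * al + of_int (int l + 1 - m) \<in> \<int>" by (intro Ints_add) simp_all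
 thus "ladder_distance m al l \<in> \<int>" by (simp add: ladder_distance_def algebra_simps)
qed

lemma single_ladder_iff: "single_ladder m al l \<longleftrightarrow> ladder_partner m al l = al"
proof
 assume s: "single_ladder m al l"
 show "ladder_partner m al l = al"
  by (rule eig_floor_inj[of _ _ m])
   (use s partner_pq[of m al l] in \<open>simp_all add: single_ladder_def ladder_p_def\<close>)
next
 assume "ladder_partner m al l = al"
 thus "single_ladder m al l" using partner_pq[of m al l] by (simp add: single_ladder_def)
qed

lemma even_distance_iff: "(\<exists>z::int. ladder_distance m al l = 2 * of_int z) \<longleftrightarrow> star m l (al rmod 2) = al rmod 2"
proof -
 have "star m l (al rmod 2) = ladder_partner m al l rmod 2"
  using star_cong[of "al rmod 2" al m l] by (simp add: star_def)
 hence "star m l (al rmod 2) = al rmod 2 \<longleftrightarrow> (\<exists>z::int. al = ladder_partner m al l + 2 * of_int z)"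
  using rmod2_eq_iff[of al "ladder_partner m al l"] by auto
 thus ?thesis unfolding ladder_distance_partner by (simp add: algebra_simps)
qed

lemma rho_distance:
 assumes "ladder_distance m al l = of_int z"
 shows "(-1) powi (m + 1) * eig al = (-1) powi (int l - z)"
proof -
 have a: "2 * al = of_int (z - int l - 1 + m)" using assms by (simp add: ladder_distance_def)
 have "eig al = cis (- pi * (2 * al))" unfolding eig_cis by (simp add: mult_ac)
 also have "... = cis (pi * of_int (- (z - int l - 1 + m)))" unfolding a by (simp add: algebra_simps)
 also have "... = (-1) powi (- (z - int l - 1 + m))" by (rule neg_one_powi_cis[symmetric])
 finally have "(-1) powi (m + 1) * eig al = (-1) powi ((m + 1) + (- (z - int l - 1 + m)))"
  by (simp only: power_int_add[of "-1 :: complex"] disjI1 zero_neq_neg_one[symmetric] simp_thms not_False_eq_True)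
 also have "(m + 1) + (- (z - int l - 1 + m)) = (int l - z) + 2 * 1" by simp
 also have "(-1) powi (int l - z + 2 * 1) = ((-1) powi (int l - z) :: complex)" by (simp add: power_int_add)
 finally show ?thesis .
qed

lemma rho_even_distance:
 assumes "ladder_distance m al l = 2 * of_int z"
 shows "(-1) powi (m + 1) * eig al = (-1) ^ l"
proof -
 have "ladder_distance m al l = of_int (2 * z)" using assms by simp
 from rho_distance[OF this] have "(-1) powi (m + 1) * eig al = (-1) powi (int l - 2 * z)" .
 also have "int l - 2 * z = int l + 2 * - z" by simp
 also have "(-1) powi (int l + 2 * - z) = ((-1) powi (int l) * (-1) powi (2 * - z) :: complex)"
  by (rule power_int_add) simp
 also have "(-1) powi (2 * - z) = (1 :: complex)" unfolding power_int_mult by simp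
 finally show ?thesis by simp
qed

lemma rho_odd_distance:
 assumes "ladder_distance m al l = 2 * of_int z + 1"
 shows "(-1) powi (m + 1) * eig al = (-1) ^ (l + 1)"
proof -
 have "ladder_distance m al l = of_int (2 * z + 1)" using assms by simp
 from rho_distance[OF this] have "(-1) powi (m + 1) * eig al = (-1) powi (int l - (2 * z + 1))" .
 also have "int l - (2 * z + 1) = int (l + 1) + 2 * (- z - 1)" by simp
 also have "(-1) powi (int (l + 1) + 2 * (- z - 1)) = ((-1) powi int (l + 1) * (-1) powi (2 * (- z - 1)) :: complex)"
  by (rule power_int_add) simp
 also have "(-1) powi (2 * (- z - 1)) = (1 :: complex)" unfolding power_int_mult by simp
 finally show ?thesis by (simp only: power_int_of_nat mult_1_right)
qed

lemma zeta_square: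
 "(cis (pi / 2 * ladder_distance m al l))\<^sup>2 = cnj ((-1) powi (m + 1) * eig al) * (-1) ^ (l + 2)"
proof -
 have c: "cnj ((-1) powi (m + 1) :: complex) = (-1) powi (m + 1)" by simp
 have "(-1) powi (m + 1) * (-1) ^ (l + 2) = ((-1) powi (m + 1) * (-1) powi (int (l + 2)) :: complex)"
  by (simp only: power_int_of_nat)
 also have "... = (-1) powi (m + 1 + int (l + 2))" by (rule power_int_add[symmetric]) simp
 also have "m + 1 + int (l + 2) = (int l + 1 - m) + 2 * (m + 1)" by simp
 also have "(-1) powi ((int l + 1 - m) + 2 * (m + 1)) = ((-1) powi (int l + 1 - m) * (-1) powi (2 * (m + 1)) :: complex)"
  by (rule power_int_add) simp
 also have "(-1) powi (2 * (m + 1)) = (1 :: complex)" unfolding power_int_mult by simp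
 finally have s: "(-1) powi (m + 1) * (-1) ^ (l + 2) = cis (pi * of_int (int l + 1 - m))"
  unfolding neg_one_powi_cis[symmetric] by simp
 have "cnj ((-1) powi (m + 1) * eig al) * (-1) ^ (l + 2) = cnj (eig al) * ((-1) powi (m + 1) * (-1) ^ (l + 2))"
  unfolding complex_cnj_mult c by (simp only: mult_ac)
 also have "... = cis (2 * pi * al + pi * of_int (int l + 1 - m))"
  unfolding s eig_cis by (simp add: cis_cnj cis_mult)
 also have "2 * pi * al + pi * of_int (int l + 1 - m) = pi / 2 * ladder_distance m al l + pi / 2 * ladder_distance m al l"
  by (simp add: ladder_distance_def algebra_simps)
 finally show ?thesis unfolding power2_eq_square cis_mult ..
qed

context steenbrink
begin

theorem top_in_ray: "kco (cnj (eig al)) 0 * etaf m al l \<in> ray (cis (pi / 2 * ladder_distance m al l))"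
proof (cases "eig al = 1")
 case True
 hence "al \<in> \<int>" unfolding eig_eq_1 .
 then obtain n where n: "al = of_int n" by (rule Ints_cases)
 have p: "ladder_p m al = m - n" unfolding ladder_p_def n of_int_diff[symmetric] floor_of_int ..
 have "etaf m al l = cis (pi / 2 * of_int (2 * n + int l + 1 - m))"
  unfolding etaf_def i_powi_cis ladder_q_def p theta_def using True by (simp add: algebra_simps)
 also have "of_int (2 * n + int l + 1 - m) = ladder_distance m al l" by (simp add: ladder_distance_def n)
 finally have "kco (cnj (eig al)) 0 * etaf m al l = cis (pi / 2 * ladder_distance m al l) * of_real 1"
  using True by (simp add: kco_0)
 thus ?thesis unfolding ray_def by (intro CollectI exI[of _ 1]) simp
next
 case False
 define p where "p = ladder_p m al"
 define f where "f = of_int m - al - of_int p"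
 have f: "0 \<le> f" "f < 1" unfolding f_def p_def ladder_p_def by linarith+
 have "f ~= 0"
 proof
  assume "f = 0"
  hence "al = of_int (m - p)" unfolding f_def by simp
  hence "eig al = 1" unfolding eig_eq_1 by (simp only: Ints_of_int)
  thus False using False by simp
 qed
 hence f: "0 < f" "f < 1" using f by simp_all
 define k where "k = m - p - 1"
 have a: "al = of_int k + (1 - f)" unfolding f_def k_def by simp
 have sk: "sin (pi * of_int k) = 0" by (simp add: sin_zero_iff_int2 mult.commute)
 have ck: "cos (pi * of_int k) * cos (pi * of_int k) = 1"
  using sin_cos_squared_add[of "pi * of_int k"] sk by (simp add: power2_eq_square)
 have "sin (pi * al) = sin (pi * of_int k + (pi - pi * f))" unfolding a by (simp add: algebra_simps)
 also have "... = cos (pi * of_int k) * sin (pi * f)" unfolding sin_add sk by simp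
 finally have s: "sin (pi * al) = cos (pi * of_int k) * sin (pi * f)" .
 have cisk: "cis (pi * of_int k) = of_real (cos (pi * of_int k))" using sk by (simp add: complex_eq_iff)
 have pos: "2 * sin (pi * f) > 0" using f by (simp add: sin_gt_zero)
 have "kco (cnj (eig al)) 0 = 1 - cis (2 * (pi * al))"
 proof -
  have "cnj (eig al) ~= 1" using False by (metis complex_cnj_cnj complex_cnj_one)
  thus ?thesis unfolding kco_0 eig_cis by (simp add: cis_cnj mult_ac)
 qed
 hence "kco (cnj (eig al)) 0 * etaf m al l =
   2 * of_real (sin (pi * al)) * (cis (pi * al - pi / 2) * cis (pi / 2 * of_int (m + int l - 2 * p)))"
  unfolding one_minus_cis etaf_def i_powi_cis ladder_q_def theta_def p_def[symmetric] using False by (simp add: mult.assoc)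
 also have "cis (pi * al - pi / 2) * cis (pi / 2 * of_int (m + int l - 2 * p)) = cis (pi / 2 * ladder_distance m al l + pi * of_int k)"
  unfolding cis_mult by (rule arg_cong[of _ _ cis]) (simp add: ladder_distance_def k_def field_simps)
 also have "... = cis (pi / 2 * ladder_distance m al l) * of_real (cos (pi * of_int k))"
  unfolding cisk[symmetric] cis_mult ..
 also have "2 * of_real (sin (pi * al)) * (cis (pi / 2 * ladder_distance m al l) * of_real (cos (pi * of_int k)))
   = cis (pi / 2 * ladder_distance m al l) * of_real (2 * sin (pi * f) * (cos (pi * of_int k) * cos (pi * of_int k)))"
  unfolding s of_real_mult by (simp only: mult_ac of_real_numeral)
 finally show ?thesis unfolding ck mult_1_right ray_def using pos by blast
qed

section \<open>Counting the blocks\<close>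

context
 fixes c assumes c: "ladder_ordering m F W M c"
begin

definition nblk :: "real => nat => nat" where
 "nblk al l = (if \<not> single_ladder m al l & (\<exists>z::int. ladder_distance m al l = 2 * of_int z) then 2 * c al l else c al l)"

lemma ordering: "if single_ladder m al l then c al l = lmult al l
  else c al l + c (ladder_partner m al l) l = lmult al l"
 using c unfolding ladder_ordering_def by (auto split: if_splits)

lemma single_partner: "single_ladder m (ladder_partner m al l) l \<longleftrightarrow> single_ladder m al l"
 unfolding single_ladder_iff by auto

lemma mult_partner: "lmult (ladder_partner m al l) l = lmult al l"
 using ordering[of al l] ordering[of "ladder_partner m al l" l] single_partner[of al l]
 by (auto simp: single_ladder_iff split: if_splits)

lemma nblk_mult: "nblk al l ~= 0 ==> lmult al l ~= 0"
proof -
 assume n: "nblk al l ~= 0"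
 have "nblk al l = 0" if "c al l = 0" unfolding nblk_def that by simp
 hence "c al l ~= 0" using n by blast
 thus ?thesis using ordering[of al l] by (cases "single_ladder m al l") simp_all
qed

definition lads :: "real => nat => real set" where
 "lads be l = {al. al rmod 2 = be rmod 2 & lmult al l ~= 0}"

lemma lads_subset: "lads be l \<subseteq> cls be"
 unfolding lads_def cls_def using ladder_mult_specs by blast

lemma finite_lads: "finite (lads be l)"
 by (rule finite_subset[OF lads_subset finite_cls])

lemma gcount_lads: "gcount be l = (\<Sum>al\<in>lads be l. lmult al l)"
 unfolding gcount_def
proof (rule sum.mono_neutral_right[OF finite_cls lads_subset])
 show "\<forall>al\<in>cls be - lads be l. lmult al l = 0" unfolding lads_def cls_def by blast
qed

lemma partner_lads:
 assumes "al \<in> lads be l" shows "ladder_partner m al l \<in> lads (star m l be) l"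
proof -
 have "star m l al = star m l be" using assms unfolding lads_def by (intro star_cong) blast
 hence "ladder_partner m al l rmod 2 = star m l be rmod 2" unfolding star_def by simp
 thus ?thesis using assms mult_partner unfolding lads_def by simp
qed

lemma lads_cong: "al rmod 2 = be rmod 2 ==> lads al l = lads be l"
 unfolding lads_def by simp

lemma sum_partner: "(\<Sum>al\<in>lads (star m l be) l. h al) = (\<Sum>al\<in>lads be l. h (ladder_partner m al l))"
proof (rule sum.reindex_bij_witness[of _ "%al. ladder_partner m al l" "%al. ladder_partner m al l"])
 show "ladder_partner m al l \<in> lads be l" if "al \<in> lads (star m l be) l" for al
  using partner_lads[OF that] lads_cong[of "star m l (star m l be)" be l] unfolding star_star by simp
 show "ladder_partner m al l \<in> lads (star m l be) l" if "al \<in> lads be l" for al by (rule partner_lads[OF that])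
qed simp_all

definition Tset :: "nat => real set => (real \<times> nat) set" where
 "Tset l K = {(al, i). al rmod 2 \<in> K & i < nblk al l}"

lemma card_Tset:
 assumes b: "be rmod 2 = be"
 shows "finite (Tset l {be, star m l be}) & card (Tset l {be, star m l be}) = gcount be l"
proof -
 let ?A = "lads be l \<union> lads (star m l be) l"
 have T: "Tset l {be, star m l be} = (SIGMA al:?A. {..<nblk al l})"
 proof (rule set_eqI, clarify)
  fix al i
  have "al rmod 2 \<in> {be, star m l be} & i < nblk al l \<longleftrightarrow> al \<in> ?A & i < nblk al l"
   using nblk_mult[of al l] b star_range(3)[of m l be] unfolding lads_def by auto
  thus "(al, i) \<in> Tset l {be, star m l be} \<longleftrightarrow> (al, i) \<in> (SIGMA al:?A. {..<nblk al l})"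
   unfolding Tset_def by simp
 qed
 have fin: "finite ?A" using finite_lads by simp
 have card: "card (Tset l {be, star m l be}) = (\<Sum>al\<in>?A. nblk al l)" unfolding T using fin by simp
 have "(\<Sum>al\<in>?A. nblk al l) = gcount be l"
 proof (cases "star m l be = be")
  case True
  have even: "\<exists>z::int. ladder_distance m al l = 2 * of_int z" if "al \<in> lads be l" for al
   unfolding even_distance_iff using that True b unfolding lads_def by simp
  have pair: "nblk al l + nblk (ladder_partner m al l) l = 2 * lmult al l" if al: "al \<in> lads be l" for al
  proof (cases "single_ladder m al l")
   case True
   hence "ladder_partner m al l = al" unfolding single_ladder_iff .
   thus ?thesis using True ordering[of al l] unfolding nblk_def by simp
  next
   case False
   have "ladder_partner m al l \<in> lads be l" using partner_lads[OF al] True by simp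
   thus ?thesis using False single_partner[of al l] ordering[of al l] even[OF al] even unfolding nblk_def by simp
  qed
  have "2 * (\<Sum>al\<in>lads be l. nblk al l) = (\<Sum>al\<in>lads be l. nblk al l) + (\<Sum>al\<in>lads be l. nblk (ladder_partner m al l) l)"
   using sum_partner[of "%al. nblk al l" l be] True by simp
  also have "... = (\<Sum>al\<in>lads be l. 2 * lmult al l)"
   unfolding sum.distrib[symmetric] by (intro sum.cong refl pair)
  also have "... = 2 * gcount be l" unfolding gcount_lads sum_distrib_left ..
  finally show ?thesis using True by simp
 next
  case False
  have odd: "\<not> (\<exists>z::int. ladder_distance m al l = 2 * of_int z)" if "al \<in> ?A" for al
  proof -
   have "al rmod 2 = be | al rmod 2 = star m l be" using that b star_range(3)[of m l be] unfolding lads_def by auto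
   thus ?thesis unfolding even_distance_iff using False star_star[of m l be] b by auto
  qed
  have nc: "nblk al l = c al l" if "al \<in> ?A" for al unfolding nblk_def using odd[OF that] by simp
  have ns: "\<not> single_ladder m al l" if "al \<in> ?A" for al
  proof
   assume "single_ladder m al l"
   hence "ladder_distance m al l = 2 * of_int 0" unfolding single_ladder_iff ladder_distance_partner by simp
   thus False using odd[OF that] by blast
  qed
  have "lads be l \<inter> lads (star m l be) l = {}" using False b star_range(3)[of m l be] unfolding lads_def by auto
  hence "(\<Sum>al\<in>?A. nblk al l) = (\<Sum>al\<in>lads be l. nblk al l) + (\<Sum>al\<in>lads (star m l be) l. nblk al l)"
   by (rule sum.union_disjoint[OF finite_lads finite_lads])
  also have "... = (\<Sum>al\<in>lads be l. nblk al l + nblk (ladder_partner m al l) l)"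
   unfolding sum_partner sum.distrib ..
  also have "... = (\<Sum>al\<in>lads be l. lmult al l)"
  proof (rule sum.cong[OF refl])
   fix al assume al: "al \<in> lads be l"
   have p: "ladder_partner m al l \<in> ?A" using partner_lads[OF al] by simp
   show "nblk al l + nblk (ladder_partner m al l) l = lmult al l"
    using nc[OF p] nc[of al] ns[of al] al ordering[of al l] by simp
  qed
  finally show ?thesis unfolding gcount_lads .
 qed
 moreover have "finite (Tset l {be, star m l be})" unfolding T using fin by simp
 ultimately show ?thesis using card by simp
qed

definition num :: "nat => real set => real \<times> nat => nat" where
 "num l K = (SOME h. bij_betw h (Tset l K) {..<card (Tset l K)})"

lemma bij_num:
 assumes b: "be rmod 2 = be"
 shows "bij_betw (num l {be, star m l be}) (Tset l {be, star m l be}) {..<gcount be l}"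
proof -
 have "\<exists>h. bij_betw h (Tset l {be, star m l be}) {..<card (Tset l {be, star m l be})}"
  by (rule finite_same_card_bij) (use card_Tset[OF b] in simp_all)
 hence "bij_betw (num l {be, star m l be}) (Tset l {be, star m l be}) {..<card (Tset l {be, star m l be})}"
  unfolding num_def by (rule someI_ex)
 thus ?thesis using card_Tset[OF b, of l] by simp
qed

definition chain_of :: "real \<times> nat \<times> nat => real \<times> nat \<times> nat" where
 "chain_of j = (case j of (al, l, i) => (al rmod 2, l, num l {al rmod 2, star m l (al rmod 2)} (al, i)))"

definition blks :: "(real \<times> nat \<times> nat) set" where "blks = {(al, l, i). i < nblk al l}"

lemma chain_of_idx:
 assumes "j \<in> blks" shows "chain_of j \<in> idx"
proof -
 obtain al l i where j: "j = (al, l, i)" by (rule prod_cases3)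
 have i: "i < nblk al l" using assms unfolding j blks_def by simp
 let ?be = "al rmod 2"
 have b: "?be rmod 2 = ?be" by simp
 have "(al, i) \<in> Tset l {?be, star m l ?be}" unfolding Tset_def using i by simp
 hence "num l {?be, star m l ?be} (al, i) < gcount ?be l" using bij_betwE[OF bij_num[OF b]] by blast
 thus ?thesis unfolding j chain_of_def idx_def by simp
qed

lemma chain_of_unique:
 assumes x: "x \<in> idx"
 shows "\<exists>!j. j \<in> blks & (chain_of j = x | chain_of j = xsig x)"
proof -
 obtain be l n where xe: "x = (be, l, n)" by (rule prod_cases3)
 have b: "be rmod 2 = be" and n: "n < gcount be l" using x unfolding xe idx_def by simp_all
 let ?K = "{be, star m l be}"
 have sx: "xsig x = (star m l be, l, n)" unfolding xe xsig_def by simp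
 have K: "{ga, star m l ga} = ?K" if "ga \<in> ?K" for ga using that star_star[of m l be] b by auto
 note bij = bij_num[OF b, of l]
 obtain t where t: "t \<in> Tset l ?K" "num l ?K t = n" using bij n unfolding bij_betw_def by (metis imageE lessThan_iff)
 obtain al i where te: "t = (al, i)" by (cases t)
 have ti: "al rmod 2 \<in> ?K" "i < nblk al l" using t(1) unfolding te Tset_def by simp_all
 show ?thesis
 proof (rule ex1I)
  have "chain_of (al, l, i) = (al rmod 2, l, n)" unfolding chain_of_def using K[OF ti(1)] t(2) te by simp
  thus "(al, l, i) \<in> blks & (chain_of (al, l, i) = x | chain_of (al, l, i) = xsig x)"
   using ti unfolding blks_def xe sx[unfolded xe] by auto
  fix j assume j: "j \<in> blks & (chain_of j = x | chain_of j = xsig x)"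
  obtain al' l' i' where je: "j = (al', l', i')" by (rule prod_cases3)
  have l': "l' = l" and r: "al' rmod 2 \<in> ?K" and n': "num l' {al' rmod 2, star m l' (al' rmod 2)} (al', i') = n"
   using j unfolding je chain_of_def xe sx[unfolded xe] by auto
  have "num l ?K (al', i') = n" using n' K[OF r] unfolding l' by simp
  moreover have "(al', i') \<in> Tset l ?K" using r j unfolding je l' blks_def Tset_def by simp
  ultimately have "(al', i') = t"
   using bij_betw_imp_inj_on[OF bij] t by (auto dest: inj_onD)
  thus "j = (al, l, i)" unfolding je te l' by simp
 qed
qed

lemma finite_blks: "finite blks"
proof (rule inj_on_finite[OF _ _ finite_idx])
 show "chain_of ` blks \<subseteq> idx" using chain_of_idx by blast
 show "inj_on chain_of blks"
 proof (rule inj_onI)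
  fix i j assume ij: "i \<in> blks" "j \<in> blks" "chain_of i = chain_of j"
  show "i = j" using chain_of_unique[OF chain_of_idx[OF ij(2)]] ij by auto
 qed
qed

theorem decomposition:
 "\<exists>U :: real => nat => nat => 'v set.
   orthogonal_decomposition UNIV L {(al, l, i). i < nblk al l} (%(al, l, i). U al l i) &
   (\<forall>al l. c al l > 0 -->
    (let mu = eig al; rho = (-1) powi (m + 1) * mu; d = ladder_distance m al l in
     (d \<in> \<int> \<longleftrightarrow> mu \<in> {1, -1}) &
     (single_ladder m al l --> d = 0) &
     (mu \<notin> {1, -1} -->
      (\<forall>i < nblk al l. seif_2c rho (l + 1) (exp (of_real pi * \<i> / 2 * of_real d)) (U al l i) L)) &
     (\<forall>z::int. d = 2 * of_int z + 1 -->
      rho = (-1) ^ (l + 1) &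
      (\<forall>i < nblk al l. seif_2 rho (l + 1) (U al l i) L & seifert_irreducible (U al l i) L)) &
     (\<forall>z::int. d = 2 * of_int z -->
      rho = (-1) ^ l &
      (\<forall>i < nblk al l. seif_1 rho (l + 1) ((-1) powi z) (U al l i) L))))"
proof -
 obtain e where cf: "chain_family idx xlam xlen xeta xsig e" and oc: "orthogonal_chains idx xlen xeta e"
  using normal_form by blast
 interpret ch: chains m F W M S idx xlam xlen xeta xsig e
  by (intro chains.intro chains_axioms.intro steenbrink_axioms cf oc)
 define U where "U al l i = ch.Ublk (chain_of (al, l, i))" for al l i
 have Ueq: "(%(al, l, i). U al l i) = (%j. ch.Ublk (chain_of j))"
  unfolding U_def by (rule ext) (simp split: prod.split)
 have od: "orthogonal_decomposition UNIV L {(al, l, i). i < nblk al l} (%(al, l, i). U al l i)"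
  unfolding Ueq blks_def[symmetric]
  by (rule ch.block_decomposition[OF finite_blks chain_of_idx chain_of_unique])
 have nd: "nondegenerate_on (ch.Ublk (chain_of j)) L" if "j \<in> blks" for j
  by (rule ch.R_nondegenerate[OF finite_blks chain_of_idx chain_of_unique that])
 have x: "chain_of (al, l, i) \<in> idx" "nondegenerate_on (U al l i) L"
  "xlam (chain_of (al, l, i)) = eig al" "xlen (chain_of (al, l, i)) = l" "xeta (chain_of (al, l, i)) = etaf m al l"
  "xsig (chain_of (al, l, i)) = chain_of (al, l, i) \<longleftrightarrow> (\<exists>z::int. ladder_distance m al l = 2 * of_int z)"
  if i: "i < nblk al l" for al l i
 proof -
  have j: "(al, l, i) \<in> blks" unfolding blks_def using i by simp
  show "chain_of (al, l, i) \<in> idx" "nondegenerate_on (U al l i) L" unfolding U_def by (rule chain_of_idx[OF j], rule nd[OF j])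
  show "xlam (chain_of (al, l, i)) = eig al" "xeta (chain_of (al, l, i)) = etaf m al l" "xlen (chain_of (al, l, i)) = l"
   unfolding chain_of_def xlam_def xeta_def xlen_def
   using eig_cong[of "al rmod 2" al] etaf_cong[of "al rmod 2" al m l] by simp_all
  show "xsig (chain_of (al, l, i)) = chain_of (al, l, i) \<longleftrightarrow> (\<exists>z::int. ladder_distance m al l = 2 * of_int z)"
   unfolding even_distance_iff chain_of_def xsig_def by simp
 qed
 have top: "kco (cnj (xlam (chain_of (al, l, i)))) 0 * xeta (chain_of (al, l, i)) \<in> ray (cis (pi / 2 * ladder_distance m al l))"
  if "i < nblk al l" for al l i
  unfolding x(3,5)[OF that] by (rule top_in_ray)
 have A: "seif_2c ((-1) powi (m + 1) * eig al) (l + 1) (exp (of_real pi * \<i> / 2 * of_real (ladder_distance m al l))) (U al l i) L"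
  if i: "i < nblk al l" and e: "eig al \<notin> {1, -1}" for al l i
 proof -
  let ?\<zeta> = "cis (pi / 2 * ladder_distance m al l)"
  have "?\<zeta>\<^sup>2 ~= 1"
  proof
   assume "?\<zeta>\<^sup>2 = 1"
   hence z: "cnj ((-1) powi (m + 1) * eig al) * (-1) ^ (l + 2) = 1" unfolding zeta_square .
   have pm: "(-1) powi (m + 1) = (1 :: complex) | (-1) powi (m + 1) = (-1 :: complex)"
    using sign_sq[of "m + 1", where ?'a = complex] square_eq_1_iff[of "(-1) powi (m + 1) :: complex"] by blast
   have "(-1) ^ (l + 2) * (-1) ^ (l + 2) = (1 :: complex)" unfolding power_mult_distrib[symmetric] by simp
   hence "(-1) ^ (l + 2) = (1 :: complex) | (-1) ^ (l + 2) = (-1 :: complex)"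
    using square_eq_1_iff[of "(-1) ^ (l + 2) :: complex"] by blast
   hence "cnj (eig al) = 1 | cnj (eig al) = -1" using z pm by (auto simp: minus_equation_iff)
   hence "eig al = 1 | eig al = -1" by (metis complex_cnj_cnj complex_cnj_one complex_cnj_minus)
   thus False using e by blast
  qed
  hence \<zeta>: "?\<zeta> \<in> sphere 0 1 - {1, -1}" by auto
  show ?thesis
   unfolding exp_cis
   using ch.seif_2c_Ublk[OF x(1)[OF i] x(2)[OF i, unfolded U_def] _ \<zeta> _ top[OF i]] e zeta_square[of m al l]
   unfolding x(3,4)[OF i] U_def by blast
 qed
 have B: "(-1) powi (m + 1) * eig al = (-1) ^ (l + 1) & seif_2 ((-1) powi (m + 1) * eig al) (l + 1) (U al l i) L &
   seifert_irreducible (U al l i) L"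
  if i: "i < nblk al l" and d: "ladder_distance m al l = 2 * of_int z + 1" for al l i z
 proof -
  have ns: "xsig (chain_of (al, l, i)) ~= chain_of (al, l, i)"
  proof
   assume "xsig (chain_of (al, l, i)) = chain_of (al, l, i)"
   then obtain y :: int where "ladder_distance m al l = 2 * of_int y" unfolding x(6)[OF i] ..
   hence "of_int (2 * y) = (of_int (2 * z + 1) :: real)" using d by simp
   hence "2 * y = 2 * z + 1" by (simp only: of_int_eq_iff)
   thus False by presburger
  qed
  have "ladder_distance m al l \<in> \<int>" unfolding d by simp
  hence "eig al = 1 | eig al = -1" unfolding distance_integer_iff by blast
  hence lam: "cnj (eig al) = eig al" by auto
  note rho = rho_odd_distance[OF d]
  have c: "cis (pi / 2 * ladder_distance m al l) = \<i> * (-1) powi z"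
  proof -
   have "pi / 2 * ladder_distance m al l = pi * of_int z + pi / 2" unfolding d by (simp add: algebra_simps)
   thus ?thesis by (simp add: neg_one_powi_cis cis_mult[symmetric] mult.commute)
  qed
  obtain r where r: "r > 0" "kco (cnj (eig al)) 0 * etaf m al l = \<i> * (-1) powi z * of_real r"
   using top_in_ray[of al l] unfolding c ray_def by blast
  have s: "kco (cnj (eig al)) 0 * etaf m al l = \<i> * of_real ((-1) powi z * r)" "(-1) powi z * r ~= 0"
   using r by simp_all
  show ?thesis
   using ch.seif_2_Ublk[OF x(1)[OF i] x(2)[OF i, unfolded U_def] ns]
    ch.irreducible_Ublk[OF x(1)[OF i] x(2)[OF i, unfolded U_def] ns] lam rho s
   unfolding x(3,4,5)[OF i] U_def by blast
 qed
 have C: "seif_1 ((-1) powi (m + 1) * eig al) (l + 1) ((-1) powi z) (U al l i) L"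
  if i: "i < nblk al l" and d: "ladder_distance m al l = 2 * of_int z" for al l i z
 proof -
  have s: "xsig (chain_of (al, l, i)) = chain_of (al, l, i)" unfolding x(6)[OF i] using d by blast
  have c: "cis (pi / 2 * ladder_distance m al l) = of_real ((-1) powi z)"
  proof -
   have "pi / 2 * ladder_distance m al l = pi * of_int z" unfolding d by simp
   thus ?thesis by (simp add: neg_one_powi_cis)
  qed
  have "(-1) powi z = (1 :: real) | (-1) powi z = (-1 :: real)"
   using sign_sq[of z, where ?'a = real] square_eq_1_iff[of "(-1) powi z :: real"] by blast
  hence pm: "(-1) powi z \<in> {1, -1 :: real}" by blast
  show ?thesis
   using ch.seif_1_Ublk[OF x(1)[OF i] x(2)[OF i, unfolded U_def] s _ pm top[OF i, unfolded c]] rho_even_distance[OF d]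
   unfolding x(3,4)[OF i] U_def by blast
 qed
 show ?thesis
  unfolding Let_def
 proof (intro exI[of _ U] conjI allI impI od distance_integer_iff)
  fix al l assume "c al l > 0"
  show "ladder_distance m al l = 0" if "single_ladder m al l"
   using that unfolding single_ladder_iff ladder_distance_partner by simp
  show "seif_2c ((-1) powi (m + 1) * eig al) (l + 1) (exp (of_real pi * \<i> / 2 * of_real (ladder_distance m al l))) (U al l i) L"
   if "eig al \<notin> {1, -1}" "i < nblk al l" for i by (rule A[OF that(2,1)])
  show "(-1) powi (m + 1) * eig al = (-1) ^ (l + 1)" if "ladder_distance m al l = 2 * of_int z + 1" for z
   by (rule rho_odd_distance[OF that])
  show "seif_2 ((-1) powi (m + 1) * eig al) (l + 1) (U al l i) L" "seifert_irreducible (U al l i) L"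
   if "ladder_distance m al l = 2 * of_int z + 1" "i < nblk al l" for i z using B[OF that(2,1)] by blast+
  show "(-1) powi (m + 1) * eig al = (-1) ^ l" if "ladder_distance m al l = 2 * of_int z" for z
   by (rule rho_even_distance[OF that])
  show "seif_1 ((-1) powi (m + 1) * eig al) (l + 1) ((-1) powi z) (U al l i) L"
   if "ladder_distance m al l = 2 * of_int z" "i < nblk al l" for i z by (rule C[OF that(2,1)])
 qed
qed

end

end

section \<open>Isomorphism classes of the Seifert form\<close>

context chains
begin

lemma expand: "v = (\<Sum>x\<in>Ix. \<Sum>j\<le>len x. sc (coef x j v) (NN j (e x)))"
 using sum_part[of v] unfolding part_def by (rule sym)

lemma coef_Npow:
 assumes "x \<in> Ix" "k \<le> j" "j \<le> len x"
 shows "coef x j (NN k v) = coef x (j - k) v"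
 using assms(2,3)
proof (induction k arbitrary: v)
 case (Suc k)
 have "coef x j ((cmap N ^^ Suc k) v) = coef x j (NN k (cmap N v))" unfolding funpow_Suc_right o_apply ..
 also have "... = coef x (j - k) (cmap N v)" by (rule Suc.IH) (use Suc.prems in simp_all)
 also have "j - k = Suc (j - Suc k)" using Suc.prems by simp
 also have "coef x (Suc (j - Suc k)) (cmap N v) = coef x (j - Suc k) v"
  by (rule coef_N[OF assms(1)]) (use Suc.prems in simp)
 finally show ?case .
qed simp

lemma coef_H:
 assumes "x \<in> Ix" "v \<in> H mu" "lam x ~= mu"
 shows "coef x j v = 0"
proof -
 have "mu * cnj (lam x) ~= 1"
 proof
  assume "mu * cnj (lam x) = 1"
  hence "lam x = mu * (lam x * cnj (lam x))" by (simp add: mult_ac)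
  thus False using lam_norm[OF assms(1)] assms(3) by simp
 qed
 moreover have "NN (len x - j) (cconj (e x)) \<in> H (cnj (lam x))"
  using Ix(1)[OF assms(1)] by (intro Npow_H) (simp add: cconj_H)
 ultimately show ?thesis unfolding coef_def using cS_orthogonal[OF assms(2)] by simp
qed

lemma length_form:
 assumes v: "v \<in> H mu" "(cmap N ^^ Suc l) v = 0"
 shows "cbil L v (NN l (cconj v)) =
  (\<Sum>x\<in>{x \<in> Ix. lam x = mu & len x = l}. of_real ((norm (coef x 0 v))\<^sup>2) * (kco (cnj mu) 0 * eta x))"
proof -
 let ?u = "NN l v"
 have Nu: "cmap N ?u = 0" using v(2) by simp
 have cu: "coef x j ?u = 0" if "x \<in> Ix" "j < len x" for x j
  using coef_N[OF that, of ?u] unfolding Nu coef_simps by simp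
 have "?u = (\<Sum>x\<in>Ix. sc (coef x (len x) ?u) ((cmap N ^^ len x) (e x)))"
 proof -
  have "(\<Sum>j\<le>len x. sc (coef x j ?u) (NN j (e x))) = sc (coef x (len x) ?u) ((cmap N ^^ len x) (e x))"
   if x: "x \<in> Ix" for x
  proof -
   have "(\<Sum>j\<le>len x. sc (coef x j ?u) (NN j (e x))) =
     (\<Sum>j\<le>len x. if j = len x then sc (coef x (len x) ?u) ((cmap N ^^ len x) (e x)) else 0)"
    by (rule sum.cong[OF refl]) (use cu[OF x] in auto)
   thus ?thesis by simp
  qed
  hence "(\<Sum>x\<in>Ix. \<Sum>j\<le>len x. sc (coef x j ?u) (NN j (e x))) =
    (\<Sum>x\<in>Ix. sc (coef x (len x) ?u) ((cmap N ^^ len x) (e x)))" by (rule sum.cong[OF refl])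
  thus ?thesis using expand[of ?u] by simp
 qed
 hence "cconj ?u = cconj (\<Sum>x\<in>Ix. sc (coef x (len x) ?u) ((cmap N ^^ len x) (e x)))"
  by (rule arg_cong)
 also have "... = (\<Sum>x\<in>Ix. sc (cnj (coef x (len x) ?u)) ((cmap N ^^ len x) (cconj (e x))))"
  unfolding cconj_sum cconj_scaleCx Npow_cconj ..
 finally have "cbil L v (cconj ?u) = cbil L v (\<Sum>x\<in>Ix. sc (cnj (coef x (len x) ?u)) ((cmap N ^^ len x) (cconj (e x))))"
  by (rule arg_cong)
 hence "cbil L v (NN l (cconj v)) =
   (\<Sum>x\<in>Ix. cnj (coef x (len x) ?u) * cbil L v ((cmap N ^^ len x) (cconj (e x))))"
  unfolding Npow_cconj by (simp only: cL_simps)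
 also have "... = (\<Sum>x\<in>Ix. if lam x = mu & len x = l then of_real ((norm (coef x 0 v))\<^sup>2) * (kco (cnj mu) 0 * eta x) else 0)"
 proof (rule sum.cong[OF refl])
  fix x assume x: "x \<in> Ix"
  have "cnj (coef x (len x) ?u) * coef x 0 v = (if lam x = mu & len x = l then of_real ((norm (coef x 0 v))\<^sup>2) else 0)"
  proof -
   consider "lam x ~= mu" | "lam x = mu" "len x = l" | "len x < l" | "l < len x" by linarith
   thus ?thesis
   proof cases
    case 1
    thus ?thesis using coef_H[OF x v(1)] by simp
   next
    case 2
    thus ?thesis using coef_Npow[OF x, of l l v] unfolding complex_norm_square by (simp add: mult.commute)
   next
    case 3
    have "?u = (cmap N ^^ len x) (NN (l - len x) v)" using 3 by (simp flip: funpow_add o_apply[of "cmap N ^^ len x"])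
    hence "coef x (len x) ?u = coef x 0 (NN (l - len x) v)" using coef_Npow[OF x, of "len x" "len x"] by simp
    moreover have "coef x 0 (NN (l - len x) v) = 0"
    proof -
     have "cbil S (NN (l - len x) v) ((cmap N ^^ len x) (cconj (e x)))
       = (-1) ^ (l - len x) * cbil S v (NN (l - len x + len x) (cconj (e x)))"
      unfolding cS_Npow funpow_add o_apply ..
     moreover have "NN (l - len x + len x) (cconj (e x)) = 0"
      unfolding Npow_cconj using kill[OF x, of "l - len x + len x"] 3 by simp
     ultimately show ?thesis unfolding coef_def by (simp add: cS_simps)
    qed
    ultimately show ?thesis using 3 by simp
   next
    case 4
    have "coef x 0 v = coef x (Suc l) ((cmap N ^^ Suc l) v)" using coef_Npow[OF x, of "Suc l" "Suc l" v] 4 by simp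
    hence "coef x 0 v = 0" unfolding v(2) coef_simps .
    thus ?thesis using 4 by simp
   qed
  qed
  thus "cnj (coef x (len x) ?u) * cbil L v ((cmap N ^^ len x) (cconj (e x))) =
    (if lam x = mu & len x = l then of_real ((norm (coef x 0 v))\<^sup>2) * (kco (cnj mu) 0 * eta x) else 0)"
   unfolding cL_top[OF x] mult.assoc[symmetric] by auto
 qed
 also have "... = (\<Sum>x\<in>{x \<in> Ix. lam x = mu & len x = l}. of_real ((norm (coef x 0 v))\<^sup>2) * (kco (cnj mu) 0 * eta x))"
  by (rule sum.mono_neutral_cong_right) (use fin_Ix in auto)
 finally show ?thesis .
qed

lemma gram:
 assumes "x \<in> Ix" "y \<in> Ix"
 shows "cbil L (NN i (e x)) (NN j (e y)) =
  (-1) ^ i * (if x = sig y & i + j \<le> len x then kco (cnj (lam x)) (len x - i - j) * eta x else 0)"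
proof -
 have "e y = cconj (e (sig y))" using Ix(9)[OF Ix(4)[OF assms(2)]] Ix(5)[OF assms(2)] by simp
 thus ?thesis using cL_chains[OF assms(1) Ix(4)[OF assms(2)], of i j] by simp
qed

end

lemma equal_chains_transfer:
 fixes S :: "'v::real_vector => 'v => real" and S' :: "'w::real_vector => 'w => real"
 assumes A: "chains m F W M S Ix lam len eta sig e" and B: "chains m' F' W' M' S' Ix lam len eta sig e'"
 obtains \<Phi> where "linear \<Phi>" "!!a b. Lnor M' S' (\<Phi> a) (\<Phi> b) = Lnor M S a b"
  "!!x j v. x \<in> Ix ==> j \<le> len x ==> chains.coef M' S' len eta e' x j (cmap \<Phi> v) = chains.coef M S len eta e x j v"
proof -
 interpret A: chains m F W M S Ix lam len eta sig e by (rule A)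
 interpret B: chains m' F' W' M' S' Ix lam len eta sig e' by (rule B)
 define P where "P v = (\<Sum>x\<in>Ix. \<Sum>j\<le>len x. sc (A.coef x j v) ((cmap B.N ^^ j) (e' x)))" for v
 have P: "clinear P"
  by (rule clinearI)
   (simp_all add: P_def A.coef_simps cx.scale_left_distrib sum.distrib cx.scale_sum_right)
 have Pc: "P (cconj v) = cconj (P v)" for v
 proof -
  have "P (cconj v) = (\<Sum>x\<in>Ix. \<Sum>j\<le>len (sig x). sc (A.coef (sig x) j (cconj v)) ((cmap B.N ^^ j) (e' (sig x))))"
   unfolding P_def by (rule sum.reindex_bij_witness[of _ sig sig]) (use A.Ix(4,5) in auto)
  also have "... = (\<Sum>x\<in>Ix. \<Sum>j\<le>len x. sc (cnj (A.coef x j v)) ((cmap B.N ^^ j) (cconj (e' x))))"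
   by (intro sum.cong) (simp_all add: A.Ix(6) A.coef_cconj B.Ix(9))
  also have "... = cconj (P v)" unfolding P_def cconj_sum cconj_scaleCx B.Npow_cconj ..
  finally show ?thesis .
 qed
 have Pcoef: "B.coef x j (P v) = A.coef x j v" if x: "x \<in> Ix" "j \<le> len x" for x j v
 proof -
  have "B.coef x j (P v) = (\<Sum>y\<in>Ix. \<Sum>i\<le>len y. A.coef y i v * (if x = y & i = j then 1 else 0))"
   unfolding P_def B.coef_sum B.coef_simps by (intro sum.cong refl) (simp only: B.coef_chain[OF x(1) _ x(2)])
  also have "... = (\<Sum>y\<in>Ix. if x = y then (\<Sum>i\<le>len y. if i = j then A.coef y i v else 0) else 0)"
  proof (rule sum.cong[OF refl])
   fix y
   show "(\<Sum>i\<le>len y. A.coef y i v * (if x = y & i = j then 1 else 0)) =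
     (if x = y then (\<Sum>i\<le>len y. if i = j then A.coef y i v else 0) else 0)"
   proof (cases "x = y")
    case True
    thus ?thesis unfolding if_P[OF True] by (intro sum.cong refl) simp
   next
    case False
    thus ?thesis by simp
   qed
  qed
  also have "... = A.coef x j v" using x A.fin_Ix by simp
  finally show ?thesis .
 qed
 have PL: "cbil B.L (P u) (P v) = cbil A.L u v" for u v
 proof -
  have "cbil B.L (P u) (P v) = (\<Sum>y\<in>Ix. \<Sum>j\<le>len y. A.coef y j v * (\<Sum>x\<in>Ix. \<Sum>i\<le>len x. A.coef x i u *
    cbil B.L ((cmap B.N ^^ i) (e' x)) ((cmap B.N ^^ j) (e' y))))"
   unfolding P_def by (simp only: B.cL_simps)
  also have "... = (\<Sum>y\<in>Ix. \<Sum>j\<le>len y. A.coef y j v * (\<Sum>x\<in>Ix. \<Sum>i\<le>len x. A.coef x i u *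
    cbil A.L ((cmap A.N ^^ i) (e x)) ((cmap A.N ^^ j) (e y))))"
   by (intro sum.cong refl arg_cong2[of _ _ _ _ "(*)"]) (simp only: A.gram B.gram)
  also have "... = cbil A.L (\<Sum>x\<in>Ix. \<Sum>i\<le>len x. sc (A.coef x i u) ((cmap A.N ^^ i) (e x)))
    (\<Sum>x\<in>Ix. \<Sum>i\<le>len x. sc (A.coef x i v) ((cmap A.N ^^ i) (e x)))"
   by (simp only: A.cL_simps)
  finally show ?thesis unfolding A.expand[symmetric] .
 qed
 obtain g where g: "linear g" "P = cmap g" using real_operator_if_commutes_with_conj[OF P Pc] by blast
 have g0: "g 0 = 0" by (rule linear_0[OF g(1)])
 have gL: "B.L (g a) (g b) = A.L a b" for a b
 proof -
  have "(of_real (B.L (g a) (g b)) :: complex) = of_real (A.L a b)"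
   using PL[of "(a, 0)" "(b, 0)"] unfolding g(2)
   by (simp add: g0 cbil_real[OF A.bilinear_L] cbil_real[OF B.bilinear_L])
  thus ?thesis by (simp only: of_real_eq_iff)
 qed
 show ?thesis by (rule that[OF g(1) gL Pcoef[unfolded g(2)]])
qed

theorem equal_chains_imp_iso:
 fixes S :: "'v::real_vector => 'v => real" and S' :: "'w::real_vector => 'w => real"
 assumes A: "chains m F W M S Ix lam len eta sig e" and B: "chains m' F' W' M' S' Ix lam len eta sig e'"
 shows "seifert_iso UNIV (Lnor M S) UNIV (Lnor M' S')"
proof -
 interpret A: chains m F W M S Ix lam len eta sig e by (rule A)
 interpret B: chains m' F' W' M' S' Ix lam len eta sig e' by (rule B)
 obtain f where f: "linear f" "!!a b. B.L (f a) (f b) = A.L a b"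
  "!!x j v. x \<in> Ix ==> j \<le> len x ==> B.coef x j (cmap f v) = A.coef x j v"
  using equal_chains_transfer[OF A B] by blast
 obtain g where g: "linear g" "!!a b. A.L (g a) (g b) = B.L a b"
  "!!x j v. x \<in> Ix ==> j \<le> len x ==> A.coef x j (cmap g v) = B.coef x j v"
  using equal_chains_transfer[OF B A] by blast
 have A_eq: "u = v" if "!!x j. x \<in> Ix ==> j \<le> len x ==> A.coef x j u = A.coef x j v" for u v
 proof -
  have "(\<Sum>x\<in>Ix. \<Sum>j\<le>len x. sc (A.coef x j u) ((cmap A.N ^^ j) (e x))) =
    (\<Sum>x\<in>Ix. \<Sum>j\<le>len x. sc (A.coef x j v) ((cmap A.N ^^ j) (e x)))"
   by (intro sum.cong refl) (simp add: that)
  thus ?thesis unfolding A.expand[symmetric] .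
 qed
 have B_eq: "u = v" if "!!x j. x \<in> Ix ==> j \<le> len x ==> B.coef x j u = B.coef x j v" for u v
 proof -
  have "(\<Sum>x\<in>Ix. \<Sum>j\<le>len x. sc (B.coef x j u) ((cmap B.N ^^ j) (e' x))) =
    (\<Sum>x\<in>Ix. \<Sum>j\<le>len x. sc (B.coef x j v) ((cmap B.N ^^ j) (e' x)))"
   by (intro sum.cong refl) (simp add: that)
  thus ?thesis unfolding B.expand[symmetric] .
 qed
 have 1: "g (f a) = a" for a
 proof -
  have "cmap g (cmap f (a, a)) = (a, a)" by (rule A_eq) (simp only: f(3) g(3))
  thus ?thesis by simp
 qed
 have 2: "f (g b) = b" for b
 proof -
  have "cmap f (cmap g (b, b)) = (b, b)" by (rule B_eq) (simp only: f(3) g(3))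
  thus ?thesis by simp
 qed
 have "bij_betw f UNIV UNIV" by (rule bij_betw_byWitness[of _ g]) (use 1 2 in auto)
 moreover have "linear_on UNIV f" unfolding linear_on_def by (simp add: linear_add[OF f(1)] linear_scale[OF f(1)])
 ultimately show ?thesis unfolding seifert_iso_def using f(2) by blast
qed

subsection \<open>Isomorphisms respect the chain structure\<close>

lemma seifert_iso_equivariant:
 fixes S :: "'v::real_vector => 'v => real" and S' :: "'w::real_vector => 'w => real"
 assumes A: "steenbrink m F W M S" and B: "steenbrink m F' W' M' S'"
  and f: "linear f" "bij f" "!!a b. Lnor M' S' (f a) (f b) = Lnor M S a b"
 shows "!!x. f (ss_part UNIV M x) = ss_part UNIV M' (f x)" "!!x. f (nilp_part UNIV M x) = nilp_part UNIV M' (f x)"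
proof -
 interpret A: steenbrink m F W M S by (rule A)
 interpret B: steenbrink m F' W' M' S' by (rule B)
 define g where "g = inv f"
 have fg: "f (g y) = y" and gf: "g (f x) = x" for x y
  unfolding g_def using f(2) by (simp_all add: bij_is_surj surj_f_inv_f bij_is_inj inv_f_f)
 have g: "linear g"
 proof (rule linearI)
  fix a b r
  have "g (f (g a + g b)) = g (a + b)" by (simp only: linear_add[OF f(1)] fg)
  thus "g (a + b) = g a + g b" unfolding gf ..
  have "g (f (r *\<^sub>R g a)) = g (r *\<^sub>R a)" by (simp only: linear_scale[OF f(1)] fg)
  thus "g (r *\<^sub>R a) = r *\<^sub>R g a" unfolding gf ..
 qed
 have T: "f (A.T0 a) = B.T0 (f a)" for a
 proof -
  have "B.L (f (A.T0 a) - B.T0 (f a)) y = 0" for y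
  proof -
   have "B.L (f (A.T0 a)) y = B.L (f (A.T0 a)) (f (g y))" unfolding fg ..
   also have "... = A.L (g y) a" unfolding f(3) by (rule A.L_monodromy)
   also have "... = B.L (f (g y)) (f a)" by (rule f(3)[symmetric])
   also have "... = B.L (B.T0 (f a)) y" unfolding fg by (rule B.L_monodromy[symmetric])
   finally show ?thesis by (simp add: bilinear_simps[OF B.bilinear_L])
  qed
  hence "f (A.T0 a) - B.T0 (f a) = 0" using B.nondegenerate_L unfolding nondegenerate_on_def by blast
  thus ?thesis by simp
 qed
 have M: "f (M a) = M' (f a)" for a
 proof -
  have "((-1) powi (m + 1)) *\<^sub>R f (M a) = ((-1) powi (m + 1)) *\<^sub>R M' (f a)"
   using T[of a] unfolding A.T0_def B.T0_def linear_scale[OF f(1)] .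
  thus ?thesis by simp
 qed
 have jd: "jordan_decomposition UNIV M' (%y. f (A.Ms (g y))) (%y. f (A.Mu (g y)))"
  unfolding jordan_decomposition_def
 proof (intro conjI ballI)
  show "linear_on UNIV (%y. f (A.Ms (g y)))" "linear_on UNIV (%y. f (A.Mu (g y)))"
   unfolding linear_on_def
   by (simp_all add: linear_add[OF f(1)] linear_scale[OF f(1)] linear_add[OF g] linear_scale[OF g]
     linear_add[OF A.jordan(2)] linear_scale[OF A.jordan(2)] linear_add[OF A.jordan(3)] linear_scale[OF A.jordan(3)])
  show "M' x = f (A.Ms (g (f (A.Mu (g x)))))" "M' x = f (A.Mu (g (f (A.Ms (g x)))))" for x
   unfolding gf A.M_decomposition[symmetric] M fg by (rule refl)+
  have pw: "((%y. f (A.Mu (g y)) - y) ^^ k) x = f (((%y. A.Mu y - y) ^^ k) (g x))" for k x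
   by (induction k) (simp_all add: fg gf linear_diff[OF f(1)])
  show "\<exists>n. \<forall>x\<in>UNIV. ((%y. f (A.Mu (g y)) - y) ^^ n) x = 0"
   by (rule exI[of _ "dim (UNIV :: 'v set)"]) (simp add: pw A.Mu_unipotent linear_0[OF f(1)])
  let ?E = "{x \<in> cplx UNIV. \<exists>mu. cmap A.Ms x = sc mu x}"
  let ?E' = "{x \<in> cplx UNIV. \<exists>mu. cmap (%y. f (A.Ms (g y))) x = sc mu x}"
  have sp: "cx.span ?E = UNIV" using A.jordan(1) unfolding jordan_decomposition_def by simp
  have cf: "clinear (cmap f)" by (rule clinear_cmap[OF f(1)])
  have "cmap f ` ?E \<subseteq> ?E'"
  proof (rule image_subsetI)
   fix x assume "x \<in> ?E"
   then obtain mu where mu: "cmap A.Ms x = sc mu x" by blast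
   have "cmap (%y. f (A.Ms (g y))) (cmap f x) = cmap f (cmap A.Ms x)" by (cases x) (simp add: gf)
   also have "... = sc mu (cmap f x)" unfolding mu by (rule cxp.linear_scale[OF cf])
   finally show "cmap f x \<in> ?E'" by auto
  qed
  hence "cx.span (cmap f ` ?E) \<subseteq> cx.span ?E'" by (rule cx.span_mono)
  hence "cmap f ` UNIV \<subseteq> cx.span ?E'" unfolding cxp.linear_span_image[OF cf] sp .
  moreover have "y \<in> cmap f ` UNIV" for y by (rule image_eqI[of _ _ "cmap g y"]) (simp_all add: fg prod_eq_iff)
  ultimately have "y \<in> cx.span ?E'" for y by (rule subsetD)
  thus "cx.span ?E' = cplx UNIV" unfolding UNIV_Times_UNIV by (intro UNIV_eq_I[symmetric])
 qed simp_all
 have s: "B.Ms y = f (A.Ms (g y))" and u: "B.Mu y = f (A.Mu (g y))" for y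
  using jordan_decomposition_unique[OF subspace_UNIV _ B.jordan(1) jd, of y] B.M_eq_0 by blast+
 show "f (A.Ms x) = B.Ms (f x)" for x unfolding s gf ..
 have pw: "f (((%y. A.Mu y - y) ^^ k) x) = ((%y. B.Mu y - y) ^^ k) (f x)" for k x
 proof -
  have "f (A.Mu y) = B.Mu (f y)" for y unfolding u gf ..
  thus ?thesis by (induction k) (simp_all add: linear_diff[OF f(1)])
 qed
 let ?n = "max (dim (UNIV :: 'v set)) (dim (UNIV :: 'w set))"
 have NA: "A.N x = (\<Sum>k = 1..?n. ((-1) ^ (k + 1) / real k) *\<^sub>R ((%y. A.Mu y - y) ^^ k) x)" for x
  unfolding nilp_part_def
 proof (rule sum.mono_neutral_left)
  show "\<forall>k\<in>{1..?n} - {1..dim (UNIV :: 'v set)}. ((-1) ^ (k + 1) / real k) *\<^sub>R ((%y. A.Mu y - y) ^^ k) x = 0"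
  proof
   fix k assume "k \<in> {1..?n} - {1..dim (UNIV :: 'v set)}"
   hence "dim (UNIV :: 'v set) \<le> k" by auto
   hence "((%y. A.Mu y - y) ^^ k) x = 0"
    by (rule funpow_nilpotent_mono[OF A.linear_Mu_minus_id A.Mu_unipotent])
   thus "((-1) ^ (k + 1) / real k) *\<^sub>R ((%y. A.Mu y - y) ^^ k) x = 0" by simp
  qed
 qed auto
 have NB: "B.N x = (\<Sum>k = 1..?n. ((-1) ^ (k + 1) / real k) *\<^sub>R ((%y. B.Mu y - y) ^^ k) x)" for x
  unfolding nilp_part_def
 proof (rule sum.mono_neutral_left)
  show "\<forall>k\<in>{1..?n} - {1..dim (UNIV :: 'w set)}. ((-1) ^ (k + 1) / real k) *\<^sub>R ((%y. B.Mu y - y) ^^ k) x = 0"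
  proof
   fix k assume "k \<in> {1..?n} - {1..dim (UNIV :: 'w set)}"
   hence "dim (UNIV :: 'w set) \<le> k" by auto
   hence "((%y. B.Mu y - y) ^^ k) x = 0"
    by (rule funpow_nilpotent_mono[OF B.linear_Mu_minus_id B.Mu_unipotent])
   thus "((-1) ^ (k + 1) / real k) *\<^sub>R ((%y. B.Mu y - y) ^^ k) x = 0" by simp
  qed
 qed auto
 show "f (A.N x) = B.N (f x)" for x
  unfolding NA NB linear_sum[OF f(1)] linear_scale[OF f(1)] pw ..
qed

theorem inertia:
 fixes S :: "'v::real_vector => 'v => real" and S' :: "'w::real_vector => 'w => real"
 assumes A: "chains m F W M S Ix lam len eta sig e" and B: "chains m F' W' M' S' Ix' lam' len' eta' sig' e'"
  and f: "linear f" "bij f" "!!a b. Lnor M' S' (f a) (f b) = Lnor M S a b"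
  and signs: "!!x. x \<in> Ix' ==> lam' x = mu ==> len' x = l ==> eta' x = \<eta> | eta' x = - \<eta>"
 shows "card {x \<in> Ix. lam x = mu & len x = l & eta x = \<eta>} \<le> card {x \<in> Ix'. lam' x = mu & len' x = l & eta' x = \<eta>}"
  (is "card ?X \<le> card ?X'")
proof (rule ccontr)
 assume "\<not> card ?X \<le> card ?X'"
 hence lt: "card ?X' < card ?X" by simp
 interpret A: chains m F W M S Ix lam len eta sig e by (rule A)
 interpret B: chains m F' W' M' S' Ix' lam' len' eta' sig' e' by (rule B)
 note eq = seifert_iso_equivariant[OF A.steenbrink_axioms B.steenbrink_axioms f]
 have cf: "clinear (cmap f)" by (rule clinear_cmap[OF f(1)])
 have fN: "cmap f ((cmap A.N ^^ k) v) = (cmap B.N ^^ k) (cmap f v)" for k v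
  by (induction k) (simp_all add: eq(2) prod_eq_iff)
 have fH: "cmap f v \<in> B.H mu" if "v \<in> A.H mu" for v
 proof -
  have "cmap B.Ms (cmap f v) = cmap f (cmap A.Ms v)" by (cases v) (simp add: eq(1))
  thus ?thesis using that unfolding A.in_H B.in_H by (simp add: cxp.linear_scale[OF cf])
 qed
 have fL: "cbil B.L (cmap f u) (cmap f v) = cbil A.L u v" for u v unfolding cbil_def by (simp add: f(3))
 have fin: "finite ?X" "finite ?X'" using A.fin_Ix B.fin_Ix by simp_all
 have "?X ~= {}"
 proof
  assume X: "?X = {}"
  show False using lt unfolding X by simp
 qed
 then obtain x0 where x0: "x0 \<in> ?X" by blast
 hence \<eta>: "\<eta> ~= 0" using A.Ix(3) by blast
 let ?u = "%x. \<Sum>y\<in>?X'. sc (B.coef y 0 (cmap f (e x))) (e' y)"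
 have "?u ` ?X \<subseteq> cx.span (e' ` ?X')"
  by (rule image_subsetI, intro cx.span_sum cx.span_scale cx.span_base) blast
 moreover have "card (e' ` ?X') < card ?X" using card_image_le[OF fin(2), of e'] lt by simp
 ultimately obtain c where c: "\<exists>x\<in>?X. c x ~= 0" "(\<Sum>x\<in>?X. sc (c x) (?u x)) = 0"
  using dependent_family[OF fin(1), of "e' ` ?X'" ?u] fin(2) by blast
 define v where "v = (\<Sum>x\<in>?X. sc (c x) (e x))"
 have coefv: "A.coef x 0 v = (if x \<in> ?X then c x else 0)" if x: "x \<in> Ix" for x
 proof -
  have "A.coef x 0 v = (\<Sum>y\<in>?X. c y * A.coef x 0 (e y))" unfolding v_def A.coef_sum A.coef_simps ..
  also have "... = (\<Sum>y\<in>?X. if y = x then c x else 0)"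
   by (rule sum.cong[OF refl]) (use A.coef_chain[OF x, of _ 0 0] in auto)
  finally show ?thesis using fin(1) by simp
 qed
 have vH: "v \<in> A.H mu"
  unfolding v_def by (intro cx.subspace_sum[OF A.subspace_H] cx.subspace_scale[OF A.subspace_H]) (use A.Ix(1) in auto)
 have vN: "(cmap A.N ^^ Suc l) v = 0"
 proof -
  have "(cmap A.N ^^ Suc l) (e x) = 0" if "x \<in> ?X" for x using A.kill[of x "Suc l"] that by simp
  thus ?thesis unfolding v_def cxp.linear_sum[OF A.clinear_Npow] cxp.linear_scale[OF A.clinear_Npow] by simp
 qed
 have coef': "B.coef y 0 (cmap f v) = 0" if y: "y \<in> ?X'" for y
 proof -
  have yI: "y \<in> Ix'" using y by blast
  have "0 = B.coef y 0 (\<Sum>x\<in>?X. sc (c x) (?u x))" unfolding c(2) B.coef_simps ..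
  also have "... = (\<Sum>x\<in>?X. c x * (\<Sum>z\<in>?X'. B.coef z 0 (cmap f (e x)) * B.coef y 0 (e' z)))"
   unfolding B.coef_sum B.coef_simps ..
  also have "... = (\<Sum>x\<in>?X. c x * B.coef y 0 (cmap f (e x)))"
  proof (intro sum.cong refl arg_cong2[of _ _ _ _ "(*)"])
   fix x
   have "(\<Sum>z\<in>?X'. B.coef z 0 (cmap f (e x)) * B.coef y 0 (e' z)) = (\<Sum>z\<in>?X'. if z = y then B.coef y 0 (cmap f (e x)) else 0)"
    by (rule sum.cong[OF refl]) (use B.coef_chain[OF yI, of _ 0 0] in auto)
   thus "(\<Sum>z\<in>?X'. B.coef z 0 (cmap f (e x)) * B.coef y 0 (e' z)) = B.coef y 0 (cmap f (e x))"
    using y fin(2) by simp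
  qed
  also have "... = B.coef y 0 (cmap f v)"
   unfolding v_def cxp.linear_sum[OF cf] cxp.linear_scale[OF cf] B.coef_sum B.coef_simps ..
  finally show ?thesis ..
 qed
 let ?k = "A.kco (cnj mu) 0"
 have "?k ~= 0" unfolding A.kco_0 by auto
 define r where "r = (\<Sum>x\<in>?X. (norm (c x))\<^sup>2)"
 have "r > 0"
 proof -
  obtain x where x: "x \<in> ?X" "c x ~= 0" using c(1) by blast
  show ?thesis unfolding r_def by (rule sum_pos2[OF fin(1) x(1)]) (use x(2) in simp_all)
 qed
 have "cbil A.L v ((cmap A.N ^^ l) (cconj v)) =
   (\<Sum>x\<in>{x \<in> Ix. lam x = mu & len x = l}. if eta x = \<eta> then of_real ((norm (c x))\<^sup>2) * (?k * \<eta>) else 0)"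
  unfolding A.length_form[OF vH vN] by (rule sum.cong[OF refl]) (auto simp: coefv)
 also have "... = (\<Sum>x\<in>?X. of_real ((norm (c x))\<^sup>2) * (?k * \<eta>))"
  by (rule sum.mono_neutral_cong_right) (use A.fin_Ix in auto)
 also have "... = of_real r * (?k * \<eta>)" unfolding r_def of_real_sum sum_distrib_right ..
 finally have 1: "cbil A.L v ((cmap A.N ^^ l) (cconj v)) = of_real r * (?k * \<eta>)" .
 define s where "s = (\<Sum>x\<in>{x \<in> Ix'. lam' x = mu & len' x = l}. (norm (B.coef x 0 (cmap f v)))\<^sup>2)"
 have "s \<ge> 0" unfolding s_def by (intro sum_nonneg) simp
 have fvN: "(cmap B.N ^^ Suc l) (cmap f v) = 0" unfolding fN[symmetric] vN by (rule cxp.linear_0[OF cf])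
 have "cbil B.L (cmap f v) ((cmap B.N ^^ l) (cconj (cmap f v))) =
   (\<Sum>x\<in>{x \<in> Ix'. lam' x = mu & len' x = l}. of_real ((norm (B.coef x 0 (cmap f v)))\<^sup>2) * (?k * - \<eta>))"
  unfolding B.length_form[OF fH[OF vH] fvN]
 proof (rule sum.cong[OF refl])
  fix x assume x: "x \<in> {x \<in> Ix'. lam' x = mu & len' x = l}"
  show "of_real ((norm (B.coef x 0 (cmap f v)))\<^sup>2) * (?k * eta' x) = of_real ((norm (B.coef x 0 (cmap f v)))\<^sup>2) * (?k * - \<eta>)"
  proof (cases "eta' x = \<eta>")
   case True
   hence "B.coef x 0 (cmap f v) = 0" using x by (intro coef') simp
   thus ?thesis by simp
  next
   case False
   hence "eta' x = - \<eta>" using signs[of x] x by blast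
   thus ?thesis by simp
  qed
 qed
 also have "... = of_real s * (?k * - \<eta>)" unfolding s_def of_real_sum sum_distrib_right ..
 finally have 2: "cbil B.L (cmap f v) ((cmap B.N ^^ l) (cconj (cmap f v))) = of_real s * (?k * - \<eta>)" .
 have "cconj (cmap f v) = cmap f (cconj v)" by (rule cmap_cconj[OF f(1), symmetric])
 hence "cbil B.L (cmap f v) ((cmap B.N ^^ l) (cconj (cmap f v))) = cbil A.L v ((cmap A.N ^^ l) (cconj v))"
  by (simp only: fN[symmetric] fL)
 hence rs: "of_real r * (?k * \<eta>) = of_real (- s) * (?k * \<eta>)" unfolding 1 2 by simp
 have "?k * \<eta> ~= 0" using \<open>?k ~= 0\<close> \<eta> by simp
 from mult_right_cancel[OF this] rs have "(of_real r :: complex) = of_real (- s)" by blast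
 hence "r = - s" by (simp only: of_real_eq_iff)
 thus False using \<open>r > 0\<close> \<open>s \<ge> 0\<close> by simp
qed

section \<open>Recovering the ladders from the spectral pairs modulo two\<close>

lemma etaf_shift: "etaf m (al + of_int n) l = (-1) powi n * etaf m al l"
proof -
 have "etaf m (al + of_int n) l = \<i> powi (2 * n + (ladder_q m al l - ladder_p m al))"
  unfolding etaf_def ladder_p_shift ladder_q_shift by (simp add: algebra_simps)
 also have "... = \<i> powi (2 * n) * etaf m al l" unfolding i_powi_add etaf_def ..
 also have "\<i> powi (2 * n) = (-1) powi n" unfolding power_int_mult by simp
 finally show ?thesis .
qed

lemma etaf_dichotomy:
 assumes "eig ga = eig be"
 shows "etaf m ga l = etaf m be l | etaf m ga l = - etaf m be l"
  and "etaf m ga l = etaf m be l \<longleftrightarrow> ga rmod 2 = be rmod 2"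
proof -
 obtain n where n: "ga = be + of_int n" using assms unfolding eig_eq_iff ..
 have e: "etaf m ga l = (-1) powi n * etaf m be l" unfolding n by (rule etaf_shift)
 have "even n | odd n" by blast
 hence d: "(even n & etaf m ga l = etaf m be l) | (odd n & etaf m ga l = - etaf m be l)"
  unfolding e by (auto simp: power_int_minus_left)
 thus "etaf m ga l = etaf m be l | etaf m ga l = - etaf m be l" by blast
 show "etaf m ga l = etaf m be l \<longleftrightarrow> ga rmod 2 = be rmod 2"
 proof
  assume eq: "etaf m ga l = etaf m be l"
  have "even n"
  proof (rule ccontr)
   assume "odd n"
   hence "etaf m be l = - etaf m be l" using d eq by auto
   thus False using etaf_nz[of m be l] by simp
  qed
  then obtain z where "n = 2 * z" ..
  hence "ga = be + 2 * of_int z" unfolding n by simp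
  thus "ga rmod 2 = be rmod 2" unfolding rmod2_eq_iff ..
 qed (rule etaf_cong)
qed

context steenbrink
begin

lemma idx_class:
 assumes b: "be rmod 2 = be"
 shows "card {x \<in> idx. xlam x = eig be & xlen x = l & xeta x = etaf m be l} = gcount be l"
proof -
 have "{x \<in> idx. xlam x = eig be & xlen x = l & xeta x = etaf m be l} = (%i. (be, l, i)) ` {..<gcount be l}"
 proof
  show "(%i. (be, l, i)) ` {..<gcount be l} \<subseteq> {x \<in> idx. xlam x = eig be & xlen x = l & xeta x = etaf m be l}"
   using b by (auto simp: idx_def xlam_def xlen_def xeta_def)
  show "{x \<in> idx. xlam x = eig be & xlen x = l & xeta x = etaf m be l} \<subseteq> (%i. (be, l, i)) ` {..<gcount be l}"
  proof
   fix x assume x: "x \<in> {x \<in> idx. xlam x = eig be & xlen x = l & xeta x = etaf m be l}"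
   obtain ga k i where xe: "x = (ga, k, i)" by (rule prod_cases3)
   have ga: "ga rmod 2 = ga" "i < gcount ga k" "eig ga = eig be" "k = l" "etaf m ga k = etaf m be l"
    using x unfolding xe idx_def xlam_def xlen_def xeta_def by auto
   have "ga rmod 2 = be rmod 2" using etaf_dichotomy(2)[OF ga(3), of m l] ga(4,5) by simp
   thus "x \<in> (%i. (be, l, i)) ` {..<gcount be l}" unfolding xe using ga b by simp
  qed
 qed
 moreover have "inj_on (%i. (be, l, i)) {..<gcount be l}" by (rule inj_onI) simp
 ultimately show ?thesis by (simp add: card_image)
qed

definition weights :: "int set" where "weights = {k. \<exists>al. sppm al k ~= 0}"

lemma finite_weights: "finite weights"
proof -
 have "weights = snd ` {(al, k). sppm al k ~= 0}" unfolding weights_def by force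
 thus ?thesis using finite_spp by simp
qed

lemma weights_symmetric: "k \<in> weights ==> 2 * m - k \<in> weights"
proof -
 assume "k \<in> weights"
 then obtain al where a: "sppm al k ~= 0" unfolding weights_def by blast
 show ?thesis
 proof (cases "m \<le> k")
  case True
  define l where "l = nat (k - m)"
  have k: "k = m + int l" "2 * m - k = m - int l" using True unfolding l_def by simp_all
  have "sppm (al + of_nat l) (m - int l) ~= 0" using a unfolding spp_symmetric k(1) .
  thus ?thesis unfolding k(2) weights_def by blast
 next
  case False
  define l where "l = nat (m - k)"
  have k: "k = m - int l" "2 * m - k = m + int l" using False unfolding l_def by simp_all
  have "sppm (al - of_nat l) (m + int l) ~= 0" using a spp_symmetric[of "al - of_nat l" l] unfolding k(1) by simp
  thus ?thesis unfolding k(2) weights_def by blast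
 qed
qed

lemma weights_nonempty:
 assumes "(UNIV :: 'v set) ~= {0}"
 shows "weights ~= {}"
proof
 assume e: "weights = {}"
 have "gcount be l = 0" for be l
  unfolding gcount_def
 proof (rule sum.neutral, rule ballI)
  fix al
  show "lmult al l = 0" using ladder_mult_spp[of al l] e unfolding weights_def by blast
 qed
 hence i: "idx = {}" unfolding idx_def by simp
 have "cx.span {(NN j) (fx x) | x j. x \<in> idx} = UNIV" using chain_family_fx unfolding chain_family_def by blast
 hence "(UNIV :: ('v \<times> 'v) set) = {0}" unfolding i by simp
 hence "(v, 0) = (0 :: 'v \<times> 'v)" for v by blast
 hence "v = 0" for v :: 'v by (simp add: zero_prod_def)
 thus False using assms by blast
qed

lemma weights_center:
 assumes "(UNIV :: 'v set) ~= {0}"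
 shows "Max weights + Min weights = 2 * m"
proof -
 note ne = weights_nonempty[OF assms]
 have "2 * m - Max weights \<in> weights" "2 * m - Min weights \<in> weights"
  using weights_symmetric Max_in[OF finite_weights ne] Min_in[OF finite_weights ne] by blast+
 hence "Min weights \<le> 2 * m - Max weights" "2 * m - Min weights \<le> Max weights"
  using Min_le[OF finite_weights] Max_ge[OF finite_weights] by blast+
 thus ?thesis by simp
qed

definition ccount :: "real => int => nat" where
 "ccount be k = (\<Sum>al\<in>cls be. sppm al k)"

lemma count_spp: "count (spp m F W M) (al, k) = sppm al k"
proof -
 have "{x. 0 < (%(al, k). sppm al k) x} = {(al, k). sppm al k ~= 0}" by auto
 hence "finite {x. 0 < (%(al, k). sppm al k) x}" using finite_spp by simp
 thus ?thesis unfolding spp_def by (simp add: Abs_multiset_inverse)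
qed

lemma count_spp_mod2: "count (spp_mod2 m F W M) (be, k) = (if be rmod 2 = be then ccount be k else 0)"
proof -
 let ?g = "%(al::real, k::int). (al rmod 2, k)"
 have c: "count (spp_mod2 m F W M) (be, k) = (\<Sum>y\<in>?g -` {(be, k)} \<inter> set_mset (spp m F W M). count (spp m F W M) y)"
  unfolding spp_mod2_def by (rule count_image_mset)
 show ?thesis
 proof (cases "be rmod 2 = be")
  case False
  have "?g -` {(be, k)} = {}" using False by auto
  thus ?thesis unfolding c using False by simp
 next
  case True
  have "(\<Sum>y\<in>?g -` {(be, k)} \<inter> set_mset (spp m F W M). count (spp m F W M) y) =
    (\<Sum>y\<in>(%al. (al, k)) ` cls be. count (spp m F W M) y)"
  proof (rule sum.mono_neutral_left)
   show "finite ((%al. (al, k)) ` cls be)" using finite_cls by simp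
   show "?g -` {(be, k)} \<inter> set_mset (spp m F W M) \<subseteq> (%al. (al, k)) ` cls be"
   proof
    fix y assume y: "y \<in> ?g -` {(be, k)} \<inter> set_mset (spp m F W M)"
    obtain al k' where ye: "y = (al, k')" by (cases y)
    have r: "al rmod 2 = be" "k' = k" using y unfolding ye by simp_all
    have "sppm al k ~= 0" using y unfolding ye r(2) count_spp[symmetric] by simp
    hence "al \<in> cls be" unfolding cls_def specs_def using r True by auto
    thus "y \<in> (%al. (al, k)) ` cls be" unfolding ye r(2) by (rule imageI)
   qed
   show "\<forall>y\<in>(%al. (al, k)) ` cls be - ?g -` {(be, k)} \<inter> set_mset (spp m F W M). count (spp m F W M) y = 0"
   proof
    fix y assume y: "y \<in> (%al. (al, k)) ` cls be - ?g -` {(be, k)} \<inter> set_mset (spp m F W M)"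
    then obtain al where al: "y = (al, k)" "al \<in> cls be" by blast
    have "?g y = (be, k)" using al True unfolding cls_def by simp
    hence "y \<notin># spp m F W M" using y by blast
    thus "count (spp m F W M) y = 0" by (simp add: not_in_iff)
   qed
  qed
  also have "... = (\<Sum>al\<in>cls be. count (spp m F W M) (al, k))"
   by (subst sum.reindex) (simp_all add: inj_on_def)
  finally show ?thesis unfolding c ccount_def count_spp using True by simp
 qed
qed

lemma weights_spp: "weights = snd ` set_mset (spp_mod2 m F W M)"
proof -
 have "snd ` set_mset (spp_mod2 m F W M) = snd ` set_mset (spp m F W M)"
  unfolding spp_mod2_def set_image_mset image_image by (rule image_cong) auto
 also have "... = weights"
 proof
  show "snd ` set_mset (spp m F W M) \<subseteq> weights"
  proof (rule image_subsetI)
   fix y assume y: "y \<in># spp m F W M"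
   obtain al k where ye: "y = (al, k)" by (cases y)
   have "sppm al k ~= 0" using y unfolding ye count_spp[symmetric] by simp
   thus "snd y \<in> weights" unfolding weights_def ye by auto
  qed
  show "weights \<subseteq> snd ` set_mset (spp m F W M)"
  proof
   fix k assume "k \<in> weights"
   then obtain al where "sppm al k ~= 0" unfolding weights_def by blast
   hence "(al, k) \<in># spp m F W M" unfolding count_spp[symmetric] not_in_iff[symmetric] not_not .
   thus "k \<in> snd ` set_mset (spp m F W M)" by (rule image_eqI[rotated]) simp
  qed
 qed
 finally show ?thesis ..
qed

lemma ccount_sum:
 assumes "finite A" "!!al. sppm al k ~= 0 ==> al rmod 2 = be rmod 2 ==> al \<in> A" "!!al. al \<in> A ==> al rmod 2 = be rmod 2"
 shows "ccount be k = (\<Sum>al\<in>A. sppm al k)"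
proof -
 have "ccount be k = (\<Sum>al\<in>{al \<in> cls be. sppm al k ~= 0}. sppm al k)"
  unfolding ccount_def by (rule sum.mono_neutral_right[OF finite_cls]) auto
 also have "{al \<in> cls be. sppm al k ~= 0} = {al \<in> A. sppm al k ~= 0}"
  using assms(2,3) unfolding cls_def specs_def by blast
 also have "(\<Sum>al\<in>{al \<in> A. sppm al k ~= 0}. sppm al k) = (\<Sum>al\<in>A. sppm al k)"
  by (rule sum.mono_neutral_left[OF assms(1)]) auto
 finally show ?thesis .
qed

lemma rmod2_add_cong: "al rmod 2 = be rmod 2 \<longleftrightarrow> (al + t) rmod 2 = (be + t) rmod 2"
 unfolding rmod2_eq_iff by (simp add: add_ac)

lemma sum_cls_shift: "(\<Sum>al\<in>cls be. h (al + t)) = (\<Sum>al\<in>(%al. al + t) ` cls be. h al)"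
 by (subst sum.reindex) (simp_all add: inj_on_def)

lemma ccount_recursion: "gcount be l + ccount (be - 1) (m + int l + 2) = ccount be (m + int l)"
proof -
 have "ccount (be - 1) (m + int l + 2) = (\<Sum>al\<in>(%al. al + - 1) ` cls be. sppm al (m + int l + 2))"
 proof (rule ccount_sum)
  show "finite ((%al. al + - 1) ` cls be)" using finite_cls by simp
  show "al rmod 2 = (be - 1) rmod 2" if "al \<in> (%al. al + - 1) ` cls be" for al
   using that rmod2_add_cong[of _ be "-1"] unfolding cls_def by auto
  fix al assume a: "sppm al (m + int l + 2) ~= 0" "al rmod 2 = (be - 1) rmod 2"
  have "sppm (al + 1) (m + int l) ~= 0" using ladder_recursion[of "al + 1" l] a(1) by simp
  hence "al + 1 \<in> cls be" using a(2) rmod2_add_cong[of al "be - 1" 1] unfolding cls_def specs_def by auto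
  thus "al \<in> (%al. al + - 1) ` cls be" by (rule image_eqI[rotated]) simp
 qed
 also have "... = (\<Sum>al\<in>cls be. sppm (al + - 1) (m + int l + 2))" by (rule sum_cls_shift[symmetric])
 finally have s: "ccount (be - 1) (m + int l + 2) = (\<Sum>al\<in>cls be. sppm (al - 1) (m + int l + 2))" by simp
 show ?thesis unfolding s unfolding gcount_def ccount_def sum.distrib[symmetric] ladder_recursion ..
qed

lemma ccount_symmetric: "ccount (be + of_nat l) (m - int l) = ccount be (m + int l)"
proof -
 have "ccount (be + of_nat l) (m - int l) = (\<Sum>al\<in>(%al. al + of_nat l) ` cls be. sppm al (m - int l))"
 proof (rule ccount_sum)
  show "finite ((%al. al + of_nat l) ` cls be)" using finite_cls by simp
  show "al rmod 2 = (be + of_nat l) rmod 2" if "al \<in> (%al. al + of_nat l) ` cls be" for al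
   using that rmod2_add_cong[of _ be "of_nat l"] unfolding cls_def by auto
  fix al assume a: "sppm al (m - int l) ~= 0" "al rmod 2 = (be + of_nat l) rmod 2"
  have "sppm (al - of_nat l) (m + int l) ~= 0" using spp_symmetric[of "al - of_nat l" l] a(1) by simp
  hence "al - of_nat l \<in> cls be" using a(2) rmod2_add_cong[of "al - of_nat l" be "of_nat l"] unfolding cls_def specs_def by auto
  thus "al \<in> (%al. al + of_nat l) ` cls be" by (rule image_eqI[rotated]) simp
 qed
 also have "... = (\<Sum>al\<in>cls be. sppm (al + of_nat l) (m - int l))" by (rule sum_cls_shift[symmetric])
 finally show ?thesis unfolding ccount_def spp_symmetric .
qed

lemma ccount_cong: "al rmod 2 = be rmod 2 ==> ccount al k = ccount be k"
 unfolding ccount_def cls_def by simp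

lemma ccount_eq_0: "k \<notin> weights ==> ccount be k = 0"
 unfolding ccount_def weights_def by (simp add: sum.neutral)

end

theorem spp_iff_iso:
 fixes S :: "'v::real_vector => 'v => real" and S' :: "'w::real_vector => 'w => real"
 assumes sA: "steenbrink m F W M S" and sB: "steenbrink m' F' W' M' S'"
  and nzA: "(UNIV :: 'v set) ~= {0}" and nzB: "(UNIV :: 'w set) ~= {0}"
 shows "spp_mod2 m F W M = spp_mod2 m' F' W' M' \<longleftrightarrow>
  m = m' & seifert_iso UNIV (Lnor M S) UNIV (Lnor M' S')"
proof -
 interpret A: steenbrink m F W M S by (rule sA)
 interpret B: steenbrink m' F' W' M' S' by (rule sB)
 obtain e where e: "A.chain_family A.idx A.xlam A.xlen A.xeta A.xsig e" "A.orthogonal_chains A.idx A.xlen A.xeta e"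
  using A.normal_form by blast
 obtain e' where e': "B.chain_family B.idx B.xlam B.xlen B.xeta B.xsig e'" "B.orthogonal_chains B.idx B.xlen B.xeta e'"
  using B.normal_form by blast
 have cA: "chains m F W M S A.idx A.xlam A.xlen A.xeta A.xsig e"
  by (intro chains.intro chains_axioms.intro sA e)
 have cB: "chains m' F' W' M' S' B.idx B.xlam B.xlen B.xeta B.xsig e'"
  by (intro chains.intro chains_axioms.intro sB e')
 show ?thesis
 proof
  assume spp: "spp_mod2 m F W M = spp_mod2 m' F' W' M'"
  have "A.weights = B.weights" unfolding A.weights_spp B.weights_spp spp ..
  hence mm: "m = m'" using A.weights_center[OF nzA] B.weights_center[OF nzB] by simp
  have cc: "A.ccount be k = B.ccount be k" for be k
  proof -
   have "A.ccount (be rmod 2) k = B.ccount (be rmod 2) k"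
    using A.count_spp_mod2[of "be rmod 2" k] B.count_spp_mod2[of "be rmod 2" k] spp by simp
   thus ?thesis using A.ccount_cong[of "be rmod 2" be k] B.ccount_cong[of "be rmod 2" be k] by simp
  qed
  have g: "A.gcount be l = B.gcount be l" for be l
  proof -
   have "A.ccount (be - 1) (m + int l + 2) = B.ccount (be - 1) (m' + int l + 2)" "A.ccount be (m + int l) = B.ccount be (m' + int l)"
    unfolding cc by (simp_all only: mm)
   thus ?thesis using A.ccount_recursion[of be l] B.ccount_recursion[of be l] by simp
  qed
  have idx: "A.idx = B.idx" unfolding A.idx_def B.idx_def g ..
  have sig: "A.xsig = B.xsig" "A.xeta = B.xeta" unfolding mm by (rule refl)+
  have "seifert_iso UNIV A.L UNIV B.L"
  proof (rule equal_chains_imp_iso[OF cA])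
   show "chains m' F' W' M' S' A.idx A.xlam A.xlen A.xeta A.xsig e'" unfolding idx sig by (rule cB)
  qed
  thus "m = m' & seifert_iso UNIV A.L UNIV B.L" using mm by blast
 next
  assume iso: "m = m' & seifert_iso UNIV A.L UNIV B.L"
  hence mm: "m' = m" by simp
  obtain f where f0: "linear_on UNIV f" "bij_betw f UNIV UNIV" "!!a b. B.L (f a) (f b) = A.L a b"
   using iso unfolding seifert_iso_def by blast
  have f: "linear f" using f0(1) unfolding linear_on_def by (intro linearI) simp_all
  have bf: "bij f" by (rule f0(2))
  define g where "g = inv f"
  have fg: "f (g y) = y" and gf: "g (f x) = x" for x y
   unfolding g_def using bf by (simp_all add: bij_is_surj surj_f_inv_f bij_is_inj inv_f_f)
  have lg: "linear g"
  proof (rule linearI)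
   fix a b r
   have "g (f (g a + g b)) = g (a + b)" by (simp only: linear_add[OF f] fg)
   thus "g (a + b) = g a + g b" unfolding gf ..
   have "g (f (r *\<^sub>R g a)) = g (r *\<^sub>R a)" by (simp only: linear_scale[OF f] fg)
   thus "g (r *\<^sub>R a) = r *\<^sub>R g a" unfolding gf ..
  qed
  have bg: "bij g" unfolding g_def using bf by (rule bij_imp_bij_inv)
  have gL: "A.L (g a) (g b) = B.L a b" for a b unfolding f0(3)[symmetric] fg ..
  have cB': "chains m F' W' M' S' B.idx B.xlam B.xlen B.xeta B.xsig e'" using cB unfolding mm .
  have sgn: "etaf m (fst x) (fst (snd x)) = etaf m be l | etaf m (fst x) (fst (snd x)) = - etaf m be l"
   if "eig (fst x) = eig be" "fst (snd x) = l" for x :: "real \<times> nat \<times> nat" and be l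
   using etaf_dichotomy(1)[OF that(1), of m l] that(2) by simp
  have g1: "A.gcount be l \<le> B.gcount be l" if b: "be rmod 2 = be" for be l
  proof -
   have "card {x \<in> A.idx. A.xlam x = eig be & A.xlen x = l & A.xeta x = etaf m be l} \<le>
     card {x \<in> B.idx. B.xlam x = eig be & B.xlen x = l & B.xeta x = etaf m be l}"
    by (rule inertia[OF cA cB' f bf f0(3)])
     (use sgn in \<open>simp add: B.xlam_def B.xlen_def A.xeta_def mm\<close>)
   thus ?thesis using A.idx_class[OF b, of l] B.idx_class[OF b, of l] mm by simp
  qed
  have g2: "B.gcount be l \<le> A.gcount be l" if b: "be rmod 2 = be" for be l
  proof -
   have "card {x \<in> B.idx. B.xlam x = eig be & B.xlen x = l & B.xeta x = etaf m be l} \<le>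
     card {x \<in> A.idx. A.xlam x = eig be & A.xlen x = l & A.xeta x = etaf m be l}"
    by (rule inertia[OF cB' cA lg bg gL])
     (use sgn in \<open>simp add: A.xlam_def A.xlen_def A.xeta_def\<close>)
   thus ?thesis using A.idx_class[OF b, of l] B.idx_class[OF b, of l] mm by simp
  qed
  have g: "A.gcount be l = B.gcount be l" for be l
  proof -
   have "A.gcount (be rmod 2) l = B.gcount (be rmod 2) l" using g1[of "be rmod 2" l] g2[of "be rmod 2" l] by simp
   thus ?thesis using A.gcount_cong[of "be rmod 2" be l] B.gcount_cong[of "be rmod 2" be l] by simp
  qed
  obtain K where K: "!!k. k \<in> A.weights \<union> B.weights ==> k < K"
  proof -
   have "finite (A.weights \<union> B.weights)" using A.finite_weights B.finite_weights by simp
   hence "k \<le> Max (A.weights \<union> B.weights)" if "k \<in> A.weights \<union> B.weights" for k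
    using that by (rule Max_ge)
   hence "k < Max (A.weights \<union> B.weights) + 1" if "k \<in> A.weights \<union> B.weights" for k
    using that by fastforce
   thus thesis by (rule that)
  qed
  have up: "A.ccount be (m + int l) = B.ccount be (m + int l)" if "nat (K - (m + int l)) \<le> n" for be l n
   using that
  proof (induction n arbitrary: be l)
   case 0
   hence "m + int l \<notin> A.weights" "m + int l \<notin> B.weights" using K[of "m + int l"] by auto
   thus ?case using A.ccount_eq_0 B.ccount_eq_0 by simp
  next
   case (Suc n)
   have "A.ccount (be - 1) (m + int (l + 2)) = B.ccount (be - 1) (m + int (l + 2))"
    by (rule Suc.IH) (use Suc.prems in simp)
   hence "A.ccount (be - 1) (m + int l + 2) = B.ccount (be - 1) (m + int l + 2)"
    by (simp only: of_nat_add of_nat_numeral add.assoc)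
   thus ?case using A.ccount_recursion[of be l] B.ccount_recursion[of be l] g[of be l] mm by simp
  qed
  have cc: "A.ccount be k = B.ccount be k" for be k
  proof (cases "m \<le> k")
   case True
   define l where "l = nat (k - m)"
   have k: "k = m + int l" using True unfolding l_def by simp
   show ?thesis unfolding k by (rule up[OF order_refl])
  next
   case False
   define l where "l = nat (m - k)"
   have k: "k = m - int l" using False unfolding l_def by simp
   have "A.ccount (be - of_nat l) (m + int l) = B.ccount (be - of_nat l) (m + int l)" by (rule up[OF order_refl])
   thus ?thesis
    using A.ccount_symmetric[of "be - of_nat l" l] B.ccount_symmetric[of "be - of_nat l" l] mm unfolding k by simp
  qed
  show "spp_mod2 m F W M = spp_mod2 m' F' W' M'"
  proof (rule multiset_eqI)
   fix y :: "real \<times> int"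
   obtain be k where y: "y = (be, k)" by (cases y)
   show "count (spp_mod2 m F W M) y = count (spp_mod2 m' F' W' M') y"
    unfolding y A.count_spp_mod2 B.count_spp_mod2 cc ..
  qed
 qed
qed

theorem theorem4p4:
  fixes m :: int
    and F :: "int \<Rightarrow> ('v::real_vector \<times> 'v) set"
    and W :: "int \<Rightarrow> 'v set"
    and M :: "'v \<Rightarrow> 'v"
    and S :: "'v \<Rightarrow> 'v \<Rightarrow> real"
  assumes pmhs: "steenbrink_pmhs m F W M S"
    and nonzero: "(UNIV :: 'v set) \<noteq> {0}"
  shows
    "seifert_pair UNIV (Lnor M S) \<and>
     (\<forall>c. ladder_ordering m F W M c \<longrightarrow>
       (\<exists>U :: real \<Rightarrow> nat \<Rightarrow> nat \<Rightarrow> 'v set.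
         let nblocks = (\<lambda>\<alpha> l. if \<not> single_ladder m \<alpha> l \<and> (\<exists>z::int. ladder_distance m \<alpha> l = 2 * of_int z)
                               then 2 * c \<alpha> l else c \<alpha> l)
         in
         orthogonal_decomposition UNIV (Lnor M S)
           {(\<alpha>, l, i). i < nblocks \<alpha> l} (\<lambda>(\<alpha>, l, i). U \<alpha> l i) \<and>
         (\<forall>\<alpha> l. c \<alpha> l > 0 \<longrightarrow>
           (let \<mu> = eig \<alpha>; \<rho> = (-1) powi (m + 1) * \<mu>; d = ladder_distance m \<alpha> l in
             (d \<in> \<int> \<longleftrightarrow> \<mu> \<in> {1, -1}) \<and>
             (single_ladder m \<alpha> l \<longrightarrow> d = 0) \<and>
             (\<mu> \<notin> {1, -1} \<longrightarrow>
               (\<forall>i < nblocks \<alpha> l.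
                 seif_2c \<rho> (l + 1) (exp (of_real pi * \<i> / 2 * of_real d)) (U \<alpha> l i) (Lnor M S))) \<and>
             (\<forall>z::int. d = 2 * of_int z + 1 \<longrightarrow>
               \<rho> = (-1) ^ (l + 1) \<and>
               (\<forall>i < nblocks \<alpha> l.
                 seif_2 \<rho> (l + 1) (U \<alpha> l i) (Lnor M S) \<and> seifert_irreducible (U \<alpha> l i) (Lnor M S))) \<and>
             (\<forall>z::int. d = 2 * of_int z \<longrightarrow>
               \<rho> = (-1) ^ l \<and>
               (\<forall>i < nblocks \<alpha> l.
                 seif_1 \<rho> (l + 1) ((-1) powi z) (U \<alpha> l i) (Lnor M S))))))) \<and>
     (\<forall>m' (F' :: int \<Rightarrow> ('w::real_vector \<times> 'w) set) W' M' S'.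
       steenbrink_pmhs m' F' W' M' S' \<and> (UNIV :: 'w set) \<noteq> {0} \<longrightarrow>
       (spp_mod2 m F W M = spp_mod2 m' F' W' M' \<longleftrightarrow>
        m = m' \<and> seifert_iso UNIV (Lnor M S) UNIV (Lnor M' S')))"
proof -
 interpret st: steenbrink m F W M S by (rule steenbrink.intro[OF pmhs])
 show ?thesis
 proof (intro conjI, rule st.seifert_pair_L, goal_cases)
  case 1
  show ?case
  proof (intro allI impI, goal_cases)
   case (1 c)
   show ?case
    unfolding Let_def by (rule st.decomposition[OF 1, unfolded st.nblk_def[OF 1] Let_def])
  qed
 next
  case 2
  show ?case
   by (intro allI impI, elim conjE)
    (rule spp_iff_iso[OF steenbrink.intro[OF pmhs] steenbrink.intro nonzero])
 qed
qed

end
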